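(* Let $p$ satisfy $1<p<\infty$ if $n\le 2$, and $1<p<\frac{n+2}{n-2}$ if $n>2$. Let $v_0\in H_0^1(U)$ satisfy $I(v_0)>0$ and $J(v_0)=\delta$. Then there exist two positive constants $K$ and $\gamma$ such that the weak solution $v$ of the initial value problem $$v_t-\Delta v=v|v|^{p-1}\log|v|\ \text{ in } U,\ t>0;\qquad v=0 \text{ on } \partial U,\ t>0;\qquad v(x,0)=v_0(x),\ x\in U,$$ satisfies $$\|\nabla v(\cdot,t)\|\le Ke^{-\gamma t},\qquad 0\le t<\infty.$$
   Context: $U\subset\mathbb{R}^n$ ($n\ge 1$) is a bounded smooth domain. $\|\cdot\|_q$ is the $L^q(U)$ norm, $\|\cdot\|=\|\cdot\|_2$, and $(h,g)_2=\int_U hg\,dx$. Expressions such as $|s|^{q}\log|s|$ ($q>0$) are taken to be $0$ at $s=0$. Weak solution: $v$ is a weak solution of the problem on $U\times[0,T)$ if $v\in L^\infty(0,T;H_0^1(U))$, $v_t\in L^2(0,T;L^2(U))$, $v(x,0)=v_0(x)$, and for every $t\in(0,T)$ and $w\in H_0^1(U)$, $(\nabla v,\nabla w)_2+(v_t,w)_2=(v|v|^{p-1}\log|v|,w)_2$. Here the solution is global, i.e. $T=\infty$. Functionals: $$I(v)=\|\nabla v\|^2-\int_U|v|^{p+1}\log|v|\,dx,$$ $$J(v)=\tfrac12\|\nabla v\|^2-\tfrac1{p+1}\int_U|v|^{p+1}\log|v|\,dx+\tfrac1{(p+1)^2}\|v\|_{p+1}^{p+1}.$$ $\mathcal N=\{v\in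 H_0^1(U): \|\nabla v\|^2\ne0,\ I(v)=0\}$ and $\delta=\inf_{v\in\mathcal N}J(v)$. *)

theory Defs
  imports "HOL-Analysis.Analysis"
begin

text \<open>Elements of \<open>L\<^sup>q(U)\<close>, \<open>H\<^sup>1(U)\<close> and \<open>H\<^sub>0\<^sup>1(U)\<close> are represented by functions on the whole
  space, of which only the values on \<open>U\<close> up to a Lebesgue null set matter. Euclidean
  \<open>n\<close>-space is an arbitrary type of class \<open>euclidean_space\<close>, with \<open>n = DIM('a)\<close>.\<close>

section \<open>Smooth functions and smooth domains\<close>

primrec C_k :: "nat \<Rightarrow> ('a::euclidean_space \<Rightarrow> real) \<Rightarrow> bool" where
  "C_k 0 f \<longleftrightarrow> continuous_on UNIV f"
| "C_k (Suc k) f \<longleftrightarrow> (\<forall>x. f differentiable (at x)) \<and>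
     (\<forall>b\<in>Basis. C_k k (\<lambda>x. frechet_derivative f (at x) b))"

definition smooth :: "('a::euclidean_space \<Rightarrow> real) \<Rightarrow> bool" where
  "smooth f \<longleftrightarrow> (\<forall>k. C_k k f)"

text \<open>The boundary is locally the graph of a smooth function \<open>\<gamma>\<close> over the hyperplane
  orthogonal to a unit vector \<open>e\<close>, with the domain on one side of it; \<open>\<gamma>\<close> is evaluated only on
  that hyperplane.\<close>

definition bounded_smooth_domain :: "'a::euclidean_space set \<Rightarrow> bool" where
  "bounded_smooth_domain U \<longleftrightarrow> U \<noteq> {} \<and> open U \<and> connected U \<and> bounded U \<and>
     (\<forall>z\<in>frontier U. \<exists>r>0. \<exists>e \<gamma>. norm e = 1 \<and> smooth \<gamma> \<and>
        U \<inter> ball z r = {x \<in> ball z r. \<gamma> (x - (x \<bullet> e) *\<^sub>R e) < x \<bullet> e})"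

definition test_fun :: "'a::euclidean_space set \<Rightarrow> ('a \<Rightarrow> real) \<Rightarrow> bool" where
  "test_fun U \<phi> \<longleftrightarrow> smooth \<phi> \<and>
     compact (closure {x. \<phi> x \<noteq> 0}) \<and> closure {x. \<phi> x \<noteq> 0} \<subseteq> U"

section \<open>Lebesgue and Sobolev spaces\<close>

definition Lq :: "real \<Rightarrow> 'a::euclidean_space set \<Rightarrow> ('a \<Rightarrow> 'b::euclidean_space) set" where
  "Lq q U = {f \<in> borel_measurable (lebesgue_on U).
     integrable (lebesgue_on U) (\<lambda>x. norm (f x) powr q)}"

definition Lq_norm :: "real \<Rightarrow> 'a::euclidean_space set \<Rightarrow> ('a \<Rightarrow> 'b::euclidean_space) \<Rightarrow> real" where
  "Lq_norm q U f = (\<integral>x. norm (f x) powr q \<partial>lebesgue_on U) powr (1 / q)"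

definition L2_inner :: "'a::euclidean_space set \<Rightarrow> ('a \<Rightarrow> 'b::euclidean_space) \<Rightarrow> ('a \<Rightarrow> 'b) \<Rightarrow> real" where
  "L2_inner U h g = (\<integral>x. h x \<bullet> g x \<partial>lebesgue_on U)"

definition is_weak_grad :: "'a::euclidean_space set \<Rightarrow> ('a \<Rightarrow> real) \<Rightarrow> ('a \<Rightarrow> 'a) \<Rightarrow> bool" where
  "is_weak_grad U u g \<longleftrightarrow> (\<forall>\<phi>. test_fun U \<phi> \<longrightarrow> (\<forall>b\<in>Basis.
     (\<integral>x. u x * frechet_derivative \<phi> (at x) b \<partial>lebesgue_on U) =
     - (\<integral>x. (g x \<bullet> b) * \<phi> x \<partial>lebesgue_on U)))"

definition H1 :: "'a::euclidean_space set \<Rightarrow> ('a \<Rightarrow> real) set" where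
  "H1 U = {u \<in> Lq 2 U. \<exists>g \<in> Lq 2 U. is_weak_grad U u g}"

text \<open>Weak gradients are unique up to null sets, so any choice will do.\<close>

definition wgrad :: "'a::euclidean_space set \<Rightarrow> ('a \<Rightarrow> real) \<Rightarrow> 'a \<Rightarrow> 'a" where
  "wgrad U u = (SOME g. g \<in> Lq 2 U \<and> is_weak_grad U u g)"

definition H1_norm :: "'a::euclidean_space set \<Rightarrow> ('a \<Rightarrow> real) \<Rightarrow> real" where
  "H1_norm U u = sqrt ((Lq_norm 2 U u)\<^sup>2 + (Lq_norm 2 U (wgrad U u))\<^sup>2)"

definition H01 :: "'a::euclidean_space set \<Rightarrow> ('a \<Rightarrow> real) set" where
  "H01 U = {u \<in> H1 U. \<exists>\<phi>. (\<forall>k. test_fun U (\<phi> k)) \<and>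
     (\<lambda>k::nat. H1_norm U (\<lambda>x. \<phi> k x - u x)) \<longlonglongrightarrow> 0}"

section \<open>The functionals\<close>

text \<open>Here \<open>0 powr q = 0\<close>, which gives the convention that \<open>\<bar>s\<bar>\<^sup>q log \<bar>s\<bar>\<close> vanishes at \<open>0\<close>.\<close>

definition I_fun :: "real \<Rightarrow> 'a::euclidean_space set \<Rightarrow> ('a \<Rightarrow> real) \<Rightarrow> real" where
  "I_fun p U v = (Lq_norm 2 U (wgrad U v))\<^sup>2
     - (\<integral>x. \<bar>v x\<bar> powr (p + 1) * ln \<bar>v x\<bar> \<partial>lebesgue_on U)"

definition J_fun :: "real \<Rightarrow> 'a::euclidean_space set \<Rightarrow> ('a \<Rightarrow> real) \<Rightarrow> real" where
  "J_fun p U v = 1 / 2 * (Lq_norm 2 U (wgrad U v))\<^sup>2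
     - 1 / (p + 1) * (\<integral>x. \<bar>v x\<bar> powr (p + 1) * ln \<bar>v x\<bar> \<partial>lebesgue_on U)
     + 1 / (p + 1)\<^sup>2 * (Lq_norm (p + 1) U v) powr (p + 1)"

definition Nehari :: "real \<Rightarrow> 'a::euclidean_space set \<Rightarrow> ('a \<Rightarrow> real) set" where
  "Nehari p U = {v \<in> H01 U. (Lq_norm 2 U (wgrad U v))\<^sup>2 \<noteq> 0 \<and> I_fun p U v = 0}"

definition depth :: "real \<Rightarrow> 'a::euclidean_space set \<Rightarrow> real" where
  "depth p U = (INF v\<in>Nehari p U. J_fun p U v)"

section \<open>Functions of time with values in a function space\<close>

definition time_interval :: "ereal \<Rightarrow> real set" where
  "time_interval T = {t. 0 < t \<and> ereal t < T}"

text \<open>Strong (Bochner) measurability of \<open>f : (0,T) \<rightarrow> X\<close>, where \<open>N\<close> is the norm of the space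
  \<open>X\<close>: almost everywhere, \<open>f\<close> is the limit in \<open>N\<close> of simple functions with values in \<open>X\<close>.\<close>

definition strongly_measurable ::
    "(('a \<Rightarrow> real) set) \<Rightarrow> (('a \<Rightarrow> real) \<Rightarrow> real) \<Rightarrow> ereal \<Rightarrow> (real \<Rightarrow> 'a \<Rightarrow> real) \<Rightarrow> bool" where
  "strongly_measurable X N T f \<longleftrightarrow> (\<forall>t\<in>time_interval T. f t \<in> X) \<and>
     (\<exists>s. (\<forall>k. simple_function (lebesgue_on (time_interval T)) (s k) \<and>
               (\<forall>t\<in>time_interval T. s k t \<in> X)) \<and>
          (AE t in lebesgue_on (time_interval T).
             (\<lambda>k::nat. N (\<lambda>x. s k t x - f t x)) \<longlonglongrightarrow> 0))"

definition in_Linf_time ::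
    "(('a \<Rightarrow> real) set) \<Rightarrow> (('a \<Rightarrow> real) \<Rightarrow> real) \<Rightarrow> ereal \<Rightarrow> (real \<Rightarrow> 'a \<Rightarrow> real) \<Rightarrow> bool" where
  "in_Linf_time X N T f \<longleftrightarrow> strongly_measurable X N T f \<and>
     (\<exists>C. AE t in lebesgue_on (time_interval T). N (f t) \<le> C)"

definition in_L2_time ::
    "(('a \<Rightarrow> real) set) \<Rightarrow> (('a \<Rightarrow> real) \<Rightarrow> real) \<Rightarrow> ereal \<Rightarrow> (real \<Rightarrow> 'a \<Rightarrow> real) \<Rightarrow> bool" where
  "in_L2_time X N T f \<longleftrightarrow> strongly_measurable X N T f \<and>
     integrable (lebesgue_on (time_interval T)) (\<lambda>t. (N (f t))\<^sup>2)"

text \<open>\<open>z\<close> is the weak derivative \<open>v\<^sub>t\<close>: the identity \<open>\<integral> \<phi>'(t) v(t) dt = - \<integral> \<phi>(t) z(t) dt\<close> of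
  Bochner integrals in \<open>L\<^sup>2(U)\<close>, tested against the elements of \<open>L\<^sup>2(U)\<close>.\<close>

definition is_weak_time_deriv ::
    "'a::euclidean_space set \<Rightarrow> ereal \<Rightarrow> (real \<Rightarrow> 'a \<Rightarrow> real) \<Rightarrow> (real \<Rightarrow> 'a \<Rightarrow> real) \<Rightarrow> bool" where
  "is_weak_time_deriv U T v z \<longleftrightarrow> (\<forall>\<phi>. test_fun (time_interval T) \<phi> \<longrightarrow> (\<forall>w\<in>Lq 2 U.
     (\<integral>t. deriv \<phi> t * L2_inner U (v t) w \<partial>lebesgue_on (time_interval T)) =
     - (\<integral>t. \<phi> t * L2_inner U (z t) w \<partial>lebesgue_on (time_interval T))))"

section \<open>Weak solutions\<close>

text \<open>A function in \<open>L\<^sup>\<infinity>(0,T;H\<^sub>0\<^sup>1(U))\<close> with \<open>v\<^sub>t \<in> L\<^sup>2(0,T;L\<^sup>2(U))\<close> has a unique representative that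
  is continuous from \<open>[0,T)\<close> to \<open>L\<^sup>2(U)\<close>. As usual \<open>v\<close> denotes this representative; this gives
  \<open>v(\<cdot>,0) = v\<^sub>0\<close>, and \<open>v(\<cdot>,t)\<close> for every single \<open>t\<close>, a meaning. Likewise the equation holds
  for every \<open>t\<close> with a suitable representative \<open>z\<close> of \<open>v\<^sub>t\<close>.\<close>

definition weak_solution ::
    "real \<Rightarrow> 'a::euclidean_space set \<Rightarrow> ('a \<Rightarrow> real) \<Rightarrow> ereal \<Rightarrow> (real \<Rightarrow> 'a \<Rightarrow> real) \<Rightarrow> bool" where
  "weak_solution p U v0 T v \<longleftrightarrow>
     in_Linf_time (H01 U) (H1_norm U) T v \<and>
     (\<forall>t. 0 \<le> t \<and> ereal t < T \<longrightarrow>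
        ((\<lambda>s. Lq_norm 2 U (\<lambda>x. v s x - v t x)) \<longlongrightarrow> 0) (at t within {s. 0 \<le> s \<and> ereal s < T})) \<and>
     (AE x in lebesgue_on U. v 0 x = v0 x) \<and>
     (\<exists>z. in_L2_time (Lq 2 U) (Lq_norm 2 U) T z \<and> is_weak_time_deriv U T v z \<and>
        (\<forall>t\<in>time_interval T. \<forall>w\<in>H01 U.
           L2_inner U (wgrad U (v t)) (wgrad U w) + L2_inner U (z t) w =
           L2_inner U (\<lambda>x. v t x * \<bar>v t x\<bar> powr (p - 1) * ln \<bar>v t x\<bar>) w))"

end

theory Submission
  imports Defs
begin

text \<open>Testing the equation at time \<open>t\<close> with \<open>w = v(t) - v(s)\<close> gives
  \<open>J(v(t)) - J(v(s)) \<le> - (v\<^sub>t(t), w)\<^sub>2 + C \<parallel>w\<parallel>\<^sup>2\<close>, because the growth of the nonlinearity is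
  subcritical. By Gronwall's inequality, \<open>J\<close> is then nonincreasing and continuous along the
  solution, and strictly decreasing until the solution becomes stationary; hence \<open>\<parallel>\<nabla>v(t)\<parallel>\<close> and
  \<open>I(v(t))\<close> are continuous in \<open>t\<close>, and \<open>\<parallel>v(s)\<parallel>\<^sup>2 - \<parallel>v(t)\<parallel>\<^sup>2 = 2 \<integral> I(v(r)) dr\<close> over \<open>[s,t]\<close>.
  As \<open>I(v\<^sub>0) > 0\<close>, the solution is not stationary at the start, so \<open>J(v(a)) < \<delta>\<close> for some small
  \<open>a > 0\<close> with \<open>I(v(a)) > 0\<close>. From then on \<open>v(t)\<close> cannot meet the Nehari manifold and \<open>I\<close> is
  positive near \<open>0\<close>, so \<open>I\<close> stays nonnegative, and comparison with the dilation of \<open>v(t)\<close> that lies on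
  the Nehari manifold improves this to \<open>I(v(t)) \<ge> c \<parallel>\<nabla>v(t)\<parallel>\<^sup>2\<close>. With the Poincare inequality,
  \<open>\<parallel>v(t)\<parallel>\<^sup>2\<close> decays geometrically over unit time steps; as \<open>J\<close> is nonincreasing and at most a multiple
  of \<open>I\<close>, \<open>J(v(t + 1))\<close> is at most a multiple of the integral of \<open>I\<close> over \<open>[t,t + 1]\<close>, hence of
  \<open>\<parallel>v(t)\<parallel>\<^sup>2\<close>, while \<open>\<parallel>\<nabla>v\<parallel>\<^sup>2\<close> is at most a multiple of \<open>J\<close>. Solutions are unique, so the constants do not
  depend on the solution.\<close>

section \<open>The Hilbert space \<open>L\<^sup>2(U)\<close>\<close>

text \<open>The formal identity J(v)' = -||v_t||^2 comes from testing with v_t, but v_t lies only in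
  L2(U), while the equation admits test functions from \<open>H01\<close>. Differences v(t) - v(s)
  are admissible, so everything about J is derived from increments. Their estimate closes because p
  + 1 stays strictly below the critical exponent 2n/(n - 2): some q fits in between, the gap absorbs
  the logarithm, and the integral of w^2 against the weight of the nonlinearity is at most \<eta>
  ||grad w||^2 + C ||w||^2 with \<eta> as small as desired. The Sobolev inequality behind this is
  proved for subcritical q by averaging over rays. A priori the gradient norm is only lower
  semicontinuous in time. Continuity of J therefore needs three ingredients: lower semicontinuity,
  monotonicity, and the exclusion of downward jumps. The level J(v_0) = \<delta> is borderline: the
  dilation argument gives the coercivity constant 1 - 1/k, where k is a positive power of \<delta>/d
  for an energy level d, and this degenerates as d tends to \<delta>. Hence the energy has to drop
  strictly before any decay can be extracted.\<close>

lemma Lq_2_iff: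
  "f \<in> Lq 2 U \<longleftrightarrow> f \<in> borel_measurable (lebesgue_on U) \<and> integrable (lebesgue_on U) (\<lambda>x. (norm (f x))\<^sup>2)"
  by (simp add: Lq_def)

lemma Lq_2_measurable: "f \<in> Lq 2 U \<Longrightarrow> f \<in> borel_measurable (lebesgue_on U)"
  by (simp add: Lq_2_iff)

lemma integrable_L2_inner:
  assumes "f \<in> Lq 2 U" "g \<in> Lq 2 U"
  shows "integrable (lebesgue_on U) (\<lambda>x. f x \<bullet> g x)"
proof (rule Bochner_Integration.integrable_bound)
  show "integrable (lebesgue_on U) (\<lambda>x. (norm (f x))\<^sup>2 + (norm (g x))\<^sup>2)"
    using assms by (auto simp: Lq_2_iff)
  show "(\<lambda>x. f x \<bullet> g x) \<in> borel_measurable (lebesgue_on U)"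
    using assms by (auto simp: Lq_2_iff)
  have "\<bar>a \<bullet> b\<bar> \<le> (norm a)\<^sup>2 + (norm b)\<^sup>2" for a b :: 'b
  proof -
    have "\<bar>a \<bullet> b\<bar> \<le> norm a * norm b" by (rule Cauchy_Schwarz_ineq2)
    also have "\<dots> \<le> (norm a)\<^sup>2 + (norm b)\<^sup>2"
      using sum_squares_bound[of "norm a" "norm b"] mult_nonneg_nonneg[OF norm_ge_zero[of a] norm_ge_zero[of b]] by linarith
    finally show ?thesis .
  qed
  then show "AE x in lebesgue_on U. norm (f x \<bullet> g x) \<le> norm ((norm (f x))\<^sup>2 + (norm (g x))\<^sup>2)"
    by auto
qed

lemma Lq_2_add:
  assumes "f \<in> Lq 2 U" "g \<in> Lq 2 U"
  shows "(\<lambda>x. f x + g x) \<in> Lq 2 U"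
proof -
  have "integrable (lebesgue_on U) (\<lambda>x. (norm (f x))\<^sup>2 + (norm (g x))\<^sup>2 + 2 * (f x \<bullet> g x))"
    using assms integrable_L2_inner[OF assms] by (auto simp: Lq_2_iff)
  then have "integrable (lebesgue_on U) (\<lambda>x. (norm (f x + g x))\<^sup>2)"
    by (simp add: power2_norm_eq_inner inner_add inner_commute algebra_simps)
  then show ?thesis using assms by (auto simp: Lq_2_iff)
qed

lemma Lq_2_scaleR: "f \<in> Lq 2 U \<Longrightarrow> (\<lambda>x. c *\<^sub>R f x) \<in> Lq 2 U"
  by (auto simp: Lq_2_iff power_mult_distrib)

lemma Lq_2_mult: "f \<in> Lq 2 U \<Longrightarrow> (\<lambda>x. c * f x :: real) \<in> Lq 2 U"
  using Lq_2_scaleR[of f U c] by simp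

lemma Lq_2_diff:
  assumes "f \<in> Lq 2 U" "g \<in> Lq 2 U"
  shows "(\<lambda>x. f x - g x) \<in> Lq 2 U"
  using Lq_2_add[OF assms(1) Lq_2_scaleR[OF assms(2), of "-1"]] by simp

lemma Lq_2_zero: "(\<lambda>x. 0) \<in> Lq 2 U"
  by (simp add: Lq_2_iff)

lemma Lq_2_cong_AE:
  assumes "f \<in> Lq 2 U" "g \<in> borel_measurable (lebesgue_on U)" "AE x in lebesgue_on U. f x = g x"
  shows "g \<in> Lq 2 U"
proof -
  have "integrable (lebesgue_on U) (\<lambda>x. (norm (f x))\<^sup>2) \<longleftrightarrow> integrable (lebesgue_on U) (\<lambda>x. (norm (g x))\<^sup>2)"
    using assms by (intro integrable_cong_AE) (auto simp: Lq_2_iff)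
  then show ?thesis using assms by (auto simp: Lq_2_iff)
qed

lemma L2_inner_commute: "L2_inner U f g = L2_inner U g f"
  by (simp add: L2_inner_def inner_commute)

lemma L2_inner_add_left:
  "f \<in> Lq 2 U \<Longrightarrow> g \<in> Lq 2 U \<Longrightarrow> h \<in> Lq 2 U \<Longrightarrow>
    L2_inner U (\<lambda>x. f x + g x) h = L2_inner U f h + L2_inner U g h"
  by (simp add: L2_inner_def inner_add_left integrable_L2_inner)

lemma L2_inner_diff_left:
  "f \<in> Lq 2 U \<Longrightarrow> g \<in> Lq 2 U \<Longrightarrow> h \<in> Lq 2 U \<Longrightarrow>
    L2_inner U (\<lambda>x. f x - g x) h = L2_inner U f h - L2_inner U g h"
  by (simp add: L2_inner_def inner_diff_left integrable_L2_inner)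

lemma L2_inner_diff_right:
  "f \<in> Lq 2 U \<Longrightarrow> g \<in> Lq 2 U \<Longrightarrow> h \<in> Lq 2 U \<Longrightarrow>
    L2_inner U h (\<lambda>x. f x - g x) = L2_inner U h f - L2_inner U h g"
  by (simp add: L2_inner_def inner_diff_right integrable_L2_inner)

lemma L2_inner_scaleR_left: "L2_inner U (\<lambda>x. c *\<^sub>R f x) h = c * L2_inner U f h"
  by (simp add: L2_inner_def)

lemma L2_inner_scaleR_right: "L2_inner U h (\<lambda>x. c *\<^sub>R f x) = c * L2_inner U h f"
  by (simp add: L2_inner_def)

lemma L2_inner_cong_AE:
  assumes "f \<in> Lq 2 U" "g \<in> Lq 2 U" "f' \<in> Lq 2 U" "g' \<in> Lq 2 U"
    and "AE x in lebesgue_on U. f x = f' x" "AE x in lebesgue_on U. g x = g' x"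
  shows "L2_inner U f g = L2_inner U f' g'"
proof -
  have "AE x in lebesgue_on U. f x \<bullet> g x = f' x \<bullet> g' x"
    using assms(5,6) by eventually_elim simp
  then show ?thesis
    using assms(1-4) unfolding L2_inner_def
    by (intro integral_cong_AE) (auto simp: Lq_2_iff)
qed

lemma Lq_norm_2: "Lq_norm 2 U f = sqrt (L2_inner U f f)"
proof -
  have "(\<integral>x. (norm (f x))\<^sup>2 \<partial>lebesgue_on U) \<ge> 0" by simp
  then show ?thesis
    by (simp add: Lq_norm_def L2_inner_def powr_half_sqrt power2_norm_eq_inner)
qed

lemma L2_inner_self_nonneg: "L2_inner U f f \<ge> 0"
  by (simp add: L2_inner_def)

lemma Lq_norm_2_sq: "(Lq_norm 2 U f)\<^sup>2 = L2_inner U f f"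
  by (simp add: Lq_norm_2 L2_inner_self_nonneg)

lemma Lq_norm_2_sq_integral: "(Lq_norm 2 U f)\<^sup>2 = (\<integral>x. (norm (f x))\<^sup>2 \<partial>lebesgue_on U)"
  by (simp add: Lq_norm_2_sq L2_inner_def power2_norm_eq_inner)

lemma Lq_norm_zero [simp]: "Lq_norm q U (\<lambda>x. 0) = 0"
  by (simp add: Lq_norm_def)

lemma Lq_norm_nonneg [simp]: "Lq_norm q U f \<ge> 0"
  by (simp add: Lq_norm_def)

lemma Lq_norm_2_diff_sq:
  assumes "f \<in> Lq 2 U" "g \<in> Lq 2 U"
  shows "(Lq_norm 2 U (\<lambda>x. f x - g x))\<^sup>2 = (Lq_norm 2 U f)\<^sup>2 - 2 * L2_inner U f g + (Lq_norm 2 U g)\<^sup>2"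
proof -
  have "(Lq_norm 2 U (\<lambda>x. f x - g x))\<^sup>2
      = L2_inner U f f - L2_inner U f g - (L2_inner U g f - L2_inner U g g)"
    using L2_inner_diff_left[OF assms Lq_2_diff[OF assms]] L2_inner_diff_right[OF assms assms(1)]
      L2_inner_diff_right[OF assms assms(2)] by (simp add: Lq_norm_2_sq)
  then show ?thesis using L2_inner_commute[of U g f] by (simp add: Lq_norm_2_sq)
qed

lemma L2_Cauchy_Schwarz:
  assumes "f \<in> Lq 2 U" "g \<in> Lq 2 U"
  shows "\<bar>L2_inner U f g\<bar> \<le> Lq_norm 2 U f * Lq_norm 2 U g"
proof -
  define a b c where "a = L2_inner U f f" and "b = L2_inner U f g" and "c = L2_inner U g g"
  have *: "0 \<le> s * s * a - 2 * s * t * b + t * t * c" for s t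
  proof -
    have "0 \<le> L2_inner U (\<lambda>x. s *\<^sub>R f x - t *\<^sub>R g x) (\<lambda>x. s *\<^sub>R f x - t *\<^sub>R g x)"
      by (rule L2_inner_self_nonneg)
    also have "\<dots> = s * s * a - 2 * s * t * b + t * t * c"
      using assms
      by (simp add: L2_inner_diff_left L2_inner_diff_right Lq_2_diff Lq_2_scaleR L2_inner_scaleR_left
          L2_inner_scaleR_right L2_inner_commute[of U g f] a_def b_def c_def algebra_simps)
    finally show ?thesis .
  qed
  have a: "a \<ge> 0" and c: "c \<ge> 0" by (auto simp: a_def c_def L2_inner_self_nonneg)
  have "b\<^sup>2 \<le> a * c"
  proof (cases "c = 0")
    case True
    show ?thesis
    proof (cases "b = 0")
      case False
      \<comment> \<open>For c = 0 and s = 1 the form is affine in t; this t makes it a - (a + 1) =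
        -1.\<close>
      have "0 \<le> 1 * 1 * a - 2 * 1 * ((a + 1) / (2 * b)) * b + 0"
        using *[of 1 "(a + 1) / (2 * b)"] True by simp
      then show ?thesis using False by simp
    qed (use a c in simp)
  next
    case False
    have "0 \<le> c * c * a - 2 * c * b * b + b * b * c" using *[of c b] by simp
    also have "\<dots> = c * (a * c - b\<^sup>2)" by (simp add: algebra_simps power2_eq_square)
    finally show ?thesis using False c by (simp add: zero_le_mult_iff)
  qed
  then have "\<bar>b\<bar> \<le> sqrt (a * c)" by (rule real_le_rsqrt[where x="\<bar>b\<bar>", unfolded power2_abs])
  then show ?thesis unfolding Lq_norm_2 a_def b_def c_def real_sqrt_mult .
qed

lemma L2_triangle:
  assumes "f \<in> Lq 2 U" "g \<in> Lq 2 U"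
  shows "Lq_norm 2 U (\<lambda>x. f x + g x) \<le> Lq_norm 2 U f + Lq_norm 2 U g"
proof (rule power2_le_imp_le)
  have "(Lq_norm 2 U (\<lambda>x. f x + g x))\<^sup>2 = (Lq_norm 2 U f)\<^sup>2 + 2 * L2_inner U f g + (Lq_norm 2 U g)\<^sup>2"
  proof -
    have "(Lq_norm 2 U (\<lambda>x. f x - (- 1) *\<^sub>R g x))\<^sup>2 = (Lq_norm 2 U f)\<^sup>2
        - 2 * L2_inner U f (\<lambda>x. (- 1) *\<^sub>R g x) + (Lq_norm 2 U (\<lambda>x. (- 1) *\<^sub>R g x))\<^sup>2"
      by (rule Lq_norm_2_diff_sq[OF assms(1) Lq_2_scaleR[OF assms(2)]])
    also have "(Lq_norm 2 U (\<lambda>x. (- 1) *\<^sub>R g x))\<^sup>2 = (Lq_norm 2 U g)\<^sup>2"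
      unfolding Lq_norm_2_sq L2_inner_scaleR_left L2_inner_scaleR_right by simp
    also have "L2_inner U f (\<lambda>x. (- 1) *\<^sub>R g x) = - L2_inner U f g"
      unfolding L2_inner_scaleR_right by simp
    finally show ?thesis by simp
  qed
  also have "\<dots> \<le> (Lq_norm 2 U f + Lq_norm 2 U g)\<^sup>2"
    using L2_Cauchy_Schwarz[OF assms] by (simp add: power2_sum)
  finally show "(Lq_norm 2 U (\<lambda>x. f x + g x))\<^sup>2 \<le> (Lq_norm 2 U f + Lq_norm 2 U g)\<^sup>2" .
qed simp

lemma Lq_norm_2_scaleR: "Lq_norm 2 U (\<lambda>x. c *\<^sub>R f x) = \<bar>c\<bar> * Lq_norm 2 U f"
  by (simp add: Lq_norm_2 L2_inner_scaleR_left L2_inner_scaleR_right real_sqrt_mult flip: mult.assoc)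

lemma Lq_norm_2_minus: "Lq_norm 2 U (\<lambda>x. f x - g x) = Lq_norm 2 U (\<lambda>x. g x - f x)"
  by (simp add: Lq_norm_def norm_minus_commute)

lemma Lq_norm_2_cong_AE:
  assumes "f \<in> borel_measurable (lebesgue_on U)" "g \<in> borel_measurable (lebesgue_on U)"
    "AE x in lebesgue_on U. f x = g x"
  shows "Lq_norm 2 U f = Lq_norm 2 U g"
proof -
  have "(\<integral>x. norm (f x) powr 2 \<partial>lebesgue_on U) = (\<integral>x. norm (g x) powr 2 \<partial>lebesgue_on U)"
    using assms by (intro integral_cong_AE) auto
  then show ?thesis unfolding Lq_norm_def by presburger
qed

lemma Lq_norm_2_eq_0_iff:
  assumes "f \<in> Lq 2 U"
  shows "Lq_norm 2 U f = 0 \<longleftrightarrow> (AE x in lebesgue_on U. f x = 0)"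
proof -
  have "Lq_norm 2 U f = 0 \<longleftrightarrow> (\<integral>x. (norm (f x))\<^sup>2 \<partial>lebesgue_on U) = 0"
    using Lq_norm_2_sq_integral[of U f] by (metis power2_eq_square mult_eq_0_iff)
  also have "\<dots> \<longleftrightarrow> (AE x in lebesgue_on U. (norm (f x))\<^sup>2 = 0)"
    using assms by (intro integral_nonneg_eq_0_iff_AE) (auto simp: Lq_2_iff)
  finally show ?thesis by simp
qed

lemma Lq_norm_2_diff_eq_0:
  assumes "f \<in> Lq 2 U" "g \<in> Lq 2 U" "Lq_norm 2 U (\<lambda>x. f x - g x) = 0"
  shows "AE x in lebesgue_on U. f x = g x"
  using Lq_norm_2_eq_0_iff[OF Lq_2_diff[OF assms(1,2)]] assms(3) by simp

text \<open>The increment splits into (F_k - f, G_k) and (f, G_k - g), and the norms of the G_k stay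
  bounded by the triangle inequality. This joint continuity of the inner product serves both for
  limits in \<open>H01\<close> and for curves in time.\<close>

lemma Lq_norm_2_diff_tendsto_sum:
  assumes "\<And>k. F k \<in> Lq 2 U" "f \<in> Lq 2 U" "\<And>k. G k \<in> Lq 2 U" "g \<in> Lq 2 U"
    and "(\<lambda>k. Lq_norm 2 U (\<lambda>x. F k x - f x)) \<longlonglongrightarrow> 0"
    and "(\<lambda>k. Lq_norm 2 U (\<lambda>x. G k x - g x)) \<longlonglongrightarrow> 0"
  shows "(\<lambda>k. L2_inner U (F k) (G k)) \<longlonglongrightarrow> L2_inner U f g"
proof -
  have G: "Lq_norm 2 U (G k) \<le> Lq_norm 2 U (\<lambda>x. G k x - g x) + Lq_norm 2 U g" for k
    using L2_triangle[OF Lq_2_diff[OF assms(3)[of k] assms(4)] assms(4)] by simp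
  have "norm (L2_inner U (F k) (G k) - L2_inner U f g) \<le>
     Lq_norm 2 U (\<lambda>x. F k x - f x) * (Lq_norm 2 U (\<lambda>x. G k x - g x) + Lq_norm 2 U g)
     + Lq_norm 2 U f * Lq_norm 2 U (\<lambda>x. G k x - g x)" for k
  proof -
    have "L2_inner U (F k) (G k) - L2_inner U f g
      = L2_inner U (\<lambda>x. F k x - f x) (G k) + L2_inner U f (\<lambda>x. G k x - g x)"
      using assms by (simp add: L2_inner_diff_left L2_inner_diff_right)
    moreover have "\<bar>L2_inner U (\<lambda>x. F k x - f x) (G k)\<bar> \<le> Lq_norm 2 U (\<lambda>x. F k x - f x) * Lq_norm 2 U (G k)"
      using assms by (intro L2_Cauchy_Schwarz) (auto intro: Lq_2_diff)
    moreover have "\<dots> \<le> Lq_norm 2 U (\<lambda>x. F k x - f x) * (Lq_norm 2 U (\<lambda>x. G k x - g x) + Lq_norm 2 U g)"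
      using G[of k] by (intro mult_left_mono) auto
    moreover have "\<bar>L2_inner U f (\<lambda>x. G k x - g x)\<bar> \<le> Lq_norm 2 U f * Lq_norm 2 U (\<lambda>x. G k x - g x)"
      using assms by (intro L2_Cauchy_Schwarz) (auto intro: Lq_2_diff)
    ultimately show ?thesis by simp
  qed
  moreover have "(\<lambda>k. Lq_norm 2 U (\<lambda>x. F k x - f x) * (Lq_norm 2 U (\<lambda>x. G k x - g x) + Lq_norm 2 U g)
     + Lq_norm 2 U f * Lq_norm 2 U (\<lambda>x. G k x - g x)) \<longlonglongrightarrow> 0 * (0 + Lq_norm 2 U g) + Lq_norm 2 U f * 0"
    by (intro tendsto_intros assms)
  ultimately have "(\<lambda>k. L2_inner U (F k) (G k) - L2_inner U f g) \<longlonglongrightarrow> 0"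
    by (intro tendsto_0_le[where K=1 and g="\<lambda>k. L2_inner U (F k) (G k) - L2_inner U f g"])
      (auto intro!: always_eventually)
  then show ?thesis by (simp add: LIM_zero_iff)
qed

lemma Lq_2_bounded:
  assumes "f \<in> borel_measurable (lebesgue_on U)" "U \<in> lmeasurable" "\<And>x. x \<in> U \<Longrightarrow> norm (f x) \<le> B"
  shows "f \<in> Lq 2 U"
proof -
  have fin: "finite_measure (lebesgue_on U)"
    using assms(2) by (simp add: finite_measure_lebesgue_on)
  have "integrable (lebesgue_on U) (\<lambda>x. (norm (f x))\<^sup>2)"
  proof (rule finite_measure.integrable_const_bound[OF fin])
    have "U \<in> sets lebesgue" using assms(2) by (simp add: fmeasurableD)
    then show "AE x in lebesgue_on U. norm ((norm (f x))\<^sup>2) \<le> B\<^sup>2"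
      by (intro AE_I2) (auto intro!: power_mono assms(3))
    show "(\<lambda>x. (norm (f x))\<^sup>2) \<in> borel_measurable (lebesgue_on U)" using assms(1) by simp
  qed
  then show ?thesis using assms(1) by (simp add: Lq_2_iff)
qed

section \<open>Smooth functions and test functions\<close>

lemma C_k_SucI:
  assumes "\<And>x. (f has_derivative f' x) (at x)" "\<And>b. b \<in> Basis \<Longrightarrow> C_k k (\<lambda>x. f' x b)"
  shows "C_k (Suc k) f"
proof -
  have "frechet_derivative f (at x) = f' x" for x
    using frechet_derivative_at[OF assms(1)] by simp
  then show ?thesis using assms by (auto simp: differentiable_def)
qed

lemma C_k_Suc_has_derivative:
  "C_k (Suc k) f \<Longrightarrow> (f has_derivative frechet_derivative f (at x)) (at x)"
  by (simp add: frechet_derivative_works[symmetric])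

lemma C_k_Suc_imp: "C_k (Suc k) f \<Longrightarrow> C_k k f"
proof (induction k arbitrary: f)
  case 0
  then have "\<forall>x. isCont f x" using differentiable_imp_continuous_within by fastforce
  then show ?case by (simp add: continuous_on_eq_continuous_at)
next
  case (Suc k)
  then show ?case by simp
qed

lemma C_k_const: "C_k k (\<lambda>_. c)"
proof (induction k arbitrary: c)
  case (Suc k)
  show ?case by (rule C_k_SucI[where f'="\<lambda>_ _. 0"]) (auto intro: Suc)
qed simp

lemma C_k_add: "C_k k f \<Longrightarrow> C_k k g \<Longrightarrow> C_k k (\<lambda>x. f x + g x)"
proof (induction k arbitrary: f g)
  case (Suc k)
  have "C_k k (\<lambda>x. frechet_derivative f (at x) b + frechet_derivative g (at x) b)" if "b \<in> Basis" for b
    using Suc.IH Suc.prems that by simp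
  then show ?case
    by (intro C_k_SucI[where f'="\<lambda>x h. frechet_derivative f (at x) h + frechet_derivative g (at x) h"]
        has_derivative_add C_k_Suc_has_derivative[OF Suc.prems(1)] C_k_Suc_has_derivative[OF Suc.prems(2)])
qed (auto intro: continuous_intros)

lemma C_k_mult: "C_k k f \<Longrightarrow> C_k k g \<Longrightarrow> C_k k (\<lambda>x. f x * g x)"
proof (induction k arbitrary: f g)
  case (Suc k)
  have "C_k k (\<lambda>x. f x * frechet_derivative g (at x) b + frechet_derivative f (at x) b * g x)" if "b \<in> Basis" for b
    using Suc.IH Suc.prems C_k_Suc_imp[OF Suc.prems(1)] C_k_Suc_imp[OF Suc.prems(2)] that
    by (intro C_k_add) auto
  then show ?case
    by (intro C_k_SucI[where f'="\<lambda>x h. f x * frechet_derivative g (at x) h + frechet_derivative f (at x) h * g x"]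
        has_derivative_mult C_k_Suc_has_derivative[OF Suc.prems(1)] C_k_Suc_has_derivative[OF Suc.prems(2)])
qed (auto intro: continuous_intros)

lemma C_k_prod: "finite A \<Longrightarrow> (\<And>i. i \<in> A \<Longrightarrow> C_k k (f i)) \<Longrightarrow> C_k k (\<lambda>x. \<Prod>i\<in>A. f i x)"
  by (induction A rule: finite_induct) (auto intro: C_k_const C_k_mult)

lemma C_k_real_SucI:
  fixes f :: "real \<Rightarrow> real"
  assumes "\<And>x. (f has_real_derivative f' x) (at x)" "C_k k f'"
  shows "C_k (Suc k) f"
  using assms by (intro C_k_SucI[where f'="\<lambda>x h. f' x * h"]) (auto simp: has_field_derivative_def)

text \<open>Composition with an affine functional is closed under differentiation: a partial
  derivative is the same composition with the derivative of h, times the constant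
  \<open>c * (e \<bullet> b)\<close>. The bumps and cutoffs below are built from such
  functions.\<close>

lemma C_k_compose_inner:
  "C_k k h \<Longrightarrow> C_k k (\<lambda>x. h (c * (x \<bullet> b) + d))"
proof (induction k arbitrary: h)
  case 0
  then have h: "continuous_on UNIV h" by simp
  have "continuous_on UNIV (\<lambda>x. c * (x \<bullet> b) + d)" by (intro continuous_intros)
  then have "continuous_on UNIV (\<lambda>x. h (c * (x \<bullet> b) + d))"
    by (rule continuous_on_compose2[OF h]) simp
  then show ?case by simp
next
  case (Suc k)
  let ?h' = "\<lambda>x. frechet_derivative h (at x) 1"
  have h': "(h has_real_derivative ?h' x) (at x)" for x
  proof -
    have d: "(h has_derivative frechet_derivative h (at x)) (at x)"
      by (rule C_k_Suc_has_derivative[OF Suc.prems])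
    have "frechet_derivative h (at x) e = ?h' x * e" for e
      using linear_cmul[OF has_derivative_linear[OF d], of e 1] by (simp add: mult.commute)
    then have "frechet_derivative h (at x) = (\<lambda>e. ?h' x * e)" by (rule ext)
    then show ?thesis unfolding has_field_derivative_def by (rule has_derivative_eq_rhs[OF d])
  qed
  have "((\<lambda>x. h (c * (x \<bullet> b) + d)) has_derivative (\<lambda>e. ?h' (c * (x \<bullet> b) + d) * (c * (e \<bullet> b)))) (at x)" for x
    by (rule has_derivative_eq_rhs[OF has_derivative_compose[OF _ h'[unfolded has_field_derivative_def]]])
      (auto intro!: derivative_eq_intros)
  moreover have "C_k k (\<lambda>x. ?h' (c * (x \<bullet> b) + d) * (c * (e \<bullet> b)))" for e
    using Suc by (intro C_k_mult C_k_const) auto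
  ultimately show ?case by (intro C_k_SucI) auto
qed

text \<open>The family q(1/x) exp(-1/x), extended by 0, is closed under differentiation: q is
  replaced by y^2 (q - q'). Carrying the polynomial along makes smoothness of the classical flat
  function, the case q = 1, a plain induction.\<close>

definition flat_exp :: "real poly \<Rightarrow> real \<Rightarrow> real" where
  "flat_exp q x = (if x > 0 then poly q (1 / x) * exp (- (1 / x)) else 0)"

lemma tendsto_poly_mult_exp_minus: "((\<lambda>y::real. poly q y * exp (- y)) \<longlongrightarrow> 0) at_top"
proof -
  have "((\<lambda>y. \<Sum>i\<le>degree q. coeff q i * (y ^ i / exp y)) \<longlongrightarrow> (\<Sum>i\<le>degree q. coeff q i * 0)) at_top"
    by (intro tendsto_sum tendsto_mult tendsto_const tendsto_power_div_exp_0)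
  then show ?thesis
    by (simp add: poly_altdef sum_distrib_right exp_minus divide_inverse mult.assoc)
qed

lemma flat_exp_tendsto_0: "((flat_exp q) \<longlongrightarrow> 0) (at 0)"
proof -
  have "((\<lambda>x. poly q (inverse x) * exp (- inverse x)) \<longlongrightarrow> 0) (at_right (0::real))"
    using tendsto_poly_mult_exp_minus filterlim_inverse_at_top_right by (rule filterlim_compose)
  then have "(flat_exp q \<longlongrightarrow> 0) (at_right 0)"
    by (rule Lim_transform_eventually) (auto simp: flat_exp_def eventually_at_right_less inverse_eq_divide
        eventually_at intro!: exI[of _ 1])
  moreover have "(flat_exp q \<longlongrightarrow> 0) (at_left 0)"
    by (rule Lim_transform_eventually[OF tendsto_const])
      (auto simp: flat_exp_def eventually_at intro!: exI[of _ 1])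
  ultimately show ?thesis by (simp add: filterlim_at_split)
qed

lemma flat_exp_has_derivative:
  "(flat_exp q has_real_derivative flat_exp ([:0, 0, 1:] * (q - pderiv q)) x) (at x)"
proof -
  consider "x > 0" | "x < 0" | "x = 0" by linarith
  then show ?thesis
  proof cases
    case 1
    have "((\<lambda>x. poly q (1 / x) * exp (- (1 / x))) has_real_derivative
        flat_exp ([:0, 0, 1:] * (q - pderiv q)) x) (at x)"
      using 1 by (auto intro!: derivative_eq_intros simp: flat_exp_def power2_eq_square field_simps)
    then show ?thesis
      by (rule has_field_derivative_transform_within_open[where S="{0<..}"]) (use 1 in \<open>auto simp: flat_exp_def\<close>)
  next
    case 2
    have "((\<lambda>x. 0) has_real_derivative 0) (at x)" by simp
    then have "(flat_exp q has_real_derivative 0) (at x)"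
      by (rule has_field_derivative_transform_within_open[where S="{..<0}"]) (use 2 in \<open>auto simp: flat_exp_def\<close>)
    then show ?thesis using 2 by (simp add: flat_exp_def)
  next
    case 3
    \<comment> \<open>At the origin the difference quotient is again a member of the family, so one
      limit lemma gives the derivative 0.\<close>
    have eq: "(flat_exp q y - flat_exp q 0) / (y - 0) = flat_exp ([:0, 1:] * q) y" for y
      by (auto simp: flat_exp_def)
    have "(flat_exp q has_real_derivative 0) (at 0)"
      unfolding has_field_derivative_iff eq by (rule flat_exp_tendsto_0)
    then show ?thesis using 3 by (simp add: flat_exp_def)
  qed
qed

lemma C_k_flat_exp: "C_k k (flat_exp q)"
proof (induction k arbitrary: q)
  case 0
  show ?case using DERIV_isCont[OF flat_exp_has_derivative]
    by (auto simp: continuous_on_eq_continuous_at)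
next
  case (Suc k)
  show ?case by (rule C_k_real_SucI[OF flat_exp_has_derivative Suc.IH])
qed

lemma flat_exp_1: "flat_exp 1 x = (if x > 0 then exp (- (1 / x)) else 0)"
  by (simp add: flat_exp_def)

section \<open>Algebra of test functions\<close>

lemma smooth_has_derivative:
  "smooth f \<Longrightarrow> (f has_derivative frechet_derivative f (at x)) (at x)"
  unfolding smooth_def by (rule C_k_Suc_has_derivative) blast

lemma smooth_partial: "smooth f \<Longrightarrow> b \<in> Basis \<Longrightarrow> smooth (\<lambda>x. frechet_derivative f (at x) b)"
  unfolding smooth_def by (metis C_k.simps(2))

lemma smooth_continuous: "smooth f \<Longrightarrow> continuous_on S f"
  unfolding smooth_def by (metis C_k.simps(1) continuous_on_subset subset_UNIV)

lemma test_fun_add: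
  assumes "test_fun U f" "test_fun U g"
  shows "test_fun U (\<lambda>x. f x + g x)"
proof -
  let ?A = "closure {x. f x \<noteq> 0}" and ?B = "closure {x. g x \<noteq> 0}"
  have sub: "closure {x. f x + g x \<noteq> 0} \<subseteq> ?A \<union> ?B"
    unfolding closure_Un[symmetric] by (rule closure_mono) auto
  have "compact (?A \<union> ?B)" using assms by (auto simp: test_fun_def)
  then have "compact ((?A \<union> ?B) \<inter> closure {x. f x + g x \<noteq> 0})" by (rule compact_Int_closed) simp
  with sub have "compact (closure {x. f x + g x \<noteq> 0})" by (simp add: inf.absorb2)
  then show ?thesis using assms sub by (auto simp: test_fun_def smooth_def intro!: C_k_add)
qed

lemma test_fun_scale:
  assumes "test_fun U f" shows "test_fun U (\<lambda>x. c * f x)"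
proof (cases "c = 0")
  case True
  then show ?thesis by (simp add: test_fun_def smooth_def C_k_const)
next
  case False
  then show ?thesis using assms by (auto simp: test_fun_def smooth_def intro!: C_k_mult C_k_const)
qed

lemma frechet_derivative_eq_0_outside:
  assumes "x \<notin> closure {x. f x \<noteq> 0}"
  shows "frechet_derivative f (at x) = (\<lambda>_. 0)"
proof -
  have "((\<lambda>_. 0) has_derivative (\<lambda>_. 0)) (at x)" by simp
  then have "(f has_derivative (\<lambda>_. 0)) (at x)"
    by (rule has_derivative_transform_within_open[where s="- closure {x. f x \<noteq> 0}"])
      (use assms closure_subset[of "{x. f x \<noteq> 0}"] in auto)
  then show ?thesis using frechet_derivative_at by metis
qed

lemma test_fun_partial:
  assumes "test_fun U f" "b \<in> Basis"
  shows "test_fun U (\<lambda>x. frechet_derivative f (at x) b)"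
proof -
  let ?A = "closure {x. f x \<noteq> 0}"
  have "{x. frechet_derivative f (at x) b \<noteq> 0} \<subseteq> ?A"
    using frechet_derivative_eq_0_outside[of _ f] by (metis (mono_tags, lifting) mem_Collect_eq subsetI)
  then have sub: "closure {x. frechet_derivative f (at x) b \<noteq> 0} \<subseteq> ?A"
    by (simp add: closure_minimal)
  have "compact (?A \<inter> closure {x. frechet_derivative f (at x) b \<noteq> 0})"
    using assms by (intro compact_Int_closed) (auto simp: test_fun_def)
  with sub have "compact (closure {x. frechet_derivative f (at x) b \<noteq> 0})" by (simp add: inf.absorb2)
  then show ?thesis using assms sub by (auto simp: test_fun_def smooth_partial)
qed

lemma test_fun_eq_0: "test_fun U f \<Longrightarrow> x \<notin> U \<Longrightarrow> f x = 0"
  using closure_subset[of "{x. f x \<noteq> 0}"] by (auto simp: test_fun_def)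

lemma test_fun_bounded:
  assumes "test_fun U f" obtains B where "\<And>x. \<bar>f x\<bar> \<le> B"
proof -
  let ?A = "closure {x. f x \<noteq> 0}"
  have "compact (f ` ?A)"
    using assms by (intro compact_continuous_image smooth_continuous) (auto simp: test_fun_def)
  then obtain B where B: "\<And>y. y \<in> f ` ?A \<Longrightarrow> norm y \<le> B"
    using compact_imp_bounded[of "f ` ?A"] unfolding bounded_iff by blast
  have "\<bar>f x\<bar> \<le> max B 0" for x
    using B[of "f x"] closure_subset[of "{x. f x \<noteq> 0}"] by (cases "f x = 0") auto
  then show thesis by (rule that)
qed

lemma test_fun_measurable: "test_fun U f \<Longrightarrow> f \<in> borel_measurable borel"
  by (auto simp: test_fun_def intro!: borel_measurable_continuous_onI smooth_continuous)

text \<open>Written with affine arguments \<open>c * (x \<bullet> i) + d\<close> so that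
  \<open>C_k_compose_inner\<close> applies; \<open>box_bump_alt\<close> is the readable form. As k
  grows, each factor tends to 1 inside the box, so the bumps converge to the indicator of the open
  box while staying in [0, 1].\<close>

definition box_bump :: "'a::euclidean_space \<Rightarrow> 'a \<Rightarrow> nat \<Rightarrow> 'a \<Rightarrow> real" where
  "box_bump a b k x = (\<Prod>i\<in>Basis. flat_exp 1 (Suc k * (x \<bullet> i) + - Suc k * (a \<bullet> i)) *
     flat_exp 1 (- Suc k * (x \<bullet> i) + Suc k * (b \<bullet> i)))"

lemma box_bump_alt:
  "box_bump a b k x = (\<Prod>i\<in>Basis. flat_exp 1 (Suc k * (x \<bullet> i - a \<bullet> i)) * flat_exp 1 (Suc k * (b \<bullet> i - x \<bullet> i)))"
  by (simp add: box_bump_def algebra_simps)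

lemma box_bump_outside: "x \<notin> box a b \<Longrightarrow> box_bump a b k x = 0"
  by (auto simp: box_bump_alt mem_box flat_exp_1 prod_zero_iff zero_less_mult_iff)

lemma test_fun_box_bump: "cbox a b \<subseteq> U \<Longrightarrow> test_fun U (box_bump a b k)"
proof -
  assume U: "cbox a b \<subseteq> U"
  have "{x. box_bump a b k x \<noteq> 0} \<subseteq> cbox a b"
    using box_bump_outside box_subset_cbox by blast
  then have sub: "closure {x. box_bump a b k x \<noteq> 0} \<subseteq> cbox a b" by (simp add: closure_minimal closed_cbox)
  have "compact (cbox a b \<inter> closure {x. box_bump a b k x \<noteq> 0})" by (intro compact_Int_closed) auto
  with sub have "compact (closure {x. box_bump a b k x \<noteq> 0})" by (simp add: inf.absorb2)
  moreover have "smooth (box_bump a b k)"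
    unfolding smooth_def box_bump_def
    by (intro allI C_k_prod C_k_mult C_k_compose_inner C_k_flat_exp) auto
  ultimately show ?thesis using sub U by (auto simp: test_fun_def)
qed

lemma flat_exp_1_bounds: "0 \<le> flat_exp 1 x" "flat_exp 1 x \<le> 1"
  by (auto simp: flat_exp_1)

lemma box_bump_bounds: "0 \<le> box_bump a b k x" "box_bump a b k x \<le> 1"
  unfolding box_bump_def
  by (auto intro!: prod_nonneg prod_le_1 mult_nonneg_nonneg mult_le_one flat_exp_1_bounds)

lemma flat_exp_1_scale_tendsto:
  fixes x :: real
  assumes x: "x > 0"
  shows "(\<lambda>k. flat_exp 1 (real (Suc k) * x)) \<longlonglongrightarrow> 1"
proof -
  have "(\<lambda>k. 1 / x * inverse (real (Suc k))) \<longlonglongrightarrow> 1 / x * 0"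
    by (intro tendsto_intros LIMSEQ_inverse_real_of_nat)
  then have "(\<lambda>k. exp (- (1 / x * inverse (real (Suc k))))) \<longlonglongrightarrow> exp (- 0)"
    by (intro tendsto_exp tendsto_minus) simp
  then show ?thesis using x by (simp add: flat_exp_1 field_simps add_pos_nonneg)
qed

lemma box_bump_tendsto: "(\<lambda>k. box_bump a b k x) \<longlonglongrightarrow> indicator (box a b) x"
proof (cases "x \<in> box a b")
  case True
  have "(\<lambda>k. box_bump a b k x) \<longlonglongrightarrow> (\<Prod>i\<in>(Basis::'a set). 1 * 1)"
    unfolding box_bump_alt using True
    by (intro tendsto_prod tendsto_mult flat_exp_1_scale_tendsto) (simp_all add: mem_box del: of_nat_Suc)
  then show ?thesis using True by simp
qed (simp add: box_bump_outside)

section \<open>The fundamental lemma of the calculus of variations\<close>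

lemma borel_measurable_lebesgue_on_cong_AE:
  fixes f g :: "'a::euclidean_space \<Rightarrow> real"
  assumes f: "f \<in> borel_measurable (lebesgue_on S)" and S: "S \<in> sets lebesgue"
    and ae: "AE x in lebesgue_on S. f x = g x"
  shows "g \<in> borel_measurable (lebesgue_on S)"
proof (rule measurableI)
  fix A :: "real set" assume A: "A \<in> sets borel"
  have ae': "AE x in lebesgue. x \<in> S \<longrightarrow> f x = g x"
    using ae S by (simp add: AE_restrict_space_iff)
  have "f -` A \<inter> S \<in> sets (lebesgue_on S)"
    using measurable_sets[OF f A] by simp
  then have "f -` A \<inter> S \<in> sets lebesgue"
    using S by (auto simp: sets_restrict_space_iff)
  then have "g -` A \<inter> S \<in> sets lebesgue"
    by (rule completion.in_sets_AE[rotated]) (use ae' in \<open>auto elim: eventually_mono\<close>)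
  then show "g -` A \<inter> space (lebesgue_on S) \<in> sets (lebesgue_on S)"
    using S by (auto simp: sets_restrict_space_iff)
qed simp

text \<open>The positive and the negative part of g are densities of two measures that agree on open
  boxes. These form a generator stable under intersection, so the measures agree, and densities are
  unique almost everywhere.\<close>

lemma AE_eq_0_if_box_integrals_eq_0:
  fixes g :: "'a::euclidean_space \<Rightarrow> real"
  assumes int: "integrable lborel g"
    and zero: "\<And>a b. (\<integral>x. g x * indicator (box a b) x \<partial>lborel) = 0"
  shows "AE x in lborel. g x = 0"
proof -
  have [measurable]: "g \<in> borel_measurable lborel" using int by simp
  \<comment> \<open>\<open>ennreal\<close> truncates negative numbers to 0, so these are the
    positive and the negative part of g.\<close>
  define f h where "f = (\<lambda>x. ennreal (g x))" and "h = (\<lambda>x. ennreal (- g x))"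
  have [measurable]: "f \<in> borel_measurable lborel" "h \<in> borel_measurable lborel"
    by (auto simp: f_def h_def)
  have "density lborel f = density lborel h"
  proof (rule measure_eqI_generator_eq[where E="range (\<lambda>(a, b). box a b)" and \<Omega>=UNIV
        and A="\<lambda>n::nat. box (- (real n *\<^sub>R One)) (real n *\<^sub>R One)"])
    show "Int_stable (range (\<lambda>(a::'a, b). box a b))"
      by (auto simp: Int_stable_def box_Int_box)
    have s: "sets (lborel :: 'a measure) = sigma_sets UNIV (range (\<lambda>(a, b). box a b))"
      by (simp_all add: borel_eq_box)
    show "sets (density lborel f) = sigma_sets UNIV (range (\<lambda>(a, b). box a b))"
      "sets (density lborel h) = sigma_sets UNIV (range (\<lambda>(a, b). box a b))"
      unfolding sets_density by (rule s)+
    fix X :: "'a set" assume "X \<in> range (\<lambda>(a, b). box a b)"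
    then obtain a b where X: "X = box a b" by auto
    have i: "integrable lborel (\<lambda>x. g x * indicator X x)"
      using integrable_real_mult_indicator[OF _ int, of X] by (simp add: X)
    have e: "ennreal (g x * indicator X x) = f x * indicator X x"
      "ennreal (- (g x * indicator X x)) = h x * indicator X x" for x
      by (auto simp: f_def h_def split: split_indicator)
    define P where "P = (\<integral>\<^sup>+x. ennreal (g x * indicator X x) \<partial>lborel)"
    define N where "N = (\<integral>\<^sup>+x. ennreal (- (g x * indicator X x)) \<partial>lborel)"
    have "P \<noteq> \<infinity>" "N \<noteq> \<infinity>"
      using i unfolding real_integrable_def P_def N_def by blast+
    moreover have "enn2real P - enn2real N = 0"
      using real_lebesgue_integral_def[OF i] zero[of a b] unfolding X P_def N_def by linarith
    ultimately have "P = N"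
      by (metis eq_iff_diff_eq_0 ennreal_enn2real infinity_ennreal_def less_top)
    then show "emeasure (density lborel f) X = emeasure (density lborel h) X"
      unfolding P_def N_def e by (simp add: emeasure_density X)
  next
    show "(\<Union>i::nat. box (- (real i *\<^sub>R One)) (real i *\<^sub>R One)) = (UNIV :: 'a set)"
      by (rule UN_box_eq_UNIV)
    show "emeasure (density lborel f) (box (- (real i *\<^sub>R One)) (real i *\<^sub>R One)) \<noteq> \<infinity>" for i
    proof -
      have "emeasure (density lborel f) (box (- (real i *\<^sub>R One)) (real i *\<^sub>R One)) \<le> (\<integral>\<^sup>+x. f x \<partial>lborel)"
        by (auto simp: emeasure_density intro!: nn_integral_mono split: split_indicator)
      also have "\<dots> < \<infinity>" using int by (auto simp: f_def real_integrable_def less_top)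
      finally show ?thesis by simp
    qed
  qed auto
  then have "AE x in lborel. f x = h x" by (intro sigma_finite_measure.density_unique[OF sigma_finite_lborel]) auto
  then show ?thesis
  proof eventually_elim
    case (elim x)
    then have e: "ennreal (g x) = ennreal (- g x)" by (simp add: f_def h_def)
    have "g x \<le> 0" if "0 \<le> g x"
      using e that by (simp add: ennreal_neg ennreal_eq_0_iff)
    moreover have "0 \<le> g x" if "g x \<le> 0"
      using e that ennreal_neg[OF that] by (simp add: ennreal_eq_0_iff eq_commute[of "0::ennreal"])
    ultimately show ?case by linarith
  qed
qed

section \<open>Test functions separate the elements of L2(U)\<close>

locale bounded_open =
  fixes U :: "'a::euclidean_space set"
  assumes open_U: "open U" and bounded_U: "bounded U"
begin

lemma U_lmeasurable: "U \<in> lmeasurable"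
  using open_U bounded_U by (rule lmeasurable_open[rotated])

lemma U_lebesgue: "U \<in> sets lebesgue"
  using U_lmeasurable by (rule fmeasurableD)

lemma finite_measure_U: "finite_measure (lebesgue_on U)"
  using U_lmeasurable by (rule finite_measure_lebesgue_on)

lemma borel_measurable_U: "f \<in> borel_measurable borel \<Longrightarrow> f \<in> borel_measurable (lebesgue_on U)"
  by (simp add: measurable_completion measurable_restrict_space1)

lemma integral_U_eq_lborel:
  fixes f :: "'a \<Rightarrow> real"
  assumes "f \<in> borel_measurable borel" "\<And>x. x \<notin> U \<Longrightarrow> f x = 0"
  shows "(\<integral>x. f x \<partial>lebesgue_on U) = (\<integral>x. f x \<partial>lborel)"
proof -
  have "(\<integral>x. f x \<partial>lebesgue_on U) = (\<integral>x. indicator U x *\<^sub>R f x \<partial>lebesgue)"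
    using U_lebesgue by (intro integral_restrict_space) simp
  also have "(\<lambda>x. indicator U x *\<^sub>R f x) = f"
    using assms(2) by (auto simp: fun_eq_iff split: split_indicator)
  also have "(\<integral>x. f x \<partial>lebesgue) = (\<integral>x. f x \<partial>lborel)"
    using assms(1) by (intro integral_completion) simp
  finally show ?thesis .
qed

lemma test_fun_Lq_2: "test_fun U \<phi> \<Longrightarrow> \<phi> \<in> Lq 2 U"
  by (rule test_fun_bounded, assumption)
    (auto intro!: Lq_2_bounded[OF borel_measurable_U[OF test_fun_measurable] U_lmeasurable])

lemma Lq_2_integrable:
  assumes "g \<in> Lq 2 U" shows "integrable (lebesgue_on U) g"
proof (rule Bochner_Integration.integrable_bound)
  show "integrable (lebesgue_on U) (\<lambda>x. 1 + (norm (g x))\<^sup>2)"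
    using assms finite_measure.integrable_const[OF finite_measure_U, of "1::real"]
    by (intro Bochner_Integration.integrable_add) (auto simp: Lq_2_iff)
  have "norm v \<le> 1 + (norm v)\<^sup>2" for v :: 'b
  proof -
    have "2 * norm v \<le> 1 + (norm v)\<^sup>2" using sum_squares_bound[of 1 "norm v"] by simp
    then show ?thesis using norm_ge_zero[of v] by linarith
  qed
  then show "AE x in lebesgue_on U. norm (g x) \<le> norm (1 + (norm (g x))\<^sup>2)"
    by (intro always_eventually) (simp add: add_nonneg_nonneg)
qed (use assms in \<open>simp add: Lq_2_iff\<close>)

text \<open>The bumps of a box whose closure lies in U are admissible test functions, and |g|
  dominates the products, so orthogonality passes to the indicator of the open box.\<close>

lemma integral_eq_0_on_cbox:
  fixes g :: "'a \<Rightarrow> real"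
  assumes "g \<in> Lq 2 U" "\<And>\<phi>. test_fun U \<phi> \<Longrightarrow> (\<integral>x. g x * \<phi> x \<partial>lebesgue_on U) = 0" "cbox a b \<subseteq> U"
  shows "(\<integral>x. g x * indicator (box a b) x \<partial>lebesgue_on U) = 0"
proof -
  have [measurable]: "g \<in> borel_measurable (lebesgue_on U)" using assms(1) by (rule Lq_2_measurable)
  have [measurable]: "box_bump a b k \<in> borel_measurable (lebesgue_on U)"
    "indicator (box a b) \<in> borel_measurable (lebesgue_on U)" for k
    using test_fun_measurable[OF test_fun_box_bump[OF assms(3)]] by (auto intro: borel_measurable_U)
  have "(\<lambda>k. \<integral>x. g x * box_bump a b k x \<partial>lebesgue_on U) \<longlonglongrightarrow>
      (\<integral>x. g x * indicator (box a b) x \<partial>lebesgue_on U)"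
  proof (rule integral_dominated_convergence[where w="\<lambda>x. \<bar>g x\<bar>"])
    show "AE x in lebesgue_on U. norm (g x * box_bump a b k x) \<le> \<bar>g x\<bar>" for k
      using box_bump_bounds[of a b k] by (auto simp: abs_mult intro!: mult_left_le)
    show "integrable (lebesgue_on U) (\<lambda>x. \<bar>g x\<bar>)" using Lq_2_integrable[OF assms(1)] by simp
  qed (auto intro!: tendsto_mult box_bump_tendsto)
  then show ?thesis
    using assms(2)[OF test_fun_box_bump[OF assms(3)]] by (simp add: LIMSEQ_const_iff)
qed

text \<open>Orthogonality says something only about boxes with closure in U. So U is covered by
  countably many closed boxes, and on each of them g times the indicator of the open box has
  vanishing integral over every box.\<close>

lemma AE_eq_0_if_orthogonal_test_fun:
  fixes g :: "'a \<Rightarrow> real"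
  assumes g: "g \<in> Lq 2 U" and orth: "\<And>\<phi>. test_fun U \<phi> \<Longrightarrow> (\<integral>x. g x * \<phi> x \<partial>lebesgue_on U) = 0"
  shows "AE x in lebesgue_on U. g x = 0"
proof -
  have gm: "(\<lambda>x. if x \<in> U then g x else 0) \<in> borel_measurable lebesgue"
    using Lq_2_measurable[OF g] U_lebesgue by (rule borel_measurable_if_I)
  \<comment> \<open>The box criterion is stated for \<open>lborel\<close>, whereas g is only
    Lebesgue measurable; hence a Borel representative of its extension by zero.\<close>
  obtain g' where g'm[measurable]: "g' \<in> borel_measurable lborel"
    and "AE x in lborel. (if x \<in> U then g x else 0) = g' x"
    using completion_ex_borel_measurable_real[OF gm] by blast
  then have g': "AE x in lebesgue. (if x \<in> U then g x else 0) = g' x"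
    by (simp add: AE_completion_iff)
  obtain \<D> where D: "countable \<D>" "\<And>X. X \<in> \<D> \<Longrightarrow> X \<subseteq> U" "\<And>X. X \<in> \<D> \<Longrightarrow> \<exists>a b. X = cbox a b" "\<Union>\<D> = U"
    using open_countable_Union_open_cbox[OF open_U] by (metis Pow_iff subsetD)
  have "AE x in lebesgue. \<forall>X\<in>\<D>. x \<in> X \<longrightarrow> g x = 0"
  proof (subst AE_ball_countable[OF D(1)], safe)
    fix X assume X: "X \<in> \<D>"
    obtain c d where cd: "X = cbox c d" using D(3)[OF X] by blast
    have sub: "cbox c d \<subseteq> U" using D(2)[OF X] cd by simp
    have intg: "integrable lebesgue (\<lambda>x. indicator U x *\<^sub>R g x)"
      using Lq_2_integrable[OF g] U_lebesgue by (subst (asm) integrable_restrict_space) auto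
    have e: "AE x in lebesgue. (indicator U x *\<^sub>R g x) * indicator (box c d) x = g' x * indicator (box c d) x"
      using g' by eventually_elim (auto split: if_splits split_indicator)
    have "integrable lebesgue (\<lambda>x. (indicator U x *\<^sub>R g x) * indicator (box c d) x)"
      using intg by (intro integrable_real_mult_indicator) auto
    then have "integrable lebesgue (\<lambda>x. g' x * indicator (box c d) x)"
      using e by (subst integrable_cong_AE[symmetric]) (auto simp: measurable_completion)
    then have i: "integrable lborel (\<lambda>x. g' x * indicator (box c d) x)"
      by (subst (asm) integrable_completion) auto
    have "AE x in lborel. g' x * indicator (box c d) x = 0"
    proof (rule AE_eq_0_if_box_integrals_eq_0[OF i])
      fix a b :: 'a
      \<comment> \<open>Cutting an arbitrary box down to the fixed one leaves a box whose closure
        still lies in U.\<close>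
      obtain p q where pq: "box c d \<inter> box a b = box p q" "cbox p q \<subseteq> cbox c d"
      proof -
        let ?p = "\<Sum>i\<in>Basis. max (c \<bullet> i) (a \<bullet> i) *\<^sub>R i" and ?q = "\<Sum>i\<in>Basis. min (d \<bullet> i) (b \<bullet> i) *\<^sub>R i"
        have "box c d \<inter> box a b = box ?p ?q" by (rule box_Int_box)
        moreover have "cbox ?p ?q \<subseteq> cbox c d" by (auto simp: mem_box)
        ultimately show thesis by (rule that)
      qed
      have "(\<integral>x. g' x * indicator (box c d) x * indicator (box a b) x \<partial>lborel)
          = (\<integral>x. g' x * indicator (box p q) x \<partial>lborel)"
        by (intro Bochner_Integration.integral_cong) (auto simp: pq(1)[symmetric] indicator_inter_arith)
      also have "\<dots> = (\<integral>x. g' x * indicator (box p q) x \<partial>lebesgue)"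
        by (intro integral_completion[symmetric]) auto
      also have "\<dots> = (\<integral>x. indicator U x *\<^sub>R (g x * indicator (box p q) x) \<partial>lebesgue)"
      proof (rule integral_cong_AE)
        show "(\<lambda>x. g' x * indicator (box p q) x) \<in> borel_measurable lebesgue"
          by (intro measurable_completion) simp
        show "(\<lambda>x. indicator U x *\<^sub>R (g x * indicator (box p q) x)) \<in> borel_measurable lebesgue"
        proof -
          have "(\<lambda>x. (indicator U x *\<^sub>R g x) * indicator (box p q) x) \<in> borel_measurable lebesgue"
            using intg measurable_completion[of "indicator (box p q)" lborel borel]
            by (intro borel_measurable_times) auto
          then show ?thesis by (simp add: mult.assoc)
        qed
        show "AE x in lebesgue. g' x * indicator (box p q) x = indicator U x *\<^sub>R (g x * indicator (box p q) x)"
          using g'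
        proof eventually_elim
          case (elim x)
          have "box p q \<subseteq> U" using pq(2) sub box_subset_cbox by blast
          then show ?case using elim by (auto split: if_splits split_indicator)
        qed
      qed
      also have "\<dots> = (\<integral>x. g x * indicator (box p q) x \<partial>lebesgue_on U)"
        using U_lebesgue by (intro integral_restrict_space[symmetric]) simp
      also have "\<dots> = 0"
        using pq(2) sub by (intro integral_eq_0_on_cbox[OF g orth]) auto
      finally show "(\<integral>x. g' x * indicator (box c d) x * indicator (box a b) x \<partial>lborel) = 0" .
    qed
    then have "AE x in lebesgue. g' x * indicator (box c d) x = 0" by (rule AE_completion)
    \<comment> \<open>The criterion controls the open box; the faces of the closed one form a null
      set.\<close>
    moreover have "AE x in lebesgue. x \<notin> cbox c d - box c d"
      using negligible_frontier_interval[of c d] by (intro AE_not_in) (simp add: negligible_iff_null_sets)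
    ultimately show "AE x in lebesgue. x \<in> X \<longrightarrow> g x = 0"
      using g' by eventually_elim (use cd sub in \<open>auto simp: indicator_def split: if_splits\<close>)
  qed
  then have "AE x in lebesgue. x \<in> U \<longrightarrow> g x = 0"
    by eventually_elim (use D(4) in blast)
  then show ?thesis using U_lebesgue by (simp add: AE_restrict_space_iff)
qed

lemma AE_eq_0_if_orthogonal_test_fun_vector:
  fixes g :: "'a \<Rightarrow> 'a"
  assumes g: "g \<in> Lq 2 U"
    and orth: "\<And>\<phi> b. test_fun U \<phi> \<Longrightarrow> b \<in> Basis \<Longrightarrow> (\<integral>x. (g x \<bullet> b) * \<phi> x \<partial>lebesgue_on U) = 0"
  shows "AE x in lebesgue_on U. g x = 0"
proof -
  have "AE x in lebesgue_on U. g x \<bullet> b = 0" if "b \<in> Basis" for b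
  proof (rule AE_eq_0_if_orthogonal_test_fun)
    show "(\<lambda>x. g x \<bullet> b) \<in> Lq 2 U"
      unfolding Lq_2_iff
    proof
      show m: "(\<lambda>x. g x \<bullet> b) \<in> borel_measurable (lebesgue_on U)"
        using Lq_2_measurable[OF g] by simp
      show "integrable (lebesgue_on U) (\<lambda>x. (norm (g x \<bullet> b))\<^sup>2)"
      proof (rule Bochner_Integration.integrable_bound)
        show "integrable (lebesgue_on U) (\<lambda>x. (norm (g x))\<^sup>2)" using g by (simp add: Lq_2_iff)
        show "AE x in lebesgue_on U. norm ((norm (g x \<bullet> b))\<^sup>2) \<le> norm ((norm (g x))\<^sup>2)"
          using Basis_le_norm[OF that] by (auto intro!: abs_le_square_iff[THEN iffD1])
      qed (use m in simp)
    qed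
  qed (use orth that in auto)
  then have "AE x in lebesgue_on U. \<forall>b\<in>Basis. g x \<bullet> b = 0"
    by (intro AE_finite_allI) auto
  then show ?thesis by eventually_elim (rule euclidean_eqI, simp)
qed

end

section \<open>Weak gradients\<close>

lemma Lq_2_scaleR_const:
  fixes f :: "'a::euclidean_space \<Rightarrow> real"
  assumes "f \<in> Lq 2 U" shows "(\<lambda>x. f x *\<^sub>R c) \<in> Lq 2 U"
  using assms by (auto simp: Lq_2_iff power_mult_distrib)

lemma Lq_2_sum: "finite A \<Longrightarrow> (\<And>i. i \<in> A \<Longrightarrow> f i \<in> Lq 2 U) \<Longrightarrow> (\<lambda>x. \<Sum>i\<in>A. f i x) \<in> Lq 2 U"
  by (induction A rule: finite_induct) (auto intro: Lq_2_zero Lq_2_add)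

lemma Lq_2_inner_const:
  assumes "g \<in> Lq 2 U" shows "(\<lambda>x. g x \<bullet> c) \<in> Lq 2 U"
  unfolding Lq_2_iff
proof
  show m: "(\<lambda>x. g x \<bullet> c) \<in> borel_measurable (lebesgue_on U)"
    using Lq_2_measurable[OF assms] by simp
  show "integrable (lebesgue_on U) (\<lambda>x. (norm (g x \<bullet> c))\<^sup>2)"
  proof (rule Bochner_Integration.integrable_bound)
    show "integrable (lebesgue_on U) (\<lambda>x. (norm (g x))\<^sup>2 * (norm c)\<^sup>2)" using assms by (simp add: Lq_2_iff)
    have "(norm (v \<bullet> c))\<^sup>2 \<le> (norm v)\<^sup>2 * (norm c)\<^sup>2" for v
      using Cauchy_Schwarz_ineq[of v c] by (simp add: power2_norm_eq_inner)
    then show "AE x in lebesgue_on U. norm ((norm (g x \<bullet> c))\<^sup>2) \<le> norm ((norm (g x))\<^sup>2 * (norm c)\<^sup>2)"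
      by (intro always_eventually) simp
  qed (use m in simp)
qed

lemma L2_inner_mult_left: "L2_inner U (\<lambda>x. c * f x :: real) h = c * L2_inner U f h"
  using L2_inner_scaleR_left[of U c f h] by simp

lemma L2_inner_sum_right:
  assumes "finite A" "h \<in> Lq 2 U" "\<And>i. i \<in> A \<Longrightarrow> f i \<in> Lq 2 U"
  shows "L2_inner U h (\<lambda>x. \<Sum>i\<in>A. f i x) = (\<Sum>i\<in>A. L2_inner U h (f i))"
  unfolding L2_inner_def inner_sum_right
  by (intro Bochner_Integration.integral_sum integrable_L2_inner assms)

section \<open>Classical integration by parts for test functions\<close>

lemma test_fun_mult:
  assumes "test_fun U f" "test_fun U g"
  shows "test_fun U (\<lambda>x. f x * g x)"
proof -
  let ?A = "closure {x. f x \<noteq> 0}"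
  have sub: "closure {x. f x * g x \<noteq> 0} \<subseteq> ?A"
    by (rule closure_mono) auto
  have "compact (?A \<inter> closure {x. f x * g x \<noteq> 0})"
    using assms by (intro compact_Int_closed) (auto simp: test_fun_def)
  with sub have "compact (closure {x. f x * g x \<noteq> 0})" by (simp add: inf.absorb2)
  then show ?thesis using assms sub by (auto simp: test_fun_def smooth_def intro!: C_k_mult)
qed

lemma test_fun_has_derivative:
  "test_fun U f \<Longrightarrow> (f has_derivative frechet_derivative f (at x)) (at x)"
  by (simp add: test_fun_def smooth_has_derivative)

lemma test_fun_line_derivative:
  assumes "test_fun U f"
  shows "((\<lambda>t. f (x + t *\<^sub>R y)) has_real_derivative frechet_derivative f (at (x + t *\<^sub>R y)) y) (at t)"
proof -
  have d: "(f has_derivative frechet_derivative f (at (x + t *\<^sub>R y))) (at (x + t *\<^sub>R y))"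
    by (rule test_fun_has_derivative[OF assms])
  have "((\<lambda>t. x + t *\<^sub>R y) has_derivative (\<lambda>s. s *\<^sub>R y)) (at t)"
    by (auto intro!: derivative_eq_intros)
  from has_derivative_compose[OF this d]
  have "((\<lambda>t. f (x + t *\<^sub>R y)) has_derivative (\<lambda>s. frechet_derivative f (at (x + t *\<^sub>R y)) (s *\<^sub>R y))) (at t)" .
  moreover have "(\<lambda>s. frechet_derivative f (at (x + t *\<^sub>R y)) (s *\<^sub>R y))
      = (*) (frechet_derivative f (at (x + t *\<^sub>R y)) y)"
    using linear_cmul[OF has_derivative_linear[OF d]] by (auto simp: fun_eq_iff mult.commute)
  ultimately show ?thesis by (simp add: has_field_derivative_def)
qed

lemma test_fun_integrable_lborel:
  assumes "test_fun U f" shows "integrable lborel f"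
proof -
  let ?A = "closure {x. f x \<noteq> 0}"
  have "integrable lborel (\<lambda>x. indicator ?A x *\<^sub>R f x)"
    using assms by (intro borel_integrable_compact) (auto simp: test_fun_def smooth_continuous)
  moreover have "(\<lambda>x. indicator ?A x *\<^sub>R f x) = f"
    using closure_subset[of "{x. f x \<noteq> 0}"] by (auto simp: fun_eq_iff split: split_indicator)
  ultimately show ?thesis by simp
qed

lemma lborel_integral_translate:
  fixes f :: "'a::euclidean_space \<Rightarrow> real"
  assumes "f \<in> borel_measurable borel"
  shows "(\<integral>x. f (x + c) \<partial>lborel) = (\<integral>x. f x \<partial>lborel)"
  using integral_distr[of "(+) c" lborel borel f] assms by (simp add: lborel_distr_plus add.commute)

lemma lborel_integrable_translate:
  fixes f :: "'a::euclidean_space \<Rightarrow> real"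
  assumes "integrable lborel f"
  shows "integrable lborel (\<lambda>x. f (x + c))"
proof -
  have "f \<in> borel_measurable borel" using assms by auto
  then show ?thesis
    using integrable_distr_eq[of "(+) c" lborel borel f] assms by (simp add: lborel_distr_plus add.commute)
qed

text \<open>The integral of each difference quotient vanishes by translation invariance of Lebesgue
  measure, and the quotients converge to the partial derivative under a common bound.\<close>

lemma integral_partial_test_fun:
  assumes h: "test_fun U h" and b: "b \<in> Basis"
  shows "(\<integral>x. frechet_derivative h (at x) b \<partial>lborel) = 0"
proof -
  let ?D = "\<lambda>x. frechet_derivative h (at x) b"
  define q where "q n x = (h (x + inverse (real (Suc n)) *\<^sub>R b) - h x) * real (Suc n)" for n x
  obtain B where B: "\<And>x. \<bar>?D x\<bar> \<le> B"
    using test_fun_bounded[OF test_fun_partial[OF h b]] by blast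
  have "bounded {x. h x \<noteq> 0}"
    using h closure_subset by (auto simp: test_fun_def intro: bounded_subset dest!: compact_imp_bounded)
  then obtain R where R: "\<And>x. h x \<noteq> 0 \<Longrightarrow> norm x \<le> R" by (auto simp: bounded_iff)
  have hm: "h \<in> borel_measurable borel" by (rule test_fun_measurable[OF h])
  \<comment> \<open>The shifts have length at most 1, so every quotient vanishes outside the ball of
    radius R + 1; inside, the mean value theorem bounds it by B.\<close>
  have "(\<lambda>n. \<integral>x. q n x \<partial>lborel) \<longlonglongrightarrow> (\<integral>x. ?D x \<partial>lborel)"
  proof (rule integral_dominated_convergence[where w="\<lambda>x. B * indicator (cball 0 (R + 1)) x"])
    show "?D \<in> borel_measurable lborel" using test_fun_measurable[OF test_fun_partial[OF h b]] by simp
    show "q n \<in> borel_measurable lborel" for n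
      using hm unfolding q_def by (auto intro!: borel_measurable_times borel_measurable_diff measurable_compose[OF _ hm])
    show "integrable lborel (\<lambda>x. B * indicator (cball 0 (R + 1)) x)"
      by (intro integrable_mult_right integrable_real_indicator)
        (use emeasure_bounded_finite[of "cball 0 (R + 1)"] in auto)
    have lim: "(\<lambda>n. q n x) \<longlonglongrightarrow> ?D x" for x
    proof -
      have "((\<lambda>t. (h (x + t *\<^sub>R b) - h (x + 0 *\<^sub>R b)) / (t - 0)) \<longlongrightarrow> frechet_derivative h (at (x + 0 *\<^sub>R b)) b) (at 0)"
        using test_fun_line_derivative[OF h, of x b 0] unfolding has_field_derivative_iff .
      moreover have "filterlim (\<lambda>n. inverse (real (Suc n))) (at 0) sequentially"
        unfolding filterlim_at by (auto simp: LIMSEQ_inverse_real_of_nat simp del: of_nat_Suc)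
      ultimately have "(\<lambda>n. (h (x + inverse (real (Suc n)) *\<^sub>R b) - h (x + 0 *\<^sub>R b)) / (inverse (real (Suc n)) - 0))
          \<longlonglongrightarrow> frechet_derivative h (at (x + 0 *\<^sub>R b)) b"
        by (rule filterlim_compose)
      then show ?thesis by (simp add: q_def divide_inverse del: of_nat_Suc)
    qed
    show "AE x in lborel. (\<lambda>n. q n x) \<longlonglongrightarrow> ?D x" using lim by simp
    have "\<bar>q n x\<bar> \<le> B * indicator (cball 0 (R + 1)) x" for n x
    proof (cases "norm x \<le> R + 1")
      case True
      obtain z where "h (x + inverse (real (Suc n)) *\<^sub>R b) - h (x + 0 *\<^sub>R b)
          = (inverse (real (Suc n)) - 0) * frechet_derivative h (at (x + z *\<^sub>R b)) b"
        using MVT2[of 0 "inverse (real (Suc n))" "\<lambda>t. h (x + t *\<^sub>R b)"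
            "\<lambda>t. frechet_derivative h (at (x + t *\<^sub>R b)) b"] test_fun_line_derivative[OF h, of x b]
        by (auto simp del: of_nat_Suc)
      then have "q n x = frechet_derivative h (at (x + z *\<^sub>R b)) b" by (simp add: q_def del: of_nat_Suc)
      then show ?thesis using B True by simp
    next
      case False
      have "inverse (real (Suc n)) \<le> 1" by (simp add: inverse_le_1_iff)
      then have "norm (inverse (real (Suc n)) *\<^sub>R b) \<le> 1" using b by simp
      then have "norm (x + inverse (real (Suc n)) *\<^sub>R b) > R"
        using False norm_triangle_ineq4[of "x + inverse (real (Suc n)) *\<^sub>R b" "inverse (real (Suc n)) *\<^sub>R b"] by simp
      then have "h (x + inverse (real (Suc n)) *\<^sub>R b) = 0" "h x = 0" using R False by force+
      then show ?thesis using B[of 0] by (auto simp: q_def split: split_indicator)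
    qed
    then show "AE x in lborel. norm (q n x) \<le> B * indicator (cball 0 (R + 1)) x" for n by simp
  qed
  moreover have "(\<integral>x. q n x \<partial>lborel) = 0" for n
    using test_fun_integrable_lborel[OF h] hm
    by (simp add: q_def lborel_integral_translate lborel_integrable_translate)
  ultimately show ?thesis by (simp add: LIMSEQ_const_iff)
qed

text \<open>The classical gradient: a concrete continuous representative where \<open>wgrad\<close>
  only offers an arbitrary choice.\<close>

definition tgrad :: "('a::euclidean_space \<Rightarrow> real) \<Rightarrow> 'a \<Rightarrow> 'a" where
  "tgrad f x = (\<Sum>b\<in>Basis. frechet_derivative f (at x) b *\<^sub>R b)"

lemma tgrad_inner_Basis: "b \<in> Basis \<Longrightarrow> tgrad f x \<bullet> b = frechet_derivative f (at x) b"
  by (simp add: tgrad_def inner_sum_left inner_Basis if_distrib cong: if_cong)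

lemma is_weak_grad_iff:
  "is_weak_grad U u g \<longleftrightarrow> (\<forall>\<phi>. test_fun U \<phi> \<longrightarrow> (\<forall>b\<in>Basis.
     L2_inner U u (\<lambda>x. frechet_derivative \<phi> (at x) b) = - L2_inner U (\<lambda>x. g x \<bullet> b) \<phi>))"
  by (simp add: is_weak_grad_def L2_inner_def)

section \<open>The Dirichlet form on \<open>H1\<close> and \<open>H01\<close>\<close>

context bounded_open
begin

abbreviation ginner :: "('a \<Rightarrow> real) \<Rightarrow> ('a \<Rightarrow> real) \<Rightarrow> real" where
  "ginner u w \<equiv> L2_inner U (wgrad U u) (wgrad U w)"

abbreviation gnorm :: "('a \<Rightarrow> real) \<Rightarrow> real" where
  "gnorm u \<equiv> Lq_norm 2 U (wgrad U u)"

lemma tgrad_Lq_2: "test_fun U f \<Longrightarrow> tgrad f \<in> Lq 2 U"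
  unfolding tgrad_def by (intro Lq_2_sum Lq_2_scaleR_const test_fun_Lq_2 test_fun_partial) auto

lemma integral_by_parts_test_fun:
  assumes f: "test_fun U f" and g: "test_fun U g" and b: "b \<in> Basis"
  shows "L2_inner U f (\<lambda>x. frechet_derivative g (at x) b) = - L2_inner U (\<lambda>x. frechet_derivative f (at x) b) g"
proof -
  have fg: "test_fun U (\<lambda>x. f x * g x)" by (rule test_fun_mult[OF f g])
  have d: "frechet_derivative (\<lambda>x. f x * g x) (at x) b
      = f x * frechet_derivative g (at x) b + frechet_derivative f (at x) b * g x" for x
    using frechet_derivative_at[OF has_derivative_mult[OF test_fun_has_derivative[OF f] test_fun_has_derivative[OF g]]]
    by metis
  have "0 = (\<integral>x. frechet_derivative (\<lambda>x. f x * g x) (at x) b \<partial>lebesgue_on U)"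
    using integral_partial_test_fun[OF fg b] test_fun_partial[OF fg b]
    by (subst integral_U_eq_lborel) (auto intro: test_fun_measurable test_fun_eq_0)
  also have "\<dots> = L2_inner U f (\<lambda>x. frechet_derivative g (at x) b) + L2_inner U (\<lambda>x. frechet_derivative f (at x) b) g"
    unfolding d L2_inner_def inner_real_def
    using integrable_L2_inner[OF test_fun_Lq_2[OF f] test_fun_Lq_2[OF test_fun_partial[OF g b]]]
      integrable_L2_inner[OF test_fun_Lq_2[OF test_fun_partial[OF f b]] test_fun_Lq_2[OF g]]
    by (intro Bochner_Integration.integral_add) auto
  finally show ?thesis by linarith
qed

lemma is_weak_grad_tgrad: "test_fun U f \<Longrightarrow> is_weak_grad U f (tgrad f)"
  by (simp add: is_weak_grad_iff tgrad_inner_Basis integral_by_parts_test_fun)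

lemma test_fun_H1: "test_fun U f \<Longrightarrow> f \<in> H1 U"
  using is_weak_grad_tgrad tgrad_Lq_2 test_fun_Lq_2 by (auto simp: H1_def)

lemma wgrad_weak_grad:
  assumes "u \<in> H1 U" shows "wgrad U u \<in> Lq 2 U" "is_weak_grad U u (wgrad U u)"
proof -
  have "\<exists>g. g \<in> Lq 2 U \<and> is_weak_grad U u g" using assms by (auto simp: H1_def)
  from someI_ex[OF this] show "wgrad U u \<in> Lq 2 U" "is_weak_grad U u (wgrad U u)"
    by (auto simp: wgrad_def)
qed

lemma H1_Lq_2: "u \<in> H1 U \<Longrightarrow> u \<in> Lq 2 U"
  by (simp add: H1_def)

lemma weak_grad_unique:
  assumes "g \<in> Lq 2 U" "g' \<in> Lq 2 U" "is_weak_grad U u g" "is_weak_grad U u g'"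
  shows "AE x in lebesgue_on U. g x = g' x"
proof -
  have "AE x in lebesgue_on U. g x - g' x = 0"
  proof (rule AE_eq_0_if_orthogonal_test_fun_vector)
    show "(\<lambda>x. g x - g' x) \<in> Lq 2 U" by (rule Lq_2_diff[OF assms(1,2)])
    fix \<phi> and b :: 'a assume \<phi>: "test_fun U \<phi>" and b: "b \<in> Basis"
    have "L2_inner U (\<lambda>x. g x \<bullet> b) \<phi> = L2_inner U (\<lambda>x. g' x \<bullet> b) \<phi>"
      using assms(3,4) \<phi> b unfolding is_weak_grad_iff by (metis neg_equal_iff_equal)
    then have "L2_inner U (\<lambda>x. g x \<bullet> b - g' x \<bullet> b) \<phi> = 0"
      using L2_inner_diff_left[OF Lq_2_inner_const[OF assms(1), of b] Lq_2_inner_const[OF assms(2), of b] test_fun_Lq_2[OF \<phi>]]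
      by simp
    then show "(\<integral>x. (g x - g' x) \<bullet> b * \<phi> x \<partial>lebesgue_on U) = 0"
      by (simp add: L2_inner_def inner_diff_left)
  qed
  then show ?thesis by simp
qed

lemma H1I: "u \<in> Lq 2 U \<Longrightarrow> g \<in> Lq 2 U \<Longrightarrow> is_weak_grad U u g \<Longrightarrow> u \<in> H1 U"
  by (auto simp: H1_def)

lemma wgrad_AE_eqI:
  assumes "u \<in> Lq 2 U" "g \<in> Lq 2 U" "is_weak_grad U u g"
  shows "AE x in lebesgue_on U. wgrad U u x = g x"
  using wgrad_weak_grad[OF H1I[OF assms]] assms by (intro weak_grad_unique) auto

lemma wgrad_tgrad_AE: "test_fun U f \<Longrightarrow> AE x in lebesgue_on U. wgrad U f x = tgrad f x"
  by (intro wgrad_AE_eqI test_fun_Lq_2 tgrad_Lq_2 is_weak_grad_tgrad)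

lemma is_weak_grad_add:
  assumes "u \<in> Lq 2 U" "g \<in> Lq 2 U" "w \<in> Lq 2 U" "h \<in> Lq 2 U" "is_weak_grad U u g" "is_weak_grad U w h"
  shows "is_weak_grad U (\<lambda>x. u x + w x) (\<lambda>x. g x + h x)"
  unfolding is_weak_grad_iff inner_add_left
proof (intro allI impI ballI)
  fix \<phi> and b :: 'a assume \<phi>: "test_fun U \<phi>" and b: "b \<in> Basis"
  show "L2_inner U (\<lambda>x. u x + w x) (\<lambda>x. frechet_derivative \<phi> (at x) b) = - L2_inner U (\<lambda>x. g x \<bullet> b + h x \<bullet> b) \<phi>"
    using assms \<phi> b
    by (simp add: L2_inner_add_left Lq_2_inner_const test_fun_Lq_2 test_fun_partial is_weak_grad_iff)
qed

lemma is_weak_grad_scale: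
  assumes "is_weak_grad U u g"
  shows "is_weak_grad U (\<lambda>x. c * u x) (\<lambda>x. c *\<^sub>R g x)"
  using assms by (simp add: is_weak_grad_iff L2_inner_mult_left)

lemma H1_add:
  assumes "u \<in> H1 U" "w \<in> H1 U"
  shows "(\<lambda>x. u x + w x) \<in> H1 U" "AE x in lebesgue_on U. wgrad U (\<lambda>x. u x + w x) x = wgrad U u x + wgrad U w x"
proof -
  have *: "(\<lambda>x. u x + w x) \<in> Lq 2 U" "(\<lambda>x. wgrad U u x + wgrad U w x) \<in> Lq 2 U"
    "is_weak_grad U (\<lambda>x. u x + w x) (\<lambda>x. wgrad U u x + wgrad U w x)"
    using H1_Lq_2[OF assms(1)] H1_Lq_2[OF assms(2)] wgrad_weak_grad[OF assms(1)] wgrad_weak_grad[OF assms(2)]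
    by (simp_all add: Lq_2_add is_weak_grad_add)
  show "(\<lambda>x. u x + w x) \<in> H1 U" using * by (rule H1I)
  show "AE x in lebesgue_on U. wgrad U (\<lambda>x. u x + w x) x = wgrad U u x + wgrad U w x"
    using * by (rule wgrad_AE_eqI)
qed

lemma H1_scale:
  assumes "u \<in> H1 U"
  shows "(\<lambda>x. c * u x) \<in> H1 U" "AE x in lebesgue_on U. wgrad U (\<lambda>x. c * u x) x = c *\<^sub>R wgrad U u x"
proof -
  have *: "(\<lambda>x. c * u x) \<in> Lq 2 U" "(\<lambda>x. c *\<^sub>R wgrad U u x) \<in> Lq 2 U"
    "is_weak_grad U (\<lambda>x. c * u x) (\<lambda>x. c *\<^sub>R wgrad U u x)"
    using H1_Lq_2[OF assms(1)] wgrad_weak_grad[OF assms(1)]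
    by (simp_all add: Lq_2_mult Lq_2_scaleR is_weak_grad_scale)
  show "(\<lambda>x. c * u x) \<in> H1 U" using * by (rule H1I)
  show "AE x in lebesgue_on U. wgrad U (\<lambda>x. c * u x) x = c *\<^sub>R wgrad U u x"
    using * by (rule wgrad_AE_eqI)
qed

lemma H1_diff:
  assumes "u \<in> H1 U" "w \<in> H1 U"
  shows "(\<lambda>x. u x - w x) \<in> H1 U" "AE x in lebesgue_on U. wgrad U (\<lambda>x. u x - w x) x = wgrad U u x - wgrad U w x"
proof -
  note s = H1_scale[OF assms(2), of "-1"]
  note a = H1_add[OF assms(1) s(1)]
  show "(\<lambda>x. u x - w x) \<in> H1 U" using a(1) by simp
  show "AE x in lebesgue_on U. wgrad U (\<lambda>x. u x - w x) x = wgrad U u x - wgrad U w x"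
    using a(2) s(2) by eventually_elim simp
qed

lemma gnorm_add_le: "u \<in> H1 U \<Longrightarrow> w \<in> H1 U \<Longrightarrow> gnorm (\<lambda>x. u x + w x) \<le> gnorm u + gnorm w"
  using Lq_norm_2_cong_AE[OF _ _ H1_add(2)[of u w]] L2_triangle[of "wgrad U u" U "wgrad U w"]
  by (simp add: Lq_2_measurable wgrad_weak_grad H1_add(1) Lq_2_add)

lemma gnorm_scale: "u \<in> H1 U \<Longrightarrow> gnorm (\<lambda>x. c * u x) = \<bar>c\<bar> * gnorm u"
  using Lq_norm_2_cong_AE[OF _ _ H1_scale(2)[of u c]] Lq_norm_2_scaleR[of U c "wgrad U u"]
  by (simp add: Lq_2_measurable wgrad_weak_grad H1_scale(1) Lq_2_scaleR)

lemma ginner_diff_left: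
  assumes "u \<in> H1 U" "w \<in> H1 U" "h \<in> H1 U"
  shows "ginner (\<lambda>x. u x - w x) h = ginner u h - ginner w h"
proof -
  have "ginner (\<lambda>x. u x - w x) h = L2_inner U (\<lambda>x. wgrad U u x - wgrad U w x) (wgrad U h)"
    using assms by (intro L2_inner_cong_AE) (auto intro: wgrad_weak_grad H1_diff Lq_2_diff)
  then show ?thesis using assms by (simp add: L2_inner_diff_left wgrad_weak_grad)
qed

lemma ginner_diff_right:
  "u \<in> H1 U \<Longrightarrow> w \<in> H1 U \<Longrightarrow> h \<in> H1 U \<Longrightarrow> ginner h (\<lambda>x. u x - w x) = ginner h u - ginner h w"
  using ginner_diff_left[of u w h] by (simp add: L2_inner_commute[of U "wgrad U h"])

lemma gnorm_diff_sq:
  assumes "u \<in> H1 U" "w \<in> H1 U"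
  shows "(gnorm (\<lambda>x. u x - w x))\<^sup>2 = (gnorm u)\<^sup>2 - 2 * ginner u w + (gnorm w)\<^sup>2"
  using ginner_diff_left[OF assms H1_diff(1)[OF assms]] ginner_diff_right[OF assms assms(1)]
    ginner_diff_right[OF assms assms(2)] L2_inner_commute[of U "wgrad U w" "wgrad U u"]
  by (simp add: Lq_norm_2_sq)

lemma ginner_abs_le: "u \<in> H1 U \<Longrightarrow> w \<in> H1 U \<Longrightarrow> \<bar>ginner u w\<bar> \<le> gnorm u * gnorm w"
  by (intro L2_Cauchy_Schwarz wgrad_weak_grad)

lemma gnorm_diff_commute:
  assumes "u \<in> H1 U" "w \<in> H1 U"
  shows "gnorm (\<lambda>x. u x - w x) = gnorm (\<lambda>x. w x - u x)"
  using gnorm_scale[OF H1_diff(1)[OF assms], of "-1"] by simp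

lemma gnorm_diff_abs_le:
  assumes "u \<in> H1 U" "w \<in> H1 U"
  shows "\<bar>gnorm u - gnorm w\<bar> \<le> gnorm (\<lambda>x. u x - w x)"
  using gnorm_add_le[OF H1_diff(1)[OF assms] assms(2)] gnorm_add_le[OF H1_diff(1)[OF assms(2,1)] assms(1)]
    gnorm_diff_commute[OF assms] by simp

lemma H1_norm_tendsto_0_iff:
  "(\<lambda>k. H1_norm U (f k)) \<longlonglongrightarrow> 0 \<longleftrightarrow> (\<lambda>k. Lq_norm 2 U (f k)) \<longlonglongrightarrow> 0 \<and> (\<lambda>k. gnorm (f k)) \<longlonglongrightarrow> 0"
proof
  assume *: "(\<lambda>k. H1_norm U (f k)) \<longlonglongrightarrow> 0"
  have "Lq_norm 2 U (f k) \<le> H1_norm U (f k)" "gnorm (f k) \<le> H1_norm U (f k)" for k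
    by (auto simp: H1_norm_def intro!: real_le_rsqrt)
  then show "(\<lambda>k. Lq_norm 2 U (f k)) \<longlonglongrightarrow> 0 \<and> (\<lambda>k. gnorm (f k)) \<longlonglongrightarrow> 0"
    by (auto intro!: tendsto_sandwich[OF _ _ tendsto_const *] always_eventually)
next
  assume "(\<lambda>k. Lq_norm 2 U (f k)) \<longlonglongrightarrow> 0 \<and> (\<lambda>k. gnorm (f k)) \<longlonglongrightarrow> 0"
  then have "(\<lambda>k. H1_norm U (f k)) \<longlonglongrightarrow> sqrt (0\<^sup>2 + 0\<^sup>2)"
    unfolding H1_norm_def by (intro tendsto_intros) auto
  then show "(\<lambda>k. H1_norm U (f k)) \<longlonglongrightarrow> 0" by simp
qed

lemma H01_H1: "u \<in> H01 U \<Longrightarrow> u \<in> H1 U"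
  by (simp add: H01_def)

lemma H01_Lq_2: "u \<in> H01 U \<Longrightarrow> u \<in> Lq 2 U"
  by (simp add: H01_def H1_def)

lemma H01_approx:
  assumes "u \<in> H01 U"
  obtains \<phi> where "\<And>k::nat. test_fun U (\<phi> k)" "(\<lambda>k. Lq_norm 2 U (\<lambda>x. \<phi> k x - u x)) \<longlonglongrightarrow> 0"
    "(\<lambda>k. gnorm (\<lambda>x. \<phi> k x - u x)) \<longlonglongrightarrow> 0"
  using assms unfolding H01_def H1_norm_tendsto_0_iff by auto

lemma H01I:
  assumes "u \<in> H1 U" "\<And>k::nat. test_fun U (\<phi> k)" "(\<lambda>k. Lq_norm 2 U (\<lambda>x. \<phi> k x - u x)) \<longlonglongrightarrow> 0"
    "(\<lambda>k. gnorm (\<lambda>x. \<phi> k x - u x)) \<longlonglongrightarrow> 0"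
  shows "u \<in> H01 U"
  using assms unfolding H01_def H1_norm_tendsto_0_iff by auto

lemma H01_add:
  assumes "u \<in> H01 U" "w \<in> H01 U" shows "(\<lambda>x. u x + w x) \<in> H01 U"
proof -
  have H1: "u \<in> H1 U" "w \<in> H1 U" using assms by (auto intro: H01_H1)
  obtain \<phi> where \<phi>: "\<And>k::nat. test_fun U (\<phi> k)" "(\<lambda>k. Lq_norm 2 U (\<lambda>x. \<phi> k x - u x)) \<longlonglongrightarrow> 0"
    "(\<lambda>k. gnorm (\<lambda>x. \<phi> k x - u x)) \<longlonglongrightarrow> 0" using H01_approx[OF assms(1)] by blast
  obtain \<psi> where \<psi>: "\<And>k::nat. test_fun U (\<psi> k)" "(\<lambda>k. Lq_norm 2 U (\<lambda>x. \<psi> k x - w x)) \<longlonglongrightarrow> 0"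
    "(\<lambda>k. gnorm (\<lambda>x. \<psi> k x - w x)) \<longlonglongrightarrow> 0" using H01_approx[OF assms(2)] by blast
  have e: "\<phi> k x + \<psi> k x - (u x + w x) = (\<phi> k x - u x) + (\<psi> k x - w x)" for k x by simp
  note d = H1_diff(1)[OF test_fun_H1[OF \<phi>(1)] H1(1)] H1_diff(1)[OF test_fun_H1[OF \<psi>(1)] H1(2)]
  show ?thesis
  proof (rule H01I[OF H1_add(1)[OF H1] test_fun_add[OF \<phi>(1) \<psi>(1)]])
    show "(\<lambda>k. Lq_norm 2 U (\<lambda>x. \<phi> k x + \<psi> k x - (u x + w x))) \<longlonglongrightarrow> 0"
      unfolding e
      by (rule tendsto_sandwich[OF _ _ tendsto_const tendsto_add_zero[OF \<phi>(2) \<psi>(2)]])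
        (auto intro!: always_eventually L2_triangle H1_Lq_2 d)
    show "(\<lambda>k. gnorm (\<lambda>x. \<phi> k x + \<psi> k x - (u x + w x))) \<longlonglongrightarrow> 0"
      unfolding e
      by (rule tendsto_sandwich[OF _ _ tendsto_const tendsto_add_zero[OF \<phi>(3) \<psi>(3)]])
        (auto intro!: always_eventually gnorm_add_le d)
  qed
qed

lemma H01_scale:
  assumes "u \<in> H01 U" shows "(\<lambda>x. c * u x) \<in> H01 U"
proof -
  have H1: "u \<in> H1 U" using assms by (rule H01_H1)
  obtain \<phi> where \<phi>: "\<And>k::nat. test_fun U (\<phi> k)" "(\<lambda>k. Lq_norm 2 U (\<lambda>x. \<phi> k x - u x)) \<longlonglongrightarrow> 0"
    "(\<lambda>k. gnorm (\<lambda>x. \<phi> k x - u x)) \<longlonglongrightarrow> 0" using H01_approx[OF assms(1)] by blast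
  have e: "c * \<phi> k x - c * u x = c * (\<phi> k x - u x)" for k x by (simp add: algebra_simps)
  note d = H1_diff(1)[OF test_fun_H1[OF \<phi>(1)] H1(1)]
  show ?thesis
  proof (rule H01I[OF H1_scale(1)[OF H1] test_fun_scale[OF \<phi>(1)]])
    show "(\<lambda>k. Lq_norm 2 U (\<lambda>x. c * \<phi> k x - c * u x)) \<longlonglongrightarrow> 0"
      using tendsto_mult_right_zero[OF \<phi>(2), of "\<bar>c\<bar>"] Lq_norm_2_scaleR[of U c "\<lambda>x. \<phi> _ x - u x"]
      unfolding e by simp
    show "(\<lambda>k. gnorm (\<lambda>x. c * \<phi> k x - c * u x)) \<longlonglongrightarrow> 0"
      using tendsto_mult_right_zero[OF \<phi>(3), of "\<bar>c\<bar>"] gnorm_scale[OF d] unfolding e by simp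
  qed
qed

lemma H01_diff: "u \<in> H01 U \<Longrightarrow> w \<in> H01 U \<Longrightarrow> (\<lambda>x. u x - w x) \<in> H01 U"
  using H01_add[of u "\<lambda>x. - 1 * w x"] H01_scale[of w "-1"] by simp

text \<open>Functions that agree almost everywhere satisfy the same predicate
  \<open>is_weak_grad\<close>, so the choice in \<open>wgrad\<close> returns literally the same
  function for both. This lets gradient norms be transported between representatives.\<close>

lemma H01_cong_AE:
  assumes u: "u \<in> H01 U" and ae: "AE x in lebesgue_on U. u x = w x"
  shows "w \<in> H01 U" "wgrad U w = wgrad U u"
proof -
  have wm: "w \<in> borel_measurable (lebesgue_on U)"
    using borel_measurable_lebesgue_on_cong_AE[OF Lq_2_measurable[OF H01_Lq_2[OF u]] U_lebesgue ae] .
  have w: "w \<in> Lq 2 U" using Lq_2_cong_AE[OF H01_Lq_2[OF u] wm ae] .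
  have "L2_inner U u h = L2_inner U w h" if "h \<in> Lq 2 U" for h
    using that u w ae by (intro L2_inner_cong_AE) (auto intro: H01_Lq_2)
  then have wg: "is_weak_grad U u = is_weak_grad U w"
    by (intro ext) (auto simp: is_weak_grad_iff test_fun_partial test_fun_Lq_2)
  then show "wgrad U w = wgrad U u" by (simp add: wgrad_def)
  have H1: "w \<in> H1 U" "u \<in> H1 U"
    using w wgrad_weak_grad[OF H01_H1[OF u]] wg H01_H1[OF u] by (auto intro!: H1I)
  obtain \<phi> where \<phi>: "\<And>k::nat. test_fun U (\<phi> k)" "(\<lambda>k. Lq_norm 2 U (\<lambda>x. \<phi> k x - u x)) \<longlonglongrightarrow> 0"
    "(\<lambda>k. gnorm (\<lambda>x. \<phi> k x - u x)) \<longlonglongrightarrow> 0" using H01_approx[OF u] by blast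
  have ae2: "AE x in lebesgue_on U. \<phi> k x - u x = \<phi> k x - w x" for k
    using ae by eventually_elim simp
  have "Lq_norm 2 U (\<lambda>x. \<phi> k x - u x) = Lq_norm 2 U (\<lambda>x. \<phi> k x - w x)" for k
    by (intro Lq_norm_2_cong_AE ae2 Lq_2_measurable H1_Lq_2 H1_diff(1) H1 test_fun_H1[OF \<phi>(1)])
  moreover have "gnorm (\<lambda>x. \<phi> k x - u x) = gnorm (\<lambda>x. \<phi> k x - w x)" for k
  proof (rule Lq_norm_2_cong_AE)
    show "AE x in lebesgue_on U. wgrad U (\<lambda>x. \<phi> k x - u x) x = wgrad U (\<lambda>x. \<phi> k x - w x) x"
      using H1_diff(2)[OF test_fun_H1[OF \<phi>(1)[of k]] H1(1)] H1_diff(2)[OF test_fun_H1[OF \<phi>(1)[of k]] H1(2)]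
      unfolding \<open>wgrad U w = wgrad U u\<close> by eventually_elim simp
  qed (intro Lq_2_measurable wgrad_weak_grad(1) H1_diff(1) H1 test_fun_H1[OF \<phi>(1)])+
  ultimately show "w \<in> H01 U" using \<phi> by (intro H01I[OF H1(1), of \<phi>]) simp_all
qed

text \<open>A second integration by parts moves the remaining derivative onto \<phi>, so that h is
  minus the Laplacian of \<phi>. Against a fixed test function the Dirichlet form is thus continuous
  for the L2 norm.\<close>

lemma ginner_test_fun:
  assumes \<phi>: "test_fun U \<phi>"
  obtains h where "h \<in> Lq 2 U" "\<And>u. u \<in> H1 U \<Longrightarrow> ginner \<phi> u = L2_inner U h u"
proof
  define D where "D = (\<lambda>b x. frechet_derivative \<phi> (at x) b)"
  define L where "L = (\<lambda>x. \<Sum>b\<in>Basis. frechet_derivative (D b) (at x) b)"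
  have D: "test_fun U (D b)" if "b \<in> Basis" for b unfolding D_def by (rule test_fun_partial[OF \<phi> that])
  show "(\<lambda>x. - 1 * L x) \<in> Lq 2 U"
    unfolding L_def by (intro Lq_2_mult Lq_2_sum test_fun_Lq_2 test_fun_partial D) auto
  have tg: "tgrad \<phi> = (\<lambda>x. \<Sum>b\<in>Basis. D b x *\<^sub>R b)" by (simp add: tgrad_def D_def fun_eq_iff)
  fix u assume u: "u \<in> H1 U"
  have "ginner \<phi> u = L2_inner U (wgrad U u) (tgrad \<phi>)"
    using u \<phi> unfolding L2_inner_commute[of U "wgrad U \<phi>"]
    by (intro L2_inner_cong_AE) (auto intro: wgrad_weak_grad test_fun_H1 tgrad_Lq_2 wgrad_tgrad_AE)
  also have "\<dots> = (\<Sum>b\<in>Basis. L2_inner U (wgrad U u) (\<lambda>x. D b x *\<^sub>R b))"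
    unfolding tg using u
    by (intro L2_inner_sum_right) (auto intro: wgrad_weak_grad Lq_2_scaleR_const test_fun_Lq_2 D)
  also have "\<dots> = (\<Sum>b\<in>Basis. L2_inner U (\<lambda>x. wgrad U u x \<bullet> b) (D b))"
    by (intro sum.cong) (auto simp: L2_inner_def mult.commute)
  also have "\<dots> = (\<Sum>b\<in>Basis. - L2_inner U u (\<lambda>x. frechet_derivative (D b) (at x) b))"
    using wgrad_weak_grad(2)[OF u] D by (intro sum.cong) (auto simp: is_weak_grad_iff)
  also have "\<dots> = - L2_inner U u L"
    unfolding L_def sum_negf using u
    by (subst L2_inner_sum_right) (auto intro: H1_Lq_2 test_fun_Lq_2 test_fun_partial D)
  also have "\<dots> = L2_inner U (\<lambda>x. - 1 * L x) u"
    using L2_inner_scaleR_left[of U "-1" L u] L2_inner_commute[of U u L] by simp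
  finally show "ginner \<phi> u = L2_inner U (\<lambda>x. - 1 * L x) u" .
qed

text \<open>By duality: for a test function \<phi> the products \<open>ginner \<phi> (w k)\<close>
  converge by L2 convergence alone, so \<open>ginner \<phi> u\<close> is at most M times the
  gradient norm of \<phi>. Letting \<phi> tend to u in \<open>H01\<close> gives ||grad u||^2 \<le> M
  ||grad u||.\<close>

lemma gnorm_lower_semicontinuous:
  assumes u: "u \<in> H01 U" and w: "\<And>k. w k \<in> H1 U"
    and lim: "(\<lambda>k. Lq_norm 2 U (\<lambda>x. w k x - u x)) \<longlonglongrightarrow> 0"
    and le: "eventually (\<lambda>k. gnorm (w k) \<le> M) sequentially"
  shows "gnorm u \<le> M"
proof -
  have uH: "u \<in> H1 U" using u by (rule H01_H1)
  have M: "M \<ge> 0" using eventually_happens[OF le] by (auto intro: order_trans[OF Lq_norm_nonneg])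
  have test: "ginner \<phi> u \<le> M * gnorm \<phi>" if \<phi>: "test_fun U \<phi>" for \<phi>
  proof -
    obtain h where h: "h \<in> Lq 2 U" "\<And>u. u \<in> H1 U \<Longrightarrow> ginner \<phi> u = L2_inner U h u"
      using ginner_test_fun[OF \<phi>] by blast
    have "(\<lambda>k. L2_inner U (w k) h) \<longlonglongrightarrow> L2_inner U u h"
      by (rule Lq_norm_2_diff_tendsto_sum[OF H1_Lq_2[OF w] H1_Lq_2[OF uH] h(1) h(1) lim]) (simp add: Lq_norm_2 L2_inner_def)
    then have "(\<lambda>k. ginner \<phi> (w k)) \<longlonglongrightarrow> ginner \<phi> u"
      unfolding h(2)[OF w] h(2)[OF uH] L2_inner_commute[of U h] .
    moreover have "eventually (\<lambda>k. ginner \<phi> (w k) \<le> M * gnorm \<phi>) sequentially"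
      using le
    proof eventually_elim
      case (elim k)
      have "ginner \<phi> (w k) \<le> gnorm \<phi> * gnorm (w k)"
        using ginner_abs_le[OF test_fun_H1[OF \<phi>] w[of k]] by simp
      also have "\<dots> \<le> gnorm \<phi> * M" using elim by (intro mult_left_mono) auto
      finally show ?case by (simp add: mult.commute)
    qed
    ultimately show ?thesis by (rule tendsto_upperbound) simp
  qed
  obtain \<phi> where \<phi>: "\<And>k::nat. test_fun U (\<phi> k)" "(\<lambda>k. gnorm (\<lambda>x. \<phi> k x - u x)) \<longlonglongrightarrow> 0"
    using H01_approx[OF u] by blast
  have lim_g: "(\<lambda>k. gnorm (\<phi> k)) \<longlonglongrightarrow> gnorm u"
  proof (rule LIM_zero_cancel, rule tendsto_0_le[OF \<phi>(2), where K=1])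
    show "\<forall>\<^sub>F k in sequentially. norm (gnorm (\<phi> k) - gnorm u) \<le> norm (gnorm (\<lambda>x. \<phi> k x - u x)) * 1"
      using gnorm_diff_abs_le[OF test_fun_H1[OF \<phi>(1)] uH] by (intro always_eventually) simp
  qed
  have "(\<lambda>k. ginner (\<phi> k) u - ginner u u) \<longlonglongrightarrow> 0"
  proof (rule tendsto_0_le[OF \<phi>(2), where K="gnorm u"], rule always_eventually, rule allI)
    fix k
    show "norm (ginner (\<phi> k) u - ginner u u) \<le> norm (gnorm (\<lambda>x. \<phi> k x - u x)) * gnorm u"
      using ginner_abs_le[OF H1_diff(1)[OF test_fun_H1[OF \<phi>(1)[of k]] uH] uH]
        ginner_diff_left[OF test_fun_H1[OF \<phi>(1)[of k]] uH uH] by simp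
  qed
  then have "(\<lambda>k. ginner (\<phi> k) u) \<longlonglongrightarrow> ginner u u" by (rule LIM_zero_cancel)
  then have "ginner u u \<le> M * gnorm u"
    using test[OF \<phi>(1)] by (intro tendsto_le[OF _ tendsto_mult[OF tendsto_const lim_g]]) auto
  then have "gnorm u * gnorm u \<le> M * gnorm u" by (simp add: Lq_norm_2_sq[symmetric] power2_eq_square)
  then show ?thesis using M by (cases "gnorm u = 0") (auto simp: less_le)
qed

end

section \<open>Sobolev and Poincare inequalities\<close>

lemma test_fun_frechet_eq_tgrad:
  assumes "test_fun U f"
  shows "frechet_derivative f (at x) y = tgrad f x \<bullet> y"
proof -
  have lin: "linear (frechet_derivative f (at x))"
    by (rule has_derivative_linear[OF test_fun_has_derivative[OF assms]])
  have "frechet_derivative f (at x) (\<Sum>b\<in>Basis. (y \<bullet> b) *\<^sub>R b)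
      = (\<Sum>b\<in>Basis. (y \<bullet> b) * frechet_derivative f (at x) b)"
    using lin by (simp add: linear_sum linear_cmul)
  also have "\<dots> = tgrad f x \<bullet> y"
    by (simp add: tgrad_def inner_sum_left) (simp add: mult.commute inner_commute)
  finally show ?thesis by (simp add: euclidean_representation)
qed

lemma tgrad_continuous: "test_fun U f \<Longrightarrow> continuous_on UNIV (tgrad f)"
  unfolding tgrad_def
  by (intro continuous_intros smooth_continuous) (auto simp: test_fun_def intro!: smooth_partial)

section \<open>The subcritical Sobolev inequality, by averaging along rays\<close>

lemma nn_integral_lborel_affine:
  fixes f :: "'a::euclidean_space \<Rightarrow> ennreal"
  assumes [measurable]: "f \<in> borel_measurable borel" and c: "c \<noteq> 0"
  shows "(\<integral>\<^sup>+x. f x \<partial>lborel) = ennreal (\<bar>c\<bar> ^ DIM('a)) * (\<integral>\<^sup>+x. f (t + c *\<^sub>R x) \<partial>lborel)"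
  by (subst lborel_affine[OF c, of t]) (simp add: nn_integral_density nn_integral_distr nn_integral_cmult)

lemma nn_integral_lborel_translate:
  fixes f :: "'a::euclidean_space \<Rightarrow> ennreal"
  assumes "f \<in> borel_measurable borel"
  shows "(\<integral>\<^sup>+x. f (x + t) \<partial>lborel) = (\<integral>\<^sup>+x. f x \<partial>lborel)"
  using nn_integral_lborel_affine[OF assms, of 1 t] by (simp add: add.commute)

lemma ennreal_add_mult:
  "0 \<le> x \<Longrightarrow> 0 \<le> c \<Longrightarrow> 0 \<le> y \<Longrightarrow> ennreal (x + c * y) = ennreal x + ennreal c * ennreal y"
  by (simp add: ennreal_mult)

text \<open>The cube [1, 2]^n serves as the set of ray directions: its measure is 1, so integrating
  over it is averaging; it is bounded, and it stays away from 0, so that all rays leave U within the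
  same time.\<close>

lemma emeasure_lborel_cbox_One: "emeasure lborel (cbox One (2 *\<^sub>R One) :: 'a::euclidean_space set) = 1"
  by (subst emeasure_lborel_cbox) (auto simp: inner_diff_left)

lemma norm_cbox_One:
  fixes y :: "'a::euclidean_space"
  assumes "y \<in> cbox One (2 *\<^sub>R One)"
  shows "1 \<le> norm y" "norm y \<le> 2 * real DIM('a)"
proof -
  obtain b :: 'a where b: "b \<in> Basis" using nonempty_Basis by blast
  have "1 \<le> y \<bullet> b" using assms b by (auto simp: mem_box)
  also have "\<dots> \<le> norm y" using Basis_le_norm[OF b, of y] by simp
  finally show "1 \<le> norm y" .
  have "norm y \<le> (\<Sum>b\<in>Basis. \<bar>y \<bullet> b\<bar>)" by (rule norm_le_l1)
  also have "\<dots> \<le> (\<Sum>b\<in>(Basis::'a set). 2)"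
    using assms by (intro sum_mono) (force simp: mem_box)
  finally show "norm y \<le> 2 * real DIM('a)" by simp
qed

text \<open>Follow the ray from \<open>x\<close> in direction \<open>y\<close> until it has left \<open>U\<close>; the substitution
  \<open>t = R s\<^sup>k\<close> tames the singularity at \<open>x\<close>.\<close>

lemma test_fun_ray_bound:
  fixes f :: "'a::euclidean_space \<Rightarrow> real"
  assumes f: "test_fun U f" and R: "R > 0" and k: "k > 0" and out: "x + R *\<^sub>R y \<notin> U"
    and L: "norm y \<le> L"
  shows "ennreal \<bar>f x\<bar> \<le> (\<integral>\<^sup>+s. ennreal (L * R * real k * s ^ (k - 1) * norm (tgrad f (x + (R * s ^ k) *\<^sub>R y)))
    * indicator {0..1} s \<partial>lborel)"
proof -
  define h' where "h' s = (tgrad f (x + (R * s ^ k) *\<^sub>R y) \<bullet> y) * (R * (real k * s ^ (k - 1)))" for s :: real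
  have d: "((\<lambda>s. f (x + (R * s ^ k) *\<^sub>R y)) has_real_derivative h' s) (at s)" for s
  proof -
    have "((\<lambda>s. R * s ^ k) has_real_derivative R * (real k * s ^ (k - 1))) (at s)"
      by (auto intro!: derivative_eq_intros)
    from DERIV_chain2[OF test_fun_line_derivative[OF f] this, of x y]
    show ?thesis unfolding h'_def test_fun_frechet_eq_tgrad[OF f] .
  qed
  have c: "continuous_on UNIV h'"
    unfolding h'_def using tgrad_continuous[OF f]
    by (auto intro!: continuous_intros continuous_on_compose2[OF tgrad_continuous[OF f]])
  have "(\<integral>s. indicator {0..1} s *\<^sub>R h' s \<partial>lborel) = f (x + (R * 1 ^ k) *\<^sub>R y) - f (x + (R * 0 ^ k) *\<^sub>R y)"
    using d by (intro integral_FTC_atLeastAtMost)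
      (auto intro: continuous_on_subset[OF c] has_vector_derivative_at_within
        simp: has_real_derivative_iff_has_vector_derivative)
  also have "\<dots> = - f x" using test_fun_eq_0[OF f out] k by (simp add: zero_power)
  finally have "\<bar>f x\<bar> = norm (\<integral>s. indicator {0..1} s *\<^sub>R h' s \<partial>lborel)" by simp
  then have "ennreal \<bar>f x\<bar> \<le> (\<integral>\<^sup>+s. norm (indicator {0..1} s *\<^sub>R h' s) \<partial>lborel)"
    using integral_norm_bound_ennreal[of lborel "\<lambda>s. indicator {0..1} s *\<^sub>R h' s"]
      borel_integrable_compact[of "{0..1::real}" h'] continuous_on_subset[OF c] by simp
  also have "\<dots> \<le> (\<integral>\<^sup>+s. ennreal (L * R * real k * s ^ (k - 1) * norm (tgrad f (x + (R * s ^ k) *\<^sub>R y)))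
    * indicator {0..1} s \<partial>lborel)"
  proof (rule nn_integral_mono)
    fix s :: real
    have "norm (h' s) \<le> L * R * real k * s ^ (k - 1) * norm (tgrad f (x + (R * s ^ k) *\<^sub>R y))" if "0 \<le> s"
    proof -
      have "\<bar>tgrad f (x + (R * s ^ k) *\<^sub>R y) \<bullet> y\<bar> \<le> norm (tgrad f (x + (R * s ^ k) *\<^sub>R y)) * norm y"
        by (rule Cauchy_Schwarz_ineq2)
      also have "\<dots> \<le> norm (tgrad f (x + (R * s ^ k) *\<^sub>R y)) * L"
        using L by (intro mult_left_mono) auto
      finally have "\<bar>tgrad f (x + (R * s ^ k) *\<^sub>R y) \<bullet> y\<bar> * (R * (real k * s ^ (k - 1)))
          \<le> norm (tgrad f (x + (R * s ^ k) *\<^sub>R y)) * L * (R * (real k * s ^ (k - 1)))"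
        using R that by (intro mult_right_mono) auto
      then show ?thesis using R that by (simp add: h'_def abs_mult mult_ac)
    qed
    then show "ennreal (norm (indicator {0..1} s *\<^sub>R h' s))
        \<le> ennreal (L * R * real k * s ^ (k - 1) * norm (tgrad f (x + (R * s ^ k) *\<^sub>R y))) * indicator {0..1} s"
      by (auto split: split_indicator intro: ennreal_leI)
  qed
  finally show ?thesis .
qed

text \<open>Here a stands for |f(x)|, and \<mu> and \<nu> for the averages of the gradient norm and
  of its square on the slice with ray parameter s. Of sqrt \<nu> the factor with exponent 1/q is
  kept; the rest is bounded through \<nu> \<le> K s^(-kn), and \<open>kn\<close> says that the power
  of s that remains is nonnegative. Young's inequality then leaves (1 - 1/q) a, which the left side
  of the later estimate absorbs, and a term linear in \<nu>.\<close>

lemma Young_interpolation: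
  fixes a \<mu> \<nu> :: real
  assumes q: "q > 2" and a: "a > 0" and \<mu>: "\<mu> \<ge> 0" "\<mu>\<^sup>2 \<le> \<nu>" and s: "0 < s" "s \<le> 1" and k: "k > 0"
    and n: "n \<ge> 0" and \<nu>: "\<nu> \<le> K * s powr (- real k * n)" and K: "K \<ge> 0" and C: "C > 0"
    and kn: "1 \<le> real k * (1 - n * (1 / 2 - 1 / q))"
  shows "C * s ^ (k - 1) * \<mu> \<le> a * (1 - 1 / q) + C powr q * K powr (q / 2 - 1) * a powr (1 - q) / q * \<nu>"
proof (cases "\<mu> = 0")
  case True
  have "0 \<le> \<nu>" using \<mu> by (meson order_trans zero_le_power2)
  then show ?thesis using True a q K C by (auto intro!: add_nonneg_nonneg mult_nonneg_nonneg)
next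
  case False
  then have \<mu>0: "\<mu> > 0" using \<mu> by simp
  then have \<nu>0: "\<nu> > 0" using \<mu> by (meson less_le_trans zero_less_power)
  then have K0: "K > 0" using \<nu> K by (cases "K = 0") auto
  define e where "e = 1 / 2 - 1 / q"
  have e: "e > 0" using q by (simp add: e_def field_simps)
  have "\<mu> \<le> sqrt \<nu>" using \<mu> by (intro real_le_rsqrt)
  also have "\<dots> = \<nu> powr (1 / q) * \<nu> powr e"
    using \<nu>0 by (simp add: powr_half_sqrt[symmetric] powr_add[symmetric] e_def)
  also have "\<dots> \<le> \<nu> powr (1 / q) * (K * s powr (- real k * n)) powr e"
    using \<nu> \<nu>0 e by (intro mult_left_mono powr_mono2) auto
  also have "(K * s powr (- real k * n)) powr e = K powr e * s powr (- real k * n * e)"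
    using K0 s by (simp add: powr_mult powr_powr)
  finally have "s ^ (k - 1) * \<mu> \<le> s ^ (k - 1) * (\<nu> powr (1 / q) * (K powr e * s powr (- real k * n * e)))"
    using s by (intro mult_left_mono) auto
  also have "s ^ (k - 1) = s powr (real k - 1)"
    using s k by (simp add: powr_realpow[symmetric] of_nat_diff)
  also have "s powr (real k - 1) * (\<nu> powr (1 / q) * (K powr e * s powr (- real k * n * e)))
      = \<nu> powr (1 / q) * K powr e * s powr (real k - 1 - real k * n * e)"
  proof -
    have "s powr (real k - 1) * s powr (- real k * n * e) = s powr (real k - 1 - real k * n * e)"
      using s by (simp add: powr_add[symmetric])
    moreover have "s powr (real k - 1) * (\<nu> powr (1 / q) * (K powr e * s powr (- real k * n * e)))
        = \<nu> powr (1 / q) * K powr e * (s powr (real k - 1) * s powr (- real k * n * e))"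
      by (simp only: mult_ac)
    ultimately show ?thesis by (simp only:)
  qed
  also have "\<dots> \<le> \<nu> powr (1 / q) * K powr e * 1"
  proof (intro mult_left_mono)
    have "0 \<le> real k - 1 - real k * n * e" using kn by (simp add: e_def algebra_simps)
    then show "s powr (real k - 1 - real k * n * e) \<le> 1" using s by (intro powr_le1) auto
  qed auto
  finally have "C * s ^ (k - 1) * \<mu> \<le> C * (\<nu> powr (1 / q) * K powr e)"
    using C s k by (simp add: powr_realpow[symmetric] of_nat_diff mult.assoc)
  \<comment> \<open>A power of a is inserted and divided out again inside the second factor, so that
    Young's inequality produces a itself.\<close>
  also have "\<dots> = a powr (1 - 1 / q) * (C powr q * K powr (q / 2 - 1) * a powr (1 - q) * \<nu>) powr (1 / q)"
  proof -
    have "(C powr q * K powr (q / 2 - 1) * a powr (1 - q) * \<nu>) powr (1 / q)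
        = C * K powr ((q / 2 - 1) / q) * a powr ((1 - q) / q) * \<nu> powr (1 / q)"
      using C K0 a \<nu>0 q by (simp add: powr_mult powr_powr)
    also have "(q / 2 - 1) / q = e" using q by (simp add: e_def field_simps)
    also have "(1 - q) / q = - (1 - 1 / q)" using q by (simp add: field_simps)
    finally have "a powr (1 - 1 / q) * (C powr q * K powr (q / 2 - 1) * a powr (1 - q) * \<nu>) powr (1 / q)
        = C * (\<nu> powr (1 / q) * K powr e) * (a powr (1 - 1 / q) * a powr (- (1 - 1 / q)))"
      by (simp only: mult_ac)
    also have "a powr (1 - 1 / q) * a powr (- (1 - 1 / q)) = 1" using a by (simp flip: powr_add)
    finally show ?thesis by simp
  qed
  also have "\<dots> \<le> (1 - 1 / q) * a + 1 / q * (C powr q * K powr (q / 2 - 1) * a powr (1 - q) * \<nu>)"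
    using q a C K0 \<nu>0 by (intro Youngs_inequality_0) (auto simp: field_simps)
  finally show ?thesis by (simp add: mult_ac)
qed

context bounded_open
begin

lemma exits_bounded: obtains R where "R > 0" "\<And>x y. x \<in> U \<Longrightarrow> norm y \<ge> 1 \<Longrightarrow> x + R *\<^sub>R y \<notin> U"
proof -
  obtain r where r: "r > 0" "\<And>x. x \<in> U \<Longrightarrow> norm x \<le> r" using bounded_U bounded_pos by blast
  have "x + (2 * r + 1) *\<^sub>R y \<notin> U" if "x \<in> U" "norm y \<ge> 1" for x y
  proof
    assume "x + (2 * r + 1) *\<^sub>R y \<in> U"
    then have "norm (x + (2 * r + 1) *\<^sub>R y) \<le> r" using r by blast
    then have "norm ((2 * r + 1) *\<^sub>R y) \<le> r + norm x"
      using norm_triangle_ineq4[of "x + (2 * r + 1) *\<^sub>R y" x] by simp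
    moreover have "norm ((2 * r + 1) *\<^sub>R y) \<ge> 2 * r + 1" using that r by simp
    ultimately show False using r(2)[OF that(1)] by linarith
  qed
  then show thesis using r(1) by (intro that[of "2 * r + 1"]) auto
qed

text \<open>The ray bound is averaged over all directions, and each slice is treated by
  \<open>Young_interpolation\<close>. The gain is that the right side is linear in the squared
  gradient: its integral over x can be computed exactly by Fubini, and the nonlinearity sits in the
  constant prefactor, a power of the total Dirichlet energy G^2.\<close>

lemma Sobolev_pointwise:
  assumes f: "test_fun U f" and q: "q > 2" and x: "x \<in> U"
    and R: "R > 0" "\<And>x y. x \<in> U \<Longrightarrow> norm y \<ge> 1 \<Longrightarrow> x + R *\<^sub>R y \<notin> U"
    and k: "k > 0" "1 \<le> real k * (1 - real DIM('a) * (1 / 2 - 1 / q))"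
    and G: "(\<integral>\<^sup>+x. ennreal ((norm (tgrad f x))\<^sup>2) \<partial>lborel) = ennreal (G\<^sup>2)"
  shows "ennreal (\<bar>f x\<bar> powr q) \<le> ennreal ((2 * real DIM('a) * R * real k) powr q * (G\<^sup>2 / R ^ DIM('a)) powr (q / 2 - 1)) *
    (\<integral>\<^sup>+s. (\<integral>\<^sup>+y. ennreal ((norm (tgrad f (x + (R * s ^ k) *\<^sub>R y)))\<^sup>2) * indicator (cbox One (2 *\<^sub>R One)) y \<partial>lborel)
       * indicator {0..1} s \<partial>lborel)"
proof (cases "f x = 0")
  case True
  then show ?thesis using q by simp
next
  case False
  define a where "a = \<bar>f x\<bar>"
  have a: "a > 0" using False by (simp add: a_def)
  define A where "A = (cbox One (2 *\<^sub>R One) :: 'a set)"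
  define g where "g = (\<lambda>x. norm (tgrad f x))"
  define n where "n = real DIM('a)"
  define C where "C = 2 * n * R * real k"
  define K where "K = G\<^sup>2 / R ^ DIM('a)"
  have n: "n \<ge> 1" by (simp add: n_def)
  have C: "C > 0" using n R k by (simp add: C_def)
  have K: "K \<ge> 0" using R by (simp add: K_def)
  have gm[measurable]: "g \<in> borel_measurable borel"
    unfolding g_def using tgrad_continuous[OF f] by (intro borel_measurable_continuous_onI continuous_intros)
  have g0: "g x \<ge> 0" for x by (simp add: g_def)
  have [measurable]: "A \<in> sets borel" by (simp add: A_def)
  have A1: "emeasure lborel A = 1" by (simp add: A_def emeasure_lborel_cbox_One)
  \<comment> \<open>\<open>N\<close> and \<open>m\<close> are the averages over directions of the
    squared gradient norm and of the gradient norm at ray parameter s.\<close>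
  define N where "N s = (\<integral>\<^sup>+y. ennreal ((g (x + (R * s ^ k) *\<^sub>R y))\<^sup>2) * indicator A y \<partial>lborel)" for s :: real
  define m where "m s = (\<integral>\<^sup>+y. ennreal (g (x + (R * s ^ k) *\<^sub>R y)) * indicator A y \<partial>lborel)" for s :: real
  define c where "c = C powr q * K powr (q / 2 - 1) * a powr (1 - q) / q"
  have c: "c \<ge> 0" using q by (simp add: c_def)
  have ea: "0 \<le> a * (1 - 1 / q)" using a q by simp
  \<comment> \<open>As A has measure 1, the constant equals its average over directions.\<close>
  have "ennreal a = (\<integral>\<^sup>+y. ennreal a * indicator A y \<partial>lborel)"
    using A1 by (simp add: nn_integral_cmult_indicator)
  also have "\<dots> \<le> (\<integral>\<^sup>+y. (\<integral>\<^sup>+s. ennreal (C * s ^ (k - 1) * g (x + (R * s ^ k) *\<^sub>R y)) * indicator {0..1} s * indicator A y \<partial>lborel) \<partial>lborel)"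
  proof (rule nn_integral_mono)
    fix y
    show "ennreal a * indicator A y
        \<le> (\<integral>\<^sup>+s. ennreal (C * s ^ (k - 1) * g (x + (R * s ^ k) *\<^sub>R y)) * indicator {0..1} s * indicator A y \<partial>lborel)"
    proof (cases "y \<in> A")
      case True
      then have "x + R *\<^sub>R y \<notin> U" "norm y \<le> 2 * n"
        using norm_cbox_One[of y] R(2)[OF x] by (auto simp: A_def n_def)
      from test_fun_ray_bound[OF f R(1) k(1) this] show ?thesis
        using True by (simp add: a_def C_def g_def)
    qed simp
  qed
  also have "\<dots> = (\<integral>\<^sup>+s. (\<integral>\<^sup>+y. ennreal (C * s ^ (k - 1) * g (x + (R * s ^ k) *\<^sub>R y)) * indicator {0..1} s * indicator A y \<partial>lborel) \<partial>lborel)"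
    by (rule lborel_pair.Fubini') measurable
  also have "\<dots> \<le> (\<integral>\<^sup>+s. (ennreal (a * (1 - 1 / q)) + ennreal c * N s) * indicator {0..1} s \<partial>lborel)"
  proof (rule nn_integral_mono_AE)
    \<comment> \<open>At s = 0 all rays degenerate to the point x and the scaling below breaks down;
      a single point is null.\<close>
    have "AE s in lborel. s \<noteq> (0::real)" by (rule AE_lborel_singleton)
    then show "AE s in lborel. (\<integral>\<^sup>+y. ennreal (C * s ^ (k - 1) * g (x + (R * s ^ k) *\<^sub>R y)) * indicator {0..1} s * indicator A y \<partial>lborel)
        \<le> (ennreal (a * (1 - 1 / q)) + ennreal c * N s) * indicator {0..1} s"
    proof eventually_elim
      case (elim s)
      show ?case
      proof (cases "s \<in> {0..1}")
        case True
        then have s: "0 < s" "s \<le> 1" using elim by auto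
        have Rs: "R * s ^ k > 0" using R s by simp
        \<comment> \<open>Enlarging the cube to the whole space and substituting gives G^2 divided
          by the n-th power of the dilation factor R s^k.\<close>
        have "N s \<le> (\<integral>\<^sup>+y. ennreal ((g (x + (R * s ^ k) *\<^sub>R y))\<^sup>2) \<partial>lborel)"
          unfolding N_def by (intro nn_integral_mono) (auto split: split_indicator)
        also have "\<dots> = ennreal (K * s powr (- real k * n))"
        proof -
          have "ennreal (\<bar>R * s ^ k\<bar> ^ DIM('a)) * (\<integral>\<^sup>+y. ennreal ((g (x + (R * s ^ k) *\<^sub>R y))\<^sup>2) \<partial>lborel) = ennreal (G\<^sup>2)"
          proof -
            have "(\<integral>\<^sup>+x. ennreal ((g x)\<^sup>2) \<partial>lborel) = ennreal (\<bar>R * s ^ k\<bar> ^ DIM('a)) *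
                (\<integral>\<^sup>+y. ennreal ((g (x + (R * s ^ k) *\<^sub>R y))\<^sup>2) \<partial>lborel)"
              using R s by (intro nn_integral_lborel_affine) auto
            then show ?thesis using G by (simp add: g_def)
          qed
          then have "ennreal (1 / (R * s ^ k) ^ DIM('a)) * (ennreal ((R * s ^ k) ^ DIM('a)) * (\<integral>\<^sup>+y. ennreal ((g (x + (R * s ^ k) *\<^sub>R y))\<^sup>2) \<partial>lborel))
              = ennreal (1 / (R * s ^ k) ^ DIM('a)) * ennreal (G\<^sup>2)"
            using Rs by simp
          moreover have "ennreal (1 / (R * s ^ k) ^ DIM('a)) * ennreal ((R * s ^ k) ^ DIM('a)) = 1"
          proof -
            have "ennreal (1 / d ^ DIM('a)) * ennreal (d ^ DIM('a)) = 1" if "d > 0" for d :: real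
              using that by (simp add: ennreal_mult[symmetric])
            from this[OF Rs] show ?thesis .
          qed
          ultimately have "(\<integral>\<^sup>+y. ennreal ((g (x + (R * s ^ k) *\<^sub>R y))\<^sup>2) \<partial>lborel) = ennreal (1 / (R * s ^ k) ^ DIM('a)) * ennreal (G\<^sup>2)"
            by (simp only: mult.assoc[symmetric] mult_1_left)
          also have "\<dots> = ennreal (1 / (R * s ^ k) ^ DIM('a) * G\<^sup>2)"
            using R s by (intro ennreal_mult[symmetric]) auto
          also have "1 / (R * s ^ k) ^ DIM('a) * G\<^sup>2 = K * s powr (- real k * n)"
          proof -
            have "s powr (real k * n) = (s ^ k) ^ DIM('a)"
              using s powr_realpow[of s "k * DIM('a)"] by (simp add: n_def power_mult)
            then show ?thesis using R s by (simp add: K_def powr_minus power_mult_distrib divide_inverse)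
          qed
          finally show ?thesis .
        qed
        finally have Ns: "N s \<le> ennreal (K * s powr (- real k * n))" .
        then obtain \<nu> where \<nu>: "N s = ennreal \<nu>" "\<nu> \<ge> 0"
          by (cases "N s") (auto simp: top_unique)
        have \<nu>K: "\<nu> \<le> K * s powr (- real k * n)"
          using Ns K \<nu> by (simp add: ennreal_le_iff)
        \<comment> \<open>Cauchy-Schwarz against the indicator of A, which has mass 1, gives
          \<open>(m s)\<^sup>2 \<le> N s\<close>.\<close>
        have "(m s)\<^sup>2 = (\<integral>\<^sup>+y. (ennreal (g (x + (R * s ^ k) *\<^sub>R y)) * indicator A y) * indicator A y \<partial>lborel)\<^sup>2"
          unfolding m_def by (intro arg_cong[where f="\<lambda>x. x\<^sup>2"] nn_integral_cong) (auto split: split_indicator)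
        also have "\<dots> \<le> (\<integral>\<^sup>+y. (ennreal (g (x + (R * s ^ k) *\<^sub>R y)) * indicator A y)\<^sup>2 \<partial>lborel) * (\<integral>\<^sup>+y. (indicator A y)\<^sup>2 \<partial>lborel)"
          by (rule Cauchy_Schwarz_nn_integral) measurable
        also have "(\<integral>\<^sup>+y. (ennreal (g (x + (R * s ^ k) *\<^sub>R y)) * indicator A y)\<^sup>2 \<partial>lborel) = N s"
          unfolding N_def by (intro nn_integral_cong) (auto simp: ennreal_power g0 split: split_indicator)
        also have "(\<integral>\<^sup>+y. (indicator A y)\<^sup>2 \<partial>lborel) = (1 :: ennreal)"
        proof -
          have "(\<lambda>y. (indicator A y :: ennreal)\<^sup>2) = indicator A" by (auto simp: fun_eq_iff split: split_indicator)
          then show ?thesis using A1 by simp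
        qed
        finally have ms: "(m s)\<^sup>2 \<le> ennreal \<nu>" using \<nu> by simp
        then obtain \<mu> where \<mu>: "m s = ennreal \<mu>" "\<mu> \<ge> 0"
          by (cases "m s") (auto simp: top_unique ennreal_top_mult power2_eq_square)
        have \<mu>\<nu>: "\<mu>\<^sup>2 \<le> \<nu>" using ms \<mu> \<nu> by (simp add: ennreal_power ennreal_le_iff)
        have "(\<integral>\<^sup>+y. ennreal (C * s ^ (k - 1) * g (x + (R * s ^ k) *\<^sub>R y)) * indicator {0..1} s * indicator A y \<partial>lborel)
            = ennreal (C * s ^ (k - 1)) * m s"
          unfolding m_def using True C s g0
          by (subst nn_integral_cmult[symmetric]) (auto simp: ennreal_mult mult.assoc intro!: nn_integral_cong)
        also have "\<dots> = ennreal (C * s ^ (k - 1) * \<mu>)"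
          using \<mu> C s by (simp add: ennreal_mult)
        also have "\<dots> \<le> ennreal (a * (1 - 1 / q) + c * \<nu>)"
          unfolding c_def using q a \<mu> \<mu>\<nu> s k n \<nu>K K C
          by (intro ennreal_leI Young_interpolation[where n=n]) (auto simp: n_def)
        also have "\<dots> = ennreal (a * (1 - 1 / q)) + ennreal c * N s"
          unfolding \<nu>(1) using ea c \<nu>(2) by (rule ennreal_add_mult)
        finally show ?thesis using True by simp
      qed simp
    qed
  qed
  also have "\<dots> = ennreal (a * (1 - 1 / q)) + ennreal c * (\<integral>\<^sup>+s. N s * indicator {0..1} s \<partial>lborel)"
  proof -
    have [measurable]: "N \<in> borel_measurable lborel" unfolding N_def by measurable
    have "(\<integral>\<^sup>+s. (ennreal (a * (1 - 1 / q)) + ennreal c * N s) * indicator {0..1} s \<partial>lborel)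
      = (\<integral>\<^sup>+s. ennreal (a * (1 - 1 / q)) * indicator {0..1} s + ennreal c * (N s * indicator {0..1} s) \<partial>lborel)"
      by (intro nn_integral_cong) (auto split: split_indicator)
    then show ?thesis
      by (simp add: nn_integral_add nn_integral_cmult nn_integral_cmult_indicator)
  qed
  finally have main: "ennreal a \<le> ennreal (a * (1 - 1 / q)) + ennreal c * (\<integral>\<^sup>+s. N s * indicator {0..1} s \<partial>lborel)" .
  have "ennreal (a powr q) \<le> ennreal (C powr q * K powr (q / 2 - 1)) * (\<integral>\<^sup>+s. N s * indicator {0..1} s \<partial>lborel)"
  proof (cases "(\<integral>\<^sup>+s. N s * indicator {0..1} s \<partial>lborel)")
    case (real X)
    have "ennreal a \<le> ennreal (a * (1 - 1 / q) + c * X)"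
      using main unfolding real ennreal_add_mult[OF ea c real(1)] .
    then have "a \<le> a * (1 - 1 / q) + c * X"
      using ea c real(1) by (subst (asm) ennreal_le_iff) (auto intro!: add_nonneg_nonneg mult_nonneg_nonneg)
    then have "a / q \<le> C powr q * K powr (q / 2 - 1) * a powr (1 - q) / q * X"
      by (simp add: algebra_simps c_def)
    then have "a \<le> C powr q * K powr (q / 2 - 1) * a powr (1 - q) * X"
      using q by (simp add: divide_le_cancel mult_ac)
    \<comment> \<open>The constant carries the factor a^(1 - q) from Young's inequality; multiplying
      by a^(q - 1) clears it and turns the left side into a^q.\<close>
    then have "a powr (q - 1) * a \<le> a powr (q - 1) * (C powr q * K powr (q / 2 - 1) * a powr (1 - q) * X)"
      by (intro mult_left_mono) auto
    also have "a powr (q - 1) * a = a powr q" using a by (simp add: powr_diff)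
    also have "a powr (q - 1) * (C powr q * K powr (q / 2 - 1) * a powr (1 - q) * X)
        = C powr q * K powr (q / 2 - 1) * X * (a powr (q - 1) * a powr (1 - q))" by (simp add: mult_ac)
    also have "a powr (q - 1) * a powr (1 - q) = 1" using a by (simp flip: powr_add)
    finally show ?thesis using real by (simp add: ennreal_mult[symmetric] ennreal_leI)
  next
    \<comment> \<open>An infinite integral makes the claim trivial unless the constant in front is
      0; in that case \<open>main\<close> would read a \<le> a (1 - 1/q), which is false for
      positive a.\<close>
    case top
    show ?thesis
    proof (cases "C powr q * K powr (q / 2 - 1) = 0")
      case True
      then have "c = 0" by (simp add: c_def)
      with main have "a \<le> a * (1 - 1 / q)" using a q by (simp add: ennreal_le_iff field_simps)
      then have "a / q \<le> 0" by (simp add: algebra_simps)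
      moreover have "a / q > 0" using a q by simp
      ultimately show ?thesis by linarith
    next
      case False
      then have "0 < C powr q * K powr (q / 2 - 1)" using C K by (simp add: less_le)
      then show ?thesis unfolding top by (metis ennreal_mult_top ennreal_eq_0_iff not_le top_greatest)
    qed
  qed
  then show ?thesis unfolding a_def C_def n_def K_def N_def g_def A_def .
qed

lemma nn_integral_U_eq_lborel:
  fixes f :: "'a \<Rightarrow> ennreal"
  assumes "f \<in> borel_measurable borel"
  shows "(\<integral>\<^sup>+x. f x \<partial>lebesgue_on U) = (\<integral>\<^sup>+x. f x * indicator U x \<partial>lborel)"
proof -
  have "(\<integral>\<^sup>+x. f x \<partial>lebesgue_on U) = (\<integral>\<^sup>+x. f x * indicator U x \<partial>lebesgue)"
    using U_lebesgue by (intro nn_integral_restrict_space) simp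
  also have "\<dots> = (\<integral>\<^sup>+x. f x * indicator U x \<partial>lborel)"
    by (rule nn_integral_completion)
  finally show ?thesis .
qed

lemma nn_integral_tgrad_sq:
  assumes f: "test_fun U f"
  shows "(\<integral>\<^sup>+x. ennreal ((norm (tgrad f x))\<^sup>2) \<partial>lborel) = ennreal ((Lq_norm 2 U (tgrad f))\<^sup>2)"
proof -
  have m: "(\<lambda>x. ennreal ((norm (tgrad f x))\<^sup>2)) \<in> borel_measurable borel"
    using borel_measurable_continuous_onI[OF tgrad_continuous[OF f]] by simp
  have 0: "tgrad f x = 0" if "x \<notin> U" for x
  proof -
    have "x \<notin> closure {x. f x \<noteq> 0}" using f that by (auto simp: test_fun_def)
    then show ?thesis by (simp add: tgrad_def frechet_derivative_eq_0_outside)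
  qed
  have "(\<integral>\<^sup>+x. ennreal ((norm (tgrad f x))\<^sup>2) \<partial>lborel) = (\<integral>\<^sup>+x. ennreal ((norm (tgrad f x))\<^sup>2) * indicator U x \<partial>lborel)"
    using 0 by (intro nn_integral_cong) (auto split: split_indicator)
  also have "\<dots> = (\<integral>\<^sup>+x. ennreal ((norm (tgrad f x))\<^sup>2) \<partial>lebesgue_on U)"
    by (rule nn_integral_U_eq_lborel[OF m, symmetric])
  also have "\<dots> = ennreal (\<integral>x. (norm (tgrad f x))\<^sup>2 \<partial>lebesgue_on U)"
    using tgrad_Lq_2[OF f] by (intro nn_integral_eq_integral) (auto simp: Lq_2_iff)
  finally show ?thesis by (simp add: Lq_norm_2_sq_integral)
qed

lemma Sobolev_test_fun:
  assumes q: "q > 2" "real DIM('a) * (q - 2) < 2 * q"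
  obtains C where "C > 0" "\<And>f. test_fun U f \<Longrightarrow>
    (\<integral>\<^sup>+x. ennreal (\<bar>f x\<bar> powr q) \<partial>lebesgue_on U) \<le> ennreal (C * Lq_norm 2 U (tgrad f) powr q)"
proof -
  obtain R where R: "R > 0" "\<And>x y. x \<in> U \<Longrightarrow> norm y \<ge> 1 \<Longrightarrow> x + R *\<^sub>R y \<notin> U"
    using exits_bounded by blast
  \<comment> \<open>That d is positive is precisely subcriticality of q. A large exponent k' in the
    substitution t = R s^k' then meets the condition of the pointwise bound.\<close>
  define d where "d = 1 - real DIM('a) * (1 / 2 - 1 / q)"
  have "d > 0" using q by (simp add: d_def field_simps)
  then obtain k' where k': "1 < real k' * d" using reals_Archimedean3 by blast
  then have k: "k' > 0" "1 \<le> real k' * (1 - real DIM('a) * (1 / 2 - 1 / q))"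
    by (auto simp: d_def intro: gr0I)
  define c where "c = (2 * real DIM('a) * R * real k') powr q * (1 / R ^ DIM('a)) powr (q / 2 - 1)"
  have c: "c > 0" using R k by (simp add: c_def)
  define A where "A = (cbox One (2 *\<^sub>R One) :: 'a set)"
  have A1: "emeasure lborel A = 1" by (simp add: A_def emeasure_lborel_cbox_One)
  have [measurable]: "A \<in> sets borel" by (simp add: A_def)
  have "(\<integral>\<^sup>+x. ennreal (\<bar>f x\<bar> powr q) \<partial>lebesgue_on U) \<le> ennreal (c * Lq_norm 2 U (tgrad f) powr q)"
    if f: "test_fun U f" for f
  proof -
    define G where "G = Lq_norm 2 U (tgrad f)"
    have G: "G \<ge> 0" by (simp add: G_def)
    define g where "g = (\<lambda>x. ennreal ((norm (tgrad f x))\<^sup>2))"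
    have gm[measurable]: "g \<in> borel_measurable borel"
      unfolding g_def using borel_measurable_continuous_onI[OF tgrad_continuous[OF f]] by simp
    have gG: "(\<integral>\<^sup>+x. g x \<partial>lborel) = ennreal (G\<^sup>2)"
      unfolding g_def G_def by (rule nn_integral_tgrad_sq[OF f])
    have fm: "(\<lambda>x. ennreal (\<bar>f x\<bar> powr q)) \<in> borel_measurable borel"
      using test_fun_measurable[OF f] by simp
    define c' where "c' = (2 * real DIM('a) * R * real k') powr q * (G\<^sup>2 / R ^ DIM('a)) powr (q / 2 - 1)"
    have "(\<integral>\<^sup>+x. ennreal (\<bar>f x\<bar> powr q) \<partial>lebesgue_on U) = (\<integral>\<^sup>+x. ennreal (\<bar>f x\<bar> powr q) * indicator U x \<partial>lborel)"
      by (rule nn_integral_U_eq_lborel[OF fm])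
    also have "\<dots> \<le> (\<integral>\<^sup>+x. ennreal c' * (\<integral>\<^sup>+s. (\<integral>\<^sup>+y. g (x + (R * s ^ k') *\<^sub>R y) * indicator A y \<partial>lborel)
       * indicator {0..1} s \<partial>lborel) \<partial>lborel)"
    proof (rule nn_integral_mono)
      fix x
      show "ennreal (\<bar>f x\<bar> powr q) * indicator U x \<le> ennreal c' * (\<integral>\<^sup>+s. (\<integral>\<^sup>+y. g (x + (R * s ^ k') *\<^sub>R y) * indicator A y \<partial>lborel)
       * indicator {0..1} s \<partial>lborel)"
        using Sobolev_pointwise[OF f q(1) _ R k nn_integral_tgrad_sq[OF f], of x]
        by (cases "x \<in> U") (auto simp: c'_def g_def G_def A_def)
    qed
    also have "\<dots> = ennreal c' * (\<integral>\<^sup>+x. (\<integral>\<^sup>+s. (\<integral>\<^sup>+y. g (x + (R * s ^ k') *\<^sub>R y) * indicator A y \<partial>lborel)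
       * indicator {0..1} s \<partial>lborel) \<partial>lborel)"
      by (rule nn_integral_cmult) measurable
    \<comment> \<open>Integrate in x first: for fixed s and y the integrand is a translate of g with
      integral G^2, and the cube and the unit interval both have mass 1.\<close>
    also have "(\<integral>\<^sup>+x. (\<integral>\<^sup>+s. (\<integral>\<^sup>+y. g (x + (R * s ^ k') *\<^sub>R y) * indicator A y \<partial>lborel)
       * indicator {0..1} s \<partial>lborel) \<partial>lborel)
      = (\<integral>\<^sup>+s. (\<integral>\<^sup>+x. (\<integral>\<^sup>+y. g (x + (R * s ^ k') *\<^sub>R y) * indicator A y \<partial>lborel)
       * indicator {0..1} s \<partial>lborel) \<partial>lborel)"
      by (rule lborel_pair.Fubini'[symmetric]) measurable
    also have "\<dots> = (\<integral>\<^sup>+s. ennreal (G\<^sup>2) * indicator {0..1::real} s \<partial>lborel)"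
    proof (rule nn_integral_cong)
      fix s :: real
      have "(\<integral>\<^sup>+x. (\<integral>\<^sup>+y. g (x + (R * s ^ k') *\<^sub>R y) * indicator A y \<partial>lborel) * indicator {0..1} s \<partial>lborel)
        = (\<integral>\<^sup>+x. (\<integral>\<^sup>+y. g (x + (R * s ^ k') *\<^sub>R y) * indicator A y \<partial>lborel) \<partial>lborel) * indicator {0..1} s"
        by (rule nn_integral_multc) measurable
      also have "(\<integral>\<^sup>+x. (\<integral>\<^sup>+y. g (x + (R * s ^ k') *\<^sub>R y) * indicator A y \<partial>lborel) \<partial>lborel)
        = (\<integral>\<^sup>+y. (\<integral>\<^sup>+x. g (x + (R * s ^ k') *\<^sub>R y) * indicator A y \<partial>lborel) \<partial>lborel)"
        by (rule lborel_pair.Fubini'[symmetric]) measurable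
      also have "\<dots> = (\<integral>\<^sup>+y. ennreal (G\<^sup>2) * indicator A y \<partial>lborel)"
      proof (rule nn_integral_cong)
        fix y
        have "(\<integral>\<^sup>+x. g (x + (R * s ^ k') *\<^sub>R y) * indicator A y \<partial>lborel)
            = (\<integral>\<^sup>+x. g (x + (R * s ^ k') *\<^sub>R y) \<partial>lborel) * indicator A y"
          by (rule nn_integral_multc) measurable
        then show "(\<integral>\<^sup>+x. g (x + (R * s ^ k') *\<^sub>R y) * indicator A y \<partial>lborel) = ennreal (G\<^sup>2) * indicator A y"
          by (simp add: nn_integral_lborel_translate gG)
      qed
      also have "\<dots> = ennreal (G\<^sup>2)" using A1 by (simp add: nn_integral_cmult_indicator)
      finally show "(\<integral>\<^sup>+x. (\<integral>\<^sup>+y. g (x + (R * s ^ k') *\<^sub>R y) * indicator A y \<partial>lborel) * indicator {0..1} s \<partial>lborel)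
        = ennreal (G\<^sup>2) * indicator {0..1} s" .
    qed
    also have "\<dots> = ennreal (G\<^sup>2)" by (simp add: nn_integral_cmult_indicator)
    also have "ennreal c' * ennreal (G\<^sup>2) = ennreal (c * G powr q)"
    proof -
      have "c' * G\<^sup>2 = c * G powr q"
      proof (cases "G = 0")
        case False
        then have G0: "G > 0" using G by simp
        have "(G\<^sup>2 / R ^ DIM('a)) powr (q / 2 - 1) = (G\<^sup>2) powr (q / 2 - 1) * (1 / R ^ DIM('a)) powr (q / 2 - 1)"
          using R G0 by (simp add: powr_mult[symmetric])
        also have "(G\<^sup>2) powr (q / 2 - 1) = G powr (q - 2)"
        proof -
          have "(G\<^sup>2) powr (q / 2 - 1) = (G powr 2) powr (q / 2 - 1)" using G by simp
          also have "\<dots> = G powr (2 * (q / 2 - 1))" by (rule powr_powr)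
          also have "2 * (q / 2 - 1) = q - 2" by simp
          finally show ?thesis .
        qed
        finally have "c' * G\<^sup>2 = c * (G powr (q - 2) * G powr 2)"
          using G0 by (simp add: c'_def c_def)
        also have "G powr (q - 2) * G powr 2 = G powr q" by (simp only: powr_add[symmetric]) simp
        finally show ?thesis .
      qed simp
      moreover have "c' \<ge> 0" by (simp add: c'_def)
      ultimately show ?thesis by (simp add: ennreal_mult[symmetric])
    qed
    finally show ?thesis by (simp add: G_def)
  qed
  then show thesis using c by (intro that[of c])
qed

text \<open>Approximating test functions converge almost everywhere along a subsequence, and Fatou's
  lemma carries the bound to the limit. Integrability comes out of the same estimate, since the
  bound is first obtained for the nonnegative integral.\<close>

theorem Sobolev_H01:
  assumes q: "q > 2" "real DIM('a) * (q - 2) < 2 * q"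
  obtains C where "C > 0" "\<And>u. u \<in> H01 U \<Longrightarrow> integrable (lebesgue_on U) (\<lambda>x. \<bar>u x\<bar> powr q)"
    "\<And>u. u \<in> H01 U \<Longrightarrow> (\<integral>x. \<bar>u x\<bar> powr q \<partial>lebesgue_on U) \<le> C * gnorm u powr q"
proof -
  obtain C where C: "C > 0" "\<And>f. test_fun U f \<Longrightarrow>
    (\<integral>\<^sup>+x. ennreal (\<bar>f x\<bar> powr q) \<partial>lebesgue_on U) \<le> ennreal (C * Lq_norm 2 U (tgrad f) powr q)"
    using Sobolev_test_fun[OF q] by blast
  have nn: "(\<integral>\<^sup>+x. ennreal (\<bar>u x\<bar> powr q) \<partial>lebesgue_on U) \<le> ennreal (C * gnorm u powr q)" if u: "u \<in> H01 U" for u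
  proof -
    obtain \<phi> where \<phi>: "\<And>k::nat. test_fun U (\<phi> k)" "(\<lambda>k. Lq_norm 2 U (\<lambda>x. \<phi> k x - u x)) \<longlonglongrightarrow> 0"
      "(\<lambda>k. gnorm (\<lambda>x. \<phi> k x - u x)) \<longlonglongrightarrow> 0" using H01_approx[OF u] by blast
    have m[measurable]: "u \<in> borel_measurable (lebesgue_on U)" "\<phi> k \<in> borel_measurable (lebesgue_on U)" for k
      using u test_fun_Lq_2[OF \<phi>(1)] by (auto intro: Lq_2_measurable H01_Lq_2)
    have d: "(\<lambda>x. \<phi> k x - u x) \<in> Lq 2 U" for k
      using test_fun_Lq_2[OF \<phi>(1)] H01_Lq_2[OF u] by (rule Lq_2_diff)
    have "(\<lambda>k. \<integral>x. norm ((\<phi> k x - u x)\<^sup>2) \<partial>lebesgue_on U) \<longlonglongrightarrow> 0"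
      using tendsto_power[OF \<phi>(2), of 2] by (simp add: Lq_norm_2_sq_integral)
    moreover have "integrable (lebesgue_on U) (\<lambda>x. (\<phi> k x - u x)\<^sup>2)" for k
      using d[of k] by (simp add: Lq_2_iff)
    ultimately obtain r where r: "strict_mono r" "AE x in lebesgue_on U. (\<lambda>k. (\<phi> (r k) x - u x)\<^sup>2) \<longlonglongrightarrow> 0"
      using tendsto_L1_AE_subseq[of "lebesgue_on U" "\<lambda>k x. (\<phi> k x - u x)\<^sup>2"] by blast
    have lim: "AE x in lebesgue_on U. (\<lambda>k. ennreal (\<bar>\<phi> (r k) x\<bar> powr q)) \<longlonglongrightarrow> ennreal (\<bar>u x\<bar> powr q)"
      using r(2)
    proof eventually_elim
      case (elim x)
      then have "(\<lambda>k. \<phi> (r k) x - u x) \<longlonglongrightarrow> 0"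
        using tendsto_real_sqrt[OF elim] by (simp add: tendsto_rabs_zero_iff)
      then have "(\<lambda>k. \<phi> (r k) x) \<longlonglongrightarrow> u x" by (rule LIM_zero_cancel)
      then have "(\<lambda>k. \<bar>\<phi> (r k) x\<bar> powr q) \<longlonglongrightarrow> \<bar>u x\<bar> powr q"
        using q by (intro tendsto_powr2 tendsto_rabs tendsto_const) auto
      then show ?case by (rule tendsto_ennrealI)
    qed
    have gn: "gnorm (\<phi> k) = Lq_norm 2 U (tgrad (\<phi> k))" for k
      using \<phi>(1) by (intro Lq_norm_2_cong_AE wgrad_tgrad_AE Lq_2_measurable wgrad_weak_grad(1) test_fun_H1 tgrad_Lq_2)
    have lim_g: "(\<lambda>k. gnorm (\<phi> k)) \<longlonglongrightarrow> gnorm u"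
    proof (rule LIM_zero_cancel, rule tendsto_0_le[OF \<phi>(3), where K=1])
      show "\<forall>\<^sub>F k in sequentially. norm (gnorm (\<phi> k) - gnorm u) \<le> norm (gnorm (\<lambda>x. \<phi> k x - u x)) * 1"
        using gnorm_diff_abs_le[OF test_fun_H1[OF \<phi>(1)] H01_H1[OF u]] by (intro always_eventually) simp
    qed
    have "(\<lambda>k. ennreal (C * gnorm (\<phi> (r k)) powr q)) \<longlonglongrightarrow> ennreal (C * gnorm u powr q)"
      using LIMSEQ_subseq_LIMSEQ[OF lim_g r(1)] q
      by (intro tendsto_ennrealI tendsto_mult tendsto_const tendsto_powr2) (auto simp: o_def)
    then have L: "liminf (\<lambda>k. ennreal (C * gnorm (\<phi> (r k)) powr q)) = ennreal (C * gnorm u powr q)"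
      by (intro lim_imp_Liminf) auto
    have "(\<integral>\<^sup>+x. ennreal (\<bar>u x\<bar> powr q) \<partial>lebesgue_on U)
        = (\<integral>\<^sup>+x. liminf (\<lambda>k. ennreal (\<bar>\<phi> (r k) x\<bar> powr q)) \<partial>lebesgue_on U)"
    proof (rule nn_integral_cong_AE, use lim in eventually_elim)
      case (elim x)
      show ?case by (rule lim_imp_Liminf[OF _ elim, symmetric]) simp
    qed
    also have "\<dots> \<le> liminf (\<lambda>k. \<integral>\<^sup>+x. ennreal (\<bar>\<phi> (r k) x\<bar> powr q) \<partial>lebesgue_on U)"
      by (rule nn_integral_liminf) measurable
    also have "\<dots> \<le> liminf (\<lambda>k. ennreal (C * gnorm (\<phi> (r k)) powr q))"
      using C(2)[OF \<phi>(1)] by (intro Liminf_mono always_eventually) (simp add: gn)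
    finally show ?thesis unfolding L .
  qed
  have int: "integrable (lebesgue_on U) (\<lambda>x. \<bar>u x\<bar> powr q)" if u: "u \<in> H01 U" for u
  proof (rule integrableI_nonneg)
    show "(\<lambda>x. \<bar>u x\<bar> powr q) \<in> borel_measurable (lebesgue_on U)"
      using Lq_2_measurable[OF H01_Lq_2[OF u]] by simp
    show "(\<integral>\<^sup>+x. ennreal (\<bar>u x\<bar> powr q) \<partial>lebesgue_on U) < \<infinity>"
      using nn[OF u] by (rule order_le_less_trans) simp
  qed simp
  moreover have "(\<integral>x. \<bar>u x\<bar> powr q \<partial>lebesgue_on U) \<le> C * gnorm u powr q" if u: "u \<in> H01 U" for u
    using nn[OF u] C(1) unfolding nn_integral_eq_integral[OF int[OF u] AE_I2[of _ "\<lambda>x. 0 \<le> \<bar>u x\<bar> powr q", OF powr_ge_zero]]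
    by (subst (asm) ennreal_le_iff) auto
  ultimately show thesis using C(1) by (intro that[of C])
qed

text \<open>The exponent q = 2 + 1/n is subcritical in every dimension. Splitting at height l gives
  u^2 \<le> l^2 + l^(2 - q) |u|^q, and the choice l = ||grad u|| makes both terms homogeneous of
  degree 2; for vanishing gradient l tends to 0 instead.\<close>

lemma Poincare_H01:
  obtains C where "C > 0" "\<And>u. u \<in> H01 U \<Longrightarrow> (Lq_norm 2 U u)\<^sup>2 \<le> C * (gnorm u)\<^sup>2"
proof -
  define n where "n = real DIM('a)"
  have n: "n \<ge> 1" by (simp add: n_def)
  define q where "q = 2 + 1 / n"
  have q: "q > 2" "real DIM('a) * (q - 2) < 2 * q" using n by (auto simp: q_def n_def[symmetric] field_simps)
  obtain C where C: "C > 0" "\<And>u. u \<in> H01 U \<Longrightarrow> integrable (lebesgue_on U) (\<lambda>x. \<bar>u x\<bar> powr q)"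
    "\<And>u. u \<in> H01 U \<Longrightarrow> (\<integral>x. \<bar>u x\<bar> powr q \<partial>lebesgue_on U) \<le> C * gnorm u powr q"
    using Sobolev_H01[OF q] by blast
  define m where "m = measure (lebesgue_on U) U"
  have m: "m \<ge> 0" by (simp add: m_def)
  interpret finite_measure "lebesgue_on U" by (rule finite_measure_U)
  have "(Lq_norm 2 U u)\<^sup>2 \<le> (m + C + 1) * (gnorm u)\<^sup>2" if u: "u \<in> H01 U" for u
  proof -
    have iu: "integrable (lebesgue_on U) (\<lambda>x. (u x)\<^sup>2)" using H01_Lq_2[OF u] by (simp add: Lq_2_iff)
    have main: "(Lq_norm 2 U u)\<^sup>2 \<le> m * l\<^sup>2 + l powr (2 - q) * (C * gnorm u powr q)" if l: "l > 0" for l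
    proof -
      have "(Lq_norm 2 U u)\<^sup>2 = (\<integral>x. (u x)\<^sup>2 \<partial>lebesgue_on U)" by (simp add: Lq_norm_2_sq_integral)
      also have "\<dots> \<le> (\<integral>x. l\<^sup>2 + l powr (2 - q) * \<bar>u x\<bar> powr q \<partial>lebesgue_on U)"
      proof (rule integral_mono)
        show "integrable (lebesgue_on U) (\<lambda>x. l\<^sup>2 + l powr (2 - q) * \<bar>u x\<bar> powr q)"
          using C(2)[OF u] by simp
        show "(u x)\<^sup>2 \<le> l\<^sup>2 + l powr (2 - q) * \<bar>u x\<bar> powr q" for x
        proof (cases "\<bar>u x\<bar> \<le> l")
          case True
          then have "(u x)\<^sup>2 \<le> l\<^sup>2" by (simp add: abs_le_square_iff[symmetric])
          then show ?thesis by (simp add: add_increasing2)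
        next
          case False
          have "(u x)\<^sup>2 = \<bar>u x\<bar> powr (2 - q) * \<bar>u x\<bar> powr q"
            using False l by (simp flip: powr_add)
          also have "\<dots> \<le> l powr (2 - q) * \<bar>u x\<bar> powr q"
            using False l q by (intro mult_right_mono powr_mono2') auto
          finally show ?thesis by (simp add: add_increasing)
        qed
      qed (rule iu)
      also have "\<dots> = m * l\<^sup>2 + l powr (2 - q) * (\<integral>x. \<bar>u x\<bar> powr q \<partial>lebesgue_on U)"
        using C(2)[OF u] by (simp add: m_def)
      also have "\<dots> \<le> m * l\<^sup>2 + l powr (2 - q) * (C * gnorm u powr q)"
        using C(3)[OF u] by (intro add_left_mono mult_left_mono) auto
      finally show ?thesis .
    qed
    show ?thesis
    proof (cases "gnorm u = 0")
      case True
      have "(Lq_norm 2 U u)\<^sup>2 \<le> m * l\<^sup>2" if "l > 0" for l using main[OF that] True by simp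
      then have "eventually (\<lambda>l. (Lq_norm 2 U u)\<^sup>2 \<le> m * l\<^sup>2) (at_right 0)"
        by (rule eventually_mono[OF eventually_at_right_less])
      moreover have "((\<lambda>l. m * l\<^sup>2) \<longlongrightarrow> m * 0\<^sup>2) (at_right 0)" by (intro tendsto_intros)
      ultimately have "(Lq_norm 2 U u)\<^sup>2 \<le> m * 0\<^sup>2" by (intro tendsto_lowerbound) auto
      then show ?thesis using True by simp
    next
      case False
      then have g: "gnorm u > 0" by (simp add: less_le)
      have "gnorm u powr (2 - q) * gnorm u powr q = (gnorm u)\<^sup>2" using g by (simp flip: powr_add)
      then have "(Lq_norm 2 U u)\<^sup>2 \<le> m * (gnorm u)\<^sup>2 + C * (gnorm u)\<^sup>2"
        using main[OF g] by (simp add: mult_ac)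
      also have "\<dots> \<le> m * (gnorm u)\<^sup>2 + C * (gnorm u)\<^sup>2 + (gnorm u)\<^sup>2" by simp
      finally show ?thesis by (simp add: algebra_simps)
    qed
  qed
  moreover have "m + C + 1 > 0" using m C(1) by simp
  ultimately show thesis by (intro that[of "m + C + 1"])
qed

end

section \<open>The logarithmic nonlinearity\<close>

definition log_src :: "real \<Rightarrow> real \<Rightarrow> real" where
  "log_src p s = s * \<bar>s\<bar> powr (p - 1) * ln \<bar>s\<bar>"

text \<open>The even primitive of \<open>log_src\<close> vanishing at 0: J is half the Dirichlet
  energy minus the integral of \<open>log_prim p (u x)\<close>.\<close>

definition log_prim :: "real \<Rightarrow> real \<Rightarrow> real" where
  "log_prim p s = \<bar>s\<bar> powr (p + 1) * ln \<bar>s\<bar> / (p + 1) - \<bar>s\<bar> powr (p + 1) / (p + 1)\<^sup>2"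

lemma log_src_minus: "log_src p (- s) = - log_src p s"
  by (simp add: log_src_def)

lemma log_prim_minus: "log_prim p (- s) = log_prim p s"
  by (simp add: log_prim_def)

lemma abs_powr_plus_1:
  fixes s p :: real
  assumes "s \<noteq> 0" shows "\<bar>s\<bar> powr (p + 1) = \<bar>s\<bar> powr (p - 1) * s\<^sup>2"
proof -
  have "\<bar>s\<bar> powr (p + 1) = \<bar>s\<bar> powr (p - 1) * \<bar>s\<bar> powr 2" by (simp only: powr_add[symmetric]) (simp add: add.commute)
  then show ?thesis by simp
qed

lemma mult_log_src: "s * log_src p s = \<bar>s\<bar> powr (p + 1) * ln \<bar>s\<bar>"
proof (cases "s = 0")
  case False
  then show ?thesis by (simp add: log_src_def abs_powr_plus_1 power2_eq_square)
qed simp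

text \<open>Both halves use ln x \<le> x^e / e: for s \<ge> 1 with e = r - a, and for s < 1 applied
  to 1/s with e = a.\<close>

lemma powr_abs_ln_le:
  fixes s a r :: real
  assumes "0 < a" "a < r" "0 \<le> s"
  shows "s powr a * \<bar>ln s\<bar> \<le> (1 / a + 1 / (r - a)) * (1 + s powr r)"
proof (cases "s = 0")
  case True
  then show ?thesis using assms by (simp add: add_nonneg_nonneg)
next
  case False
  then have s: "s > 0" using assms by simp
  show ?thesis
  proof (cases "s \<ge> 1")
    case True
    have "ln s \<le> s powr (r - a) / (r - a)" using True assms by (intro ln_powr_bound) auto
    then have "s powr a * \<bar>ln s\<bar> \<le> s powr a * (s powr (r - a) / (r - a))"
      using True by (intro mult_left_mono) auto
    also have "\<dots> = 1 / (r - a) * s powr r" using s by (simp flip: powr_add)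
    also have "\<dots> \<le> (1 / a + 1 / (r - a)) * (1 + s powr r)"
      using assms by (intro mult_mono) auto
    finally show ?thesis .
  next
    case False
    have "ln (1 / s) \<le> (1 / s) powr a / a" using False s assms by (intro ln_powr_bound) auto
    then have "s powr a * \<bar>ln s\<bar> \<le> s powr a * ((1 / s) powr a / a)"
      using False s by (intro mult_left_mono) (auto simp: ln_div)
    also have "\<dots> = 1 / a" using s by (simp add: powr_divide)
    also have "\<dots> \<le> (1 / a + 1 / (r - a)) * (1 + s powr r)"
      using assms mult_mono[of "1 / a" "1 / a + 1 / (r - a)" 1 "1 + s powr r"] by simp
    finally show ?thesis .
  qed
qed

lemma powr_le_1_plus_powr:
  fixes s a r :: real
  assumes "0 \<le> a" "a \<le> r" "0 \<le> s"
  shows "s powr a \<le> 1 + s powr r"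
proof (cases "s \<ge> 1")
  case True
  then show ?thesis using assms powr_mono[of a r s] by simp
next
  case False
  then have "s powr a \<le> 1" using assms powr_le1[of a s] by simp
  then show ?thesis by (simp add: add_increasing2)
qed

text \<open>The gap between p - 1 and r pays for the logarithm: all bounds on the source below carry
  the pure power weight 1 + |s|^r.\<close>

locale log_exponents =
  fixes p r :: real
  assumes p: "1 < p" and r: "p - 1 < r"
begin

definition cf :: real where "cf = 1 / (p - 1) + 1 / (r - (p - 1))"

lemma cf_pos: "cf > 0"
  using p r by (simp add: cf_def add_pos_pos)

lemma abs_log_src_le: "\<bar>log_src p s\<bar> \<le> cf * (1 + \<bar>s\<bar> powr r) * \<bar>s\<bar>"
  using mult_right_mono[OF powr_abs_ln_le[of "p - 1" r "\<bar>s\<bar>"], of "\<bar>s\<bar>"] p r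
  by (simp add: log_src_def cf_def abs_mult mult_ac)

lemma abs_powr_ln_le: "\<bar>\<bar>s\<bar> powr (p + 1) * ln \<bar>s\<bar>\<bar> \<le> cf * (1 + \<bar>s\<bar> powr r) * s\<^sup>2"
proof -
  have "\<bar>\<bar>s\<bar> powr (p + 1) * ln \<bar>s\<bar>\<bar> = \<bar>s\<bar> * \<bar>log_src p s\<bar>"
    by (simp only: mult_log_src[symmetric] abs_mult)
  also have "\<dots> \<le> \<bar>s\<bar> * (cf * (1 + \<bar>s\<bar> powr r) * \<bar>s\<bar>)"
    by (intro mult_left_mono abs_log_src_le) simp
  also have "\<dots> = cf * (1 + \<bar>s\<bar> powr r) * \<bar>s\<bar>\<^sup>2" by (simp only: power2_eq_square mult_ac)
  finally show ?thesis by simp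
qed

lemma abs_powr_le: "\<bar>s\<bar> powr (p + 1) \<le> (1 + \<bar>s\<bar> powr r) * s\<^sup>2"
proof (cases "s = 0")
  case False
  then have "\<bar>s\<bar> powr (p + 1) = \<bar>s\<bar> powr (p - 1) * s\<^sup>2" by (rule abs_powr_plus_1)
  also have "\<bar>s\<bar> powr (p - 1) * s\<^sup>2 \<le> (1 + \<bar>s\<bar> powr r) * s\<^sup>2"
    using powr_le_1_plus_powr[of "p - 1" r "\<bar>s\<bar>"] p r by (intro mult_right_mono) auto
  finally show ?thesis .
qed simp

lemma abs_log_prim_le: "\<bar>log_prim p s\<bar> \<le> (cf + 1) * (1 + \<bar>s\<bar> powr r) * s\<^sup>2"
proof -
  have "\<bar>log_prim p s\<bar> \<le> \<bar>\<bar>s\<bar> powr (p + 1) * ln \<bar>s\<bar> / (p + 1)\<bar> + \<bar>\<bar>s\<bar> powr (p + 1) / (p + 1)\<^sup>2\<bar>"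
    unfolding log_prim_def by (rule abs_triangle_ineq4)
  also have "\<bar>\<bar>s\<bar> powr (p + 1) * ln \<bar>s\<bar> / (p + 1)\<bar> \<le> \<bar>\<bar>s\<bar> powr (p + 1) * ln \<bar>s\<bar>\<bar>"
    using p divide_left_mono[of 1 "p + 1" "\<bar>\<bar>s\<bar> powr (p + 1) * ln \<bar>s\<bar>\<bar>"] by simp
  also have "\<bar>\<bar>s\<bar> powr (p + 1) / (p + 1)\<^sup>2\<bar> \<le> \<bar>s\<bar> powr (p + 1)"
    using p divide_left_mono[of 1 "(p + 1)\<^sup>2" "\<bar>s\<bar> powr (p + 1)"] by (simp add: one_le_power)
  finally show ?thesis using abs_powr_ln_le[of s] abs_powr_le[of s] by (simp add: algebra_simps)
qed

lemma log_src_pos_Lipschitz: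
  assumes "0 < a" "a < b"
  shows "\<bar>log_src p b - log_src p a\<bar> \<le> (p * cf + 1) * (1 + b powr r) * (b - a)"
proof -
  let ?f' = "\<lambda>s. s powr (p - 1) * (p * ln s + 1)"
  have eq: "log_src p s = s powr p * ln s" if "s > 0" for s
    using that powr_add[of s 1 "p - 1"] by (simp add: log_src_def)
  have d: "((\<lambda>s. s powr p * ln s) has_real_derivative ?f' s) (at s)" if "a \<le> s" for s
  proof -
    have "s powr p / s = s powr (p - 1)" using that assms by (simp add: powr_diff)
    then show ?thesis using that assms by (auto intro!: derivative_eq_intros simp: algebra_simps)
  qed
  obtain z where z: "a < z" "z < b" "b powr p * ln b - a powr p * ln a = (b - a) * ?f' z"
    using MVT2[OF assms(2) d] by auto
  have "\<bar>?f' z\<bar> \<le> p * (z powr (p - 1) * \<bar>ln z\<bar>) + z powr (p - 1)"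
  proof -
    have "\<bar>p * ln z + 1\<bar> \<le> p * \<bar>ln z\<bar> + 1"
      using p abs_triangle_ineq[of "p * ln z" 1] by (simp add: abs_mult)
    then have "z powr (p - 1) * \<bar>p * ln z + 1\<bar> \<le> z powr (p - 1) * (p * \<bar>ln z\<bar> + 1)"
      by (rule mult_left_mono) simp
    moreover have "\<bar>?f' z\<bar> = z powr (p - 1) * \<bar>p * ln z + 1\<bar>" by (simp add: abs_mult)
    ultimately show ?thesis by (simp add: distrib_left mult_ac)
  qed
  also have "\<dots> \<le> p * (cf * (1 + z powr r)) + (1 + z powr r)"
    using p r z assms powr_abs_ln_le[of "p - 1" r z] powr_le_1_plus_powr[of "p - 1" r z]
    unfolding cf_def by (intro add_mono mult_left_mono) auto
  also have "\<dots> = (p * cf + 1) * (1 + z powr r)" by (simp add: algebra_simps)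
  also have "\<dots> \<le> (p * cf + 1) * (1 + b powr r)"
    using p r z assms cf_pos by (intro mult_left_mono add_left_mono powr_mono2) auto
  finally have "\<bar>?f' z\<bar> * (b - a) \<le> (p * cf + 1) * (1 + b powr r) * (b - a)"
    using assms by (intro mult_right_mono) auto
  then show ?thesis using z(3) assms eq[of a] eq[of b] by (simp add: abs_mult mult.commute)
qed

definition cL :: real where "cL = 4 * (p * cf + cf + 1)"

lemma cL: "cL > 0" "cf \<le> cL" "p * cf + 1 \<le> cL"
  using cf_pos p by (auto simp: cL_def add_pos_pos)

lemma weight_ge: "0 \<le> 1 + \<bar>a\<bar> powr r + \<bar>b\<bar> powr r"
  by (simp add: add_nonneg_nonneg)

text \<open>For equal signs this is the mean value theorem. For opposite signs |a - b| = |a| + |b|,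
  so the growth bound for each value suffices and the derivative is never examined at 0.\<close>

lemma log_src_Lipschitz:
  "\<bar>log_src p a - log_src p b\<bar> \<le> cL * (1 + \<bar>a\<bar> powr r + \<bar>b\<bar> powr r) * \<bar>a - b\<bar>"
proof -
  have pos: "\<bar>log_src p a - log_src p b\<bar> \<le> cL * (1 + \<bar>a\<bar> powr r + \<bar>b\<bar> powr r) * \<bar>a - b\<bar>"
    if "0 < a" "a < b" for a b
  proof -
    have "\<bar>log_src p b - log_src p a\<bar> \<le> (p * cf + 1) * (1 + b powr r) * (b - a)"
      by (rule log_src_pos_Lipschitz[OF that])
    also have "\<dots> \<le> cL * (1 + \<bar>a\<bar> powr r + \<bar>b\<bar> powr r) * (b - a)"
      using that cL by (intro mult_right_mono mult_mono) auto
    finally show ?thesis using that by (simp add: abs_minus_commute)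
  qed
  have pos': "\<bar>log_src p a - log_src p b\<bar> \<le> cL * (1 + \<bar>a\<bar> powr r + \<bar>b\<bar> powr r) * \<bar>a - b\<bar>"
    if "0 < a" "0 < b" for a b
    using pos[of a b] pos[of b a] that
    by (cases a b rule: linorder_cases) (auto simp: abs_minus_commute add_ac)
  consider "0 < a \<and> 0 < b" | "a < 0 \<and> b < 0" | "a * b \<le> 0"
    by (metis linorder_not_less mult_nonneg_nonpos mult_nonpos_nonneg not_less_iff_gr_or_eq order_le_less)
  then show ?thesis
  proof cases
    case 1
    then show ?thesis using pos'[of a b] by blast
  next
    case 2
    then show ?thesis using pos'[of "- a" "- b"] by (simp add: log_src_minus abs_minus_commute)
  next
    case 3
    then have ab: "\<bar>a - b\<bar> = \<bar>a\<bar> + \<bar>b\<bar>" by (auto simp: mult_le_0_iff)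
    have "\<bar>log_src p a - log_src p b\<bar> \<le> \<bar>log_src p a\<bar> + \<bar>log_src p b\<bar>" by (rule abs_triangle_ineq4)
    also have "\<dots> \<le> cf * (1 + \<bar>a\<bar> powr r) * \<bar>a\<bar> + cf * (1 + \<bar>b\<bar> powr r) * \<bar>b\<bar>"
      by (intro add_mono abs_log_src_le)
    also have "\<dots> \<le> cL * (1 + \<bar>a\<bar> powr r + \<bar>b\<bar> powr r) * \<bar>a\<bar> + cL * (1 + \<bar>a\<bar> powr r + \<bar>b\<bar> powr r) * \<bar>b\<bar>"
    proof -
      have "cf * (1 + \<bar>a\<bar> powr r) \<le> cL * (1 + \<bar>a\<bar> powr r + \<bar>b\<bar> powr r)"
        "cf * (1 + \<bar>b\<bar> powr r) \<le> cL * (1 + \<bar>a\<bar> powr r + \<bar>b\<bar> powr r)"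
        using cL by (intro mult_mono; simp)+
      then show ?thesis by (intro add_mono mult_right_mono) auto
    qed
    finally show ?thesis by (simp add: ab distrib_left)
  qed
qed

text \<open>One summand serves equal signs, where the weight at the intermediate point costs a
  factor 2; the other serves opposite signs, where three terms are bounded separately.\<close>

definition cT :: real where "cT = 2 * cL + 3 * (cf + 1)"

lemma cT: "cT > 0" "2 * cL \<le> cT" "3 * (cf + 1) \<le> cT"
  using cf_pos cL by (auto simp: cT_def)

text \<open>For equal signs the mean value theorem turns the remainder into (f(z) - f(b)) (b - a)
  with f = \<open>log_src p\<close>, and f is Lipschitz with weight. For opposite signs |a| and |b|
  are at most |b - a|, so each of the three terms is quadratic by itself.\<close>

lemma log_prim_Taylor:
  "\<bar>log_prim p b - log_prim p a - log_src p b * (b - a)\<bar> \<le> cT * (1 + \<bar>a\<bar> powr r + \<bar>b\<bar> powr r) * (b - a)\<^sup>2"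
proof -
  have pos: "\<bar>log_prim p b - log_prim p a - log_src p b * (b - a)\<bar> \<le> cT * (1 + \<bar>a\<bar> powr r + \<bar>b\<bar> powr r) * (b - a)\<^sup>2"
    if ab: "0 < a" "0 < b" for a b
  proof -
    have d: "(log_prim p has_real_derivative log_src p s) (at s)" if "s > 0" for s
    proof -
      have "((\<lambda>s. s powr (p + 1) * ln s / (p + 1) - s powr (p + 1) / (p + 1)\<^sup>2) has_real_derivative
          (s powr (p + 1) / s + (p + 1) * s powr p * ln s) / (p + 1) - (p + 1) * s powr p / (p + 1)\<^sup>2) (at s)"
        using that p by (intro DERIV_diff DERIV_cdivide) (auto intro!: derivative_eq_intros)
      moreover have "(s powr (p + 1) / s + (p + 1) * s powr p * ln s) / (p + 1) - (p + 1) * s powr p / (p + 1)\<^sup>2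
          = log_src p s"
      proof -
        have 1: "s powr (p + 1) / s = s powr p" using that by (simp add: powr_add)
        have 2: "log_src p s = s powr p * ln s" using that powr_add[of s 1 "p - 1"] by (simp add: log_src_def)
        show ?thesis unfolding 1 2 using p by (simp add: divide_simps power2_eq_square)
      qed
      ultimately have "((\<lambda>s. s powr (p + 1) * ln s / (p + 1) - s powr (p + 1) / (p + 1)\<^sup>2) has_real_derivative log_src p s) (at s)"
        by simp
      then show ?thesis
        by (rule has_field_derivative_transform_within_open[where S="{0<..}"]) (use that in \<open>auto simp: log_prim_def\<close>)
    qed
    \<comment> \<open>The intermediate point is recorded through its distance to b and its weight,
      so that both orders of a and b can be treated alike.\<close>
    obtain z where z: "log_prim p b - log_prim p a = (b - a) * log_src p z" "\<bar>z - b\<bar> \<le> \<bar>b - a\<bar>"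
      "\<bar>z\<bar> powr r \<le> \<bar>a\<bar> powr r \<or> \<bar>z\<bar> powr r \<le> \<bar>b\<bar> powr r"
    proof (cases a b rule: linorder_cases)
      case less
      then obtain z where "a < z" "z < b" "log_prim p b - log_prim p a = (b - a) * log_src p z"
        using MVT2[OF less, of "log_prim p" "log_src p"] d ab by force
      then show thesis using ab r p by (intro that[of z]) (auto intro!: powr_mono2)
    next
      case equal
      then show thesis by (intro that[of b]) auto
    next
      case greater
      then obtain z where "b < z" "z < a" "log_prim p a - log_prim p b = (a - b) * log_src p z"
        using MVT2[OF greater, of "log_prim p" "log_src p"] d ab by force
      then show thesis using ab r p by (intro that[of z]) (auto intro!: powr_mono2 simp: algebra_simps)
    qed
    have w: "1 + \<bar>z\<bar> powr r + \<bar>b\<bar> powr r \<le> 2 * (1 + \<bar>a\<bar> powr r + \<bar>b\<bar> powr r)"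
    proof -
      have "0 \<le> \<bar>a\<bar> powr r" "0 \<le> \<bar>b\<bar> powr r" by simp_all
      with z(3) show ?thesis by argo
    qed
    have w2: "cL * (1 + \<bar>z\<bar> powr r + \<bar>b\<bar> powr r) * \<bar>z - b\<bar> \<le> (2 * cL) * (1 + \<bar>a\<bar> powr r + \<bar>b\<bar> powr r) * \<bar>b - a\<bar>"
    proof -
      have "cL * (1 + \<bar>z\<bar> powr r + \<bar>b\<bar> powr r) * \<bar>z - b\<bar> \<le> cL * (2 * (1 + \<bar>a\<bar> powr r + \<bar>b\<bar> powr r)) * \<bar>b - a\<bar>"
        using weight_ge[of a b] cL(1) by (intro mult_mono[OF mult_left_mono[OF w] z(2)]) auto
      then show ?thesis by (simp only: mult_ac)
    qed
    have "log_prim p b - log_prim p a - log_src p b * (b - a) = (log_src p z - log_src p b) * (b - a)"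
      using z(1) by (simp add: algebra_simps)
    then have "\<bar>log_prim p b - log_prim p a - log_src p b * (b - a)\<bar> = \<bar>log_src p z - log_src p b\<bar> * \<bar>b - a\<bar>"
      by (simp add: abs_mult)
    also have "\<dots> \<le> (2 * cL) * (1 + \<bar>a\<bar> powr r + \<bar>b\<bar> powr r) * \<bar>b - a\<bar> * \<bar>b - a\<bar>"
      using order_trans[OF log_src_Lipschitz w2] by (intro mult_right_mono) auto
    also have "\<dots> = (2 * cL) * ((1 + \<bar>a\<bar> powr r + \<bar>b\<bar> powr r) * (b - a)\<^sup>2)"
      by (simp add: power2_eq_square mult.assoc)
    also have "\<dots> \<le> cT * ((1 + \<bar>a\<bar> powr r + \<bar>b\<bar> powr r) * (b - a)\<^sup>2)"
      using cT weight_ge[of a b] by (intro mult_right_mono) auto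
    finally show ?thesis by (simp add: mult.assoc)
  qed
  consider "0 < a \<and> 0 < b" | "a < 0 \<and> b < 0" | "a * b \<le> 0"
    by (metis linorder_not_less mult_nonneg_nonpos mult_nonpos_nonneg not_less_iff_gr_or_eq order_le_less)
  then show ?thesis
  proof cases
    case 1
    then show ?thesis using pos[of a b] by blast
  next
    case 2
    have "log_src p (- b) * (- b - - a) = log_src p b * (b - a)" "(- b - - a)\<^sup>2 = (b - a)\<^sup>2"
      unfolding log_src_minus by (simp_all add: algebra_simps power2_commute)
    then show ?thesis using pos[of "- a" "- b"] 2 unfolding log_prim_minus abs_minus_cancel by simp
  next
    case 3
    define W where "W = 1 + \<bar>a\<bar> powr r + \<bar>b\<bar> powr r"
    define d where "d = \<bar>b - a\<bar>"
    have d: "\<bar>a\<bar> \<le> d" "\<bar>b\<bar> \<le> d" "d\<^sup>2 = (b - a)\<^sup>2" using 3 by (auto simp: mult_le_0_iff d_def)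
    then have sq: "a\<^sup>2 \<le> d\<^sup>2" "b\<^sup>2 \<le> d\<^sup>2" by (auto simp: abs_le_square_iff[symmetric] d_def)
    have W: "1 + \<bar>a\<bar> powr r \<le> W" "1 + \<bar>b\<bar> powr r \<le> W" "0 \<le> W"
      using weight_ge by (auto simp: W_def)
    have "\<bar>log_prim p a\<bar> \<le> (cf + 1) * (1 + \<bar>a\<bar> powr r) * a\<^sup>2" by (rule abs_log_prim_le)
    also have "\<dots> \<le> (cf + 1) * W * d\<^sup>2"
      using cf_pos W sq by (intro mult_mono mult_left_mono) auto
    finally have a: "\<bar>log_prim p a\<bar> \<le> (cf + 1) * W * d\<^sup>2" .
    have "\<bar>log_prim p b\<bar> \<le> (cf + 1) * (1 + \<bar>b\<bar> powr r) * b\<^sup>2" by (rule abs_log_prim_le)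
    also have "\<dots> \<le> (cf + 1) * W * d\<^sup>2"
      using cf_pos W sq by (intro mult_mono mult_left_mono) auto
    finally have b: "\<bar>log_prim p b\<bar> \<le> (cf + 1) * W * d\<^sup>2" .
    have "\<bar>log_src p b * (b - a)\<bar> \<le> cf * (1 + \<bar>b\<bar> powr r) * \<bar>b\<bar> * d"
      unfolding abs_mult d_def by (intro mult_right_mono abs_log_src_le) simp
    also have "\<dots> \<le> (cf + 1) * W * d * d"
      using cf_pos W d by (intro mult_right_mono mult_mono) auto
    finally have c: "\<bar>log_src p b * (b - a)\<bar> \<le> (cf + 1) * W * d\<^sup>2" by (simp add: power2_eq_square mult.assoc)
    have "\<bar>log_prim p b - log_prim p a - log_src p b * (b - a)\<bar> \<le> 3 * ((cf + 1) * W * d\<^sup>2)"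
      using a b c by linarith
    also have "\<dots> = (3 * (cf + 1)) * (W * d\<^sup>2)" by simp
    also have "\<dots> \<le> cT * (W * d\<^sup>2)" using cT W by (intro mult_right_mono) auto
    finally show ?thesis by (simp add: W_def d(3) mult.assoc)
  qed
qed

end

section \<open>The functionals \<open>I\<close> and \<open>J\<close>\<close>

text \<open>If a \<le> K, then K^r is an admissible constant. If a > K, the larger number m of the
  two exceeds K, and m^(r + 2) = m^(-e) m^q with m^(-e) \<le> K^(-e) \<le> \<eta>; K is chosen for
  the last inequality. The room e > 0 is what makes \<eta> arbitrary.\<close>

lemma powr_mult_sq_le:
  fixes r q \<eta> :: real
  assumes r: "0 \<le> r" "r + 2 < q" and \<eta>: "\<eta> > 0"
  obtains C where "C \<ge> 0" "\<And>a b. 0 \<le> a \<Longrightarrow> 0 \<le> b \<Longrightarrow> a powr r * b\<^sup>2 \<le> \<eta> * (a powr q + b powr q) + C * b\<^sup>2"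
proof -
  define e where "e = q - (r + 2)"
  have e: "e > 0" using r by (simp add: e_def)
  define K where "K = max 1 (\<eta> powr (- 1 / e))"
  have K: "K \<ge> 1" "K powr (- e) \<le> \<eta>"
  proof -
    have "K powr (- e) \<le> (\<eta> powr (- 1 / e)) powr (- e)"
      using \<eta> e by (intro powr_mono2') (auto simp: K_def)
    also have "\<dots> = \<eta>" using \<eta> e by (simp add: powr_powr)
    finally show "K powr (- e) \<le> \<eta>" .
  qed (simp add: K_def)
  have "a powr r * b\<^sup>2 \<le> \<eta> * (a powr q + b powr q) + K powr r * b\<^sup>2" if ab: "0 \<le> a" "0 \<le> b" for a b
  proof (cases "a \<le> K")
    case True
    then have "a powr r * b\<^sup>2 \<le> K powr r * b\<^sup>2" using ab r by (intro mult_right_mono powr_mono2) auto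
    then show ?thesis using \<eta> by (simp add: add_increasing)
  next
    case False
    define m where "m = max a b"
    have m: "m > K" "m > 0" using False K by (auto simp: m_def)
    have "a powr r * b\<^sup>2 \<le> m powr r * m\<^sup>2"
      using ab r by (intro mult_mono powr_mono2 power_mono) (auto simp: m_def)
    also have "\<dots> = m powr r * m powr 2" using m by simp
    also have "\<dots> = m powr (- e) * m powr q" by (simp only: powr_add[symmetric]) (simp add: e_def)
    also have "\<dots> \<le> K powr (- e) * m powr q"
      using m e K by (intro mult_right_mono powr_mono2') auto
    also have "\<dots> \<le> \<eta> * m powr q" using K by (intro mult_right_mono) auto
    also have "\<dots> \<le> \<eta> * (a powr q + b powr q)"
      using \<eta> by (intro mult_left_mono) (auto simp: m_def max_def)
    finally show ?thesis by (simp add: add_increasing2)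
  qed
  then show thesis by (intro that[of "K powr r"]) auto
qed

lemma weighted_Young:
  fixes a b d e :: real
  assumes e: "e > 0"
  shows "(\<bar>a\<bar> + \<bar>b\<bar>) * \<bar>d\<bar> \<le> e * (a\<^sup>2 + b\<^sup>2) + 1 / (2 * e) * d\<^sup>2"
proof -
  define m where "m = \<bar>a\<bar> + \<bar>b\<bar>"
  have "m\<^sup>2 \<le> 2 * (a\<^sup>2 + b\<^sup>2)"
    using sum_squares_bound[of "\<bar>a\<bar>" "\<bar>b\<bar>"] by (simp add: m_def power2_sum)
  then have "e\<^sup>2 * m\<^sup>2 \<le> e\<^sup>2 * (2 * (a\<^sup>2 + b\<^sup>2))" by (intro mult_left_mono) auto
  moreover have "2 * (e * m) * \<bar>d\<bar> \<le> (e * m)\<^sup>2 + \<bar>d\<bar>\<^sup>2" by (rule sum_squares_bound)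
  ultimately have "2 * (e * m) * \<bar>d\<bar> \<le> e\<^sup>2 * (2 * (a\<^sup>2 + b\<^sup>2)) + d\<^sup>2" by (simp add: power_mult_distrib)
  then have "2 * (e * m) * \<bar>d\<bar> / (2 * e) \<le> (e\<^sup>2 * (2 * (a\<^sup>2 + b\<^sup>2)) + d\<^sup>2) / (2 * e)"
    using e by (intro divide_right_mono) auto
  also have "2 * (e * m) * \<bar>d\<bar> / (2 * e) = m * \<bar>d\<bar>" using e by simp
  also have "(e\<^sup>2 * (2 * (a\<^sup>2 + b\<^sup>2)) + d\<^sup>2) / (2 * e) = e * (a\<^sup>2 + b\<^sup>2) + 1 / (2 * e) * d\<^sup>2"
    using e by (simp add: add_divide_distrib power2_eq_square[of e])
  finally show ?thesis by (simp add: m_def)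
qed

text \<open>The exponent q lies strictly between p + 1 and the critical Sobolev exponent. Below, r +
  2 is the midpoint of p + 1 and q: the lower half of the gap absorbs the logarithm, the upper half
  yields the small constant \<eta>.\<close>

locale log_heat = bounded_open U for U :: "'a::euclidean_space set" +
  fixes p q :: real
  assumes p1: "1 < p" and pq: "p + 1 < q" and qn: "real DIM('a) * (q - 2) < 2 * q"
begin

definition r :: real where "r = (p + 1 + q) / 2 - 2"

lemma r_bounds: "p - 1 < r" "0 \<le> r" "r + 2 < q" "2 < q"
  using p1 pq by (auto simp: r_def)

sublocale log_exponents p r
  using p1 r_bounds by unfold_locales auto

text \<open>The common weight of the growth, Lipschitz and Taylor bounds; the integral estimates for
  the nonlinearity reduce to integrals of \<open>wt u v x * (w x)\<^sup>2\<close>.\<close>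

definition wt :: "('a \<Rightarrow> real) \<Rightarrow> ('a \<Rightarrow> real) \<Rightarrow> 'a \<Rightarrow> real" where
  "wt u v x = 1 + \<bar>u x\<bar> powr r + \<bar>v x\<bar> powr r"

lemma wt_nonneg: "0 \<le> wt u v x"
  by (simp add: wt_def weight_ge)

lemma wt_ge: "1 + \<bar>u x\<bar> powr r \<le> wt u v x" "1 + \<bar>v x\<bar> powr r \<le> wt u v x"
  by (simp_all add: wt_def)

lemma le_wt:
  assumes "a \<le> c * (1 + \<bar>u x\<bar> powr r) * b" "0 \<le> c" "0 \<le> b"
  shows "a \<le> c * (wt u v x * b)"
proof -
  have "c * ((1 + \<bar>u x\<bar> powr r) * b) \<le> c * (wt u v x * b)"
    using assms wt_ge(1)[of u x v] by (intro mult_left_mono mult_right_mono) auto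
  then show ?thesis using assms(1) by (simp add: mult.assoc)
qed

lemma H01_measurable: "u \<in> H01 U \<Longrightarrow> u \<in> borel_measurable (lebesgue_on U)"
  by (intro Lq_2_measurable H01_Lq_2)

lemma wt_measurable:
  "u \<in> H01 U \<Longrightarrow> v \<in> H01 U \<Longrightarrow> wt u v \<in> borel_measurable (lebesgue_on U)"
  using H01_measurable[of u] H01_measurable[of v] unfolding wt_def[abs_def] by simp

lemma gnorm_eq_0_AE:
  assumes "w \<in> H01 U" "gnorm w = 0" shows "AE x in lebesgue_on U. w x = 0"
proof -
  obtain C where "\<And>u. u \<in> H01 U \<Longrightarrow> (Lq_norm 2 U u)\<^sup>2 \<le> C * (gnorm u)\<^sup>2"
    using Poincare_H01 by blast
  then have "(Lq_norm 2 U w)\<^sup>2 \<le> C * 0\<^sup>2" using assms by metis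
  then have "Lq_norm 2 U w = 0" by simp
  then show ?thesis using Lq_norm_2_eq_0_iff[OF H01_Lq_2[OF assms(1)]] by simp
qed

text \<open>The splitting \<open>powr_mult_sq_le\<close> is applied to |u| and |w| / l and
  multiplied by l^2. For l = ||grad w|| the Sobolev inequality makes all q-th powers contribute
  multiples of l^2. If the gradient of w vanishes, so does w, by Poincare.\<close>

lemma weighted_integral_le:
  assumes M: "M \<ge> 0" and \<eta>: "\<eta> > 0"
  obtains C where "C \<ge> 0"
    "\<And>u v w. u \<in> H01 U \<Longrightarrow> v \<in> H01 U \<Longrightarrow> w \<in> H01 U \<Longrightarrow> gnorm u \<le> M \<Longrightarrow> gnorm v \<le> M \<Longrightarrow>
      (\<integral>x. wt u v x * (w x)\<^sup>2 \<partial>lebesgue_on U) \<le> \<eta> * (gnorm w)\<^sup>2 + C * (Lq_norm 2 U w)\<^sup>2"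
    "\<And>u v w. u \<in> H01 U \<Longrightarrow> v \<in> H01 U \<Longrightarrow> w \<in> H01 U \<Longrightarrow> gnorm u \<le> M \<Longrightarrow> gnorm v \<le> M \<Longrightarrow>
      integrable (lebesgue_on U) (\<lambda>x. wt u v x * (w x)\<^sup>2)"
proof -
  obtain S where S: "S > 0" "\<And>u. u \<in> H01 U \<Longrightarrow> integrable (lebesgue_on U) (\<lambda>x. \<bar>u x\<bar> powr q)"
    "\<And>u. u \<in> H01 U \<Longrightarrow> (\<integral>x. \<bar>u x\<bar> powr q \<partial>lebesgue_on U) \<le> S * gnorm u powr q"
    using Sobolev_H01[OF r_bounds(4) qn] by blast
  \<comment> \<open>Sum of the Sobolev bounds: S M^q each from u and v, and 2 S from the rescaled w;
    e is then fixed by e B = \<eta>.\<close>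
  define B where "B = 2 * S * (M powr q + 1)"
  have B: "B > 0" using S by (simp add: B_def add_nonneg_pos)
  define e where "e = \<eta> / B"
  have e: "e > 0" "e * B = \<eta>" using B \<eta> by (auto simp: e_def)
  obtain C where C: "C \<ge> 0"
    "\<And>a b. 0 \<le> a \<Longrightarrow> 0 \<le> b \<Longrightarrow> a powr r * b\<^sup>2 \<le> e * (a powr q + b powr q) + C * b\<^sup>2"
    using powr_mult_sq_le[OF r_bounds(2,3), of e] e by auto
  have point: "wt u v x * (w x)\<^sup>2 \<le> e * (l\<^sup>2 * (\<bar>u x\<bar> powr q + \<bar>v x\<bar> powr q) + 2 * l powr (2 - q) * \<bar>w x\<bar> powr q)
      + (1 + 2 * C) * (w x)\<^sup>2" if l: "l > 0" for l u v w and x :: 'a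
  proof -
    have *: "\<bar>a\<bar> powr r * (w x)\<^sup>2 \<le> e * (l\<^sup>2 * \<bar>a\<bar> powr q + l powr (2 - q) * \<bar>w x\<bar> powr q) + C * (w x)\<^sup>2" for a
    proof -
      have "l\<^sup>2 * (\<bar>a\<bar> powr r * (\<bar>w x\<bar> / l)\<^sup>2) \<le> l\<^sup>2 * (e * (\<bar>a\<bar> powr q + (\<bar>w x\<bar> / l) powr q) + C * (\<bar>w x\<bar> / l)\<^sup>2)"
        using l by (intro mult_left_mono C) auto
      also have "l\<^sup>2 * (\<bar>a\<bar> powr r * (\<bar>w x\<bar> / l)\<^sup>2) = \<bar>a\<bar> powr r * (w x)\<^sup>2"
        using l by (simp add: power_divide)
      also have "l\<^sup>2 * (e * (\<bar>a\<bar> powr q + (\<bar>w x\<bar> / l) powr q) + C * (\<bar>w x\<bar> / l)\<^sup>2)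
          = e * (l\<^sup>2 * \<bar>a\<bar> powr q + (l\<^sup>2 * (\<bar>w x\<bar> / l) powr q)) + C * (l\<^sup>2 * (\<bar>w x\<bar> / l)\<^sup>2)"
        by (simp only: distrib_left mult_ac)
      also have "l\<^sup>2 * (\<bar>w x\<bar> / l)\<^sup>2 = (w x)\<^sup>2" using l by (simp add: power_divide)
      also have "l\<^sup>2 * (\<bar>w x\<bar> / l) powr q = l powr (2 - q) * \<bar>w x\<bar> powr q"
        using l by (simp add: powr_divide powr_diff)
      finally show ?thesis .
    qed
    show ?thesis using *[of "u x"] *[of "v x"] 
      by (simp add: wt_def algebra_simps)
  qed
  have bint: "integrable (lebesgue_on U) (\<lambda>x. e * (l\<^sup>2 * (\<bar>u x\<bar> powr q + \<bar>v x\<bar> powr q) + 2 * l powr (2 - q) * \<bar>w x\<bar> powr q)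
      + (1 + 2 * C) * (w x)\<^sup>2)" if "u \<in> H01 U" "v \<in> H01 U" "w \<in> H01 U" for l u v w
    using S(2)[OF that(1)] S(2)[OF that(2)] S(2)[OF that(3)] H01_Lq_2[OF that(3)]
    by (intro Bochner_Integration.integrable_add integrable_mult_right) (auto simp: Lq_2_iff)
  have int: "integrable (lebesgue_on U) (\<lambda>x. wt u v x * (w x)\<^sup>2)"
    if uvw: "u \<in> H01 U" "v \<in> H01 U" "w \<in> H01 U" for u v w
  proof (rule Bochner_Integration.integrable_bound[OF bint[OF uvw, of 1]])
    show "(\<lambda>x. wt u v x * (w x)\<^sup>2) \<in> borel_measurable (lebesgue_on U)"
      using wt_measurable[OF uvw(1,2)] H01_measurable[OF uvw(3)] by simp
    show "AE x in lebesgue_on U. norm (wt u v x * (w x)\<^sup>2) \<le> norm (e * (1\<^sup>2 * (\<bar>u x\<bar> powr q + \<bar>v x\<bar> powr q)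
        + 2 * 1 powr (2 - q) * \<bar>w x\<bar> powr q) + (1 + 2 * C) * (w x)\<^sup>2)"
    proof (rule always_eventually, rule allI)
      fix x
      show "norm (wt u v x * (w x)\<^sup>2) \<le> norm (e * (1\<^sup>2 * (\<bar>u x\<bar> powr q + \<bar>v x\<bar> powr q)
        + 2 * 1 powr (2 - q) * \<bar>w x\<bar> powr q) + (1 + 2 * C) * (w x)\<^sup>2)"
        using point[of 1 u v x w] wt_nonneg[of u v x] by (simp add: abs_mult)
    qed
  qed
  have "(\<integral>x. wt u v x * (w x)\<^sup>2 \<partial>lebesgue_on U) \<le> \<eta> * (gnorm w)\<^sup>2 + (1 + 2 * C) * (Lq_norm 2 U w)\<^sup>2"
    if uvw: "u \<in> H01 U" "v \<in> H01 U" "w \<in> H01 U" and le: "gnorm u \<le> M" "gnorm v \<le> M" for u v w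
  proof (cases "gnorm w = 0")
    case True
    have "(\<integral>x. wt u v x * (w x)\<^sup>2 \<partial>lebesgue_on U) = (\<integral>x. 0 \<partial>lebesgue_on U)"
      using int[OF uvw] gnorm_eq_0_AE[OF uvw(3) True] by (intro integral_cong_AE) auto
    then show ?thesis using \<eta> C by simp
  next
    case False
    define l where "l = gnorm w"
    have l: "l > 0" using False by (simp add: l_def less_le)
    have iu: "(\<integral>x. \<bar>u x\<bar> powr q \<partial>lebesgue_on U) \<le> S * M powr q" if "u \<in> H01 U" "gnorm u \<le> M" for u
    proof -
      have "S * gnorm u powr q \<le> S * M powr q"
        using S(1) that r_bounds by (intro mult_left_mono powr_mono2) auto
      then show ?thesis using S(3)[OF that(1)] by linarith
    qed
    have "(\<integral>x. wt u v x * (w x)\<^sup>2 \<partial>lebesgue_on U) \<le>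
      (\<integral>x. e * (l\<^sup>2 * (\<bar>u x\<bar> powr q + \<bar>v x\<bar> powr q) + 2 * l powr (2 - q) * \<bar>w x\<bar> powr q)
      + (1 + 2 * C) * (w x)\<^sup>2 \<partial>lebesgue_on U)"
      by (intro integral_mono int bint uvw point l)
    also have "\<dots> = e * (l\<^sup>2 * ((\<integral>x. \<bar>u x\<bar> powr q \<partial>lebesgue_on U) + (\<integral>x. \<bar>v x\<bar> powr q \<partial>lebesgue_on U))
        + 2 * l powr (2 - q) * (\<integral>x. \<bar>w x\<bar> powr q \<partial>lebesgue_on U)) + (1 + 2 * C) * (Lq_norm 2 U w)\<^sup>2"
      using S(2)[OF uvw(1)] S(2)[OF uvw(2)] S(2)[OF uvw(3)] H01_Lq_2[OF uvw(3)]
      by (simp add: Lq_norm_2_sq_integral Lq_2_iff)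
    also have "\<dots> \<le> e * (l\<^sup>2 * (S * M powr q + S * M powr q) + 2 * l powr (2 - q) * (S * l powr q))
        + (1 + 2 * C) * (Lq_norm 2 U w)\<^sup>2"
      using iu[OF uvw(1) le(1)] iu[OF uvw(2) le(2)] S(3)[OF uvw(3)] e l
      by (intro add_right_mono mult_left_mono add_mono) (auto simp: l_def)
    also have "2 * l powr (2 - q) * (S * l powr q) = 2 * S * (l powr (2 - q) * l powr q)" by simp
    also have "l powr (2 - q) * l powr q = l\<^sup>2" using l by (simp flip: powr_add)
    also have "e * (l\<^sup>2 * (S * M powr q + S * M powr q) + 2 * S * l\<^sup>2) = e * (B * l\<^sup>2)"
      by (simp add: B_def algebra_simps)
    also have "\<dots> = \<eta> * l\<^sup>2" using e by (simp add: mult.assoc[symmetric])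
    finally show ?thesis by (simp add: l_def)
  qed
  then show thesis using C int by (intro that[of "1 + 2 * C"]) auto
qed

lemma weighted_integrable:
  "u \<in> H01 U \<Longrightarrow> v \<in> H01 U \<Longrightarrow> w \<in> H01 U \<Longrightarrow> integrable (lebesgue_on U) (\<lambda>x. wt u v x * (w x)\<^sup>2)"
  by (rule weighted_integral_le[of "max (gnorm u) (gnorm v)" 1]) (auto simp: le_max_iff_disj)

lemma weighted_integral_bound:
  assumes "M \<ge> 0" "\<eta> > 0"
  obtains C where "C \<ge> 0"
    "\<And>u v w. u \<in> H01 U \<Longrightarrow> v \<in> H01 U \<Longrightarrow> w \<in> H01 U \<Longrightarrow> gnorm u \<le> M \<Longrightarrow> gnorm v \<le> M \<Longrightarrow>
      (\<integral>x. wt u v x * (w x)\<^sup>2 \<partial>lebesgue_on U) \<le> \<eta> * (gnorm w)\<^sup>2 + C * (Lq_norm 2 U w)\<^sup>2"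
  using assms by (rule weighted_integral_le) (rule that)

lemma integrable_if_weighted_bound:
  assumes "u \<in> H01 U" "v \<in> H01 U" "w \<in> H01 U" "f \<in> borel_measurable (lebesgue_on U)"
    and le: "\<And>x. \<bar>f x\<bar> \<le> c * (wt u v x * (w x)\<^sup>2)"
  shows "integrable (lebesgue_on U) f"
proof (rule Bochner_Integration.integrable_bound)
  show "integrable (lebesgue_on U) (\<lambda>x. c * (wt u v x * (w x)\<^sup>2))"
    using weighted_integrable[OF assms(1-3)] by simp
  show "AE x in lebesgue_on U. norm (f x) \<le> norm (c * (wt u v x * (w x)\<^sup>2))"
    using le abs_ge_self order_trans by (intro always_eventually) (fastforce simp del: abs_mult)
qed (rule assms(4))

section \<open>Integrals of the nonlinearity and their dependence on the function\<close>

abbreviation potential :: "('a \<Rightarrow> real) \<Rightarrow> real" where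
  "potential u \<equiv> \<integral>x. log_prim p (u x) \<partial>lebesgue_on U"

abbreviation log_power :: "('a \<Rightarrow> real) \<Rightarrow> real" where
  "log_power u \<equiv> \<integral>x. \<bar>u x\<bar> powr (p + 1) * ln \<bar>u x\<bar> \<partial>lebesgue_on U"

abbreviation power_integral :: "('a \<Rightarrow> real) \<Rightarrow> real" where
  "power_integral u \<equiv> \<integral>x. \<bar>u x\<bar> powr (p + 1) \<partial>lebesgue_on U"

lemma measurable_log_src: "u \<in> H01 U \<Longrightarrow> (\<lambda>x. log_src p (u x)) \<in> borel_measurable (lebesgue_on U)"
  using H01_measurable[of u] unfolding log_src_def by simp

lemma measurable_log_prim: "u \<in> H01 U \<Longrightarrow> (\<lambda>x. log_prim p (u x)) \<in> borel_measurable (lebesgue_on U)"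
  using H01_measurable[of u] unfolding log_prim_def by simp

lemma integrable_log_prim: "u \<in> H01 U \<Longrightarrow> integrable (lebesgue_on U) (\<lambda>x. log_prim p (u x))"
proof (rule integrable_if_weighted_bound[of u u u])
  show "\<bar>log_prim p (u x)\<bar> \<le> (cf + 1) * (wt u u x * (u x)\<^sup>2)" for x
    using cf_pos by (intro le_wt abs_log_prim_le) auto
qed (auto intro: measurable_log_prim)

lemma integrable_log_power: "u \<in> H01 U \<Longrightarrow> integrable (lebesgue_on U) (\<lambda>x. \<bar>u x\<bar> powr (p + 1) * ln \<bar>u x\<bar>)"
proof (rule integrable_if_weighted_bound[of u u u])
  show "\<bar>\<bar>u x\<bar> powr (p + 1) * ln \<bar>u x\<bar>\<bar> \<le> cf * (wt u u x * (u x)\<^sup>2)" for x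
    using cf_pos by (intro le_wt abs_powr_ln_le) auto
  show "u \<in> H01 U \<Longrightarrow> (\<lambda>x. \<bar>u x\<bar> powr (p + 1) * ln \<bar>u x\<bar>) \<in> borel_measurable (lebesgue_on U)"
    using H01_measurable[of u] by simp
qed auto

lemma integrable_power: "u \<in> H01 U \<Longrightarrow> integrable (lebesgue_on U) (\<lambda>x. \<bar>u x\<bar> powr (p + 1))"
proof (rule integrable_if_weighted_bound[of u u u])
  show "\<bar>\<bar>u x\<bar> powr (p + 1)\<bar> \<le> 1 * (wt u u x * (u x)\<^sup>2)" for x
    using abs_powr_le[of "u x"] mult_right_mono[OF wt_ge(1)[of u x u], of "(u x)\<^sup>2"] by simp
  show "u \<in> H01 U \<Longrightarrow> (\<lambda>x. \<bar>u x\<bar> powr (p + 1)) \<in> borel_measurable (lebesgue_on U)"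
    using H01_measurable[of u] by simp
qed auto

lemma integrable_log_src_mult:
  assumes u: "u \<in> H01 U" and w: "w \<in> H01 U"
  shows "integrable (lebesgue_on U) (\<lambda>x. log_src p (u x) * w x)"
proof (rule Bochner_Integration.integrable_bound)
  show "integrable (lebesgue_on U) (\<lambda>x. cf * (wt u u x * (u x)\<^sup>2) + cf * (wt u u x * (w x)\<^sup>2))"
    using weighted_integrable[OF u u u] weighted_integrable[OF u u w] by simp
  show "(\<lambda>x. log_src p (u x) * w x) \<in> borel_measurable (lebesgue_on U)"
    using measurable_log_src[OF u] H01_measurable[OF w] by simp
  show "AE x in lebesgue_on U. norm (log_src p (u x) * w x) \<le> norm (cf * (wt u u x * (u x)\<^sup>2) + cf * (wt u u x * (w x)\<^sup>2))"
  proof (rule always_eventually, rule allI)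
    fix x
    have "\<bar>log_src p (u x)\<bar> * \<bar>w x\<bar> \<le> cf * (1 + \<bar>u x\<bar> powr r) * \<bar>u x\<bar> * \<bar>w x\<bar>"
      by (intro mult_right_mono abs_log_src_le) simp
    also have "\<dots> \<le> cf * wt u u x * (\<bar>u x\<bar> * \<bar>w x\<bar>)"
      unfolding mult.assoc[of _ "\<bar>u x\<bar>"] using cf_pos wt_ge(1)[of u x u] by (intro mult_right_mono mult_left_mono) auto
    also have "\<dots> \<le> cf * wt u u x * ((u x)\<^sup>2 + (w x)\<^sup>2)"
    proof (intro mult_left_mono)
      have "2 * \<bar>u x\<bar> * \<bar>w x\<bar> \<le> (u x)\<^sup>2 + (w x)\<^sup>2" using sum_squares_bound[of "\<bar>u x\<bar>" "\<bar>w x\<bar>"] by simp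
      moreover have "0 \<le> \<bar>u x\<bar> * \<bar>w x\<bar>" by simp
      ultimately show "\<bar>u x\<bar> * \<bar>w x\<bar> \<le> (u x)\<^sup>2 + (w x)\<^sup>2" by linarith
    qed (use cf_pos wt_nonneg in auto)
    also have "\<dots> = cf * (wt u u x * (u x)\<^sup>2) + cf * (wt u u x * (w x)\<^sup>2)" by (simp add: algebra_simps)
    finally show "norm (log_src p (u x) * w x) \<le> norm (cf * (wt u u x * (u x)\<^sup>2) + cf * (wt u u x * (w x)\<^sup>2))"
      unfolding real_norm_def abs_mult[of "log_src p (u x)"] by (rule order_trans) simp
  qed
qed

lemma J_fun_eq:
  assumes "u \<in> H01 U" shows "J_fun p U u = (gnorm u)\<^sup>2 / 2 - potential u"
proof -
  have "0 \<le> power_integral u" by simp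
  then have "Lq_norm (p + 1) U u powr (p + 1) = power_integral u"
    using p1 by (simp add: Lq_norm_def powr_powr)
  moreover have "potential u = log_power u / (p + 1) - power_integral u / (p + 1)\<^sup>2"
    unfolding log_prim_def using integrable_log_power[OF assms] integrable_power[OF assms] by simp
  ultimately show ?thesis by (simp add: J_fun_def)
qed

lemma I_fun_eq: "I_fun p U u = (gnorm u)\<^sup>2 - log_power u"
  by (simp add: I_fun_def)

lemma J_fun_I_fun:
  assumes "u \<in> H01 U"
  shows "J_fun p U u = I_fun p U u / (p + 1) + (1 / 2 - 1 / (p + 1)) * (gnorm u)\<^sup>2 + power_integral u / (p + 1)\<^sup>2"
proof -
  have "0 \<le> power_integral u" by simp
  then have "Lq_norm (p + 1) U u powr (p + 1) = power_integral u"
    using p1 by (simp add: Lq_norm_def powr_powr)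
  then show ?thesis by (simp add: J_fun_def I_fun_def algebra_simps diff_divide_distrib)
qed

lemma log_src_self: "L2_inner U (\<lambda>x. log_src p (u x)) u = log_power u"
  unfolding L2_inner_def inner_real_def mult.commute[of "log_src p _"] mult_log_src ..

lemma wt_diff_bounds:
  assumes "M \<ge> 0" "\<eta> > 0" "0 < c"
  obtains C where "C \<ge> 0"
    "\<And>u v f. u \<in> H01 U \<Longrightarrow> v \<in> H01 U \<Longrightarrow> gnorm u \<le> M \<Longrightarrow> gnorm v \<le> M \<Longrightarrow> integrable (lebesgue_on U) f \<Longrightarrow>
      \<forall>x. \<bar>f x\<bar> \<le> c * (1 + \<bar>v x\<bar> powr r + \<bar>u x\<bar> powr r) * (u x - v x)\<^sup>2 \<Longrightarrow>
      \<bar>\<integral>x. f x \<partial>lebesgue_on U\<bar> \<le> c * (\<eta> * (gnorm (\<lambda>x. u x - v x))\<^sup>2 + C * (Lq_norm 2 U (\<lambda>x. u x - v x))\<^sup>2)"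
proof -
  obtain C where C: "C \<ge> 0"
    "\<And>u v w. u \<in> H01 U \<Longrightarrow> v \<in> H01 U \<Longrightarrow> w \<in> H01 U \<Longrightarrow> gnorm u \<le> M \<Longrightarrow> gnorm v \<le> M \<Longrightarrow>
      (\<integral>x. wt u v x * (w x)\<^sup>2 \<partial>lebesgue_on U) \<le> \<eta> * (gnorm w)\<^sup>2 + C * (Lq_norm 2 U w)\<^sup>2"
    using assms(1,2) by (rule weighted_integral_bound) (rule that)
  show thesis
  proof (rule that[OF C(1)])
    fix u v f assume u: "u \<in> H01 U" and v: "v \<in> H01 U" and le: "gnorm u \<le> M" "gnorm v \<le> M"
      and f: "integrable (lebesgue_on U) f"
      and f_le: "\<forall>x. \<bar>f x\<bar> \<le> c * (1 + \<bar>v x\<bar> powr r + \<bar>u x\<bar> powr r) * (u x - v x)\<^sup>2"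
    have c: "0 < c" by (rule assms(3))
    have w: "(\<lambda>x. u x - v x) \<in> H01 U" using u v by (rule H01_diff)
    have "\<bar>\<integral>x. f x \<partial>lebesgue_on U\<bar> \<le> (\<integral>x. \<bar>f x\<bar> \<partial>lebesgue_on U)"
      by (rule integral_abs_bound)
    also have "\<dots> \<le> (\<integral>x. c * (wt v u x * (u x - v x)\<^sup>2) \<partial>lebesgue_on U)"
    proof (rule integral_mono)
      show "integrable (lebesgue_on U) (\<lambda>x. c * (wt v u x * (u x - v x)\<^sup>2))"
        using weighted_integrable[OF v u w] by simp
      show "\<bar>f x\<bar> \<le> c * (wt v u x * (u x - v x)\<^sup>2)" for x
        using f_le by (simp add: wt_def mult.assoc)
    qed (use f in simp)
    also have "\<dots> = c * (\<integral>x. wt v u x * (u x - v x)\<^sup>2 \<partial>lebesgue_on U)"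
      by simp
    also have "\<dots> \<le> c * (\<eta> * (gnorm (\<lambda>x. u x - v x))\<^sup>2 + C * (Lq_norm 2 U (\<lambda>x. u x - v x))\<^sup>2)"
      using c by (intro mult_left_mono C(2)[OF v u w le(2) le(1)]) auto
    finally show "\<bar>\<integral>x. f x \<partial>lebesgue_on U\<bar> \<le>
      c * (\<eta> * (gnorm (\<lambda>x. u x - v x))\<^sup>2 + C * (Lq_norm 2 U (\<lambda>x. u x - v x))\<^sup>2)" .
  qed
qed

text \<open>The free constant is taken as 1 / (2 \<open>cT\<close>) so that the squared gradient
  norm appears with factor exactly 1/2, the amount that the Dirichlet part of J gives back.\<close>

lemma potential_Taylor:
  assumes "M \<ge> 0"
  obtains C where "C \<ge> 0"
    "\<And>u v. u \<in> H01 U \<Longrightarrow> v \<in> H01 U \<Longrightarrow> gnorm u \<le> M \<Longrightarrow> gnorm v \<le> M \<Longrightarrow>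
      \<bar>potential u - potential v - L2_inner U (\<lambda>x. log_src p (u x)) (\<lambda>x. u x - v x)\<bar>
        \<le> (gnorm (\<lambda>x. u x - v x))\<^sup>2 / 2 + C * (Lq_norm 2 U (\<lambda>x. u x - v x))\<^sup>2"
proof -
  have cT': "0 < 1 / (2 * cT)" using cT(1) by simp
  obtain C where C: "C \<ge> 0"
    "\<And>u v f. u \<in> H01 U \<Longrightarrow> v \<in> H01 U \<Longrightarrow> gnorm u \<le> M \<Longrightarrow> gnorm v \<le> M \<Longrightarrow> integrable (lebesgue_on U) f \<Longrightarrow>
      \<forall>x. \<bar>f x\<bar> \<le> cT * (1 + \<bar>v x\<bar> powr r + \<bar>u x\<bar> powr r) * (u x - v x)\<^sup>2 \<Longrightarrow>
      \<bar>\<integral>x. f x \<partial>lebesgue_on U\<bar> \<le> cT * (1 / (2 * cT) * (gnorm (\<lambda>x. u x - v x))\<^sup>2 + C * (Lq_norm 2 U (\<lambda>x. u x - v x))\<^sup>2)"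
    using assms cT' cT(1) by (rule wt_diff_bounds) (rule that)
  show thesis
  proof (rule that[of "cT * C"])
    fix u v assume u: "u \<in> H01 U" and v: "v \<in> H01 U" and le: "gnorm u \<le> M" "gnorm v \<le> M"
    let ?f = "\<lambda>x. log_prim p (u x) - log_prim p (v x) - log_src p (u x) * (u x - v x)"
    note i = integrable_log_prim[OF u] integrable_log_prim[OF v] integrable_log_src_mult[OF u H01_diff[OF u v]]
    have "potential u - potential v - L2_inner U (\<lambda>x. log_src p (u x)) (\<lambda>x. u x - v x) = (\<integral>x. ?f x \<partial>lebesgue_on U)"
      using i by (simp add: L2_inner_def)
    moreover have "\<bar>\<integral>x. ?f x \<partial>lebesgue_on U\<bar> \<le> cT * (1 / (2 * cT) * (gnorm (\<lambda>x. u x - v x))\<^sup>2 + C * (Lq_norm 2 U (\<lambda>x. u x - v x))\<^sup>2)"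
      using i by (intro C(2) u v le allI log_prim_Taylor) auto
    ultimately show "\<bar>potential u - potential v - L2_inner U (\<lambda>x. log_src p (u x)) (\<lambda>x. u x - v x)\<bar>
        \<le> (gnorm (\<lambda>x. u x - v x))\<^sup>2 / 2 + cT * C * (Lq_norm 2 U (\<lambda>x. u x - v x))\<^sup>2"
      using cT(1) by (simp add: distrib_left)
  qed (use C cT in simp)
qed

text \<open>Here the free constant is 1 / \<open>cL\<close>, giving the squared gradient norm the
  factor 1: this is what the difference of two equations supplies in the uniqueness proof.\<close>

lemma source_Lipschitz:
  assumes "M \<ge> 0"
  obtains C where "C \<ge> 0"
    "\<And>u v. u \<in> H01 U \<Longrightarrow> v \<in> H01 U \<Longrightarrow> gnorm u \<le> M \<Longrightarrow> gnorm v \<le> M \<Longrightarrow>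
      \<bar>L2_inner U (\<lambda>x. log_src p (u x)) (\<lambda>x. u x - v x) - L2_inner U (\<lambda>x. log_src p (v x)) (\<lambda>x. u x - v x)\<bar>
        \<le> (gnorm (\<lambda>x. u x - v x))\<^sup>2 + C * (Lq_norm 2 U (\<lambda>x. u x - v x))\<^sup>2"
proof -
  have cL': "0 < 1 / cL" using cL(1) by simp
  obtain C where C: "C \<ge> 0"
    "\<And>u v f. u \<in> H01 U \<Longrightarrow> v \<in> H01 U \<Longrightarrow> gnorm u \<le> M \<Longrightarrow> gnorm v \<le> M \<Longrightarrow> integrable (lebesgue_on U) f \<Longrightarrow>
      \<forall>x. \<bar>f x\<bar> \<le> cL * (1 + \<bar>v x\<bar> powr r + \<bar>u x\<bar> powr r) * (u x - v x)\<^sup>2 \<Longrightarrow>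
      \<bar>\<integral>x. f x \<partial>lebesgue_on U\<bar> \<le> cL * (1 / cL * (gnorm (\<lambda>x. u x - v x))\<^sup>2 + C * (Lq_norm 2 U (\<lambda>x. u x - v x))\<^sup>2)"
    using assms cL' cL(1) by (rule wt_diff_bounds) (rule that)
  show thesis
  proof (rule that[of "cL * C"])
    fix u v assume u: "u \<in> H01 U" and v: "v \<in> H01 U" and le: "gnorm u \<le> M" "gnorm v \<le> M"
    let ?f = "\<lambda>x. log_src p (u x) * (u x - v x) - log_src p (v x) * (u x - v x)"
    note i = integrable_log_src_mult[OF u H01_diff[OF u v]] integrable_log_src_mult[OF v H01_diff[OF u v]]
    have "L2_inner U (\<lambda>x. log_src p (u x)) (\<lambda>x. u x - v x) - L2_inner U (\<lambda>x. log_src p (v x)) (\<lambda>x. u x - v x) = (\<integral>x. ?f x \<partial>lebesgue_on U)"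
      using i by (simp add: L2_inner_def)
    moreover have "\<bar>\<integral>x. ?f x \<partial>lebesgue_on U\<bar> \<le> cL * (1 / cL * (gnorm (\<lambda>x. u x - v x))\<^sup>2 + C * (Lq_norm 2 U (\<lambda>x. u x - v x))\<^sup>2)"
    proof (intro C(2) u v le allI)
      show "integrable (lebesgue_on U) ?f" using i by simp
      fix x
      have "\<bar>?f x\<bar> = \<bar>log_src p (v x) - log_src p (u x)\<bar> * \<bar>u x - v x\<bar>"
        unfolding left_diff_distrib[symmetric] abs_mult by (simp add: abs_minus_commute)
      also have "\<dots> \<le> cL * (1 + \<bar>v x\<bar> powr r + \<bar>u x\<bar> powr r) * \<bar>v x - u x\<bar> * \<bar>u x - v x\<bar>"
        by (intro mult_right_mono log_src_Lipschitz) simp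
      also have "\<dots> = cL * (1 + \<bar>v x\<bar> powr r + \<bar>u x\<bar> powr r) * \<bar>u x - v x\<bar>\<^sup>2"
        by (simp only: abs_minus_commute[of "v x"] power2_eq_square mult.assoc)
      finally show "\<bar>?f x\<bar> \<le> cL * (1 + \<bar>v x\<bar> powr r + \<bar>u x\<bar> powr r) * (u x - v x)\<^sup>2" by simp
    qed
    ultimately show "\<bar>L2_inner U (\<lambda>x. log_src p (u x)) (\<lambda>x. u x - v x) - L2_inner U (\<lambda>x. log_src p (v x)) (\<lambda>x. u x - v x)\<bar>
        \<le> (gnorm (\<lambda>x. u x - v x))\<^sup>2 + cL * C * (Lq_norm 2 U (\<lambda>x. u x - v x))\<^sup>2"
      using cL(1) by (simp add: distrib_left)
  qed (use C cL in simp)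
qed

text \<open>The hypothesis is only first order in a - b. Young's inequality with a small e splits it
  into e times u^2 + v^2, which is bounded in terms of M, and 1 / (2 e) times (u - v)^2, to which
  the weighted estimate applies with a second small constant. So such integrals are continuous in
  the L2 norm on bounded sets of \<open>H01\<close>.\<close>

lemma integral_weighted_continuity:
  assumes M: "M \<ge> 0" and \<eta>: "\<eta> > 0" and c: "c > 0"
    and h: "\<And>a b. \<bar>h a - h b\<bar> \<le> c * (1 + \<bar>a\<bar> powr r + \<bar>b\<bar> powr r) * (\<bar>a\<bar> + \<bar>b\<bar>) * \<bar>a - b\<bar>"
    and hi: "\<And>u. u \<in> H01 U \<Longrightarrow> integrable (lebesgue_on U) (\<lambda>x. h (u x))"
  obtains C where "C \<ge> 0"
    "\<And>u v. u \<in> H01 U \<Longrightarrow> v \<in> H01 U \<Longrightarrow> gnorm u \<le> M \<Longrightarrow> gnorm v \<le> M \<Longrightarrow>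
      \<bar>(\<integral>x. h (u x) \<partial>lebesgue_on U) - (\<integral>x. h (v x) \<partial>lebesgue_on U)\<bar> \<le> \<eta> + C * (Lq_norm 2 U (\<lambda>x. u x - v x))\<^sup>2"
proof -
  obtain P where P: "P > 0" "\<And>u. u \<in> H01 U \<Longrightarrow> (Lq_norm 2 U u)\<^sup>2 \<le> P * (gnorm u)\<^sup>2"
    using Poincare_H01 by blast
  obtain C1 where C1: "C1 \<ge> 0"
    "\<And>u v w. u \<in> H01 U \<Longrightarrow> v \<in> H01 U \<Longrightarrow> w \<in> H01 U \<Longrightarrow> gnorm u \<le> M \<Longrightarrow> gnorm v \<le> M \<Longrightarrow>
      (\<integral>x. wt u v x * (w x)\<^sup>2 \<partial>lebesgue_on U) \<le> 1 * (gnorm w)\<^sup>2 + C1 * (Lq_norm 2 U w)\<^sup>2"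
    using M zero_less_one by (rule weighted_integral_bound) (rule that)
  \<comment> \<open>Bounds the weighted integrals of u^2 and v^2 together; the summand 1 keeps A
    positive when M = 0. Then e is fixed by c e A = \<eta>/2.\<close>
  define A where "A = 2 * ((1 + C1 * P) * M\<^sup>2) + 1"
  have A: "A > 0" using C1 P by (auto simp: A_def intro!: add_nonneg_pos mult_nonneg_nonneg)
  define e where "e = \<eta> / (2 * c * A)"
  have e: "e > 0" using \<eta> c A by (simp add: e_def)
  \<comment> \<open>Chosen with ||grad (u - v)||^2 \<le> 4 M^2 in view, so that this term costs at
    most \<eta>/2; the 1 guards against M = 0.\<close>
  define \<eta>2 where "\<eta>2 = \<eta> * e / (4 * c * M\<^sup>2 + 1)"
  have den: "4 * c * M\<^sup>2 + 1 > 0" using c by (intro add_nonneg_pos) auto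
  have \<eta>2: "\<eta>2 > 0" using \<eta> e den by (simp add: \<eta>2_def)
  obtain C2 where C2: "C2 \<ge> 0"
    "\<And>u v w. u \<in> H01 U \<Longrightarrow> v \<in> H01 U \<Longrightarrow> w \<in> H01 U \<Longrightarrow> gnorm u \<le> M \<Longrightarrow> gnorm v \<le> M \<Longrightarrow>
      (\<integral>x. wt u v x * (w x)\<^sup>2 \<partial>lebesgue_on U) \<le> \<eta>2 * (gnorm w)\<^sup>2 + C2 * (Lq_norm 2 U w)\<^sup>2"
    using M \<eta>2 by (rule weighted_integral_bound) (rule that)
  show thesis
  proof (rule that[of "c / (2 * e) * C2"])
    show "0 \<le> c / (2 * e) * C2" using c e C2 by simp
    fix u v assume u: "u \<in> H01 U" and v: "v \<in> H01 U" and le: "gnorm u \<le> M" "gnorm v \<le> M"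
    have w: "(\<lambda>x. u x - v x) \<in> H01 U" using u v by (rule H01_diff)
    let ?w = "\<lambda>x. u x - v x"
    note i = weighted_integrable[OF u v u] weighted_integrable[OF u v v] weighted_integrable[OF u v w]
    have gw: "(gnorm ?w)\<^sup>2 \<le> 4 * M\<^sup>2"
    proof -
      have "gnorm (\<lambda>x. u x + - 1 * v x) \<le> gnorm u + gnorm (\<lambda>x. - 1 * v x)"
        by (intro gnorm_add_le H1_scale(1) H01_H1 u v)
      then have "gnorm ?w \<le> 2 * M" using gnorm_scale[OF H01_H1[OF v], of "-1"] le by simp
      then have "(gnorm ?w)\<^sup>2 \<le> (2 * M)\<^sup>2" by (intro power_mono) auto
      then show ?thesis by (simp add: power_mult_distrib)
    qed
    have bound: "(\<integral>x. wt u v x * (w x)\<^sup>2 \<partial>lebesgue_on U) \<le> (1 + C1 * P) * M\<^sup>2" if "w \<in> H01 U" "gnorm w \<le> M" for w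
    proof -
      have "(\<integral>x. wt u v x * (w x)\<^sup>2 \<partial>lebesgue_on U) \<le> (gnorm w)\<^sup>2 + C1 * (Lq_norm 2 U w)\<^sup>2"
        using C1(2)[OF u v that(1) le] by simp
      also have "\<dots> \<le> (gnorm w)\<^sup>2 + C1 * (P * (gnorm w)\<^sup>2)"
        using C1(1) by (intro add_left_mono mult_left_mono P(2) that)
      also have "\<dots> = (1 + C1 * P) * (gnorm w)\<^sup>2" by (simp add: algebra_simps)
      also have "\<dots> \<le> (1 + C1 * P) * M\<^sup>2"
        using C1(1) P(1) that by (intro mult_left_mono power_mono) auto
      finally show ?thesis .
    qed
    have "\<bar>(\<integral>x. h (u x) \<partial>lebesgue_on U) - (\<integral>x. h (v x) \<partial>lebesgue_on U)\<bar> = \<bar>\<integral>x. h (u x) - h (v x) \<partial>lebesgue_on U\<bar>"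
      using hi[OF u] hi[OF v] by simp
    also have "\<dots> \<le> (\<integral>x. \<bar>h (u x) - h (v x)\<bar> \<partial>lebesgue_on U)" by (rule integral_abs_bound)
    also have "\<dots> \<le> (\<integral>x. c * e * (wt u v x * (u x)\<^sup>2 + wt u v x * (v x)\<^sup>2) + c / (2 * e) * (wt u v x * (?w x)\<^sup>2) \<partial>lebesgue_on U)"
    proof (rule integral_mono)
      show "integrable (lebesgue_on U) (\<lambda>x. c * e * (wt u v x * (u x)\<^sup>2 + wt u v x * (v x)\<^sup>2) + c / (2 * e) * (wt u v x * (?w x)\<^sup>2))"
        using i by (intro Bochner_Integration.integrable_add integrable_mult_right)
      fix x
      have "(\<bar>u x\<bar> + \<bar>v x\<bar>) * \<bar>?w x\<bar> \<le> e * ((u x)\<^sup>2 + (v x)\<^sup>2) + 1 / (2 * e) * (?w x)\<^sup>2"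
        by (rule weighted_Young[OF e])
      then have "c * wt u v x * ((\<bar>u x\<bar> + \<bar>v x\<bar>) * \<bar>?w x\<bar>) \<le> c * wt u v x * (e * ((u x)\<^sup>2 + (v x)\<^sup>2) + 1 / (2 * e) * (?w x)\<^sup>2)"
        using c wt_nonneg by (intro mult_left_mono) auto
      also have "\<dots> = c * e * (wt u v x * (u x)\<^sup>2 + wt u v x * (v x)\<^sup>2) + c / (2 * e) * (wt u v x * (?w x)\<^sup>2)"
        by (simp add: algebra_simps)
      finally show "\<bar>h (u x) - h (v x)\<bar> \<le> c * e * (wt u v x * (u x)\<^sup>2 + wt u v x * (v x)\<^sup>2) + c / (2 * e) * (wt u v x * (?w x)\<^sup>2)"
        using h[of "u x" "v x"] unfolding wt_def by (simp add: mult.assoc)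
    qed (use hi[OF u] hi[OF v] in simp)
    also have "\<dots> = c * e * ((\<integral>x. wt u v x * (u x)\<^sup>2 \<partial>lebesgue_on U) + (\<integral>x. wt u v x * (v x)\<^sup>2 \<partial>lebesgue_on U))
        + c / (2 * e) * (\<integral>x. wt u v x * (?w x)\<^sup>2 \<partial>lebesgue_on U)"
      using i by simp
    also have "\<dots> \<le> c * e * ((1 + C1 * P) * M\<^sup>2 + (1 + C1 * P) * M\<^sup>2) + c / (2 * e) * (\<eta>2 * (4 * M\<^sup>2) + C2 * (Lq_norm 2 U ?w)\<^sup>2)"
    proof -
      have "(\<integral>x. wt u v x * (?w x)\<^sup>2 \<partial>lebesgue_on U) \<le> \<eta>2 * (gnorm ?w)\<^sup>2 + C2 * (Lq_norm 2 U ?w)\<^sup>2"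
        by (rule C2(2)[OF u v w le])
      also have "\<dots> \<le> \<eta>2 * (4 * M\<^sup>2) + C2 * (Lq_norm 2 U ?w)\<^sup>2"
        using \<eta>2 gw by simp
      finally show ?thesis
        using c e bound[OF u le(1)] bound[OF v le(2)] by (intro add_mono mult_left_mono) auto
    qed
    also have "\<dots> \<le> \<eta> + c / (2 * e) * C2 * (Lq_norm 2 U ?w)\<^sup>2"
    proof -
      have "c * e * ((1 + C1 * P) * M\<^sup>2 + (1 + C1 * P) * M\<^sup>2) \<le> c * e * A"
        using c e by (intro mult_left_mono) (auto simp: A_def)
      also have "\<dots> = \<eta> / 2" using c A by (simp add: e_def)
      finally have 1: "c * e * ((1 + C1 * P) * M\<^sup>2 + (1 + C1 * P) * M\<^sup>2) \<le> \<eta> / 2" .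
      have "c / (2 * e) * (\<eta>2 * (4 * M\<^sup>2)) = \<eta> / 2 * (4 * c * M\<^sup>2 / (4 * c * M\<^sup>2 + 1))"
        using e by (simp add: \<eta>2_def)
      also have "\<dots> \<le> \<eta> / 2 * 1"
        using \<eta> den by (intro mult_left_mono) auto
      finally have 2: "c / (2 * e) * (\<eta>2 * (4 * M\<^sup>2)) \<le> \<eta> / 2" by simp
      show ?thesis using 1 2 by (simp add: distrib_left mult.assoc)
    qed
    finally show "\<bar>(\<integral>x. h (u x) \<partial>lebesgue_on U) - (\<integral>x. h (v x) \<partial>lebesgue_on U)\<bar>
      \<le> \<eta> + c / (2 * e) * C2 * (Lq_norm 2 U ?w)\<^sup>2" .
  qed
qed

lemma potential_continuity:
  assumes M: "M \<ge> 0" and \<eta>: "\<eta> > 0"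
  obtains C where "C \<ge> 0"
    "\<And>u v. u \<in> H01 U \<Longrightarrow> v \<in> H01 U \<Longrightarrow> gnorm u \<le> M \<Longrightarrow> gnorm v \<le> M \<Longrightarrow>
      \<bar>potential u - potential v\<bar> \<le> \<eta> + C * (Lq_norm 2 U (\<lambda>x. u x - v x))\<^sup>2"
proof -
  have c: "0 < cf + cT" using cf_pos cT by simp
  have h: "\<bar>log_prim p a - log_prim p b\<bar> \<le> (cf + cT) * (1 + \<bar>a\<bar> powr r + \<bar>b\<bar> powr r) * (\<bar>a\<bar> + \<bar>b\<bar>) * \<bar>a - b\<bar>" for a b
  proof -
    define W where "W = 1 + \<bar>a\<bar> powr r + \<bar>b\<bar> powr r"
    have W: "1 + \<bar>a\<bar> powr r \<le> W" "0 \<le> W" using weight_ge by (auto simp: W_def)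
    have "\<bar>log_src p a * (a - b)\<bar> \<le> cf * (1 + \<bar>a\<bar> powr r) * \<bar>a\<bar> * \<bar>a - b\<bar>"
      unfolding abs_mult by (intro mult_right_mono abs_log_src_le) simp
    also have "\<dots> \<le> cf * W * (\<bar>a\<bar> + \<bar>b\<bar>) * \<bar>a - b\<bar>"
      using cf_pos W by (intro mult_right_mono mult_mono) auto
    finally have 1: "\<bar>log_src p a * (a - b)\<bar> \<le> cf * (W * (\<bar>a\<bar> + \<bar>b\<bar>) * \<bar>a - b\<bar>)" by (simp add: mult.assoc)
    have "\<bar>log_prim p a - log_prim p b - log_src p a * (a - b)\<bar> \<le> cT * W * (\<bar>a - b\<bar> * \<bar>a - b\<bar>)"
      using log_prim_Taylor[of a b] by (simp add: W_def power2_eq_square add_ac)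
    also have "\<dots> \<le> cT * W * ((\<bar>a\<bar> + \<bar>b\<bar>) * \<bar>a - b\<bar>)"
      using cT W by (intro mult_left_mono mult_right_mono) auto
    finally have 2: "\<bar>log_prim p a - log_prim p b - log_src p a * (a - b)\<bar> \<le> cT * (W * (\<bar>a\<bar> + \<bar>b\<bar>) * \<bar>a - b\<bar>)"
      by (simp add: mult.assoc)
    have "\<bar>log_prim p a - log_prim p b\<bar> \<le> cf * (W * (\<bar>a\<bar> + \<bar>b\<bar>) * \<bar>a - b\<bar>) + cT * (W * (\<bar>a\<bar> + \<bar>b\<bar>) * \<bar>a - b\<bar>)"
      using 1 2 by linarith
    then show ?thesis by (simp add: W_def distrib_right mult.assoc)
  qed
  show thesis
    using M \<eta> c h integrable_log_prim by (rule integral_weighted_continuity) (assumption, rule that)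
qed

lemma log_power_continuity:
  assumes M: "M \<ge> 0" and \<eta>: "\<eta> > 0"
  obtains C where "C \<ge> 0"
    "\<And>u v. u \<in> H01 U \<Longrightarrow> v \<in> H01 U \<Longrightarrow> gnorm u \<le> M \<Longrightarrow> gnorm v \<le> M \<Longrightarrow>
      \<bar>log_power u - log_power v\<bar> \<le> \<eta> + C * (Lq_norm 2 U (\<lambda>x. u x - v x))\<^sup>2"
proof -
  have c: "0 < cf + cL" using cf_pos cL by simp
  have h: "\<bar>\<bar>a\<bar> powr (p + 1) * ln \<bar>a\<bar> - \<bar>b\<bar> powr (p + 1) * ln \<bar>b\<bar>\<bar>
      \<le> (cf + cL) * (1 + \<bar>a\<bar> powr r + \<bar>b\<bar> powr r) * (\<bar>a\<bar> + \<bar>b\<bar>) * \<bar>a - b\<bar>" for a b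
  proof -
    define W where "W = 1 + \<bar>a\<bar> powr r + \<bar>b\<bar> powr r"
    have W: "1 + \<bar>a\<bar> powr r \<le> W" "0 \<le> W" using weight_ge by (auto simp: W_def)
    have "\<bar>log_src p a * (a - b)\<bar> \<le> cf * (1 + \<bar>a\<bar> powr r) * \<bar>a\<bar> * \<bar>a - b\<bar>"
      unfolding abs_mult by (intro mult_right_mono abs_log_src_le) simp
    also have "\<dots> \<le> cf * W * (\<bar>a\<bar> + \<bar>b\<bar>) * \<bar>a - b\<bar>"
      using cf_pos W by (intro mult_right_mono mult_mono) auto
    finally have 1: "\<bar>log_src p a * (a - b)\<bar> \<le> cf * (W * (\<bar>a\<bar> + \<bar>b\<bar>) * \<bar>a - b\<bar>)" by (simp add: mult.assoc)
    have "\<bar>b * (log_src p a - log_src p b)\<bar> \<le> \<bar>b\<bar> * (cL * W * \<bar>a - b\<bar>)"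
      unfolding abs_mult W_def by (intro mult_left_mono log_src_Lipschitz) simp
    also have "\<dots> \<le> (\<bar>a\<bar> + \<bar>b\<bar>) * (cL * W * \<bar>a - b\<bar>)"
      using cL W by (intro mult_right_mono) auto
    finally have 2: "\<bar>b * (log_src p a - log_src p b)\<bar> \<le> cL * (W * (\<bar>a\<bar> + \<bar>b\<bar>) * \<bar>a - b\<bar>)"
      by (simp only: mult_ac)
    have "a * log_src p a - b * log_src p b = log_src p a * (a - b) + b * (log_src p a - log_src p b)"
      by (simp add: algebra_simps)
    then have "\<bar>a * log_src p a - b * log_src p b\<bar> \<le> cf * (W * (\<bar>a\<bar> + \<bar>b\<bar>) * \<bar>a - b\<bar>) + cL * (W * (\<bar>a\<bar> + \<bar>b\<bar>) * \<bar>a - b\<bar>)"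
      using 1 2 by linarith
    then show ?thesis unfolding mult_log_src by (simp add: W_def distrib_right mult.assoc)
  qed
  show thesis
    using M \<eta> c h integrable_log_power by (rule integral_weighted_continuity) (assumption, rule that)
qed

text \<open>The logarithm is nonpositive for |s| \<le> 1, so the integrand is at most c |s|^q
  everywhere. By Sobolev its integral is at most c S ||grad u||^q, which is below ||grad u||^2 once
  ||grad u||^(q - 2) \<le> 1 / (c S); this defines \<rho>.\<close>

lemma I_fun_nonneg_small:
  obtains \<rho> where "\<rho> > 0" "\<And>u. u \<in> H01 U \<Longrightarrow> gnorm u \<le> \<rho> \<Longrightarrow> 0 \<le> I_fun p U u"
proof -
  obtain S where S: "S > 0" "\<And>u. u \<in> H01 U \<Longrightarrow> integrable (lebesgue_on U) (\<lambda>x. \<bar>u x\<bar> powr q)"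
    "\<And>u. u \<in> H01 U \<Longrightarrow> (\<integral>x. \<bar>u x\<bar> powr q \<partial>lebesgue_on U) \<le> S * gnorm u powr q"
    using Sobolev_H01[OF r_bounds(4) qn] by blast
  define c where "c = 1 / (q - (p + 1))"
  have c: "c > 0" using pq by (simp add: c_def)
  define \<rho> where "\<rho> = (1 / (c * S)) powr (1 / (q - 2))"
  have \<rho>: "\<rho> > 0" using c S by (simp add: \<rho>_def)
  have "0 \<le> I_fun p U u" if u: "u \<in> H01 U" and le: "gnorm u \<le> \<rho>" for u
  proof -
    have point: "\<bar>s\<bar> powr (p + 1) * ln \<bar>s\<bar> \<le> c * \<bar>s\<bar> powr q" for s
    proof (cases "\<bar>s\<bar> \<ge> 1")
      case True
      have "ln \<bar>s\<bar> \<le> \<bar>s\<bar> powr (q - (p + 1)) / (q - (p + 1))"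
        using True pq by (intro ln_powr_bound) auto
      then have "\<bar>s\<bar> powr (p + 1) * ln \<bar>s\<bar> \<le> \<bar>s\<bar> powr (p + 1) * (\<bar>s\<bar> powr (q - (p + 1)) * c)"
        by (intro mult_left_mono) (auto simp: c_def)
      also have "\<dots> = c * (\<bar>s\<bar> powr (p + 1) * \<bar>s\<bar> powr (q - (p + 1)))" by (simp only: mult_ac)
      also have "\<bar>s\<bar> powr (p + 1) * \<bar>s\<bar> powr (q - (p + 1)) = \<bar>s\<bar> powr q" by (simp only: powr_add[symmetric]) simp
      finally show ?thesis .
    next
      case False
      then have "\<bar>s\<bar> powr (p + 1) * ln \<bar>s\<bar> \<le> 0"
        by (cases "s = 0") (auto intro!: mult_nonneg_nonpos)
      also have "0 \<le> c * \<bar>s\<bar> powr q" using c by simp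
      finally show ?thesis .
    qed
    have "log_power u \<le> (\<integral>x. c * \<bar>u x\<bar> powr q \<partial>lebesgue_on U)"
      using S(2)[OF u] by (intro integral_mono integrable_log_power u point) auto
    also have "\<dots> \<le> c * (S * gnorm u powr q)" using S(3)[OF u] c by simp
    also have "\<dots> \<le> (gnorm u)\<^sup>2"
    proof (cases "gnorm u = 0")
      case False
      then have g: "gnorm u > 0" by (simp add: less_le)
      have "gnorm u powr (q - 2) \<le> \<rho> powr (q - 2)" using g le r_bounds by (intro powr_mono2) auto
      also have "\<dots> = 1 / (c * S)" using c S r_bounds by (simp add: \<rho>_def powr_powr)
      finally have "c * S * gnorm u powr (q - 2) \<le> 1" using c S by (simp add: field_simps)
      then have "c * S * gnorm u powr (q - 2) * (gnorm u)\<^sup>2 \<le> 1 * (gnorm u)\<^sup>2" by (intro mult_right_mono) auto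
      moreover have "gnorm u powr q = gnorm u powr (q - 2) * gnorm u powr 2" by (simp only: powr_add[symmetric]) simp
      ultimately show ?thesis using g by (simp add: mult.assoc)
    qed simp
    finally show ?thesis by (simp add: I_fun_eq)
  qed
  then show thesis using \<rho> by (intro that[of \<rho>])
qed

lemma J_fun_le:
  assumes M: "M \<ge> 0"
  obtains C where "C > 0" "\<And>u. u \<in> H01 U \<Longrightarrow> gnorm u \<le> M \<Longrightarrow> J_fun p U u \<le> C * (gnorm u)\<^sup>2"
proof -
  obtain P where P: "P > 0" "\<And>u. u \<in> H01 U \<Longrightarrow> (Lq_norm 2 U u)\<^sup>2 \<le> P * (gnorm u)\<^sup>2"
    using Poincare_H01 by blast
  obtain C where C: "C \<ge> 0"
    "\<And>u v w. u \<in> H01 U \<Longrightarrow> v \<in> H01 U \<Longrightarrow> w \<in> H01 U \<Longrightarrow> gnorm u \<le> M \<Longrightarrow> gnorm v \<le> M \<Longrightarrow>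
      (\<integral>x. wt u v x * (w x)\<^sup>2 \<partial>lebesgue_on U) \<le> 1 * (gnorm w)\<^sup>2 + C * (Lq_norm 2 U w)\<^sup>2"
    using M zero_less_one by (rule weighted_integral_bound) (rule that)
  have "J_fun p U u \<le> (1 + (cf + 1) * (1 + C * P)) * (gnorm u)\<^sup>2" if u: "u \<in> H01 U" and le: "gnorm u \<le> M" for u
  proof -
    have "- potential u \<le> (\<integral>x. (cf + 1) * (wt u u x * (u x)\<^sup>2) \<partial>lebesgue_on U)"
      unfolding Bochner_Integration.integral_minus[symmetric]
    proof (rule integral_mono)
      show "- log_prim p (u x) \<le> (cf + 1) * (wt u u x * (u x)\<^sup>2)" for x
        using le_wt[where x=x and u=u and v=u, OF abs_log_prim_le] cf_pos abs_ge_minus_self[of "log_prim p (u x)"]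
        by (meson add_nonneg_nonneg less_imp_le order_trans zero_le_one zero_le_power2)
    qed (use integrable_log_prim[OF u] weighted_integrable[OF u u u] in auto)
    also have "\<dots> = (cf + 1) * (\<integral>x. wt u u x * (u x)\<^sup>2 \<partial>lebesgue_on U)" by simp
    also have "\<dots> \<le> (cf + 1) * (1 * (gnorm u)\<^sup>2 + C * (P * (gnorm u)\<^sup>2))"
    proof -
      have "C * (Lq_norm 2 U u)\<^sup>2 \<le> C * (P * (gnorm u)\<^sup>2)" using C(1) by (intro mult_left_mono P(2) u)
      then have "(\<integral>x. wt u u x * (u x)\<^sup>2 \<partial>lebesgue_on U) \<le> 1 * (gnorm u)\<^sup>2 + C * (P * (gnorm u)\<^sup>2)"
        using C(2)[OF u u u le le] by linarith
      then show ?thesis using cf_pos by (intro mult_left_mono) auto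
    qed
    finally have "- potential u \<le> (cf + 1) * (1 + C * P) * (gnorm u)\<^sup>2" by (simp add: algebra_simps)
    then show ?thesis
      unfolding J_fun_eq[OF u] distrib_right[of 1] mult_1_left using zero_le_power2[of "gnorm u"] by linarith
  qed
  moreover have "0 < 1 + (cf + 1) * (1 + C * P)"
    using cf_pos C(1) P(1) by (intro add_pos_nonneg mult_nonneg_nonneg add_nonneg_nonneg) auto
  ultimately show thesis by (rule that[rotated])
qed

text \<open>Such a u agrees almost everywhere with 0 times u, whose gradient norm is known from
  scaling.\<close>

lemma AE_zero_gnorm:
  assumes u: "u \<in> H01 U" and "AE x in lebesgue_on U. u x = 0" shows "gnorm u = 0"
proof -
  have "AE x in lebesgue_on U. 0 * u x = u x" using assms(2) by eventually_elim simp
  then have "wgrad U u = wgrad U (\<lambda>x. 0 * u x)" by (rule H01_cong_AE(2)[OF H01_scale[OF u]])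
  then have "gnorm u = gnorm (\<lambda>x. 0 * u x)" by simp
  also have "\<dots> = 0" using gnorm_scale[OF H01_H1[OF u], of 0] by simp
  finally show ?thesis .
qed

lemma I_fun_eq_0:
  assumes "u \<in> H01 U" "gnorm u = 0" shows "I_fun p U u = 0"
proof -
  have "log_power u = (\<integral>x. 0 \<partial>lebesgue_on U)"
  proof (rule integral_cong_AE)
    show "AE x in lebesgue_on U. \<bar>u x\<bar> powr (p + 1) * ln \<bar>u x\<bar> = 0"
      using gnorm_eq_0_AE[OF assms] by eventually_elim simp
  qed (use integrable_log_power[OF assms(1)] in auto)
  then show ?thesis using assms(2) by (simp add: I_fun_eq)
qed

lemma J_I_fun_cong_AE:
  assumes u: "u \<in> H01 U" and ae: "AE x in lebesgue_on U. u x = v x"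
  shows "J_fun p U v = J_fun p U u" "I_fun p U v = I_fun p U u"
proof -
  note v = H01_cong_AE[OF assms]
  have "potential v = potential u"
    by (rule integral_cong_AE) (use integrable_log_prim u v ae in \<open>auto elim: eventually_mono\<close>)
  then show "J_fun p U v = J_fun p U u" using v by (simp add: J_fun_eq u)
  have "log_power v = log_power u"
    by (rule integral_cong_AE) (use integrable_log_power u v ae in \<open>auto elim: eventually_mono\<close>)
  then show "I_fun p U v = I_fun p U u" using v by (simp add: I_fun_eq)
qed

lemma J_fun_lower: "u \<in> H01 U \<Longrightarrow> 0 \<le> I_fun p U u \<Longrightarrow> (1 / 2 - 1 / (p + 1)) * (gnorm u)\<^sup>2 \<le> J_fun p U u"
  using p1 by (simp add: J_fun_I_fun)

text \<open>\<open>depth\<close> is an infimum of reals, so being a lower bound requires the values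
  to be bounded below; on the Nehari manifold J is nonnegative because I vanishes there.\<close>

lemma depth_le_J_fun: "u \<in> Nehari p U \<Longrightarrow> depth p U \<le> J_fun p U u"
  unfolding depth_def
proof (rule cINF_lower)
  have "0 \<le> J_fun p U u" if "u \<in> Nehari p U" for u
  proof -
    have "0 \<le> 1 / 2 - 1 / (p + 1)" using p1 by (simp add: field_simps)
    then have "0 \<le> (1 / 2 - 1 / (p + 1)) * (gnorm u)\<^sup>2" by (rule mult_nonneg_nonneg) simp
    then show ?thesis using J_fun_lower[of u] that by (simp add: Nehari_def)
  qed
  then show "bdd_below (J_fun p U ` Nehari p U)" by (auto intro!: bdd_belowI[of _ 0])
qed

lemma log_power_scale:
  assumes "u \<in> H01 U" "l > 0"
  shows "log_power (\<lambda>x. l * u x) = l powr (p + 1) * (log_power u + ln l * power_integral u)"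
proof -
  have "\<bar>l * s\<bar> powr (p + 1) * ln \<bar>l * s\<bar> = l powr (p + 1) * (\<bar>s\<bar> powr (p + 1) * ln \<bar>s\<bar> + ln l * \<bar>s\<bar> powr (p + 1))" for s
    using assms(2) by (cases "s = 0") (simp_all add: abs_mult powr_mult ln_mult algebra_simps)
  then show ?thesis
    using integrable_log_power[OF assms(1)] integrable_power[OF assms(1)] by simp
qed

lemma power_integral_scale: "l > 0 \<Longrightarrow> power_integral (\<lambda>x. l * u x) = l powr (p + 1) * power_integral u"
  by (simp add: abs_mult powr_mult)

text \<open>If \<open>I u > 0\<close>, some dilation \<open>l u\<close> with \<open>l > 1\<close> lies on the Nehari manifold; comparing
  \<open>J (l u)\<close> with \<open>l\<^sup>p\<^sup>+\<^sup>1 J u\<close> bounds \<open>l\<close> away from \<open>1\<close>.\<close>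

lemma I_fun_coercive:
  assumes d: "0 < depth p U" "d1 < depth p U"
  obtains c where "c > 0" "\<And>u. u \<in> H01 U \<Longrightarrow> J_fun p U u \<le> d1 \<Longrightarrow> 0 \<le> I_fun p U u \<Longrightarrow> c * (gnorm u)\<^sup>2 \<le> I_fun p U u"
proof -
  \<comment> \<open>The energy level is going to be a divisor, hence it is raised to a positive
    number still below the depth.\<close>
  define d2 where "d2 = max d1 (depth p U / 2)"
  have d2: "0 < d2" "d1 \<le> d2" "d2 < depth p U" using d by (auto simp: d2_def)
  \<comment> \<open>The comparison yields l^(p + 1) \<ge> depth / d2; the exponent converts this
    into a bound for l^(p - 1), the factor that occurs in \<psi>.\<close>
  define k where "k = (depth p U / d2) powr ((p - 1) / (p + 1))"
  have k: "k > 1" unfolding k_def using d2 p1 by (intro gr_one_powr) auto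
  have "(1 - 1 / k) * (gnorm u)\<^sup>2 \<le> I_fun p U u"
    if u: "u \<in> H01 U" and J: "J_fun p U u \<le> d1" and I: "0 \<le> I_fun p U u" for u
  proof (cases "gnorm u = 0")
    case True
    then show ?thesis using I_fun_eq_0[OF u] by simp
  next
    case False
    then have g: "(gnorm u)\<^sup>2 > 0" by simp
    have "I_fun p U u \<noteq> 0"
      using depth_le_J_fun[of u] False u J d by (auto simp: Nehari_def)
    with I have I: "I_fun p U u > 0" by simp
    define N L where "N = power_integral u" and "L = log_power u"
    have "N \<noteq> 0"
    proof
      assume "N = 0"
      then have "AE x in lebesgue_on U. \<bar>u x\<bar> powr (p + 1) = 0"
        unfolding N_def using integrable_power[OF u] by (subst (asm) integral_nonneg_eq_0_iff_AE) auto
      then have "AE x in lebesgue_on U. u x = 0" by eventually_elim simp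
      then show False using AE_zero_gnorm[OF u] False by simp
    qed
    then have N: "N > 0" by (simp add: N_def less_le)
    \<comment> \<open>I(l u) = l^2 \<psi>(l), so a zero of \<psi> is a dilation onto the Nehari
      manifold.\<close>
    define \<psi> where "\<psi> l = (gnorm u)\<^sup>2 - l powr (p - 1) * (L + ln l * N)" for l
    \<comment> \<open>At l = exp s the term ln l N = s N outweighs |L| + ||grad u||^2, which makes
      \<psi> nonpositive there.\<close>
    define s where "s = max 1 ((\<bar>L\<bar> + (gnorm u)\<^sup>2) / N)"
    have s: "s \<ge> 1" by (simp add: s_def)
    have "\<psi> (exp s) \<le> 0"
    proof -
      have "(\<bar>L\<bar> + (gnorm u)\<^sup>2) / N * N \<le> s * N" using N by (intro mult_right_mono) (auto simp: s_def)
      then have 1: "(gnorm u)\<^sup>2 \<le> L + ln (exp s) * N" using N by simp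
      have "1 * (gnorm u)\<^sup>2 \<le> exp s powr (p - 1) * (L + ln (exp s) * N)"
        using s p1 1 by (intro mult_mono) (auto simp: powr_def)
      then show ?thesis by (simp add: \<psi>_def)
    qed
    moreover have psi1: "\<psi> 1 > 0" using I by (simp add: \<psi>_def I_fun_eq L_def)
    moreover have "continuous_on {1..exp s} \<psi>"
      unfolding \<psi>_def by (intro continuous_intros) auto
    ultimately obtain l where l: "1 \<le> l" "\<psi> l = 0"
      using IVT2'[of \<psi> "exp s" 0 1] s by force
    have "(gnorm u)\<^sup>2 - L > 0" using psi1 by (simp add: \<psi>_def)
    have l1: "l > 0" using l by simp
    let ?w = "\<lambda>x. l * u x"
    have w: "?w \<in> H01 U" by (rule H01_scale[OF u])
    have gw: "(gnorm ?w)\<^sup>2 = l\<^sup>2 * (gnorm u)\<^sup>2"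
      using gnorm_scale[OF H01_H1[OF u], of l] by (simp add: power_mult_distrib)
    have lp: "l powr (p + 1) = l\<^sup>2 * l powr (p - 1)"
      using abs_powr_plus_1[of l p] l1 by (simp add: mult.commute)
    have Iw: "I_fun p U ?w = 0"
    proof -
      have "I_fun p U ?w = l\<^sup>2 * \<psi> l"
        unfolding I_fun_eq gw log_power_scale[OF u l1] \<psi>_def L_def N_def lp by (simp add: algebra_simps)
      then show ?thesis using l by simp
    qed
    have "(gnorm ?w)\<^sup>2 \<noteq> 0" unfolding gw using False l1 by simp
    then have "?w \<in> Nehari p U" using w Iw by (simp add: Nehari_def)
    then have "depth p U \<le> J_fun p U ?w" by (rule depth_le_J_fun)
    also have "\<dots> = (1 / 2 - 1 / (p + 1)) * (l\<^sup>2 * (gnorm u)\<^sup>2) + l powr (p + 1) * N / (p + 1)\<^sup>2"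
      unfolding J_fun_I_fun[OF w] Iw gw power_integral_scale[OF l1] N_def by simp
    also have "\<dots> \<le> (1 / 2 - 1 / (p + 1)) * (l powr (p + 1) * (gnorm u)\<^sup>2) + l powr (p + 1) * N / (p + 1)\<^sup>2"
    proof -
      have "l\<^sup>2 \<le> l powr (p + 1)" using powr_mono[of 2 "p + 1" l] l l1 p1 by simp
      then show ?thesis using p1 by (intro add_right_mono mult_left_mono mult_right_mono) (auto simp: field_simps)
    qed
    also have "\<dots> = l powr (p + 1) * (J_fun p U u - I_fun p U u / (p + 1))"
      unfolding J_fun_I_fun[OF u] N_def by (simp add: algebra_simps)
    also have "\<dots> \<le> l powr (p + 1) * d2"
    proof -
      have "0 \<le> I_fun p U u / (p + 1)" using I p1 by simp
      then show ?thesis using J d2 by (intro mult_left_mono) auto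
    qed
    finally have "depth p U / d2 \<le> l powr (p + 1)" using d2 by (simp add: divide_le_eq)
    then have "k \<le> (l powr (p + 1)) powr ((p - 1) / (p + 1))"
      unfolding k_def using d2 p1 by (intro powr_mono2) auto
    also have "\<dots> = l powr (p - 1)" using p1 by (simp add: powr_powr)
    finally have kl: "k \<le> l powr (p - 1)" .
    \<comment> \<open>Dropping the nonnegative term ln l N from \<psi>(l) = 0 turns the lower bound
      for l^(p - 1) into an upper bound for L.\<close>
    have "l powr (p - 1) * L \<le> l powr (p - 1) * (L + ln l * N)"
      using l N by (intro mult_left_mono) auto
    also have "\<dots> = (gnorm u)\<^sup>2" using l by (simp add: \<psi>_def)
    finally have "L \<le> (gnorm u)\<^sup>2 / l powr (p - 1)" using l1 by (simp add: field_simps)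
    also have "\<dots> \<le> (gnorm u)\<^sup>2 / k" using kl k l1 by (intro divide_left_mono) auto
    finally show ?thesis by (simp add: I_fun_eq L_def algebra_simps)
  qed
  then show thesis using k by (intro that[of "1 - 1 / k"]) auto
qed

end

section \<open>Curves in \<open>L\<^sup>2(U)\<close>\<close>

definition L2_cont :: "'a::euclidean_space set \<Rightarrow> (real \<Rightarrow> 'a \<Rightarrow> real) \<Rightarrow> bool" where
  "L2_cont U y \<longleftrightarrow> (\<forall>t\<ge>0. y t \<in> Lq 2 U) \<and>
     (\<forall>t\<ge>0. ((\<lambda>s. Lq_norm 2 U (\<lambda>x. y s x - y t x)) \<longlongrightarrow> 0) (at t within {0..}))"

text \<open>Absolute continuity of v in L2(U) with square integrable derivative z, phrased by scalar
  integrals against fixed w in place of Bochner integrals. Measurability is demanded along every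
  continuous curve y, since products such as (z, v) will be integrated.\<close>

definition L2_curve :: "'a::euclidean_space set \<Rightarrow> (real \<Rightarrow> 'a \<Rightarrow> real) \<Rightarrow> (real \<Rightarrow> 'a \<Rightarrow> real) \<Rightarrow> bool" where
  "L2_curve U v z \<longleftrightarrow> L2_cont U v \<and> (\<forall>t\<ge>0. z t \<in> Lq 2 U) \<and>
     (\<forall>y. L2_cont U y \<longrightarrow> (\<lambda>t. L2_inner U (z t) (y t)) \<in> borel_measurable (lebesgue_on {0..})) \<and>
     (\<lambda>t. (Lq_norm 2 U (z t))\<^sup>2) absolutely_integrable_on {0..} \<and>
     (\<forall>w\<in>Lq 2 U. \<forall>s\<ge>0. \<forall>t\<ge>s.
        ((\<lambda>r. L2_inner U (z r) w) has_integral (L2_inner U (v t) w - L2_inner U (v s) w)) {s..t})"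

lemma L2_cont_Lq_2: "L2_cont U y \<Longrightarrow> 0 \<le> t \<Longrightarrow> y t \<in> Lq 2 U"
  by (simp add: L2_cont_def)

lemma L2_cont_const: "w \<in> Lq 2 U \<Longrightarrow> L2_cont U (\<lambda>_. w)"
  by (simp add: L2_cont_def Lq_norm_def)

lemma L2_cont_sequentially:
  assumes "L2_cont U y" "0 \<le> t" "\<And>n. 0 \<le> X n" "X \<longlonglongrightarrow> t"
  shows "(\<lambda>n::nat. Lq_norm 2 U (\<lambda>x. y (X n) x - y t x)) \<longlonglongrightarrow> 0"
proof -
  have "continuous (at t within {0..}) (\<lambda>s. Lq_norm 2 U (\<lambda>x. y s x - y t x))"
    using assms(1,2) by (simp add: continuous_within L2_cont_def)
  then have "(\<lambda>n. Lq_norm 2 U (\<lambda>x. y (X n) x - y t x)) \<longlonglongrightarrow> Lq_norm 2 U (\<lambda>x. y t x - y t x)"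
    using assms(3,4) by (auto simp: continuous_within_sequentially o_def)
  then show ?thesis by (simp add:)
qed

lemma L2_cont_inner:
  assumes "L2_cont U y" "L2_cont U w"
  shows "continuous_on {0..} (\<lambda>t. L2_inner U (y t) (w t))"
  unfolding continuous_on_sequentially
proof (intro allI ballI impI)
  fix X :: "nat \<Rightarrow> real" and t assume "t \<in> {0..}" "(\<forall>n. X n \<in> {0..}) \<and> X \<longlonglongrightarrow> t"
  then have t: "0 \<le> t" "\<And>n. 0 \<le> X n" "X \<longlonglongrightarrow> t" by auto
  show "((\<lambda>t. L2_inner U (y t) (w t)) \<circ> X) \<longlonglongrightarrow> L2_inner U (y t) (w t)"
    unfolding o_def
    by (rule Lq_norm_2_diff_tendsto_sum) (use assms t in \<open>auto intro: L2_cont_Lq_2 L2_cont_sequentially\<close>)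
qed

lemma L2_curve_cont: "L2_curve U v z \<Longrightarrow> L2_cont U v"
  by (simp add: L2_curve_def)

lemma L2_curve_Lq_2: "L2_curve U v z \<Longrightarrow> 0 \<le> t \<Longrightarrow> v t \<in> Lq 2 U \<and> z t \<in> Lq 2 U"
  by (simp add: L2_curve_def L2_cont_def)

lemma L2_curve_sq_integrable:
  "L2_curve U v z \<Longrightarrow> 0 \<le> s \<Longrightarrow> (\<lambda>t. (Lq_norm 2 U (z t))\<^sup>2) integrable_on {s..t}"
  by (intro set_lebesgue_integral_eq_integral(1) absolutely_integrable_on_subinterval[where S="{0..}"])
    (auto simp: L2_curve_def)

lemma L2_curve_inner_integrable:
  assumes v: "L2_curve U v z" and y: "L2_cont U y" and s: "0 \<le> s"
  shows "(\<lambda>r. L2_inner U (z r) (y r)) integrable_on {s..t}"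
proof (rule measurable_bounded_by_integrable_imp_integrable)
  have "(\<lambda>t. L2_inner U (z t) (y t)) \<in> borel_measurable (lebesgue_on {0..})"
    using v y by (simp add: L2_curve_def)
  then show "(\<lambda>t. L2_inner U (z t) (y t)) \<in> borel_measurable (lebesgue_on {s..t})"
    by (rule measurable_restrict_mono) (use s in auto)
  show "(\<lambda>r. (Lq_norm 2 U (z r))\<^sup>2 + L2_inner U (y r) (y r)) integrable_on {s..t}"
  proof (rule integrable_add)
    show "(\<lambda>r. L2_inner U (y r) (y r)) integrable_on {s..t}"
      by (rule integrable_continuous_real, rule continuous_on_subset[OF L2_cont_inner[OF y y]]) (use s in auto)
  qed (rule L2_curve_sq_integrable[OF v s])
  fix r assume "r \<in> {s..t}"
  then have r: "z r \<in> Lq 2 U" "y r \<in> Lq 2 U" using L2_curve_Lq_2[OF v] y s by (auto simp: L2_cont_def)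
  have "norm (L2_inner U (z r) (y r)) \<le> Lq_norm 2 U (z r) * Lq_norm 2 U (y r)"
    using L2_Cauchy_Schwarz[OF r] by simp
  moreover have "2 * Lq_norm 2 U (z r) * Lq_norm 2 U (y r) \<le> (Lq_norm 2 U (z r))\<^sup>2 + (Lq_norm 2 U (y r))\<^sup>2"
    by (rule sum_squares_bound)
  moreover have "0 \<le> Lq_norm 2 U (z r) * Lq_norm 2 U (y r)" by simp
  ultimately show "norm (L2_inner U (z r) (y r)) \<le> (Lq_norm 2 U (z r))\<^sup>2 + L2_inner U (y r) (y r)"
    unfolding Lq_norm_2_sq[of U "y r", symmetric] by linarith
qed simp

lemma mult_le_weighted_squares:
  fixes a b h :: real
  assumes "h > 0" shows "a * b \<le> h / 2 * a\<^sup>2 + b\<^sup>2 / (2 * h)"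
proof -
  have "0 \<le> (h * a - b)\<^sup>2 / (2 * h)" using assms by simp
  also have "\<dots> = h / 2 * a\<^sup>2 + b\<^sup>2 / (2 * h) - a * b"
    using assms by (simp add: field_simps power2_eq_square)
  finally show ?thesis by simp
qed

text \<open>With d = v t - v s as the fixed test element, ||d||^2 is the integral of (z, d). The
  weighted Young inequality bounds it by half the right side plus ||d||^2 / 2.\<close>

lemma L2_curve_increment:
  assumes v: "L2_curve U v z" and s: "0 \<le> s" "s \<le> t"
  shows "(Lq_norm 2 U (\<lambda>x. v t x - v s x))\<^sup>2 \<le> (t - s) * integral {s..t} (\<lambda>r. (Lq_norm 2 U (z r))\<^sup>2)"
proof (cases "s = t")
  case False
  then have st: "t - s > 0" using s by simp
  define d where "d = (\<lambda>x. v t x - v s x)"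
  have L: "v t \<in> Lq 2 U" "v s \<in> Lq 2 U" using L2_curve_Lq_2[OF v] s by auto
  then have d: "d \<in> Lq 2 U" unfolding d_def by (rule Lq_2_diff)
  have "((\<lambda>r. L2_inner U (z r) d) has_integral (L2_inner U (v t) d - L2_inner U (v s) d)) {s..t}"
    using v d s by (simp add: L2_curve_def)
  then have hi: "((\<lambda>r. L2_inner U (z r) d) has_integral (Lq_norm 2 U d)\<^sup>2) {s..t}"
    using L2_inner_diff_left[OF L d] by (simp add: Lq_norm_2_sq d_def)
  let ?g = "\<lambda>r. (t - s) / 2 * (Lq_norm 2 U (z r))\<^sup>2 + (Lq_norm 2 U d)\<^sup>2 / (2 * (t - s))"
  have gi: "(?g has_integral (t - s) / 2 * integral {s..t} (\<lambda>r. (Lq_norm 2 U (z r))\<^sup>2)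
      + (t - s) * ((Lq_norm 2 U d)\<^sup>2 / (2 * (t - s)))) {s..t}"
    using has_integral_const_real[of "(Lq_norm 2 U d)\<^sup>2 / (2 * (t - s))" s t] s
    by (intro has_integral_add has_integral_mult_right integrable_integral L2_curve_sq_integrable[OF v]) auto
  have "(Lq_norm 2 U d)\<^sup>2 \<le> (t - s) / 2 * integral {s..t} (\<lambda>r. (Lq_norm 2 U (z r))\<^sup>2)
      + (t - s) * ((Lq_norm 2 U d)\<^sup>2 / (2 * (t - s)))"
  proof (rule has_integral_le[OF hi gi])
    fix r assume "r \<in> {s..t}"
    then have "z r \<in> Lq 2 U" using L2_curve_Lq_2[OF v] s by auto
    then have "L2_inner U (z r) d \<le> Lq_norm 2 U (z r) * Lq_norm 2 U d" using L2_Cauchy_Schwarz[OF _ d] by fastforce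
    also have "\<dots> \<le> ?g r" by (rule mult_le_weighted_squares[OF st])
    finally show "L2_inner U (z r) d \<le> ?g r" .
  qed
  also have "(t - s) * ((Lq_norm 2 U d)\<^sup>2 / (2 * (t - s))) = (Lq_norm 2 U d)\<^sup>2 / 2"
  proof -
    have "h * (a / (2 * h)) = a / 2" if "h > 0" for h a :: real using that by simp
    then show ?thesis using st by blast
  qed
  finally show ?thesis by (simp add: d_def)
qed (simp add:)

text \<open>Continuity of Q makes the increments of D of smaller order than y - x, so D has
  derivative 0 everywhere.\<close>

lemma eq_if_increments_small:
  fixes D Q :: "real \<Rightarrow> real"
  assumes ab: "a \<le> b" and Q: "continuous_on {a..b} Q"
    and inc: "\<And>x y. a \<le> x \<Longrightarrow> x \<le> y \<Longrightarrow> y \<le> b \<Longrightarrow> \<bar>D y - D x\<bar> \<le> (y - x) * (Q y - Q x)"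
  shows "D b = D a"
proof -
  have inc': "\<bar>D y - D x\<bar> \<le> \<bar>y - x\<bar> * \<bar>Q y - Q x\<bar>" if "x \<in> {a..b}" "y \<in> {a..b}" for x y
  proof (cases "x \<le> y")
    case True
    then have "(y - x) * (Q y - Q x) \<le> \<bar>y - x\<bar> * \<bar>Q y - Q x\<bar>"
      using mult_left_mono[OF abs_ge_self[of "Q y - Q x"], of "y - x"] by simp
    moreover have "\<bar>D y - D x\<bar> \<le> (y - x) * (Q y - Q x)" using that True by (intro inc) auto
    ultimately show ?thesis by (rule order_trans[rotated])
  next
    case False
    then have "(x - y) * (Q x - Q y) \<le> \<bar>y - x\<bar> * \<bar>Q y - Q x\<bar>"
      using mult_left_mono[OF abs_ge_self[of "Q x - Q y"], of "x - y"] by (simp add: abs_minus_commute[of "Q y"])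
    moreover have "\<bar>D x - D y\<bar> \<le> (x - y) * (Q x - Q y)" using that False by (intro inc) auto
    ultimately have "\<bar>D x - D y\<bar> \<le> \<bar>y - x\<bar> * \<bar>Q y - Q x\<bar>" by (rule order_trans[rotated])
    then show ?thesis by (simp only: abs_minus_commute[of "D y" "D x"])
  qed
  have "(D has_field_derivative 0) (at x within {a..b})" if x: "x \<in> {a..b}" for x
    unfolding has_field_derivative_iff
  proof (rule tendsto_0_le[where K=1])
    show "((\<lambda>y. Q y - Q x) \<longlongrightarrow> 0) (at x within {a..b})"
      using Q x by (auto simp: continuous_on_def intro!: tendsto_eq_intros)
    have "norm ((D y - D x) / (y - x)) \<le> norm (Q y - Q x) * 1" if "y \<in> {a..b}" "y \<noteq> x" for y
      using inc'[OF x that(1)] that by (simp add: divide_le_eq mult.commute)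
    then show "\<forall>\<^sub>F y in at x within {a..b}. norm ((D y - D x) / (y - x)) \<le> norm (Q y - Q x) * 1"
      by (auto simp: eventually_at_filter)
  qed
  then obtain c where "\<forall>x\<in>{a..b}. D x = c"
    using has_field_derivative_zero_constant[of "{a..b}" D] by auto
  then show ?thesis using ab by simp
qed

text \<open>D is the defect of the formula. On a short interval the identity is exact when the
  factors are frozen, and unfreezing them costs the interval length times an increment of Q, by
  \<open>L2_curve_increment\<close>; so D is constant. No regularization of the curves
  enters.\<close>

lemma L2_curve_product_rule:
  assumes v: "L2_curve U v z" and u: "L2_curve U u y" and st: "0 \<le> s" "s \<le> t"
  shows "((\<lambda>r. L2_inner U (z r) (u r) + L2_inner U (y r) (v r)) has_integral
    (L2_inner U (v t) (u t) - L2_inner U (v s) (u s))) {s..t}"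
proof -
  let ?g = "\<lambda>r. L2_inner U (z r) (u r) + L2_inner U (y r) (v r)"
  let ?q = "\<lambda>r. (Lq_norm 2 U (z r))\<^sup>2 + (Lq_norm 2 U (y r))\<^sup>2"
  have gi: "?g integrable_on {a..b}" if "0 \<le> a" for a b
    using that by (intro integrable_add L2_curve_inner_integrable[OF v] L2_curve_inner_integrable[OF u] L2_curve_cont[OF u] L2_curve_cont[OF v])
  have qi: "?q integrable_on {a..b}" if "0 \<le> a" for a b
    using that by (intro integrable_add L2_curve_sq_integrable[OF v] L2_curve_sq_integrable[OF u])
  define D where "D r = L2_inner U (v r) (u r) - integral {s..r} ?g" for r
  define Q where "Q r = integral {s..r} ?q" for r
  have "D t = D s"
  proof (rule eq_if_increments_small[OF st(2)])
    show "continuous_on {s..t} Q" unfolding Q_def by (rule indefinite_integral_continuous_1[OF qi[OF st(1)]])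
    fix a b assume ab: "s \<le> a" "a \<le> b" "b \<le> t"
    have a0: "0 \<le> a" "0 \<le> b" using ab st by auto
    have L: "v a \<in> Lq 2 U" "v b \<in> Lq 2 U" "u a \<in> Lq 2 U" "u b \<in> Lq 2 U"
      using L2_curve_Lq_2[OF v] L2_curve_Lq_2[OF u] a0 by auto
    have Qd: "Q b - Q a = integral {a..b} ?q"
      using Henstock_Kurzweil_Integration.integral_combine[OF ab(1,2) qi[OF st(1)]] by (simp add: Q_def)
    have Dd: "D b - D a = L2_inner U (v b) (u b) - L2_inner U (v a) (u a) - integral {a..b} ?g"
      using Henstock_Kurzweil_Integration.integral_combine[OF ab(1,2) gi[OF st(1)]] by (simp add: D_def)
    show "\<bar>D b - D a\<bar> \<le> (b - a) * (Q b - Q a)"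
    proof (cases "a = b")
      case False
      define h where "h = b - a"
      have h: "h > 0" using False ab by (simp add: h_def)
      define Yv where "Yv = integral {a..b} (\<lambda>r. (Lq_norm 2 U (z r))\<^sup>2)"
      define Yu where "Yu = integral {a..b} (\<lambda>r. (Lq_norm 2 U (y r))\<^sup>2)"
      have Q: "integral {a..b} ?q = Yv + Yu"
        unfolding Yv_def Yu_def using a0 by (intro integral_add L2_curve_sq_integrable[OF v] L2_curve_sq_integrable[OF u])
      \<comment> \<open>u is frozen at the right end and v at the left end, so that the two
        contributions telescope exactly.\<close>
      have 1: "((\<lambda>r. L2_inner U (z r) (u b)) has_integral (L2_inner U (v b) (u b) - L2_inner U (v a) (u b))) {a..b}"
        using v L a0 ab by (simp add: L2_curve_def)
      have 2: "((\<lambda>r. L2_inner U (y r) (v a)) has_integral (L2_inner U (u b) (v a) - L2_inner U (u a) (v a))) {a..b}"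
        using u L a0 ab by (simp add: L2_curve_def)
      have "((\<lambda>r. L2_inner U (z r) (u b) + L2_inner U (y r) (v a) - ?g r) has_integral
          (L2_inner U (v b) (u b) - L2_inner U (v a) (u b)) + (L2_inner U (u b) (v a) - L2_inner U (u a) (v a)) - integral {a..b} ?g) {a..b}"
        by (intro has_integral_diff has_integral_add 1 2 integrable_integral gi a0)
      moreover have "(L2_inner U (v b) (u b) - L2_inner U (v a) (u b)) + (L2_inner U (u b) (v a) - L2_inner U (u a) (v a)) - integral {a..b} ?g
          = D b - D a"
        unfolding Dd using L2_inner_commute[of U "u b" "v a"] L2_inner_commute[of U "u a" "v a"] by simp
      ultimately have hi: "((\<lambda>r. L2_inner U (z r) (u b) + L2_inner U (y r) (v a) - ?g r) has_integral (D b - D a)) {a..b}" by simp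
      let ?w = "\<lambda>r. h / 2 * ?q r + (h * Yu / (2 * h) + h * Yv / (2 * h))"
      have wi: "(?w has_integral h / 2 * integral {a..b} ?q + h * (h * Yu / (2 * h) + h * Yv / (2 * h))) {a..b}"
        using has_integral_const_real[of "h * Yu / (2 * h) + h * Yv / (2 * h)" a b] ab
        by (intro has_integral_add has_integral_mult_right integrable_integral qi a0) (simp add: h_def)
      have "norm (D b - D a) \<le> h / 2 * integral {a..b} ?q + h * (h * Yu / (2 * h) + h * Yv / (2 * h))"
        unfolding integral_unique[OF hi, symmetric] integral_unique[OF wi, symmetric]
      proof (rule integral_norm_bound_integral[OF has_integral_integrable[OF hi] has_integral_integrable[OF wi]])
        fix r assume r: "r \<in> {a..b}"
        then have r0: "0 \<le> r" using a0 by auto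
        have Lr: "z r \<in> Lq 2 U" "y r \<in> Lq 2 U" "u r \<in> Lq 2 U" "v r \<in> Lq 2 U"
          using L2_curve_Lq_2[OF v r0] L2_curve_Lq_2[OF u r0] by auto
        have "(Lq_norm 2 U (\<lambda>x. u b x - u r x))\<^sup>2 \<le> (b - r) * integral {r..b} (\<lambda>r. (Lq_norm 2 U (y r))\<^sup>2)"
          using r r0 by (intro L2_curve_increment[OF u]) auto
        also have "\<dots> \<le> h * Yu"
          unfolding Yu_def h_def using r r0 a0
          by (intro mult_mono integral_subset_le L2_curve_sq_integrable[OF u] integral_nonneg) auto
        finally have b1: "(Lq_norm 2 U (\<lambda>x. u b x - u r x))\<^sup>2 \<le> h * Yu" .
        have "(Lq_norm 2 U (\<lambda>x. v r x - v a x))\<^sup>2 \<le> (r - a) * integral {a..r} (\<lambda>r. (Lq_norm 2 U (z r))\<^sup>2)"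
          using r a0 by (intro L2_curve_increment[OF v]) auto
        also have "\<dots> \<le> h * Yv"
          unfolding Yv_def h_def using r r0 a0
          by (intro mult_mono integral_subset_le L2_curve_sq_integrable[OF v] integral_nonneg) auto
        finally have b2: "(Lq_norm 2 U (\<lambda>x. v a x - v r x))\<^sup>2 \<le> h * Yv"
          by (simp add: Lq_norm_2_minus[of U "v a"])
        have e: "L2_inner U (z r) (u b) + L2_inner U (y r) (v a) - ?g r
            = L2_inner U (z r) (\<lambda>x. u b x - u r x) + L2_inner U (y r) (\<lambda>x. v a x - v r x)"
          using L Lr by (simp add: L2_inner_diff_right)
        have "\<bar>L2_inner U (z r) (\<lambda>x. u b x - u r x)\<bar> \<le> Lq_norm 2 U (z r) * Lq_norm 2 U (\<lambda>x. u b x - u r x)"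
          using L Lr by (intro L2_Cauchy_Schwarz Lq_2_diff)
        also have "\<dots> \<le> h / 2 * (Lq_norm 2 U (z r))\<^sup>2 + (Lq_norm 2 U (\<lambda>x. u b x - u r x))\<^sup>2 / (2 * h)"
          by (rule mult_le_weighted_squares[OF h])
        also have "\<dots> \<le> h / 2 * (Lq_norm 2 U (z r))\<^sup>2 + h * Yu / (2 * h)"
          using b1 h by (intro add_left_mono divide_right_mono) auto
        finally have c1: "\<bar>L2_inner U (z r) (\<lambda>x. u b x - u r x)\<bar> \<le> h / 2 * (Lq_norm 2 U (z r))\<^sup>2 + h * Yu / (2 * h)" .
        have "\<bar>L2_inner U (y r) (\<lambda>x. v a x - v r x)\<bar> \<le> Lq_norm 2 U (y r) * Lq_norm 2 U (\<lambda>x. v a x - v r x)"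
          using L Lr by (intro L2_Cauchy_Schwarz Lq_2_diff)
        also have "\<dots> \<le> h / 2 * (Lq_norm 2 U (y r))\<^sup>2 + (Lq_norm 2 U (\<lambda>x. v a x - v r x))\<^sup>2 / (2 * h)"
          by (rule mult_le_weighted_squares[OF h])
        also have "\<dots> \<le> h / 2 * (Lq_norm 2 U (y r))\<^sup>2 + h * Yv / (2 * h)"
          using b2 h by (intro add_left_mono divide_right_mono) auto
        finally have c2: "\<bar>L2_inner U (y r) (\<lambda>x. v a x - v r x)\<bar> \<le> h / 2 * (Lq_norm 2 U (y r))\<^sup>2 + h * Yv / (2 * h)" .
        show "norm (L2_inner U (z r) (u b) + L2_inner U (y r) (v a) - ?g r) \<le> ?w r"
          unfolding e real_norm_def distrib_left using c1 c2 by linarith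
      qed
      also have "\<dots> = (b - a) * (Q b - Q a)"
        unfolding Qd Q using h by (simp add: h_def[symmetric] distrib_left)
      finally show ?thesis by simp
    qed simp
  qed
  then have e: "integral {s..t} ?g = L2_inner U (v t) (u t) - L2_inner U (v s) (u s)" by (simp add: D_def)
  have "(?g has_integral integral {s..t} ?g) {s..t}" by (rule integrable_integral[OF gi[OF st(1)]])
  then show ?thesis unfolding e .
qed

lemma L2_curve_const:
  assumes "w \<in> Lq 2 U" shows "L2_curve U (\<lambda>_. w) (\<lambda>_ _. 0)"
proof -
  have "Lq_norm 2 U (\<lambda>_. 0 :: real) = 0" "L2_inner U (\<lambda>_. 0 :: real) y = 0" for y :: "'a \<Rightarrow> real"
    by (simp_all add: Lq_norm_def L2_inner_def)
  then show ?thesis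
    using assms by (simp add: L2_curve_def L2_cont_const Lq_2_zero)
qed

lemma L2_curve_dist_sq:
  assumes v: "L2_curve U v z" and u: "L2_curve U u y" and st: "0 \<le> s" "s \<le> t"
  shows "((\<lambda>r. 2 * (L2_inner U (z r) (\<lambda>x. v r x - u r x) - L2_inner U (y r) (\<lambda>x. v r x - u r x))) has_integral
    ((Lq_norm 2 U (\<lambda>x. v t x - u t x))\<^sup>2 - (Lq_norm 2 U (\<lambda>x. v s x - u s x))\<^sup>2)) {s..t}"
proof -
  let ?A = "\<lambda>r. (L2_inner U (z r) (v r) + L2_inner U (z r) (v r)) - 2 * (L2_inner U (z r) (u r) + L2_inner U (y r) (v r))
      + (L2_inner U (y r) (u r) + L2_inner U (y r) (u r))"
  have hi: "(?A has_integral
    (L2_inner U (v t) (v t) - L2_inner U (v s) (v s)) - 2 * (L2_inner U (v t) (u t) - L2_inner U (v s) (u s))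
      + (L2_inner U (u t) (u t) - L2_inner U (u s) (u s))) {s..t}"
    by (intro has_integral_add has_integral_diff has_integral_mult_right
        L2_curve_product_rule[OF v v st] L2_curve_product_rule[OF v u st] L2_curve_product_rule[OF u u st])
  have L: "v r \<in> Lq 2 U" "u r \<in> Lq 2 U" "z r \<in> Lq 2 U" "y r \<in> Lq 2 U" if "0 \<le> r" for r
    using L2_curve_Lq_2[OF v that] L2_curve_Lq_2[OF u that] by auto
  have e: "(Lq_norm 2 U (\<lambda>x. v r x - u r x))\<^sup>2 = L2_inner U (v r) (v r) - 2 * L2_inner U (v r) (u r) + L2_inner U (u r) (u r)"
    if "0 \<le> r" for r using Lq_norm_2_diff_sq[OF L(1)[OF that] L(2)[OF that]] by (simp add: Lq_norm_2_sq)
  have "(Lq_norm 2 U (\<lambda>x. v t x - u t x))\<^sup>2 - (Lq_norm 2 U (\<lambda>x. v s x - u s x))\<^sup>2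
     = (L2_inner U (v t) (v t) - L2_inner U (v s) (v s)) - 2 * (L2_inner U (v t) (u t) - L2_inner U (v s) (u s))
      + (L2_inner U (u t) (u t) - L2_inner U (u s) (u s))"
    using st by (simp add: e)
  with hi have "(?A has_integral ((Lq_norm 2 U (\<lambda>x. v t x - u t x))\<^sup>2 - (Lq_norm 2 U (\<lambda>x. v s x - u s x))\<^sup>2)) {s..t}"
    by simp
  then show ?thesis
    by (rule has_integral_eq[rotated]) (use st L in \<open>simp add: L2_inner_diff_right\<close>)
qed

lemma continuous_dist_sq:
  assumes v: "L2_curve U v z" and u: "L2_curve U u y"
  shows "continuous_on {0..} (\<lambda>t. (Lq_norm 2 U (\<lambda>x. v t x - u t x))\<^sup>2)"
proof -
  have "continuous_on {0..} (\<lambda>t. L2_inner U (v t) (v t) - 2 * L2_inner U (v t) (u t) + L2_inner U (u t) (u t))"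
    by (intro continuous_intros L2_cont_inner L2_curve_cont[OF v] L2_curve_cont[OF u])
  then show ?thesis
    by (rule continuous_on_eq)
      (use L2_curve_Lq_2[OF v] L2_curve_Lq_2[OF u] in \<open>subst Lq_norm_2_diff_sq, auto simp: Lq_norm_2_sq\<close>)
qed

text \<open>The integral of \<theta> times exp (- L x) starts at 0 and is nonincreasing by
  hypothesis, so the integral is nonpositive, and then so is \<theta>.\<close>

lemma Gronwall_zero:
  fixes \<theta> :: "real \<Rightarrow> real"
  assumes c: "continuous_on {a..b} \<theta>" and L: "L \<ge> 0"
    and le: "\<And>t. a \<le> t \<Longrightarrow> t \<le> b \<Longrightarrow> \<theta> t \<le> L * integral {a..t} \<theta>"
    and t: "a \<le> t" "t \<le> b"
  shows "\<theta> t \<le> 0"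
proof -
  define Y where "Y x = exp (- L * x) * integral {a..x} \<theta>" for x
  have "Y t \<le> Y a"
  proof (rule DERIV_nonpos_imp_decreasing_open[OF t(1)])
    have "continuous_on {a..t} \<theta>" using c by (rule continuous_on_subset) (use t in auto)
    then show "continuous_on {a..t} Y"
      unfolding Y_def by (intro continuous_intros indefinite_integral_continuous_1 integrable_continuous_real)
    fix x assume x: "a < x" "x < t"
    have "((\<lambda>x. integral {a..x} \<theta>) has_real_derivative \<theta> x) (at x within {a..b})"
      using x t by (intro integral_has_real_derivative c) auto
    then have d: "((\<lambda>x. integral {a..x} \<theta>) has_real_derivative \<theta> x) (at x)"
      using x t by (simp add: at_within_Icc_at)
    have "(Y has_real_derivative (exp (- L * x) * \<theta> x + exp (- L * x) * (- L) * integral {a..x} \<theta>)) (at x)"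
      unfolding Y_def by (auto intro!: derivative_eq_intros d)
    moreover have "exp (- L * x) * \<theta> x + exp (- L * x) * (- L) * integral {a..x} \<theta> = exp (- L * x) * (\<theta> x - L * integral {a..x} \<theta>)"
      by (simp add: algebra_simps)
    moreover have "\<dots> \<le> 0" using le[of x] x t by (intro mult_nonneg_nonpos) auto
    ultimately show "\<exists>y. (Y has_real_derivative y) (at x) \<and> y \<le> 0" by metis
  qed
  then have "integral {a..t} \<theta> \<le> 0" by (simp add: Y_def mult_le_0_iff)
  then show ?thesis using le[OF t] L by (meson mult_nonneg_nonpos order_trans)
qed

text \<open>The normalized primitive of a bump on [0, 1]. Its rescaled translates give the cutoffs
  in time, and those of its derivative \<beta> give approximate unit masses.\<close>

lemma smooth_step_exists:
  obtains S \<beta> :: "real \<Rightarrow> real" where "smooth S" "\<And>x. (S has_real_derivative \<beta> x) (at x)"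
    "continuous_on UNIV \<beta>" "\<And>x. 0 \<le> \<beta> x" "\<And>x. x \<notin> {0..1} \<Longrightarrow> \<beta> x = 0" "\<And>x. x \<le> 0 \<Longrightarrow> S x = 0" "\<And>x. 1 \<le> x \<Longrightarrow> S x = 1"
    "\<And>x. 0 \<le> S x" "\<And>x. S x \<le> 1"
proof -
  define b where "b x = flat_exp 1 x * flat_exp 1 (- 1 * (x \<bullet> 1) + 1)" for x :: real
  have bk: "C_k k b" for k unfolding b_def by (intro C_k_mult C_k_flat_exp C_k_compose_inner)
  have bc: "continuous_on A b" for A using bk[of 0] continuous_on_subset by auto
  have b0: "0 \<le> b x" for x by (simp add: b_def flat_exp_1_bounds)
  have bz: "b x = 0" if "x \<notin> {0..1}" for x using that by (auto simp: b_def flat_exp_1)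
  \<comment> \<open>Integration starts at -1, so that 0 is an interior point when the primitive is
    differentiated.\<close>
  define A where "A x = integral {-1..x} b" for x
  have A0: "A x = 0" if "x \<le> 0" for x
  proof -
    have "integral {-1..x} b = integral {-1..x} (\<lambda>_. 0)"
      using that by (intro integral_cong) (auto simp: b_def flat_exp_1)
    then show ?thesis by (simp add: A_def)
  qed
  have d: "(A has_real_derivative b x) (at x)" for x
  proof (cases "x < 0")
    case True
    have "((\<lambda>_. 0) has_real_derivative 0) (at x)" by simp
    then have "(A has_real_derivative 0) (at x)"
      by (rule has_field_derivative_transform_within_open[where S="{..<0}"]) (use True A0 in auto)
    then show ?thesis using True bz[of x] by simp
  next
    case False
    have "(A has_real_derivative b x) (at x within {-1..x+1})"
      unfolding A_def using False by (intro integral_has_real_derivative bc) auto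
    then show ?thesis using False by (simp add: at_within_Icc_at)
  qed
  have mono: "A x \<le> A y" if "x \<le> y" for x y
    by (rule DERIV_nonneg_imp_nondecreasing[OF that]) (use d b0 in blast)
  obtain z where z: "0 < z" "z < 1" "A 1 - A 0 = (1 - 0) * b z"
    using MVT2[of 0 1 A b] d by auto
  have A1: "A 1 > 0" using z A0[of 0] by (simp add: b_def flat_exp_1)
  have Ac: "A x = A 1" if "1 \<le> x" for x
  proof (cases "x = 1")
    case False
    then have "1 < x" using that by simp
    then obtain z where z: "1 < z" "z < x" "A x - A 1 = (x - 1) * b z"
      using MVT2[of 1 x A b] d by blast
    then show ?thesis using bz[of z] by simp
  qed simp
  have dS: "((\<lambda>x. 1 / A 1 * A x) has_real_derivative 1 / A 1 * b x) (at x)" for x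
    by (intro DERIV_cmult d)
  show thesis
  proof (rule that[of "\<lambda>x. 1 / A 1 * A x" "\<lambda>x. 1 / A 1 * b x"])
    have Sk: "C_k (Suc k) (\<lambda>x. 1 / A 1 * A x)" for k
      by (rule C_k_real_SucI[OF dS]) (intro C_k_mult C_k_const bk)
    then show "smooth (\<lambda>x. 1 / A 1 * A x)" unfolding smooth_def using C_k_Suc_imp by blast
    show "0 \<le> 1 / A 1 * A x" for x using mono[of "min x 0" x] A0[of "min x 0"] A1 by simp
    show "1 / A 1 * A x \<le> 1" for x using mono[of x "max x 1"] Ac[of "max x 1"] A1 by simp
    show "continuous_on UNIV (\<lambda>x. 1 / A 1 * b x)" by (intro continuous_intros bc)
    show "x \<le> 0 \<Longrightarrow> 1 / A 1 * A x = 0" for x by (simp add: A0)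
    show "1 \<le> x \<Longrightarrow> 1 / A 1 * A x = 1" for x using A1 Ac[of x] by simp
    show "0 \<le> 1 / A 1 * b x" for x using A1 b0[of x] by simp
    show "x \<notin> {0..1} \<Longrightarrow> 1 / A 1 * b x = 0" for x using bz[of x] by simp
  qed (rule dS)
qed

section \<open>From the weak time derivative to a curve in L2(U)\<close>

lemma time_interval_infinity: "time_interval \<infinity> = {0<..}"
  by (auto simp: time_interval_def)

text \<open>An approximating simple function takes finitely many values, and each fixed value paired
  with y is continuous in time; the pairings with z are limits almost everywhere.\<close>

lemma strongly_measurable_inner:
  assumes z: "strongly_measurable (Lq 2 U) (Lq_norm 2 U) \<infinity> z" and y: "L2_cont U y"
  shows "(\<lambda>t. L2_inner U (z t) (y t)) \<in> borel_measurable (lebesgue_on {0<..})"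
proof -
  let ?T = "{0::real<..}"
  have T: "?T \<in> sets lebesgue" by simp
  obtain s where s: "\<And>k. simple_function (lebesgue_on ?T) (s k)" "\<And>k t. t \<in> ?T \<Longrightarrow> s k t \<in> Lq 2 U"
    and lim: "AE t in lebesgue_on ?T. (\<lambda>k::nat. Lq_norm 2 U (\<lambda>x. s k t x - z t x)) \<longlonglongrightarrow> 0"
    using z unfolding strongly_measurable_def time_interval_infinity by blast
  have zL: "z t \<in> Lq 2 U" if "t \<in> ?T" for t
    using z that unfolding strongly_measurable_def time_interval_infinity by blast
  have m: "(\<lambda>t. L2_inner U (s k t) (y t)) \<in> borel_measurable (lebesgue_on ?T)" for k
  proof (rule measurable_compose_countable'[where I="s k ` ?T" and g="s k" and f="\<lambda>h t. L2_inner U h (y t)"])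
    show "countable (s k ` ?T)"
      using simple_functionD(1)[OF s(1)] by (simp add: countable_finite)
    show "s k \<in> measurable (lebesgue_on ?T) (count_space (s k ` ?T))"
      using simple_functionD[OF s(1)[of k]] by (subst measurable_count_space_eq2) auto
    fix h assume "h \<in> s k ` ?T"
    then have "h \<in> Lq 2 U" using s(2) by auto
    then have "continuous_on ?T (\<lambda>t. L2_inner U h (y t))"
      by (intro continuous_on_subset[OF L2_cont_inner[OF L2_cont_const y]]) auto
    then show "(\<lambda>t. L2_inner U h (y t)) \<in> borel_measurable (lebesgue_on ?T)"
      by (rule continuous_imp_measurable_on_sets_lebesgue[OF _ T])
  qed
  show ?thesis
  proof (rule borel_measurable_lebesgue_on_cong_AE[OF borel_measurable_lim_metric[OF m] T])
    have "AE t in lebesgue_on ?T. t \<in> ?T" by (rule AE_I2) simp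
    with lim show "AE t in lebesgue_on ?T. lim (\<lambda>k. L2_inner U (s k t) (y t)) = L2_inner U (z t) (y t)"
    proof eventually_elim
      case (elim t)
      have "y t \<in> Lq 2 U" using y elim(2) by (simp add: L2_cont_def)
      then have "(\<lambda>k. L2_inner U (s k t) (y t)) \<longlonglongrightarrow> L2_inner U (z t) (y t)"
        using elim s(2) zL by (intro Lq_norm_2_diff_tendsto_sum) auto
      then show ?case by (rule limI)
    qed
  qed
qed

lemma integral_positive_time:
  fixes f :: "real \<Rightarrow> real"
  assumes f: "f absolutely_integrable_on {a..b}" and a: "0 < a" and 0: "\<And>x. x \<notin> {a..b} \<Longrightarrow> f x = 0"
  shows "integrable (lebesgue_on {0<..}) f" "(\<integral>x. f x \<partial>lebesgue_on {0<..}) = integral {a..b} f"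
proof -
  have e: "indicator {0<..} x * f x = indicator {a..b} x * f x" for x
    using a 0[of x] by (auto split: split_indicator)
  show "integrable (lebesgue_on {0<..}) f"
    using f by (subst integrable_restrict_space) (auto simp: e set_integrable_def)
  have "(\<integral>x. f x \<partial>lebesgue_on {0<..}) = (\<integral>x. indicator {a..b} x *\<^sub>R f x \<partial>lebesgue)"
    by (subst integral_restrict_space) (auto simp: e)
  also have "\<dots> = integral {a..b} f"
    using set_lebesgue_integral_eq_integral(2)[OF f] by (simp add: set_lebesgue_integral_def)
  finally show "(\<integral>x. f x \<partial>lebesgue_on {0<..}) = integral {a..b} f" .
qed

text \<open>The weak identity is tested with smooth approximations \<phi> n of the indicator of
  [s, t]. Their derivatives are the difference of two kernels concentrating at s and at t, which
  recover the values of the continuous function c.\<close>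

lemma weak_derivative_integral:
  fixes c Z :: "real \<Rightarrow> real"
  assumes c: "continuous_on {0..} c" and Zm: "Z \<in> borel_measurable (lebesgue_on {0<..})"
    and Zi: "\<And>a b. 0 \<le> a \<Longrightarrow> Z absolutely_integrable_on {a..b}"
    and weak: "\<And>\<phi>. test_fun {0<..} \<phi> \<Longrightarrow> (\<integral>t. deriv \<phi> t * c t \<partial>lebesgue_on {0<..}) = - (\<integral>t. \<phi> t * Z t \<partial>lebesgue_on {0<..})"
    and st: "0 < s" "s < t"
  shows "integral {s..t} Z = c t - c s"
proof -
  obtain S \<beta> :: "real \<Rightarrow> real" where S: "smooth S" and dS: "\<And>x. (S has_real_derivative \<beta> x) (at x)"
    and \<beta>c: "continuous_on UNIV \<beta>" and \<beta>0: "\<And>x. 0 \<le> \<beta> x" and \<beta>z: "\<And>x. x \<notin> {0..1} \<Longrightarrow> \<beta> x = 0"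
    and S0: "\<And>x. x \<le> 0 \<Longrightarrow> S x = 0" and S1: "\<And>x. 1 \<le> x \<Longrightarrow> S x = 1" and Sb: "\<And>x. 0 \<le> S x" "\<And>x. S x \<le> 1"
    using smooth_step_exists by metis
  define e where "e n = inverse (real (Suc n))" for n
  have e: "0 < e n" "e n \<le> 1" for n by (auto simp: e_def inverse_le_1_iff simp del: of_nat_Suc)
  have elim: "e \<longlonglongrightarrow> 0" unfolding e_def by (rule LIMSEQ_inverse_real_of_nat)
  \<comment> \<open>A nonnegative kernel of mass 1 supported in [a, a + e n].\<close>
  define K where "K n a x = \<beta> ((x - a) / e n) / e n" for n a x
  have Kd: "((\<lambda>x. S ((x - a) / e n)) has_real_derivative K n a x) (at x)" for n a x
  proof -
    have "((\<lambda>x. (x - a) / e n) has_real_derivative 1 / e n) (at x)"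
      using e[of n] by (auto intro!: derivative_eq_intros)
    from DERIV_chain2[OF dS this] show ?thesis by (simp add: K_def)
  qed
  have Kc: "continuous_on A (K n a)" for A n a
    unfolding K_def using e[of n] by (intro continuous_intros continuous_on_compose2[OF \<beta>c]) auto
  have K0: "0 \<le> K n a x" for n a x using \<beta>0 e[of n] by (simp add: K_def)
  have Kz: "K n a x = 0" if "x \<notin> {a..a + e n}" for n a x
  proof -
    have "(x - a) / e n \<notin> {0..1}" using that e[of n] by (auto simp: field_simps)
    then show ?thesis using \<beta>z by (simp add: K_def)
  qed
  \<comment> \<open>It rises just after s and falls just after t, so the support starts at s and
    stays within positive times.\<close>
  define \<phi> where "\<phi> n x = S ((x - s) / e n) - S ((x - t) / e n)" for n x
  have \<phi>z: "\<phi> n x = 0" if "x \<notin> {s..t + e n}" for n x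
  proof (cases "x < s")
    case True
    then show ?thesis using st e[of n] by (simp add: \<phi>_def S0 divide_nonpos_pos)
  next
    case False
    then have x: "x > t + e n" using that by auto
    then have "1 \<le> (x - s) / e n" "1 \<le> (x - t) / e n" using st e[of n] by (auto simp: field_simps)
    then show ?thesis by (simp add: \<phi>_def S1)
  qed
  have test: "test_fun {0<..} (\<phi> n)" for n
  proof -
    have sub: "closure {x. \<phi> n x \<noteq> 0} \<subseteq> {s..t + e n}"
      by (intro closure_minimal subsetI) (use \<phi>z in \<open>blast, simp\<close>)
    have "compact ({s..t + e n} \<inter> closure {x. \<phi> n x \<noteq> 0})" by (intro compact_Int_closed) auto
    with sub have "compact (closure {x. \<phi> n x \<noteq> 0})" by (simp add: inf.absorb2)
    moreover have "smooth (\<phi> n)"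
    proof -
      have "C_k k (\<lambda>x. S (1 / e n * (x \<bullet> 1) + - s / e n) + (-1) * S (1 / e n * (x \<bullet> 1) + - t / e n))" for k
        using S by (intro C_k_add C_k_mult C_k_const C_k_compose_inner) (auto simp: smooth_def)
      moreover have "\<phi> n = (\<lambda>x. S (1 / e n * (x \<bullet> 1) + - s / e n) + (-1) * S (1 / e n * (x \<bullet> 1) + - t / e n))"
        by (simp add: \<phi>_def fun_eq_iff diff_divide_distrib)
      ultimately have "C_k k (\<phi> n)" for k by (simp only:)
      then show ?thesis by (simp add: smooth_def)
    qed
    ultimately show ?thesis using sub st by (auto simp: test_fun_def)
  qed
  have d\<phi>: "deriv (\<phi> n) x = K n s x - K n t x" for n x
    unfolding \<phi>_def[abs_def] by (intro DERIV_imp_deriv DERIV_diff Kd)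
  have A: "integrable (lebesgue_on {0<..}) (\<lambda>x. K n a x * c x)"
    "(\<integral>x. K n a x * c x \<partial>lebesgue_on {0<..}) = integral {a..a + e n} (\<lambda>x. K n a x * c x)" if "0 < a" for n a
  proof -
    have "continuous_on {a..a + e n} (\<lambda>x. K n a x * c x)"
      using that by (intro continuous_intros Kc continuous_on_subset[OF c]) auto
    then have "(\<lambda>x. K n a x * c x) absolutely_integrable_on {a..a + e n}"
      by (rule absolutely_integrable_continuous_real)
    from integral_positive_time[OF this that] Kz
    show "integrable (lebesgue_on {0<..}) (\<lambda>x. K n a x * c x)"
      "(\<integral>x. K n a x * c x \<partial>lebesgue_on {0<..}) = integral {a..a + e n} (\<lambda>x. K n a x * c x)" by auto
  qed
  have Alim: "(\<lambda>n. \<integral>x. K n a x * c x \<partial>lebesgue_on {0<..}) \<longlonglongrightarrow> c a" if a: "0 < a" for a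
  proof (rule LIMSEQ_I)
    fix \<eta> :: real assume \<eta>: "0 < \<eta>"
    obtain d where d: "d > 0" "\<And>x. x \<in> {0..} \<Longrightarrow> dist x a < d \<Longrightarrow> dist (c x) (c a) < \<eta> / 2"
      using c a \<eta> unfolding continuous_on_iff by (metis atLeast_iff half_gt_zero less_imp_le)
    obtain N where N: "\<And>n. N \<le> n \<Longrightarrow> norm (e n - 0) < d" using LIMSEQ_D[OF elim d(1)] by blast
    have "norm ((\<integral>x. K n a x * c x \<partial>lebesgue_on {0<..}) - c a) < \<eta>" if n: "N \<le> n" for n
    proof -
      have ed: "e n < d" using N[OF n] by simp
      have K1: "(K n a has_integral 1) {a..a + e n}"
      proof -
        have "(K n a has_integral S ((a + e n - a) / e n) - S ((a - a) / e n)) {a..a + e n}"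
          using e[of n] Kd[of a n]
          by (intro fundamental_theorem_of_calculus)
            (auto simp: has_real_derivative_iff_has_vector_derivative intro: has_vector_derivative_at_within)
        then show ?thesis using e[of n] by (simp add: S0 S1)
      qed
      have ci: "continuous_on {a..a + e n} (\<lambda>x. K n a x * c x)"
        using a by (intro continuous_intros Kc continuous_on_subset[OF c]) auto
      have "((\<lambda>x. K n a x * c x - K n a x * c a) has_integral integral {a..a + e n} (\<lambda>x. K n a x * c x) - 1 * c a) {a..a + e n}"
        by (intro has_integral_diff integrable_integral integrable_continuous_real ci has_integral_mult_left K1)
      then have hi: "((\<lambda>x. K n a x * (c x - c a)) has_integral integral {a..a + e n} (\<lambda>x. K n a x * c x) - c a) {a..a + e n}"
        by (simp add: right_diff_distrib)
      have hk: "((\<lambda>x. K n a x * (\<eta> / 2)) has_integral 1 * (\<eta> / 2)) {a..a + e n}"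
        by (rule has_integral_mult_left[OF K1])
      have "norm (integral {a..a + e n} (\<lambda>x. K n a x * c x) - c a) \<le> 1 * (\<eta> / 2)"
        unfolding integral_unique[OF hi, symmetric] integral_unique[OF hk, symmetric]
      proof (rule integral_norm_bound_integral[OF has_integral_integrable[OF hi] has_integral_integrable[OF hk]])
        fix x assume "x \<in> {a..a + e n}"
        then have "\<bar>c x - c a\<bar> \<le> \<eta> / 2" using d(2)[of x] a ed by (auto simp: dist_real_def)
        then have "K n a x * \<bar>c x - c a\<bar> \<le> K n a x * (\<eta> / 2)" using K0 by (rule mult_left_mono)
        then show "norm (K n a x * (c x - c a)) \<le> K n a x * (\<eta> / 2)"
          using K0[of n a x] by (simp add: abs_mult)
      qed
      then show ?thesis using A(2)[OF a] \<eta> by simp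
    qed
    then show "\<exists>N. \<forall>n\<ge>N. norm ((\<integral>x. K n a x * c x \<partial>lebesgue_on {0<..}) - c a) < \<eta>" by blast
  qed
  have lhs: "(\<lambda>n. \<integral>x. deriv (\<phi> n) x * c x \<partial>lebesgue_on {0<..}) \<longlonglongrightarrow> c s - c t"
  proof -
    have "(\<integral>x. deriv (\<phi> n) x * c x \<partial>lebesgue_on {0<..})
        = (\<integral>x. K n s x * c x \<partial>lebesgue_on {0<..}) - (\<integral>x. K n t x * c x \<partial>lebesgue_on {0<..})" for n
      unfolding d\<phi> left_diff_distrib using A(1)[of s n] A(1)[of t n] st by (intro Bochner_Integration.integral_diff) auto
    then show ?thesis using Alim[of s] Alim[of t] st by (simp add: tendsto_diff)
  qed
  have "(\<lambda>n. \<integral>x. \<phi> n x * Z x \<partial>lebesgue_on {0<..}) \<longlonglongrightarrow> (\<integral>x. indicator {s..t} x * Z x \<partial>lebesgue_on {0<..})"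
  proof (rule integral_dominated_convergence[where w="\<lambda>x. indicator {s..t + 1} x * \<bar>Z x\<bar>"])
    show "(\<lambda>x. indicator {s..t} x * Z x) \<in> borel_measurable (lebesgue_on {0<..})"
      using Zm st by (intro borel_measurable_times borel_measurable_indicator) (auto simp: sets_restrict_space_iff)
    show "(\<lambda>x. \<phi> n x * Z x) \<in> borel_measurable (lebesgue_on {0<..})" for n
    proof -
      have "\<phi> n \<in> borel_measurable (lebesgue_on {0<..})"
        by (intro measurable_restrict_space1 measurable_completion) (use test_fun_measurable[OF test] in simp)
      then show ?thesis using Zm by (rule borel_measurable_times)
    qed
    show "integrable (lebesgue_on {0<..}) (\<lambda>x. indicator {s..t + 1} x * \<bar>Z x\<bar>)"
    proof (rule integral_positive_time(1)[OF _ st(1)])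
      have "(\<lambda>x. \<bar>Z x\<bar>) absolutely_integrable_on {s..t + 1}"
        using Zi[of s "t + 1"] st absolutely_integrable_abs by fastforce
      then show "(\<lambda>x. indicator {s..t + 1} x * \<bar>Z x\<bar>) absolutely_integrable_on {s..t + 1}"
        by (simp add: set_integrable_def mult.assoc[symmetric] indicator_inter_arith[symmetric])
    qed auto
    \<comment> \<open>At x = s all \<phi> n vanish while the indicator is 1; at x = t the limit is
      1, as it should be.\<close>
    have "(\<lambda>n. \<phi> n x * Z x) \<longlonglongrightarrow> indicator {s..t} x * Z x" if x: "x \<noteq> s" for x
    proof -
      have step: "(\<lambda>n. S ((x - a) / e n)) \<longlonglongrightarrow> (if a < x then 1 else 0)" for a
      proof (cases "a < x")
        case True
        have "eventually (\<lambda>n. e n < x - a) sequentially"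
          using order_tendstoD(2)[OF elim, of "x - a"] True by simp
        then have "eventually (\<lambda>n. S ((x - a) / e n) = 1) sequentially"
          by eventually_elim (use e in \<open>auto intro!: S1 simp: field_simps less_imp_le\<close>)
        then show ?thesis using True by (auto intro: tendsto_eventually)
      next
        case False
        then have "S ((x - a) / e n) = 0" for n using e[of n] by (intro S0) (simp add: divide_nonpos_pos)
        then show ?thesis using False by simp
      qed
      have "(\<lambda>n. \<phi> n x) \<longlonglongrightarrow> (if s < x then 1 else 0) - (if t < x then 1 else 0)"
        unfolding \<phi>_def by (intro tendsto_diff step)
      also have "(if s < x then 1 else 0) - (if t < x then 1 else 0) = (indicator {s..t} x :: real)"
        using x st by (auto split: split_indicator)
      finally show ?thesis by (intro tendsto_mult tendsto_const)
    qed
    moreover have "AE x in lebesgue_on {0<..}. x \<noteq> s"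
      using AE_completion[OF AE_lborel_singleton[of s]]
      by (subst AE_restrict_space_iff) (auto elim: eventually_mono)
    ultimately show "AE x in lebesgue_on {0<..}. (\<lambda>n. \<phi> n x * Z x) \<longlonglongrightarrow> indicator {s..t} x * Z x"
      by (auto elim: eventually_mono)
    show "AE x in lebesgue_on {0<..}. norm (\<phi> n x * Z x) \<le> indicator {s..t + 1} x * \<bar>Z x\<bar>" for n
    proof (rule always_eventually, rule allI)
      fix x
      show "norm (\<phi> n x * Z x) \<le> indicator {s..t + 1} x * \<bar>Z x\<bar>"
      proof (cases "x \<in> {s..t + 1}")
        case True
        have "\<bar>\<phi> n x\<bar> \<le> 1"
          using Sb(1)[of "(x - s) / e n"] Sb(2)[of "(x - s) / e n"] Sb(1)[of "(x - t) / e n"] Sb(2)[of "(x - t) / e n"]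
          by (simp add: \<phi>_def abs_le_iff)
        then show ?thesis using True by (simp add: abs_mult mult_left_le_one_le)
      next
        case False
        then have "\<phi> n x = 0" using e[of n] by (intro \<phi>z) auto
        then show ?thesis by simp
      qed
    qed
  qed
  moreover have "(\<integral>x. indicator {s..t} x * Z x \<partial>lebesgue_on {0<..}) = integral {s..t} Z"
  proof -
    have "(\<lambda>x. indicator {s..t} x * Z x) absolutely_integrable_on {s..t}"
      using Zi[of s t] st by (simp add: set_integrable_def mult.assoc[symmetric] indicator_inter_arith[symmetric])
    then have "(\<integral>x. indicator {s..t} x * Z x \<partial>lebesgue_on {0<..}) = integral {s..t} (\<lambda>x. indicator {s..t} x * Z x)"
      using st by (intro integral_positive_time(2)) auto
    also have "\<dots> = integral {s..t} Z" by (intro integral_cong) auto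
    finally show ?thesis .
  qed
  ultimately have "(\<lambda>n. - (\<integral>x. deriv (\<phi> n) x * c x \<partial>lebesgue_on {0<..})) \<longlonglongrightarrow> integral {s..t} Z"
    using weak[OF test] by simp
  then have "integral {s..t} Z = - (c s - c t)"
    using tendsto_minus[OF lhs] by (rule LIMSEQ_unique)
  then show ?thesis by simp
qed

text \<open>The solution concept prescribes z only for positive times, hence the value 0 elsewhere.
  The integral identity is first obtained for 0 < s and extended to s = 0 by continuity of both
  sides.\<close>

lemma weak_solution_L2_curve:
  assumes v: "L2_cont U v" and z: "in_L2_time (Lq 2 U) (Lq_norm 2 U) \<infinity> z" and w: "is_weak_time_deriv U \<infinity> v z"
  shows "L2_curve U v (\<lambda>t. if 0 < t then z t else (\<lambda>_. 0))"
proof -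
  let ?z = "\<lambda>t. if 0 < t then z t else (\<lambda>_. 0)"
  have zm: "strongly_measurable (Lq 2 U) (Lq_norm 2 U) \<infinity> z"
    and zi: "integrable (lebesgue_on {0<..}) (\<lambda>t. (Lq_norm 2 U (z t))\<^sup>2)"
    using z by (simp_all add: in_L2_time_def time_interval_infinity)
  have zL: "?z t \<in> Lq 2 U" for t
    using zm by (simp add: strongly_measurable_def time_interval_infinity Lq_2_zero)
  have I0: "L2_inner U (\<lambda>_. 0 :: real) y = 0" for y by (simp add: L2_inner_def)
  have m: "(\<lambda>t. L2_inner U (?z t) (y t)) \<in> borel_measurable (lebesgue_on {0..})" if "L2_cont U y" for y
  proof -
    have "(\<lambda>t. if t \<in> {0<..} then L2_inner U (z t) (y t) else 0) \<in> borel_measurable lebesgue"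
      by (rule borel_measurable_if_I[OF strongly_measurable_inner[OF zm that]]) simp
    also have "(\<lambda>t. if t \<in> {0<..} then L2_inner U (z t) (y t) else 0) = (\<lambda>t. L2_inner U (?z t) (y t))"
      by (auto simp: fun_eq_iff I0)
    finally show ?thesis by (rule measurable_restrict_space1)
  qed
  have sq: "(\<lambda>t. (Lq_norm 2 U (?z t))\<^sup>2) absolutely_integrable_on {0..}"
  proof -
    have "integrable lebesgue (\<lambda>t. indicator {0<..} t *\<^sub>R (Lq_norm 2 U (z t))\<^sup>2)"
      using zi by (subst (asm) integrable_restrict_space) auto
    also have "(\<lambda>t. indicator {0<..} t *\<^sub>R (Lq_norm 2 U (z t))\<^sup>2) = (\<lambda>t. indicator {0..} t *\<^sub>R (Lq_norm 2 U (?z t))\<^sup>2)"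
      by (auto simp: fun_eq_iff split: split_indicator)
    finally show ?thesis by (simp add: set_integrable_def)
  qed
  have "((\<lambda>r. L2_inner U (?z r) w) has_integral (L2_inner U (v t) w - L2_inner U (v s) w)) {s..t}"
    if wL: "w \<in> Lq 2 U" and st: "0 \<le> s" "s \<le> t" for w s t
  proof -
    let ?Z = "\<lambda>r. L2_inner U (?z r) w" and ?c = "\<lambda>r. L2_inner U (v r) w"
    have c: "continuous_on {0..} ?c" by (rule L2_cont_inner[OF v L2_cont_const[OF wL]])
    have Zi: "?Z absolutely_integrable_on {a..b}" if "0 \<le> a" for a b
    proof (rule measurable_bounded_by_integrable_imp_absolutely_integrable)
      show "?Z \<in> borel_measurable (lebesgue_on {a..b})"
        by (rule measurable_restrict_mono[OF m[OF L2_cont_const[OF wL]]]) (use that in auto)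
      have "(\<lambda>t. (Lq_norm 2 U (?z t))\<^sup>2) absolutely_integrable_on {a..b}"
        by (rule absolutely_integrable_on_subinterval[OF sq]) (use that in auto)
      then show "(\<lambda>r. (Lq_norm 2 U (?z r))\<^sup>2 + (Lq_norm 2 U w)\<^sup>2) integrable_on {a..b}"
        by (intro integrable_add set_lebesgue_integral_eq_integral(1)) auto
      fix r
      have "norm (?Z r) \<le> Lq_norm 2 U (?z r) * Lq_norm 2 U w"
        using L2_Cauchy_Schwarz[OF zL wL] by simp
      moreover have "2 * Lq_norm 2 U (?z r) * Lq_norm 2 U w \<le> (Lq_norm 2 U (?z r))\<^sup>2 + (Lq_norm 2 U w)\<^sup>2"
        by (rule sum_squares_bound)
      moreover have "0 \<le> Lq_norm 2 U (?z r) * Lq_norm 2 U w" by simp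
      ultimately show "norm (?Z r) \<le> (Lq_norm 2 U (?z r))\<^sup>2 + (Lq_norm 2 U w)\<^sup>2" by linarith
    qed simp
    have pos: "integral {a..b} ?Z = ?c b - ?c a" if ab: "0 < a" "a \<le> b" for a b
    proof (cases "a = b")
      case False
      show ?thesis
      proof (rule weak_derivative_integral[OF c _ Zi])
        show "?Z \<in> borel_measurable (lebesgue_on {0<..})"
          by (rule measurable_restrict_mono[OF m[OF L2_cont_const[OF wL]]]) auto
        fix \<phi> assume "test_fun {0::real<..} \<phi>"
        then have "(\<integral>t. deriv \<phi> t * ?c t \<partial>lebesgue_on {0<..}) = - (\<integral>t. \<phi> t * L2_inner U (z t) w \<partial>lebesgue_on {0<..})"
          using w wL by (simp add: is_weak_time_deriv_def time_interval_infinity)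
        also have "(\<integral>t. \<phi> t * L2_inner U (z t) w \<partial>lebesgue_on {0<..}) = (\<integral>t. \<phi> t * ?Z t \<partial>lebesgue_on {0<..})"
          by (intro Bochner_Integration.integral_cong) auto
        finally show "(\<integral>t. deriv \<phi> t * ?c t \<partial>lebesgue_on {0<..}) = - (\<integral>t. \<phi> t * ?Z t \<partial>lebesgue_on {0<..})" .
      qed (use ab False in auto)
    qed simp
    have Zint: "?Z integrable_on {a..b}" if "0 \<le> a" for a b
      using set_lebesgue_integral_eq_integral(1)[OF Zi[OF that]] .
    have "integral {s..t} ?Z = ?c t - ?c s"
    proof (cases "0 < s")
      case True
      then show ?thesis using pos st by simp
    next
      case False
      then have s0: "s = 0" using st by simp
      show ?thesis
      proof (cases "t = 0")
        case False
        then have t: "0 < t" using st by simp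
        have lim1: "((\<lambda>r. integral {r..t} ?Z) \<longlongrightarrow> integral {0..t} ?Z) (at 0 within {0..t})"
          using indefinite_integral_continuous_1'[OF Zint[of 0 t]] t by (simp add: continuous_on_def)
        have lim2: "((\<lambda>r. ?c t - ?c r) \<longlongrightarrow> ?c t - ?c 0) (at 0 within {0..t})"
          using continuous_on_subset[OF c, of "{0..t}"] t by (intro tendsto_diff tendsto_const) (auto simp: continuous_on_def)
        have "eventually (\<lambda>r. integral {r..t} ?Z = ?c t - ?c r) (at 0 within {0..t})"
          using pos by (auto simp: eventually_at_filter)
        from tendsto_cong[OF this] lim1 have lim3: "((\<lambda>r. ?c t - ?c r) \<longlongrightarrow> integral {0..t} ?Z) (at 0 within {0..t})" by simp
        have "at 0 within {0..t} \<noteq> bot" using t by (simp add: at_within_Icc_at_right)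
        then have "integral {0..t} ?Z = ?c t - ?c 0" using lim3 lim2 by (rule tendsto_unique)
        then show ?thesis using s0 by simp
      qed (use s0 in simp)
    qed
    then show ?thesis using integrable_integral[OF Zint[OF st(1), of t]] by simp
  qed
  then show ?thesis using v zL m sq by (simp add: L2_curve_def)
qed

section \<open>The energy along a solution\<close>

lemma AE_lebesgue_ex_in_open:
  fixes S :: "'a::euclidean_space set"
  assumes "AE x in lebesgue. Q x" "open S" "S \<noteq> {}"
  shows "\<exists>x\<in>S. Q x"
proof (rule ccontr)
  assume "\<not> (\<exists>x\<in>S. Q x)"
  then have "S \<subseteq> {x \<in> space lebesgue. \<not> Q x}" by auto
  moreover have "negligible {x \<in> space lebesgue. \<not> Q x}"
    using assms(1) by (simp add: completion.AE_iff_null_sets negligible_iff_null_sets)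
  ultimately have "negligible S" by (rule negligible_subset[rotated])
  then show False using open_not_negligible[OF assms(2,3)] by simp
qed

lemma positive_near_obtain:
  fixes f :: "real \<Rightarrow> real"
  assumes "continuous_on {0..} f" "0 \<le> t" "0 < f t"
  obtains d where "d > 0" "\<And>s. 0 \<le> s \<Longrightarrow> \<bar>s - t\<bar> < d \<Longrightarrow> 0 < f s"
proof -
  obtain d where d: "d > 0" "\<And>s. s \<in> {0..} \<Longrightarrow> dist s t < d \<Longrightarrow> dist (f s) (f t) < f t"
    using assms unfolding continuous_on_iff by (metis atLeast_iff)
  show thesis
  proof (rule that[OF d(1)])
    fix s :: real assume "0 \<le> s" "\<bar>s - t\<bar> < d"
    then have "dist (f s) (f t) < f t" by (intro d) (auto simp: dist_real_def)
    then show "0 < f s" by (auto simp: dist_real_def abs_less_iff)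
  qed
qed

context log_heat
begin

text \<open>A weak solution as the energy argument uses it: time 0 is included, and the gradient
  bound holds at every time instead of almost every time.\<close>

definition heat_flow :: "(real \<Rightarrow> 'a \<Rightarrow> real) \<Rightarrow> (real \<Rightarrow> 'a \<Rightarrow> real) \<Rightarrow> bool" where
  "heat_flow v z \<longleftrightarrow> L2_curve U v z \<and> (\<forall>t\<ge>0. v t \<in> H01 U) \<and> (\<exists>M. \<forall>t\<ge>0. gnorm (v t) \<le> M) \<and>
     (\<forall>t>0. \<forall>w\<in>H01 U. ginner (v t) w + L2_inner U (z t) w = L2_inner U (\<lambda>x. log_src p (v t x)) w)"

text \<open>The essential bound holds at times decreasing to any given t, and lower semicontinuity
  of the gradient norm under L2 convergence transfers it to t itself.\<close>

lemma weak_solution_heat_flow: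
  assumes v0: "v0 \<in> H01 U" and v: "weak_solution p U v0 \<infinity> v"
  obtains z where "heat_flow v z"
proof -
  have T: "time_interval \<infinity> = {0<..}" "{s. 0 \<le> s \<and> ereal s < \<infinity>} = {0..}"
    by (auto simp: time_interval_def)
  have vH: "in_Linf_time (H01 U) (H1_norm U) \<infinity> v"
    and vc: "\<And>t. 0 \<le> t \<Longrightarrow> ((\<lambda>s. Lq_norm 2 U (\<lambda>x. v s x - v t x)) \<longlongrightarrow> 0) (at t within {0..})"
    and v00: "AE x in lebesgue_on U. v 0 x = v0 x"
    using v unfolding weak_solution_def T by auto
  obtain z where z: "in_L2_time (Lq 2 U) (Lq_norm 2 U) \<infinity> z" "is_weak_time_deriv U \<infinity> v z"
    and eq: "\<And>t w. 0 < t \<Longrightarrow> w \<in> H01 U \<Longrightarrow> L2_inner U (wgrad U (v t)) (wgrad U w) + L2_inner U (z t) w =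
           L2_inner U (\<lambda>x. v t x * \<bar>v t x\<bar> powr (p - 1) * ln \<bar>v t x\<bar>) w"
    using v unfolding weak_solution_def T by auto
  have H: "v t \<in> H01 U" if "0 \<le> t" for t
  proof (cases "t = 0")
    case True
    have "AE x in lebesgue_on U. v0 x = v 0 x" using v00 by eventually_elim simp
    then show ?thesis using H01_cong_AE(1)[OF v0] True by simp
  next
    case False
    then show ?thesis using vH that by (simp add: in_Linf_time_def strongly_measurable_def T)
  qed
  have cont: "L2_cont U v" using H vc by (auto simp: L2_cont_def H01_Lq_2)
  obtain C where "AE t in lebesgue_on {0<..}. H1_norm U (v t) \<le> C"
    using vH unfolding in_Linf_time_def T by blast
  then have C: "AE t in lebesgue. t \<in> {0<..} \<longrightarrow> H1_norm U (v t) \<le> C"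
    by (subst (asm) AE_restrict_space_iff) auto
  have bound: "gnorm (v t) \<le> C" if t: "0 \<le> t" for t
  proof -
    have "\<exists>s. t < s \<and> s < t + inverse (real (Suc n)) \<and> H1_norm U (v s) \<le> C" for n
      using AE_lebesgue_ex_in_open[OF C, of "{t<..<t + inverse (real (Suc n))}"] t by (auto simp del: of_nat_Suc)
    then obtain X where X: "\<And>n. t < X n" "\<And>n. X n < t + inverse (real (Suc n))" "\<And>n. H1_norm U (v (X n)) \<le> C"
      by metis
    have X0: "0 \<le> X n" for n using X(1)[of n] t by simp
    have "(\<lambda>n. t + inverse (real (Suc n))) \<longlonglongrightarrow> t + 0"
      by (intro tendsto_intros LIMSEQ_inverse_real_of_nat)
    then have "X \<longlonglongrightarrow> t"
      using X by (intro tendsto_sandwich[OF _ _ tendsto_const, of t X _ "\<lambda>n. t + inverse (real (Suc n))"])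
        (auto intro!: always_eventually less_imp_le simp del: of_nat_Suc)
    then have "(\<lambda>n. Lq_norm 2 U (\<lambda>x. v (X n) x - v t x)) \<longlonglongrightarrow> 0"
      by (intro L2_cont_sequentially[OF cont t X0])
    moreover have "gnorm (v (X n)) \<le> C" for n
    proof -
      have "gnorm (v (X n)) \<le> H1_norm U (v (X n))" by (auto simp: H1_norm_def intro!: real_le_rsqrt)
      then show ?thesis using X(3)[of n] by simp
    qed
    ultimately show ?thesis
      by (intro gnorm_lower_semicontinuous[OF H[OF t], of "\<lambda>n. v (X n)"] always_eventually allI)
        (use H X0 in \<open>auto intro: H01_H1\<close>)
  qed
  have "heat_flow v (\<lambda>t. if 0 < t then z t else (\<lambda>_. 0))"
    unfolding heat_flow_def using weak_solution_L2_curve[OF cont z] H bound eq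
    by (auto simp: log_src_def)
  then show thesis by (rule that)
qed

section \<open>Monotonicity and continuity of the energy along a flow\<close>

context
  fixes v z :: "real \<Rightarrow> 'a \<Rightarrow> real"
  assumes flow: "heat_flow v z"
begin

lemma flow_curve: "L2_curve U v z" and flow_H01: "0 \<le> t \<Longrightarrow> v t \<in> H01 U"
  and flow_eq: "0 < t \<Longrightarrow> w \<in> H01 U \<Longrightarrow> ginner (v t) w + L2_inner U (z t) w = L2_inner U (\<lambda>x. log_src p (v t x)) w"
  using flow by (auto simp: heat_flow_def)

lemma flow_bound: obtains M where "0 \<le> M" "\<And>t. 0 \<le> t \<Longrightarrow> gnorm (v t) \<le> M"
proof -
  obtain M where M: "\<And>t. 0 \<le> t \<Longrightarrow> gnorm (v t) \<le> M" using flow by (auto simp: heat_flow_def)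
  then have "0 \<le> M" using order_trans[OF Lq_norm_nonneg M[of 0]] by simp
  then show thesis using M by (rule that)
qed

lemma flow_Lq_2: "0 \<le> t \<Longrightarrow> v t \<in> Lq 2 U" "0 \<le> t \<Longrightarrow> z t \<in> Lq 2 U"
  using L2_curve_Lq_2[OF flow_curve] by auto

text \<open>Test the equation at time \<open>t\<close> with \<open>v(t) - v(s)\<close>: the term \<open>\<parallel>\<nabla>(v(t) - v(s))\<parallel>\<^sup>2 / 2\<close> lost by the
  Dirichlet energy absorbs the part of the Taylor remainder that the \<open>L\<^sup>2\<close> norm does not control.\<close>

lemma flow_energy_increment:
  obtains C where "0 \<le> C" "\<And>t s. 0 < t \<Longrightarrow> 0 \<le> s \<Longrightarrow>
    J_fun p U (v t) - J_fun p U (v s) \<le> - L2_inner U (z t) (\<lambda>x. v t x - v s x) + C * (Lq_norm 2 U (\<lambda>x. v t x - v s x))\<^sup>2"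
proof -
  obtain M where M: "0 \<le> M" "\<And>t. 0 \<le> t \<Longrightarrow> gnorm (v t) \<le> M" using flow_bound by blast
  obtain C where C: "C \<ge> 0"
    "\<And>u v. u \<in> H01 U \<Longrightarrow> v \<in> H01 U \<Longrightarrow> gnorm u \<le> M \<Longrightarrow> gnorm v \<le> M \<Longrightarrow>
      \<bar>potential u - potential v - L2_inner U (\<lambda>x. log_src p (u x)) (\<lambda>x. u x - v x)\<bar>
        \<le> (gnorm (\<lambda>x. u x - v x))\<^sup>2 / 2 + C * (Lq_norm 2 U (\<lambda>x. u x - v x))\<^sup>2"
    using M(1) by (rule potential_Taylor) (rule that)
  show thesis
  proof (rule that[OF C(1)])
    fix t s :: real assume t: "0 < t" and s: "0 \<le> s"
    let ?w = "\<lambda>x. v t x - v s x"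
    have H: "v t \<in> H01 U" "v s \<in> H01 U" using flow_H01 t s by auto
    have w: "?w \<in> H01 U" using H by (rule H01_diff)
    have "\<bar>potential (v t) - potential (v s) - L2_inner U (\<lambda>x. log_src p (v t x)) ?w\<bar>
        \<le> (gnorm ?w)\<^sup>2 / 2 + C * (Lq_norm 2 U ?w)\<^sup>2"
      using t s by (intro C(2) H M) auto
    moreover have "ginner (v t) ?w = (gnorm (v t))\<^sup>2 - ginner (v t) (v s)"
      using ginner_diff_right[OF H01_H1[OF H(1)] H01_H1[OF H(2)] H01_H1[OF H(1)]] by (simp add: Lq_norm_2_sq)
    ultimately show "J_fun p U (v t) - J_fun p U (v s) \<le> - L2_inner U (z t) ?w + C * (Lq_norm 2 U ?w)\<^sup>2"
      using flow_eq[OF t w] gnorm_diff_sq[OF H01_H1[OF H(1)] H01_H1[OF H(2)]]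
      unfolding J_fun_eq[OF H(1)] J_fun_eq[OF H(2)] abs_le_iff by argo
  qed
qed

text \<open>The gradient norms are bounded along the flow and the flow is L2 continuous, so it
  suffices that h is controlled by the L2 distance on bounded sets up to an arbitrarily small
  error.\<close>

lemma flow_functional_continuous:
  assumes h: "\<And>M \<eta>. 0 \<le> M \<Longrightarrow> 0 < \<eta> \<Longrightarrow> \<exists>C\<ge>0. \<forall>u\<in>H01 U. \<forall>w\<in>H01 U. gnorm u \<le> M \<longrightarrow> gnorm w \<le> M \<longrightarrow>
    \<bar>h u - h w\<bar> \<le> \<eta> + C * (Lq_norm 2 U (\<lambda>x. u x - w x))\<^sup>2"
  shows "continuous_on {0..} (\<lambda>t. h (v t) :: real)"
  unfolding continuous_on_def
proof (intro ballI tendstoI)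
  fix t \<epsilon> :: real assume t: "t \<in> {0..}" and \<epsilon>: "0 < \<epsilon>"
  obtain M where M: "0 \<le> M" "\<And>t. 0 \<le> t \<Longrightarrow> gnorm (v t) \<le> M" using flow_bound by blast
  obtain C where C: "C \<ge> 0" "\<forall>u\<in>H01 U. \<forall>w\<in>H01 U. gnorm u \<le> M \<longrightarrow> gnorm w \<le> M \<longrightarrow>
    \<bar>h u - h w\<bar> \<le> \<epsilon> / 2 + C * (Lq_norm 2 U (\<lambda>x. u x - w x))\<^sup>2"
    using h[OF M(1), of "\<epsilon> / 2"] \<epsilon> by auto
  have "((\<lambda>s. Lq_norm 2 U (\<lambda>x. v s x - v t x)) \<longlongrightarrow> 0) (at t within {0..})"
    using L2_curve_cont[OF flow_curve] t by (simp add: L2_cont_def)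
  then have "((\<lambda>s. C * (Lq_norm 2 U (\<lambda>x. v s x - v t x))\<^sup>2) \<longlongrightarrow> C * 0\<^sup>2) (at t within {0..})"
    by (intro tendsto_intros)
  then have "eventually (\<lambda>s. C * (Lq_norm 2 U (\<lambda>x. v s x - v t x))\<^sup>2 < \<epsilon> / 2) (at t within {0..})"
    using \<epsilon> by (intro order_tendstoD(2)) auto
  moreover have "eventually (\<lambda>s. s \<in> {0..}) (at t within {0..})" by (simp add: eventually_at_filter)
  ultimately show "eventually (\<lambda>s. dist (h (v s)) (h (v t)) < \<epsilon>) (at t within {0..})"
  proof eventually_elim
    case (elim s)
    have "\<bar>h (v s) - h (v t)\<bar> \<le> \<epsilon> / 2 + C * (Lq_norm 2 U (\<lambda>x. v s x - v t x))\<^sup>2"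
      using C(2) flow_H01 M(2) elim(2) t by auto
    then show ?case using elim(1) by (simp add: dist_real_def)
  qed
qed

lemma flow_potential_continuous: "continuous_on {0..} (\<lambda>t. potential (v t))"
proof (rule flow_functional_continuous[where h=potential])
  fix M \<eta> :: real assume "0 \<le> M" "0 < \<eta>"
  then obtain C where "C \<ge> 0"
    "\<And>u v. u \<in> H01 U \<Longrightarrow> v \<in> H01 U \<Longrightarrow> gnorm u \<le> M \<Longrightarrow> gnorm v \<le> M \<Longrightarrow>
      \<bar>potential u - potential v\<bar> \<le> \<eta> + C * (Lq_norm 2 U (\<lambda>x. u x - v x))\<^sup>2"
    by (rule potential_continuity) (rule that)
  then show "\<exists>C\<ge>0. \<forall>u\<in>H01 U. \<forall>w\<in>H01 U. gnorm u \<le> M \<longrightarrow> gnorm w \<le> M \<longrightarrow>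
    \<bar>potential u - potential w\<bar> \<le> \<eta> + C * (Lq_norm 2 U (\<lambda>x. u x - w x))\<^sup>2"
    by blast
qed

lemma flow_log_power_continuous: "continuous_on {0..} (\<lambda>t. log_power (v t))"
proof (rule flow_functional_continuous[where h=log_power])
  fix M \<eta> :: real assume "0 \<le> M" "0 < \<eta>"
  then obtain C where "C \<ge> 0"
    "\<And>u v. u \<in> H01 U \<Longrightarrow> v \<in> H01 U \<Longrightarrow> gnorm u \<le> M \<Longrightarrow> gnorm v \<le> M \<Longrightarrow>
      \<bar>log_power u - log_power v\<bar> \<le> \<eta> + C * (Lq_norm 2 U (\<lambda>x. u x - v x))\<^sup>2"
    by (rule log_power_continuity) (rule that)
  then show "\<exists>C\<ge>0. \<forall>u\<in>H01 U. \<forall>w\<in>H01 U. gnorm u \<le> M \<longrightarrow> gnorm w \<le> M \<longrightarrow>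
    \<bar>log_power u - log_power w\<bar> \<le> \<eta> + C * (Lq_norm 2 U (\<lambda>x. u x - w x))\<^sup>2"
    by blast
qed

lemma flow_AE_eq:
  assumes "0 \<le> s" "0 \<le> t" "Lq_norm 2 U (\<lambda>x. v t x - v s x) = 0"
  shows "AE x in lebesgue_on U. v s x = v t x"
  using Lq_norm_2_diff_eq_0[OF flow_Lq_2(1)[OF assms(2)] flow_Lq_2(1)[OF assms(1)] assms(3)]
  by eventually_elim simp

text \<open>If J never falls below J(v s), the increment estimate becomes (z(t), v(t) - v(s)) \<le>
  C ||v(t) - v(s)||^2. The left side is half the derivative of the squared distance, so Gronwall
  forces the distance to be 0.\<close>

lemma flow_constant_if_J_minimal:
  assumes s: "0 \<le> s" "s \<le> b" and J: "\<And>t. s < t \<Longrightarrow> t \<le> b \<Longrightarrow> J_fun p U (v s) \<le> J_fun p U (v t)"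
  shows "Lq_norm 2 U (\<lambda>x. v b x - v s x) = 0"
proof -
  obtain C where C: "0 \<le> C" "\<And>t s. 0 < t \<Longrightarrow> 0 \<le> s \<Longrightarrow>
    J_fun p U (v t) - J_fun p U (v s) \<le> - L2_inner U (z t) (\<lambda>x. v t x - v s x) + C * (Lq_norm 2 U (\<lambda>x. v t x - v s x))\<^sup>2"
    using flow_energy_increment by blast
  define \<theta> where "\<theta> t = (Lq_norm 2 U (\<lambda>x. v t x - v s x))\<^sup>2" for t
  note const = L2_curve_const[OF flow_Lq_2(1)[OF s(1)]]
  have c: "continuous_on {s..b} \<theta>"
    unfolding \<theta>_def by (rule continuous_on_subset[OF continuous_dist_sq[OF flow_curve const]]) (use s in auto)
  have "\<theta> b \<le> 0"
  proof (rule Gronwall_zero[OF c, of "2 * C"])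
    fix t assume t: "s \<le> t" "t \<le> b"
    have I0: "L2_inner U (\<lambda>_. 0 :: real) y = 0" for y by (simp add: L2_inner_def)
    have hi: "((\<lambda>r. 2 * L2_inner U (z r) (\<lambda>x. v r x - v s x)) has_integral \<theta> t) {s..t}"
      using L2_curve_dist_sq[OF flow_curve const s(1) t(1)] by (simp add: I0 \<theta>_def)
    have ti: "((\<lambda>r. 2 * C * \<theta> r) has_integral 2 * C * integral {s..t} \<theta>) {s..t}"
      by (intro has_integral_mult_right integrable_integral integrable_continuous_real continuous_on_subset[OF c]) (use t in auto)
    show "\<theta> t \<le> 2 * C * integral {s..t} \<theta>"
    proof (rule has_integral_le[OF hi ti])
      fix r assume r: "r \<in> {s..t}"
      show "2 * L2_inner U (z r) (\<lambda>x. v r x - v s x) \<le> 2 * C * \<theta> r"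
      proof (cases "r = s")
        case True
        then show ?thesis using C(1) by (simp add: L2_inner_def \<theta>_def)
      next
        case False
        then show ?thesis using C(2)[of r s] J[of r] r s t by (auto simp: \<theta>_def)
      qed
    qed
  qed (use C s in auto)
  then show ?thesis by (simp add: \<theta>_def)
qed

text \<open>The potential is continuous along the flow and the gradient norm is lower
  semicontinuous, so sublevel sets of J are closed in time.\<close>

lemma flow_J_closed:
  assumes X: "\<And>n. 0 \<le> X n" "X \<longlonglongrightarrow> t" and le: "\<And>n. J_fun p U (v (X n)) \<le> c"
  shows "J_fun p U (v t) \<le> c"
proof -
  have t: "0 \<le> t" using X LIMSEQ_le_const by blast
  have "(\<lambda>n. potential (v (X n))) \<longlonglongrightarrow> potential (v t)"
    using flow_potential_continuous X t unfolding continuous_on_sequentially by (auto simp: o_def)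
  then have lim: "(\<lambda>n. 2 * (c + potential (v (X n)))) \<longlonglongrightarrow> 2 * (c + potential (v t))"
    by (intro tendsto_intros)
  have g: "(gnorm (v (X n)))\<^sup>2 \<le> 2 * (c + potential (v (X n)))" for n
    using le[of n] by (simp add: J_fun_eq flow_H01 X)
  have "(gnorm (v t))\<^sup>2 \<le> 2 * (c + potential (v t))"
  proof (rule field_le_epsilon)
    \<comment> \<open>Lower semicontinuity takes a constant bound, whereas the bounds vary with n;
      eventually they are below their limit plus \<epsilon>.\<close>
    fix \<epsilon> :: real assume \<epsilon>: "0 < \<epsilon>"
    have ev: "eventually (\<lambda>n. 2 * (c + potential (v (X n))) < 2 * (c + potential (v t)) + \<epsilon>) sequentially"
      using \<epsilon> by (intro order_tendstoD(2)[OF lim]) simp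
    have "gnorm (v t) \<le> sqrt (2 * (c + potential (v t)) + \<epsilon>)"
    proof (rule gnorm_lower_semicontinuous[OF flow_H01[OF t], of "\<lambda>n. v (X n)"])
      show "v (X n) \<in> H1 U" for n by (rule H01_H1[OF flow_H01[OF X(1)]])
      show "(\<lambda>n. Lq_norm 2 U (\<lambda>x. v (X n) x - v t x)) \<longlonglongrightarrow> 0"
        by (rule L2_cont_sequentially[OF L2_curve_cont[OF flow_curve] t X])
      show "eventually (\<lambda>n. gnorm (v (X n)) \<le> sqrt (2 * (c + potential (v t)) + \<epsilon>)) sequentially"
        using ev
      proof eventually_elim
        case (elim n)
        then show ?case using g[of n] by (intro real_le_rsqrt) simp
      qed
    qed
    then have "(gnorm (v t))\<^sup>2 \<le> (sqrt (2 * (c + potential (v t)) + \<epsilon>))\<^sup>2" by (intro power_mono) auto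
    moreover have "0 \<le> 2 * (c + potential (v t)) + \<epsilon>"
    proof -
      have "0 \<le> 2 * (c + potential (v (X n)))" for n using order_trans[OF zero_le_power2 g[of n]] .
      then have "0 \<le> 2 * (c + potential (v t))" using lim by (intro LIMSEQ_le_const[OF lim]) auto
      then show ?thesis using \<epsilon> by simp
    qed
    ultimately show "(gnorm (v t))\<^sup>2 \<le> 2 * (c + potential (v t)) + \<epsilon>" by simp
  qed
  then show ?thesis by (simp add: J_fun_eq flow_H01 t)
qed

text \<open>By closedness there is a last time in [a, b] at which J is at most J(v a). Were b later,
  J would stay above its value at that time, so the flow would be constant from there on, and J
  would not have risen.\<close>

lemma flow_J_nonincreasing:
  assumes ab: "0 \<le> a" "a \<le> b" shows "J_fun p U (v b) \<le> J_fun p U (v a)"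
proof (rule ccontr)
  assume nle: "\<not> J_fun p U (v b) \<le> J_fun p U (v a)"
  define S where "S = {t \<in> {a..b}. J_fun p U (v t) \<le> J_fun p U (v a)}"
  have "closed S"
    unfolding closed_sequential_limits
  proof (intro allI impI)
    fix X t assume X: "(\<forall>n. X n \<in> S) \<and> X \<longlonglongrightarrow> t"
    have Xn: "X n \<in> {a..b}" "J_fun p U (v (X n)) \<le> J_fun p U (v a)" for n using X by (auto simp: S_def)
    have lim: "X \<longlonglongrightarrow> t" using X by simp
    have "t \<in> {a..b}" by (rule closed_sequentially[OF closed_atLeastAtMost _ lim]) (use Xn in auto)
    moreover have "0 \<le> X n" for n using Xn(1)[of n] ab by simp
    then have "J_fun p U (v t) \<le> J_fun p U (v a)" using lim Xn(2) by (rule flow_J_closed)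
    ultimately show "t \<in> S" by (simp add: S_def)
  qed
  moreover have "a \<in> S" "bdd_above S" using ab by (auto simp: S_def intro!: bdd_aboveI[of _ b])
  ultimately have "Sup S \<in> S" by (intro closed_contains_Sup) auto
  then have m: "a \<le> Sup S" "Sup S \<le> b" "J_fun p U (v (Sup S)) \<le> J_fun p U (v a)" by (auto simp: S_def)
  have "J_fun p U (v a) < J_fun p U (v t)" if "Sup S < t" "t \<le> b" for t
  proof (rule ccontr)
    assume "\<not> J_fun p U (v a) < J_fun p U (v t)"
    then have "t \<in> S" using that m by (simp add: S_def)
    then show False using cSup_upper[of t S] \<open>bdd_above S\<close> that by simp
  qed
  then have "Lq_norm 2 U (\<lambda>x. v b x - v (Sup S) x) = 0"
    using m ab by (intro flow_constant_if_J_minimal) (auto intro: less_imp_le order_le_less_trans)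
  then have "AE x in lebesgue_on U. v (Sup S) x = v b x" using m ab by (intro flow_AE_eq) auto
  then have "J_fun p U (v b) = J_fun p U (v (Sup S))"
    using m ab by (intro J_I_fun_cong_AE flow_H01) auto
  then show False using nle m by simp
qed

text \<open>Excludes a downward jump on arrival at t. If J exceeded J(v t) by \<epsilon> throughout
  [0, t), the increment estimate at times r < t, compared with the state at t and integrated over
  [t - h, t], would bound h \<epsilon> by h times a multiple of the integral of ||z||^2 over that
  interval, which tends to 0 with h.\<close>

lemma flow_J_left:
  assumes t: "0 < t" and \<epsilon>: "0 < \<epsilon>"
  shows "\<exists>s. 0 \<le> s \<and> s < t \<and> J_fun p U (v s) < J_fun p U (v t) + \<epsilon>"
proof (rule ccontr)
  assume "\<not> (\<exists>s. 0 \<le> s \<and> s < t \<and> J_fun p U (v s) < J_fun p U (v t) + \<epsilon>)"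
  then have J: "\<epsilon> \<le> J_fun p U (v s) - J_fun p U (v t)" if "0 \<le> s" "s < t" for s
    using that by force
  obtain C where C: "0 \<le> C" "\<And>t s. 0 < t \<Longrightarrow> 0 \<le> s \<Longrightarrow>
    J_fun p U (v t) - J_fun p U (v s) \<le> - L2_inner U (z t) (\<lambda>x. v t x - v s x) + C * (Lq_norm 2 U (\<lambda>x. v t x - v s x))\<^sup>2"
    using flow_energy_increment by blast
  define \<zeta> where "\<zeta> r = (Lq_norm 2 U (z r))\<^sup>2" for r
  have \<zeta>i: "\<zeta> integrable_on {a..b}" if "0 \<le> a" for a b
    unfolding \<zeta>_def using L2_curve_sq_integrable[OF flow_curve that] .
  note const = L2_curve_const[OF flow_Lq_2(1)[OF less_imp_le[OF t]]]
  have main: "\<epsilon> \<le> (1 / 2 + C) * integral {t - h..t} \<zeta>" if h: "0 < h" "h < t" "h \<le> 1" for h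
  proof -
    define Y where "Y = integral {t - h..t} \<zeta>"
    have Y0: "0 \<le> Y" unfolding Y_def using \<zeta>i[of "t - h" t] h by (intro integral_nonneg) (simp_all, simp add: \<zeta>_def)
    have I0: "L2_inner U (\<lambda>_. 0 :: real) y = 0" for y by (simp add: L2_inner_def)
    let ?g = "\<lambda>r. - 1 / 2 * (2 * L2_inner U (z r) (\<lambda>x. v r x - v t x)) + C * (h * Y)"
    have "((\<lambda>r. 2 * L2_inner U (z r) (\<lambda>x. v r x - v t x)) has_integral
        0 - (Lq_norm 2 U (\<lambda>x. v (t - h) x - v t x))\<^sup>2) {t - h..t}"
      using L2_curve_dist_sq[OF flow_curve const, of "t - h" t] h by (simp add: I0)
    then have gi: "(?g has_integral - 1 / 2 * (0 - (Lq_norm 2 U (\<lambda>x. v (t - h) x - v t x))\<^sup>2) + h * (C * (h * Y))) {t - h..t}"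
      using has_integral_const_real[of "C * (h * Y)" "t - h" t] h
      by (intro has_integral_add has_integral_mult_right) auto
    \<comment> \<open>The gap \<epsilon> is assumed only for r < t; the value at r = t is altered so
      that the pointwise comparison holds on the whole interval.\<close>
    have fi: "((\<lambda>r. if r = t then ?g t else \<epsilon>) has_integral h * \<epsilon>) {t - h..t}"
    proof (rule has_integral_spike_finite[of "{t}" _ _ "\<lambda>_. \<epsilon>"])
      show "((\<lambda>_. \<epsilon>) has_integral h * \<epsilon>) {t - h..t}"
        using has_integral_const_real[of \<epsilon> "t - h" t] h by simp
    qed auto
    have inc: "(Lq_norm 2 U (\<lambda>x. v r x - v t x))\<^sup>2 \<le> h * Y" if r: "r \<in> {t - h..t}" for r
    proof -
      have "(Lq_norm 2 U (\<lambda>x. v t x - v r x))\<^sup>2 \<le> (t - r) * integral {r..t} \<zeta>"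
        unfolding \<zeta>_def using r h by (intro L2_curve_increment[OF flow_curve]) auto
      also have "\<dots> \<le> h * Y"
        unfolding Y_def using r h
        by (intro mult_mono integral_subset_le \<zeta>i integral_nonneg) (auto simp: \<zeta>_def)
      finally show ?thesis by (simp add: Lq_norm_2_minus[of U "v r"])
    qed
    have "h * \<epsilon> \<le> - 1 / 2 * (0 - (Lq_norm 2 U (\<lambda>x. v (t - h) x - v t x))\<^sup>2) + h * (C * (h * Y))"
    proof (rule has_integral_le[OF fi gi])
      fix r assume r: "r \<in> {t - h..t}"
      show "(if r = t then ?g t else \<epsilon>) \<le> ?g r"
      proof (cases "r = t")
        case False
        then have r': "0 < r" "r < t" using r h by auto
        have "\<epsilon> \<le> J_fun p U (v r) - J_fun p U (v t)" using J[of r] r' by simp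
        also have "\<dots> \<le> - L2_inner U (z r) (\<lambda>x. v r x - v t x) + C * (Lq_norm 2 U (\<lambda>x. v r x - v t x))\<^sup>2"
          using r' t by (intro C(2)) auto
        also have "\<dots> \<le> - L2_inner U (z r) (\<lambda>x. v r x - v t x) + C * (h * Y)"
          using inc[OF r] C(1) by (intro add_left_mono mult_left_mono) auto
        finally show ?thesis using False by simp
      qed simp
    qed
    \<comment> \<open>h \<le> 1 is used to replace the inner factor h by 1.\<close>
    also have "\<dots> \<le> h * Y / 2 + h * (C * (1 * Y))"
      using inc[of "t - h"] h C(1) Y0 by (intro add_mono mult_left_mono mult_right_mono) auto
    also have "\<dots> = h * ((1 / 2 + C) * Y)" by (simp add: algebra_simps)
    finally show ?thesis unfolding Y_def using h by (subst (asm) mult_le_cancel_left_pos) auto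
  qed
  have "continuous_on {0..t} (\<lambda>r. integral {r..t} \<zeta>)"
    by (rule indefinite_integral_continuous_1'[OF \<zeta>i]) simp
  then have "((\<lambda>r. integral {r..t} \<zeta>) \<longlongrightarrow> integral {t..t} \<zeta>) (at t within {0..t})"
    unfolding continuous_on_def by (rule bspec) (use t in simp)
  then have "((\<lambda>r. (1 / 2 + C) * integral {r..t} \<zeta>) \<longlongrightarrow> (1 / 2 + C) * 0) (at t within {0..t})"
    by (intro tendsto_intros) simp
  then have "eventually (\<lambda>r. (1 / 2 + C) * integral {r..t} \<zeta> < \<epsilon>) (at t within {0..t})"
    using \<epsilon> by (intro order_tendstoD(2)) auto
  then obtain d where d: "d > 0" "\<And>r. r \<in> {0..t} \<Longrightarrow> r \<noteq> t \<Longrightarrow> dist r t < d \<Longrightarrow> (1 / 2 + C) * integral {r..t} \<zeta> < \<epsilon>"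
    unfolding eventually_at by auto
  define h where "h = min (min 1 (t / 2)) (d / 2)"
  have h: "0 < h" "h < t" "h \<le> 1" "h < d" using t d by (auto simp: h_def)
  then have "(1 / 2 + C) * integral {t - h..t} \<zeta> < \<epsilon>" by (intro d) (auto simp: dist_real_def)
  then show False using main[OF h(1-3)] by simp
qed

text \<open>Closed sublevel sets give the lower bound near t. The upper bound comes from
  monotonicity: after t directly, and before t starting from the point supplied by
  \<open>flow_J_left\<close>.\<close>

lemma flow_J_continuous: "continuous_on {0..} (\<lambda>t. J_fun p U (v t))"
  unfolding continuous_on_iff
proof (intro ballI allI impI)
  fix t \<epsilon> :: real assume "t \<in> {0..}" and \<epsilon>: "0 < \<epsilon>"
  then have t: "0 \<le> t" by simp
  have "\<exists>d>0. \<forall>s\<ge>0. \<bar>s - t\<bar> < d \<longrightarrow> J_fun p U (v t) - \<epsilon> < J_fun p U (v s)"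
  proof (rule ccontr)
    assume "\<not> (\<exists>d>0. \<forall>s\<ge>0. \<bar>s - t\<bar> < d \<longrightarrow> J_fun p U (v t) - \<epsilon> < J_fun p U (v s))"
    then have "\<exists>s\<ge>0. \<bar>s - t\<bar> < inverse (real (Suc n)) \<and> J_fun p U (v s) \<le> J_fun p U (v t) - \<epsilon>" for n
      by (metis inverse_positive_iff_positive of_nat_0_less_iff not_less zero_less_Suc)
    then obtain X where X: "\<And>n. 0 \<le> X n" "\<And>n. \<bar>X n - t\<bar> < inverse (real (Suc n))"
      "\<And>n. J_fun p U (v (X n)) \<le> J_fun p U (v t) - \<epsilon>" by metis
    have "(\<lambda>n. X n - t) \<longlonglongrightarrow> 0"
      using X(2) by (intro tendsto_0_le[OF LIMSEQ_inverse_real_of_nat, where K=1])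
        (auto intro!: always_eventually less_imp_le simp del: of_nat_Suc)
    then have "X \<longlonglongrightarrow> t" by (rule LIM_zero_cancel)
    from flow_J_closed[OF X(1) this X(3)] show False using \<epsilon> by simp
  qed
  then obtain d1 where d1: "d1 > 0" "\<And>s. 0 \<le> s \<Longrightarrow> \<bar>s - t\<bar> < d1 \<Longrightarrow> J_fun p U (v t) - \<epsilon> < J_fun p U (v s)"
    by blast
  obtain d2 where d2: "d2 > 0" "\<And>s. 0 \<le> s \<Longrightarrow> \<bar>s - t\<bar> < d2 \<Longrightarrow> J_fun p U (v s) < J_fun p U (v t) + \<epsilon>"
  proof (cases "t = 0")
    case True
    have "J_fun p U (v s) < J_fun p U (v t) + \<epsilon>" if "0 \<le> s" for s
      using flow_J_nonincreasing[of t s] that True \<epsilon> by simp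
    then show thesis by (intro that[of 1]) auto
  next
    case False
    then obtain s0 where s0: "0 \<le> s0" "s0 < t" "J_fun p U (v s0) < J_fun p U (v t) + \<epsilon>"
      using flow_J_left[of t \<epsilon>] t \<epsilon> by auto
    have "J_fun p U (v s) < J_fun p U (v t) + \<epsilon>" if "0 \<le> s" "\<bar>s - t\<bar> < t - s0" for s
      using flow_J_nonincreasing[of s0 s] s0 that by (auto simp: abs_less_iff)
    then show thesis using s0 by (intro that[of "t - s0"]) auto
  qed
  show "\<exists>d>0. \<forall>s\<in>{0..}. dist s t < d \<longrightarrow> dist (J_fun p U (v s)) (J_fun p U (v t)) < \<epsilon>"
  proof (intro exI[of _ "min d1 d2"] conjI ballI impI)
    fix s assume "s \<in> {0..}" "dist s t < min d1 d2"
    then have "0 \<le> s" "\<bar>s - t\<bar> < d1" "\<bar>s - t\<bar> < d2" by (auto simp: dist_real_def)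
    then show "dist (J_fun p U (v s)) (J_fun p U (v t)) < \<epsilon>"
      using d1(2)[of s] d2(2)[of s] by (simp add: dist_real_def abs_less_iff)
  qed (use d1 d2 in auto)
qed

lemma flow_gnorm_continuous: "continuous_on {0..} (\<lambda>t. (gnorm (v t))\<^sup>2)"
proof -
  have "continuous_on {0..} (\<lambda>t. 2 * (J_fun p U (v t) + potential (v t)))"
    by (intro continuous_intros flow_J_continuous flow_potential_continuous)
  then show ?thesis by (rule continuous_on_eq) (simp add: J_fun_eq flow_H01)
qed

lemma flow_I_continuous: "continuous_on {0..} (\<lambda>t. I_fun p U (v t))"
  unfolding I_fun_eq by (intro continuous_intros flow_gnorm_continuous flow_log_power_continuous)

text \<open>The equation is tested with the solution itself, which turns (z, v) into -I; time 0,
  where no equation is available, is a single point.\<close>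

lemma flow_L2_balance:
  assumes st: "0 \<le> s" "s \<le> t"
  shows "(Lq_norm 2 U (v s))\<^sup>2 - (Lq_norm 2 U (v t))\<^sup>2 = integral {s..t} (\<lambda>r. 2 * I_fun p U (v r))"
proof -
  have "((\<lambda>r. L2_inner U (z r) (v r) + L2_inner U (z r) (v r)) has_integral
    (Lq_norm 2 U (v t))\<^sup>2 - (Lq_norm 2 U (v s))\<^sup>2) {s..t}"
    unfolding Lq_norm_2_sq by (rule L2_curve_product_rule[OF flow_curve flow_curve st])
  then have "((\<lambda>r. - (2 * I_fun p U (v r))) has_integral (Lq_norm 2 U (v t))\<^sup>2 - (Lq_norm 2 U (v s))\<^sup>2) {s..t}"
  proof (rule has_integral_spike_finite[of "{0}", rotated 2])
    fix r assume "r \<in> {s..t} - {0}"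
    then have r: "0 < r" using st by auto
    have "(gnorm (v r))\<^sup>2 + L2_inner U (z r) (v r) = log_power (v r)"
      using flow_eq[OF r flow_H01[of r]] r log_src_self[of "v r"] by (simp add: Lq_norm_2_sq)
    then show "- (2 * I_fun p U (v r)) = L2_inner U (z r) (v r) + L2_inner U (z r) (v r)"
      by (simp add: I_fun_eq)
  qed simp
  from integral_unique[OF this] show ?thesis by simp
qed

end

text \<open>Subtract the equations and test with the difference: the squared gradient norm allowed
  by \<open>source_Lipschitz\<close> cancels, which leaves a Gronwall inequality for the squared L2
  distance.\<close>

lemma heat_flow_unique:
  assumes v: "heat_flow v z" and u: "heat_flow u y" and eq0: "Lq_norm 2 U (\<lambda>x. v 0 x - u 0 x) = 0" and t: "0 \<le> t"
  shows "Lq_norm 2 U (\<lambda>x. v t x - u t x) = 0"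
proof -
  obtain M1 where M1: "0 \<le> M1" "\<And>t. 0 \<le> t \<Longrightarrow> gnorm (v t) \<le> M1" using flow_bound[OF v] by blast
  obtain M2 where M2: "0 \<le> M2" "\<And>t. 0 \<le> t \<Longrightarrow> gnorm (u t) \<le> M2" using flow_bound[OF u] by blast
  have M: "0 \<le> max M1 M2" using M1 by simp
  obtain C where C: "C \<ge> 0"
    "\<And>u v. u \<in> H01 U \<Longrightarrow> v \<in> H01 U \<Longrightarrow> gnorm u \<le> max M1 M2 \<Longrightarrow> gnorm v \<le> max M1 M2 \<Longrightarrow>
      \<bar>L2_inner U (\<lambda>x. log_src p (u x)) (\<lambda>x. u x - v x) - L2_inner U (\<lambda>x. log_src p (v x)) (\<lambda>x. u x - v x)\<bar>
        \<le> (gnorm (\<lambda>x. u x - v x))\<^sup>2 + C * (Lq_norm 2 U (\<lambda>x. u x - v x))\<^sup>2"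
    using M by (rule source_Lipschitz) (rule that)
  note cv = flow_curve[OF v] and cu = flow_curve[OF u]
  define \<theta> where "\<theta> t = (Lq_norm 2 U (\<lambda>x. v t x - u t x))\<^sup>2" for t
  have c: "continuous_on {0..t} \<theta>"
    unfolding \<theta>_def by (rule continuous_on_subset[OF continuous_dist_sq[OF cv cu]]) auto
  have "\<theta> t \<le> 0"
  proof (rule Gronwall_zero[OF c, of "2 * C"])
    fix s assume s: "0 \<le> s" "s \<le> t"
    have hi: "((\<lambda>r. 2 * (L2_inner U (z r) (\<lambda>x. v r x - u r x) - L2_inner U (y r) (\<lambda>x. v r x - u r x))) has_integral \<theta> s) {0..s}"
      using L2_curve_dist_sq[OF cv cu order_refl s(1)] eq0 by (simp add: \<theta>_def)
    have ti: "((\<lambda>r. 2 * C * \<theta> r) has_integral 2 * C * integral {0..s} \<theta>) {0..s}"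
      by (intro has_integral_mult_right integrable_integral integrable_continuous_real continuous_on_subset[OF c]) (use s in auto)
    show "\<theta> s \<le> 2 * C * integral {0..s} \<theta>"
    proof (rule has_integral_le[OF hi ti])
      fix r assume r: "r \<in> {0..s}"
      let ?w = "\<lambda>x. v r x - u r x"
      have H: "v r \<in> H01 U" "u r \<in> H01 U" using r flow_H01[OF v] flow_H01[OF u] by auto
      have w: "?w \<in> H01 U" using H by (rule H01_diff)
      show "2 * (L2_inner U (z r) ?w - L2_inner U (y r) ?w) \<le> 2 * C * \<theta> r"
      proof (cases "r = 0")
        \<comment> \<open>There is no equation at time 0, but the difference vanishes there, so both
          inner products are 0.\<close>
        case True
        have L: "z r \<in> Lq 2 U" "y r \<in> Lq 2 U" using L2_curve_Lq_2[OF cv] L2_curve_Lq_2[OF cu] r by auto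
        have "\<bar>L2_inner U (z r) ?w\<bar> \<le> 0" "\<bar>L2_inner U (y r) ?w\<bar> \<le> 0"
          using L2_Cauchy_Schwarz[OF L(1) H01_Lq_2[OF w]] L2_Cauchy_Schwarz[OF L(2) H01_Lq_2[OF w]] eq0 True by simp_all
        then show ?thesis using C(1) by (simp add: \<theta>_def)
      next
        case False
        then have r0: "0 < r" using r by simp
        have "\<bar>L2_inner U (\<lambda>x. log_src p (v r x)) ?w - L2_inner U (\<lambda>x. log_src p (u r x)) ?w\<bar>
          \<le> (gnorm ?w)\<^sup>2 + C * (Lq_norm 2 U ?w)\<^sup>2"
          using M1(2)[of r] M2(2)[of r] r by (intro C(2) H) auto
        moreover have "(gnorm ?w)\<^sup>2 = ginner (v r) ?w - ginner (u r) ?w"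
          using ginner_diff_left[OF H01_H1[OF H(1)] H01_H1[OF H(2)] H01_H1[OF w]] by (simp add: Lq_norm_2_sq)
        ultimately have "L2_inner U (z r) ?w - L2_inner U (y r) ?w \<le> C * \<theta> r"
          using flow_eq[OF v r0 w] flow_eq[OF u r0 w] unfolding \<theta>_def abs_le_iff by argo
        then show ?thesis by simp
      qed
    qed
  qed (use C t in auto)
  then show ?thesis by (simp add: \<theta>_def)
qed

end

section \<open>Exponential decay\<close>

context log_heat
begin

context
  fixes v z :: "real \<Rightarrow> 'a \<Rightarrow> real"
  assumes flow: "heat_flow v z"
begin

text \<open>If J had not dropped by time t, the flow would be constant on a short initial interval,
  and so would its L2 norm, although I > 0 makes that norm decrease.\<close>

lemma flow_J_strict_decrease:
  assumes I0: "0 < I_fun p U (v 0)" and t: "0 < t"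
  shows "J_fun p U (v t) < J_fun p U (v 0)"
proof (rule ccontr)
  assume "\<not> J_fun p U (v t) < J_fun p U (v 0)"
  then have Jt: "J_fun p U (v 0) \<le> J_fun p U (v t)" by simp
  obtain d where d: "d > 0" "\<And>s. 0 \<le> s \<Longrightarrow> \<bar>s - 0\<bar> < d \<Longrightarrow> 0 < I_fun p U (v s)"
    using flow_I_continuous[OF flow] order_refl I0 by (rule positive_near_obtain) (rule that)
  define b where "b = min t (d / 2)"
  have b: "0 < b" "b \<le> t" "b < d" using d t by (auto simp: b_def)
  have "Lq_norm 2 U (\<lambda>x. v b x - v 0 x) = 0"
  proof (rule flow_constant_if_J_minimal[OF flow])
    fix s assume s: "0 < s" "s \<le> b"
    have "J_fun p U (v t) \<le> J_fun p U (v s)"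
      by (rule flow_J_nonincreasing[OF flow]) (use s b in auto)
    then show "J_fun p U (v 0) \<le> J_fun p U (v s)" using Jt by simp
  qed (use b in auto)
  then have ae: "AE x in lebesgue_on U. v 0 x = v b x" using b by (intro flow_AE_eq[OF flow]) auto
  have L: "v 0 \<in> Lq 2 U" "v b \<in> Lq 2 U" using flow_Lq_2(1)[OF flow] b by auto
  have "(Lq_norm 2 U (v 0))\<^sup>2 = (Lq_norm 2 U (v b))\<^sup>2"
    unfolding Lq_norm_2_sq by (rule L2_inner_cong_AE[OF L(1) L(1) L(2) L(2) ae ae])
  then have "integral {0..b} (\<lambda>r. 2 * I_fun p U (v r)) = 0"
    using flow_L2_balance[OF flow order_refl less_imp_le[OF b(1)]] by simp
  moreover have pos: "0 < I_fun p U (v r)" if "r \<in> {0..b}" for r using d(2)[of r] that b by simp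
  moreover have "continuous_on {0..b} (\<lambda>r. 2 * I_fun p U (v r))"
    by (intro continuous_intros continuous_on_subset[OF flow_I_continuous[OF flow]]) auto
  ultimately have "\<forall>r\<in>{0..b}. 2 * I_fun p U (v r) = 0"
    using b(1) by (subst (asm) integral_eq_0_iff) (auto intro: less_imp_le)
  then show False using pos[of 0] b by simp
qed

text \<open>The times with I \<ge> 0 form a closed set that is also open to the right. Where I
  vanishes, the energy is below the depth, so the state is off the Nehari manifold and has zero
  gradient; by continuity of the gradient norm, I is nonnegative at nearby times. Strict positivity
  may fail, because the solution may reach 0.\<close>

lemma flow_I_nonneg:
  assumes a: "0 \<le> a" "J_fun p U (v a) < depth p U" "0 \<le> I_fun p U (v a)" and t: "a \<le> t"
  shows "0 \<le> I_fun p U (v t)"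
proof (rule ccontr)
  assume neg: "\<not> 0 \<le> I_fun p U (v t)"
  have open_right: "\<exists>d>0. \<forall>r\<ge>0. \<bar>r - s\<bar> < d \<longrightarrow> 0 \<le> I_fun p U (v r)" if s: "a \<le> s" "0 \<le> I_fun p U (v s)" for s
  proof (cases "I_fun p U (v s) = 0")
    case False
    then have "0 \<le> s" "0 < I_fun p U (v s)" using s a by auto
    then obtain d where "d > 0" "\<And>r. 0 \<le> r \<Longrightarrow> \<bar>r - s\<bar> < d \<Longrightarrow> 0 < I_fun p U (v r)"
      by (rule positive_near_obtain[OF flow_I_continuous[OF flow]]) (rule that)
    then show ?thesis by (intro exI[of _ d]) (auto intro: less_imp_le)
  next
    case True
    have s0: "0 \<le> s" using s a by simp
    have "J_fun p U (v s) < depth p U" using flow_J_nonincreasing[OF flow a(1) s(1)] a(2) by simp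
    then have "v s \<notin> Nehari p U" using depth_le_J_fun[of "v s"] by auto
    then have g0: "gnorm (v s) = 0" using True flow_H01[OF flow s0] by (simp add: Nehari_def)
    obtain \<rho> where \<rho>: "\<rho> > 0" "\<And>u. u \<in> H01 U \<Longrightarrow> gnorm u \<le> \<rho> \<Longrightarrow> 0 \<le> I_fun p U u"
      by (rule I_fun_nonneg_small) (rule that)
    have cont: "continuous_on {0..} (\<lambda>r. \<rho>\<^sup>2 - (gnorm (v r))\<^sup>2)"
      by (intro continuous_intros flow_gnorm_continuous[OF flow])
    have pos: "0 < \<rho>\<^sup>2 - (gnorm (v s))\<^sup>2" using \<rho>(1) by (simp add: g0)
    obtain d where d: "d > 0" "\<And>r. 0 \<le> r \<Longrightarrow> \<bar>r - s\<bar> < d \<Longrightarrow> 0 < \<rho>\<^sup>2 - (gnorm (v r))\<^sup>2"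
      by (rule positive_near_obtain[OF cont s0 pos]) (rule that)
    have "0 \<le> I_fun p U (v r)" if r: "0 \<le> r" "\<bar>r - s\<bar> < d" for r
    proof (rule \<rho>(2)[OF flow_H01[OF flow r(1)]])
      show "gnorm (v r) \<le> \<rho>" using power2_less_imp_less[of "gnorm (v r)" \<rho>] d(2)[OF r] \<rho>(1) by simp
    qed
    then show ?thesis using d(1) by blast
  qed
  define S where "S = {a..t} \<inter> (\<lambda>s. I_fun p U (v s)) -` {0..}"
  have "closed S" unfolding S_def
    by (intro continuous_closed_preimage continuous_on_subset[OF flow_I_continuous[OF flow]]) (use a in auto)
  moreover have "a \<in> S" and bdd: "bdd_above S" using a t by (auto simp: S_def intro!: bdd_aboveI[of _ t])
  ultimately have "Sup S \<in> S" by (intro closed_contains_Sup) auto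
  then have m: "a \<le> Sup S" "Sup S \<le> t" "0 \<le> I_fun p U (v (Sup S))" by (auto simp: S_def)
  obtain d where d: "d > 0" "\<And>r. 0 \<le> r \<Longrightarrow> \<bar>r - Sup S\<bar> < d \<Longrightarrow> 0 \<le> I_fun p U (v r)"
    using open_right[OF m(1,3)] by blast
  have "Sup S \<noteq> t" using m neg by auto
  then have r: "Sup S < min t (Sup S + d / 2)" using m d by simp
  then have "0 \<le> I_fun p U (v (min t (Sup S + d / 2)))"
    using m a d(1) by (intro d(2)) auto
  then have "min t (Sup S + d / 2) \<in> S" using m r by (auto simp: S_def)
  then show False using cSup_upper[OF _ bdd] r by fastforce
qed

lemma flow_decay:
  assumes a: "0 \<le> a" "J_fun p U (v a) < depth p U" "0 \<le> I_fun p U (v a)" and depth: "0 < depth p U"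
  obtains K \<gamma> where "K > 0" "\<gamma> > 0" "\<And>t. 0 \<le> t \<Longrightarrow> gnorm (v t) \<le> K * exp (- \<gamma> * t)"
proof -
  obtain M where M: "0 \<le> M" "\<And>t. 0 \<le> t \<Longrightarrow> gnorm (v t) \<le> M" using flow_bound[OF flow] by blast
  obtain C where C: "C > 0" "\<And>u. u \<in> H01 U \<Longrightarrow> gnorm u \<le> M \<Longrightarrow> J_fun p U u \<le> C * (gnorm u)\<^sup>2"
    using M(1) by (rule J_fun_le) (rule that)
  obtain c where c: "c > 0" "\<And>u. u \<in> H01 U \<Longrightarrow> J_fun p U u \<le> J_fun p U (v a) \<Longrightarrow> 0 \<le> I_fun p U u \<Longrightarrow>
      c * (gnorm u)\<^sup>2 \<le> I_fun p U u"
    using depth a(2) by (rule I_fun_coercive) (rule that)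
  obtain P where P: "P > 0" "\<And>u. u \<in> H01 U \<Longrightarrow> (Lq_norm 2 U u)\<^sup>2 \<le> P * (gnorm u)\<^sup>2"
    by (rule Poincare_H01) (rule that)
  define y where "y t = (Lq_norm 2 U (v t))\<^sup>2" for t
  have y0: "0 \<le> y t" for t by (simp add: y_def)
  note H = flow_H01[OF flow] and I0 = flow_I_nonneg[OF a]
  have coercive: "c * (gnorm (v t))\<^sup>2 \<le> I_fun p U (v t)" if "a \<le> t" for t
    using that a(1) by (intro c(2) H I0 flow_J_nonincreasing[OF flow]) auto
  have Ii: "(\<lambda>r. 2 * I_fun p U (v r)) integrable_on {s..t}" if "a \<le> s" for s t
    by (intro integrable_continuous_real continuous_intros continuous_on_subset[OF flow_I_continuous[OF flow]])
      (use that a in auto)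
  have balance: "(t - s) * k \<le> y s - y t"
    if "a \<le> s" "s \<le> t" "\<And>r. r \<in> {s..t} \<Longrightarrow> k \<le> 2 * I_fun p U (v r)" for s t k
  proof -
    have "((\<lambda>_. k) has_integral (t - s) * k) {s..t}"
      using has_integral_const_real[of k s t] that by simp
    then have "(t - s) * k \<le> integral {s..t} (\<lambda>r. 2 * I_fun p U (v r))"
      by (rule has_integral_le[OF _ integrable_integral[OF Ii]]) (use that in auto)
    then show ?thesis using flow_L2_balance[OF flow _ that(2)] that a by (simp add: y_def)
  qed
  have y_mono: "y t \<le> y s" if "a \<le> s" "s \<le> t" for s t
    using balance[OF that, of 0] I0 that by simp
  \<comment> \<open>Over a unit time step I \<ge> c ||grad v||^2 and Poincare give y t - y (t + 1)
    \<ge> (2 c / P) y (t + 1).\<close>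
  define \<kappa> where "\<kappa> = 1 + 2 * c / P"
  have \<kappa>: "\<kappa> > 1" using c P by (simp add: \<kappa>_def)
  have y_step: "\<kappa> * y (t + 1) \<le> y t" if t: "a \<le> t" for t
  proof -
    have "2 * c / P * y (t + 1) \<le> 2 * I_fun p U (v r)" if r: "r \<in> {t..t + 1}" for r
    proof -
      have "y (t + 1) \<le> y r" using r t by (intro y_mono) auto
      also have "\<dots> \<le> P * (gnorm (v r))\<^sup>2"
        unfolding y_def using r t a by (intro P(2) H) auto
      finally have "2 * c / P * y (t + 1) \<le> 2 * c / P * (P * (gnorm (v r))\<^sup>2)"
        by (rule mult_left_mono) (use c P in auto)
      also have "\<dots> = 2 * (c * (gnorm (v r))\<^sup>2)" using P(1) by simp
      also have "\<dots> \<le> 2 * I_fun p U (v r)" using coercive[of r] r t by simp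
      finally show ?thesis .
    qed
    from balance[OF t, of "t + 1", OF _ this] show ?thesis by (simp add: \<kappa>_def algebra_simps)
  qed
  have y_decay: "\<kappa> ^ n * y (a + real n) \<le> y a" for n
  proof (induction n)
    case (Suc n)
    have "\<kappa> ^ Suc n * y (a + real (Suc n)) = \<kappa> ^ n * (\<kappa> * y (a + real n + 1))" by (simp add: ac_simps)
    also have "\<dots> \<le> \<kappa> ^ n * y (a + real n)"
      using \<kappa> by (intro mult_left_mono y_step) auto
    finally show ?case using Suc.IH by simp
  qed simp
  have J_step: "2 * c / C * J_fun p U (v (t + 1)) \<le> y t" if t: "a \<le> t" for t
  proof -
    have "2 * c / C * J_fun p U (v (t + 1)) \<le> 2 * I_fun p U (v r)" if r: "r \<in> {t..t + 1}" for r
    proof -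
      have r0: "0 \<le> r" using r t a by simp
      have "J_fun p U (v (t + 1)) \<le> J_fun p U (v r)" using r r0 by (intro flow_J_nonincreasing[OF flow]) auto
      also have "\<dots> \<le> C * (gnorm (v r))\<^sup>2" using r0 by (intro C(2) H M)
      finally have "2 * c / C * J_fun p U (v (t + 1)) \<le> 2 * c / C * (C * (gnorm (v r))\<^sup>2)"
        by (rule mult_left_mono) (use c C in auto)
      also have "\<dots> = 2 * (c * (gnorm (v r))\<^sup>2)" using C(1) by simp
      also have "\<dots> \<le> 2 * I_fun p U (v r)" using coercive[of r] r t by simp
      finally show ?thesis .
    qed
    from balance[OF t, of "t + 1", OF _ this] show ?thesis using y0[of "t + 1"] by simp
  qed
  define \<theta> where "\<theta> = 1 / 2 - 1 / (p + 1)"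
  have \<theta>: "\<theta> > 0" using p1 by (simp add: \<theta>_def field_simps)
  define b where "b = 2 * c / C * \<theta>"
  have b: "b > 0" using c C \<theta> by (simp add: b_def)
  \<comment> \<open>exp (2 \<gamma>) = \<kappa>; the factor 1/2 appears because \<kappa> governs
    squared norms.\<close>
  define \<gamma> where "\<gamma> = ln \<kappa> / 2"
  have \<gamma>: "\<gamma> > 0" using \<kappa> by (simp add: \<gamma>_def)
  \<comment> \<open>The factor exp (2 \<gamma> (a + 2)) makes up for the completed steps: their
    number n is only known to be at least t - a - 2.\<close>
  define B where "B = y a / b * exp (2 * \<gamma> * (a + 2))"
  have B: "B \<ge> 0" using y0 b by (simp add: B_def)
  have late: "gnorm (v t) \<le> sqrt B * exp (- \<gamma> * t)" if t: "a + 1 \<le> t" for t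
  proof -
    \<comment> \<open>One time unit before t is reserved for \<open>J_step\<close>, so a + n + 1
      \<le> t is required.\<close>
    define n where "n = nat \<lfloor>t - a - 1\<rfloor>"
    have n: "real n \<le> t - a - 1" "t - a - 2 \<le> real n"
      using t by (auto simp: n_def) linarith+
    have "\<theta> * (gnorm (v t))\<^sup>2 \<le> J_fun p U (v t)"
      unfolding \<theta>_def using t a(1) by (intro J_fun_lower H I0) auto
    then have "2 * c / C * (\<theta> * (gnorm (v t))\<^sup>2) \<le> 2 * c / C * J_fun p U (v t)"
      by (rule mult_left_mono) (use c C in auto)
    then have "b * (gnorm (v t))\<^sup>2 \<le> 2 * c / C * J_fun p U (v t)" by (simp add: b_def mult.assoc)
    also have "\<dots> \<le> 2 * c / C * J_fun p U (v (a + real n + 1))"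
      using n a c C by (intro mult_left_mono flow_J_nonincreasing[OF flow]) auto
    also have "\<dots> \<le> y (a + real n)" by (rule J_step) simp
    finally have g: "b * (gnorm (v t))\<^sup>2 \<le> y (a + real n)" .
    have "exp (2 * \<gamma> * (t - a - 2)) \<le> exp (real n * (2 * \<gamma>))"
      using n(2) \<gamma> by (simp add: mult.commute)
    also have "\<dots> = \<kappa> ^ n" using \<kappa> by (simp add: \<gamma>_def exp_of_nat_mult)
    finally have "exp (2 * \<gamma> * (t - a - 2)) * (b * (gnorm (v t))\<^sup>2) \<le> \<kappa> ^ n * y (a + real n)"
      using g b \<kappa> by (intro mult_mono) auto
    also have "\<dots> \<le> y a" by (rule y_decay)
    finally have "(gnorm (v t))\<^sup>2 \<le> y a / b / exp (2 * \<gamma> * (t - a - 2))"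
      using b by (simp add: field_simps)
    also have "\<dots> = (sqrt B * exp (- \<gamma> * t))\<^sup>2"
    proof -
      have eq: "exp (2 * \<gamma> * (a + 2)) * (exp (- \<gamma> * t))\<^sup>2 = inverse (exp (2 * \<gamma> * (t - a - 2)))"
        by (simp add: exp_minus[symmetric] exp_add[symmetric] power2_eq_square algebra_simps)
      have "(sqrt B * exp (- \<gamma> * t))\<^sup>2 = B * (exp (- \<gamma> * t))\<^sup>2"
        using B by (simp add: power_mult_distrib)
      also have "\<dots> = y a / b * (exp (2 * \<gamma> * (a + 2)) * (exp (- \<gamma> * t))\<^sup>2)"
        unfolding B_def mult.assoc ..
      finally show ?thesis unfolding eq by (simp add: divide_inverse)
    qed
    finally show ?thesis by (rule power2_le_imp_le) (use B in simp)
  qed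
  show thesis
  \<comment> \<open>The last summand covers times before a + 1 through the uniform bound M; the 1
    keeps K positive when B and M are both 0.\<close>
  proof (rule that[of "1 + sqrt B + M * exp (\<gamma> * (a + 1))" \<gamma>])
    show "0 < 1 + sqrt B + M * exp (\<gamma> * (a + 1))"
      using M(1) B by (intro add_pos_nonneg) auto
    fix t :: real assume t: "0 \<le> t"
    show "gnorm (v t) \<le> (1 + sqrt B + M * exp (\<gamma> * (a + 1))) * exp (- \<gamma> * t)"
    proof (cases "a + 1 \<le> t")
      case True
      have "sqrt B * exp (- \<gamma> * t) \<le> (1 + sqrt B + M * exp (\<gamma> * (a + 1))) * exp (- \<gamma> * t)"
        using M(1) by (intro mult_right_mono) auto
      then show ?thesis by (rule order_trans[OF late[OF True]])
    next
      case False
      then have "M * 1 \<le> M * exp (\<gamma> * (a + 1) + - \<gamma> * t)"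
        using M(1) \<gamma> by (intro mult_left_mono) (auto simp: algebra_simps[symmetric] mult_left_mono)
      also have "\<dots> = M * exp (\<gamma> * (a + 1)) * exp (- \<gamma> * t)" by (simp only: exp_add mult.assoc)
      also have "\<dots> \<le> (1 + sqrt B + M * exp (\<gamma> * (a + 1))) * exp (- \<gamma> * t)"
        using B by (intro mult_right_mono) auto
      finally show ?thesis using M(2)[OF t] by simp
    qed
  qed (rule \<gamma>)
qed

end

lemma heat_flow_decay:
  assumes flow: "heat_flow v z" and I: "0 < I_fun p U (v 0)" and J: "J_fun p U (v 0) = depth p U"
  obtains K \<gamma> where "K > 0" "\<gamma> > 0" "\<And>t. 0 \<le> t \<Longrightarrow> gnorm (v t) \<le> K * exp (- \<gamma> * t)"
proof -
  have "0 \<le> 1 / 2 - 1 / (p + 1)" using p1 by (simp add: field_simps)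
  then have "(1 / 2 - 1 / (p + 1)) * (gnorm (v 0))\<^sup>2 \<ge> 0" by (rule mult_nonneg_nonneg) simp
  moreover have "I_fun p U (v 0) / (p + 1) > 0" "power_integral (v 0) / (p + 1)\<^sup>2 \<ge> 0" using p1 I by simp_all
  \<comment> \<open>Positivity of the depth is read off from the datum, whose energy equals it and
    for which I > 0.\<close>
  ultimately have depth: "0 < depth p U"
    unfolding J[symmetric] J_fun_I_fun[OF flow_H01[OF flow order_refl]] by linarith
  obtain d where d: "d > 0" "\<And>s. 0 \<le> s \<Longrightarrow> \<bar>s - 0\<bar> < d \<Longrightarrow> 0 < I_fun p U (v s)"
    using flow_I_continuous[OF flow] order_refl I by (rule positive_near_obtain) (rule that)
  have "0 \<le> d / 2" "J_fun p U (v (d / 2)) < depth p U" "0 \<le> I_fun p U (v (d / 2))"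
    using d(1) d(2)[of "d / 2"] flow_J_strict_decrease[OF flow I, of "d / 2"] J by auto
  then show thesis using depth by (rule flow_decay[OF flow]) (rule that)
qed

text \<open>The constants must precede the solution, while \<open>heat_flow_decay\<close> provides
  them for one given flow. So one solution is fixed, if there is any; every other solution agrees
  with it almost everywhere at each time and therefore has the same \<open>wgrad\<close>.\<close>

lemma weak_solution_decay:
  assumes v0: "v0 \<in> H01 U" and I: "I_fun p U v0 > 0" and J: "J_fun p U v0 = depth p U"
  shows "\<exists>K \<gamma>. K > 0 \<and> \<gamma> > 0 \<and> (\<forall>v. weak_solution p U v0 \<infinity> v \<longrightarrow> (\<forall>t\<ge>0. gnorm (v t) \<le> K * exp (- \<gamma> * t)))"
proof (cases "\<exists>v. weak_solution p U v0 \<infinity> v")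
  case False
  then show ?thesis by (intro exI[of _ 1]) auto
next
  case True
  have init: "AE x in lebesgue_on U. v0 x = v 0 x" if "weak_solution p U v0 \<infinity> v" for v
  proof -
    have "AE x in lebesgue_on U. v 0 x = v0 x" using that by (simp add: weak_solution_def)
    then show ?thesis by eventually_elim simp
  qed
  from True obtain v where v: "weak_solution p U v0 \<infinity> v" by blast
  obtain z where flow: "heat_flow v z" using v0 v by (rule weak_solution_heat_flow)
  have "0 < I_fun p U (v 0)" "J_fun p U (v 0) = depth p U"
    using J_I_fun_cong_AE[OF v0 init[OF v]] I J by simp_all
  then obtain K \<gamma> where K: "K > 0" "\<gamma> > 0" "\<And>t. 0 \<le> t \<Longrightarrow> gnorm (v t) \<le> K * exp (- \<gamma> * t)"
    by (rule heat_flow_decay[OF flow]) (rule that)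
  have "gnorm (u t) \<le> K * exp (- \<gamma> * t)" if u: "weak_solution p U v0 \<infinity> u" and t: "0 \<le> t" for u t
  proof -
    obtain y where flow': "heat_flow u y" using v0 u by (rule weak_solution_heat_flow)
    have "AE x in lebesgue_on U. v 0 x - u 0 x = 0"
      using init[OF v] init[OF u] by eventually_elim simp
    then have "Lq_norm 2 U (\<lambda>x. v 0 x - u 0 x) = 0"
      by (subst Lq_norm_2_eq_0_iff)
        (auto intro!: Lq_2_diff flow_Lq_2(1)[OF flow] flow_Lq_2(1)[OF flow'])
    then have "Lq_norm 2 U (\<lambda>x. v t x - u t x) = 0"
      by (rule heat_flow_unique[OF flow flow' _ t])
    then have "AE x in lebesgue_on U. v t x = u t x"
      using flow_Lq_2(1)[OF flow t] flow_Lq_2(1)[OF flow' t] by (intro Lq_norm_2_diff_eq_0)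
    then have "wgrad U (u t) = wgrad U (v t)" by (rule H01_cong_AE(2)[OF flow_H01[OF flow t]])
    then show ?thesis using K(3)[OF t] by simp
  qed
  then show ?thesis using K(1,2) by blast
qed

end

theorem proposition4p1:
  fixes U :: "'a::euclidean_space set" and p :: real and v0 :: "'a \<Rightarrow> real"
  assumes "bounded_smooth_domain U"
    and "1 < p"
    and "DIM('a) > 2 \<Longrightarrow> p < (real DIM('a) + 2) / (real DIM('a) - 2)"
    and "v0 \<in> H01 U"
    and "I_fun p U v0 > 0"
    and "J_fun p U v0 = depth p U"
  shows "\<exists>K \<gamma>. K > 0 \<and> \<gamma> > 0 \<and>
    (\<forall>v. weak_solution p U v0 \<infinity> v \<longrightarrow>
      (\<forall>t\<ge>0. Lq_norm 2 U (wgrad U (v t)) \<le> K * exp (- \<gamma> * t)))"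
proof -
  define n where "n = real DIM('a)"
  \<comment> \<open>For n > 2 the bound on p says p + 1 < 2n / (n - 2), and any q strictly between
    qualifies; for n \<le> 2 every q > 2 is subcritical and p + 2 is taken.\<close>
  obtain q where q: "p + 1 < q" "n * (q - 2) < 2 * q"
  proof (cases "DIM('a) > 2")
    case True
    then have n: "n > 2" by (simp add: n_def)
    have "p + 1 < (n + 2) / (n - 2) + 1" using assms(3)[OF True] by (simp add: n_def)
    also have "\<dots> = 2 * n / (n - 2)" using n by (simp add: field_simps)
    finally obtain q where q: "p + 1 < q" "q < 2 * n / (n - 2)" using dense by blast
    then have "n * (q - 2) < 2 * q" using n by (simp add: field_simps)
    then show thesis using q(1) by (rule that[rotated])
  next
    case False
    then have "n * p \<le> 2 * p" using assms(2) by (intro mult_right_mono) (auto simp: n_def)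
    then show thesis by (intro that[of "p + 2"]) (auto simp: algebra_simps)
  qed
  interpret log_heat U p q
    by unfold_locales (use assms q in \<open>auto simp: bounded_smooth_domain_def n_def\<close>)
  show ?thesis using assms(4-6) by (rule weak_solution_decay)
qed

end
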